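(* Let $\hat{\mathbf{A}}_1$ be the matrix with entries $\hat A_h((0,\phi_l^\Gamma),(0,\phi_m^\Gamma))$, $m,l\in I^\Gamma$, and $\mathbf{D}_1=\mathrm{diag}(\hat{\mathbf{A}}_1)$. Then the matrix $\mathbf{D}_1^{-\frac12}\hat{\mathbf{A}}_1\mathbf{D}_1^{-\frac12}$ has a spectral condition number that is uniformly bounded, i.e. bounded by a constant independent of $h$ and of the location of $\Gamma$ in the triangulation. If the triangulations $\{\mathcal{T}_h^\Gamma\}_{h>0}$ are quasi-uniform, the scaling with $\mathbf{D}_1^{-\frac12}$ can be deleted, i.e. then $\hat{\mathbf{A}}_1$ itself has a uniformly bounded spectral condition number.
   Context: Geometry and mesh. $d\in\{2,3\}$, $k\ge 1$; $\Omega\subset\mathbb{R}^d$ is a bounded connected polygonal domain with a non-overlapping partitioning into $\Omega_1,\Omega_2$, and $\Gamma=\overline{\Omega}_1\cap\overline{\Omega}_2$ is the (smooth) interface with unit normal $\mathbf{n}_\Gamma$ pointing from $\Omega_1$ into $\Omega_2$. $\{\mathcal{T}_h\}_{h>0}$ is a family of shape regular (not necessarily quasi-uniform) simplicial triangulations of $\Omega$, not fitted to $\Gamma$; $h_T$ is the diameter of $T\in\mathcal{T}_h$. $V_h$ is the space of continuous piecewise polynomials of degree $\le k$ on $\mathcal{T}_h$ vanishing on $\partial\Omega$. $\mathcal{T}_h^\Gamma$ is the set of simplices cut by $\Gamma$ and $\Omega_h^\Gamma$ is the domain they form; $\Omega_{i,h}^{\rm ex}$ is the domain formed by all simplices with nonzero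 intersection with $\Omega_i$. $V_{i,h}=\{(v_h)_{|\Omega_{i,h}^{\rm ex}}: v_h\in V_h\}$. Norms. $\|\cdot\|_\omega$ is the $L^2$ norm on $\omega$ and $(\cdot,\cdot)_\omega$ the $L^2$ scalar product. Scalings with $h$ are element-wise: $(h^{-1}u,v)_\Gamma=\sum_{T\in\mathcal{T}_h^\Gamma}h_T^{-1}(u,v)_{T\cap\Gamma}$, $\|h^{-1/2}v\|_\Gamma^2=(h^{-1}v,v)_\Gamma$. $A\sim B$ means $c_1B\le A\le c_2B$ with constants $c_1,c_2>0$ independent of $h$ and of the location of $\Gamma$ in the triangulation; these and the uniform bounds in the claim may depend on shape regularity, quasi-uniformity (where assumed), $d$, $k$, the smoothness of $\Gamma$, $\alpha_1,\alpha_2$, $\gamma$, $\beta$. Spaces. $\phi_j$, $j\in I_0$, are the nodal basis functions of $V_h$. $I^\Gamma\subset I_0$ are the labels of nodes in $\Omega_h^\Gamma$, $I_i^\Gamma=\{j\in I^\Gamma:\text{node } j\text{ is not in }\Omega_i\}$, $i=1,2$. It is assumed that no nodes lie on $\Gamma$; then $I^\Gamma=I_1^\Gamma\cup I_2^\Gamma$ is a disjoint partition. Cut basis functions: $\phi_j^\Gamma=\phi_j|_{\Omega_h^\Gamma}$, $j\in I^\Gamma$. $V_i^\Gamma=\mathrm{span}\{\phi_j^\Gamma: j\in I_i^\Gamma\}$ and $V_h^\Gamma=V_1^\Gamma\oplus V_2^\Gamma$; $Q_i:V_h^\Gamma\to V_i^\Gamma$, $Q_i\big(\sum_{j\in I^\Gamma}\beta_j\phi_j^\Gamma\big)=\sum_{j\in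 I_i^\Gamma}\beta_j\phi_j^\Gamma$. Functions in $V_i^\Gamma$ are extended by zero to $\Omega_{i,h}^{\rm ex}$. The isomorphism $L:V_h\times V_h^\Gamma\to V_{1,h}\times V_{2,h}$ is $L(u_0,u^\Gamma)=(u_{1,h},u_{2,h})$ with $u_{i,h}={u_0}_{|\Omega_{i,h}^{\rm ex}}+Q_iu^\Gamma$. Bilinear forms. $\alpha_1,\alpha_2>0$ are the diffusion coefficients, $\gamma,\beta>0$ fixed parameters, $[\![\cdot]\!]$ the jump across $\Gamma$ (resp. across a face), $[\![u_h]\!]=(u_{1,h}-u_{2,h})_{|\Gamma}$, $\{\!\!\{\cdot\}\!\!\}$ a weighted averaging operator across $\Gamma$, $\bar\alpha$ a corresponding average of $\alpha_1,\alpha_2$, and $\mathcal{F}_{g,i}$ a suitable subset of faces in $\Omega_h^\Gamma$ with face diameters $h_F$. For $u_h,v_h\in V_{1,h}\times V_{2,h}$: $$A_h(u_h,v_h)=\sum_{i=1}^2(\alpha_i\nabla u_{i,h},\nabla v_{i,h})_{\Omega_i}+N_h^c(u_h,v_h)+N_h^c(v_h,u_h)+\bar\alpha\gamma(h^{-1}[\![u_h]\!],[\![v_h]\!])_\Gamma+G_h(u_h,v_h),$$ $$N_h^c(u_h,v_h)=(\{\!\!\{-\alpha\nabla v_h\}\!\!\}\cdot\mathbf{n}_\Gamma,[\![u_h]\!])_\Gamma,\quad G_h(u_h,v_h)=\beta\sum_{i=1}^2\sum_{\ell=1}^k\sum_{F\in\mathcal{F}_{g,i}}h_F^{2\ell-1}([\![\partial_n^\ell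 u_{i,h}]\!],[\![\partial_n^\ell v_{i,h}]\!])_F .$$ Set $\hat A_h(\hat u_h,\hat v_h)=A_h(L\hat u_h,L\hat v_h)$ on $V_h\times V_h^\Gamma$. The averaging, $\gamma$, $\beta$ and $\mathcal{F}_{g,i}$ are such that the following norm equivalence, known from the CutFEM literature, holds: $\hat A_h(\hat u_h,\hat u_h)\sim\sum_{i=1}^2\|\nabla u_{i,h}\|_{\Omega_{i,h}^{\rm ex}}^2+\|h^{-1/2}(u_{1,h}-u_{2,h})\|_\Gamma^2$ for all $\hat u_h\in V_h\times V_h^\Gamma$. *)

theory Defs
  imports "HOL-Analysis.Analysis" "Jordan_Normal_Form.Gauss_Jordan_Elimination"
begin

no_notation scalar_prod (infix \<open>\<bullet>\<close> 70)

text \<open>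
  The \<open>s\<close>-dimensional Hausdorff measure, for \<open>s \<ge> 1\<close>, normalised so that for \<open>s = d - 1\<close> it is the
  usual surface measure.  It is used both on the interface and on the faces of simplices.
\<close>

definition hausdorff_outer :: "nat \<Rightarrow> 'a::euclidean_space set \<Rightarrow> ennreal" where
  "hausdorff_outer s A = (SUP \<delta>\<in>{0<..}.
     INF U\<in>{U :: nat \<Rightarrow> 'a set. A \<subseteq> (\<Union>i. U i) \<and> (\<forall>i. bounded (U i) \<and> diameter (U i) \<le> \<delta>)}.
       \<Sum>i. ennreal (unit_ball_vol (real s) * (diameter (U i) / 2) ^ s))"

definition hausdorff :: "nat \<Rightarrow> 'a::euclidean_space measure" where
  "hausdorff s = measure_of UNIV (sets borel) (hausdorff_outer s)"

definition surface_integral :: "'a::euclidean_space set \<Rightarrow> ('a \<Rightarrow> real) \<Rightarrow> real" where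
  "surface_integral S f = set_lebesgue_integral (hausdorff (DIM('a) - 1)) S f"

definition polygonal_domain :: "'a::euclidean_space set \<Rightarrow> bool" where
  "polygonal_domain \<Omega> \<longleftrightarrow> \<Omega> \<noteq> {} \<and> connected \<Omega> \<and>
     (\<exists>\<P>. finite \<P> \<and> (\<forall>K\<in>\<P>. polytope K) \<and> \<Omega> = interior (\<Union>\<P>))"

definition simplicial_mesh :: "'a::euclidean_space set \<Rightarrow> 'a set set \<Rightarrow> bool" where
  "simplicial_mesh \<Omega> \<T> \<longleftrightarrow> triangulation \<T> \<and> (\<forall>T\<in>\<T>. int DIM('a) simplex T) \<and> \<Union>\<T> = closure \<Omega>"

definition shape_regular :: "real \<Rightarrow> 'a::euclidean_space set set \<Rightarrow> bool" where
  "shape_regular \<sigma> \<T> \<longleftrightarrow> (\<forall>T\<in>\<T>. \<exists>x \<rho>. 0 < \<rho> \<and> cball x \<rho> \<subseteq> T \<and> diameter T \<le> \<sigma> * \<rho>)"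

definition quasi_uniform :: "real \<Rightarrow> 'a::euclidean_space set set \<Rightarrow> bool" where
  "quasi_uniform q \<T> \<longleftrightarrow> (\<forall>T\<in>\<T>. \<forall>T'\<in>\<T>. diameter T \<le> q * diameter T')"

text \<open>Polynomials on \<open>\<real>\<^sup>d\<close> of total degree at most \<open>k\<close>; \<open>m\<close> ranges over the multi-indices.\<close>

definition poly_space :: "nat \<Rightarrow> ('a::euclidean_space \<Rightarrow> real) set" where
  "poly_space k = {p. \<exists>c. p = (\<lambda>x.
     \<Sum>m\<in>{m :: 'a \<Rightarrow> nat. (\<forall>b. b \<notin> Basis \<longrightarrow> m b = 0) \<and> (\<Sum>b\<in>Basis. m b) \<le> k}.
       c m * (\<Prod>b\<in>Basis. (x \<bullet> b) ^ m b))}"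

definition lagrange_nodes :: "nat \<Rightarrow> 'a::euclidean_space set \<Rightarrow> 'a set" where
  "lagrange_nodes k T =
     {\<Sum>v | v extreme_point_of T. (real (m v) / real k) *\<^sub>R v
       | m :: 'a \<Rightarrow> nat. (\<Sum>v | v extreme_point_of T. m v) = k}"

definition grad :: "('a::euclidean_space \<Rightarrow> real) \<Rightarrow> 'a \<Rightarrow> 'a" where
  "grad f x = (\<Sum>b\<in>Basis. frechet_derivative f (at x) b *\<^sub>R b)"

definition dir_deriv :: "nat \<Rightarrow> 'a::euclidean_space \<Rightarrow> ('a \<Rightarrow> real) \<Rightarrow> 'a \<Rightarrow> real" where
  "dir_deriv l n f x = (deriv ^^ l) (\<lambda>t. f (x + t *\<^sub>R n)) 0"

definition restr :: "'a set \<Rightarrow> ('a \<Rightarrow> real) \<Rightarrow> 'a \<Rightarrow> real" where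
  "restr S v = (\<lambda>x. if x \<in> S then v x else 0)"

text \<open>
  The index \<open>i \<in> {1, 2}\<close> selects the subdomain in \<open>sub\<close>, \<open>diffc\<close>, \<open>weight\<close> and \<open>gfaces\<close>.
  The averaging weights \<open>weight i T\<close> may vary from one cut simplex to another; this covers constant
  weights and weights given by the volume fractions of the two parts of \<open>T\<close>.
\<close>

record 'a cutfem =
  Om     :: "'a set"
  sub    :: "nat \<Rightarrow> 'a set"
  normal :: "'a \<Rightarrow> 'a"
  mesh   :: "'a set set"
  deg    :: nat
  diffc  :: "nat \<Rightarrow> real"
  weight :: "nat \<Rightarrow> 'a set \<Rightarrow> real"
  abar   :: real
  nitsche :: real
  ghost  :: real
  gfaces :: "nat \<Rightarrow> 'a set set"

definition Gam :: "('a::euclidean_space) cutfem \<Rightarrow> 'a set" where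
  "Gam P = closure (sub P 1) \<inter> closure (sub P 2)"

definition partitioned :: "('a::euclidean_space) cutfem \<Rightarrow> bool" where
  "partitioned P \<longleftrightarrow> open (sub P 1) \<and> open (sub P 2) \<and> sub P 1 \<noteq> {} \<and> sub P 2 \<noteq> {} \<and>
     sub P 1 \<inter> sub P 2 = {} \<and> Om P = sub P 1 \<union> sub P 2 \<union> (Om P \<inter> Gam P)"

text \<open>
  Smoothness of the interface with explicit constants: within distance \<open>r\<close> of each of its points the
  two subdomains are the parts of the domain where a function \<open>f\<close> is negative, respectively positive.
  The gradient \<open>g\<close> of \<open>f\<close> has Lipschitz constant \<open>M\<close> and norm 1 at the given point, and the unit normal,
  which points from subdomain 1 into subdomain 2, is the normalised gradient.  A compact interface of
  class \<open>C\<^sup>2\<close> (up to its boundary, if it reaches the boundary of the domain) has this property for some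
  \<open>r\<close> and \<open>M\<close>.
\<close>

definition smooth_interface :: "real \<Rightarrow> real \<Rightarrow> ('a::euclidean_space) cutfem \<Rightarrow> bool" where
  "smooth_interface r M P \<longleftrightarrow> (\<forall>p\<in>Gam P. \<exists>f g.
     (\<forall>x\<in>ball p r. (f has_derivative (\<lambda>v. g x \<bullet> v)) (at x)) \<and>
     M-lipschitz_on (ball p r) g \<and> norm (g p) = 1 \<and>
     sub P 1 \<inter> ball p r = {x \<in> Om P \<inter> ball p r. f x < (0::real)} \<and>
     sub P 2 \<inter> ball p r = {x \<in> Om P \<inter> ball p r. f x > 0} \<and>
     (\<forall>y\<in>Gam P \<inter> ball p r. g y \<noteq> 0 \<and> normal P y = g y /\<^sub>R norm (g y)))"

text \<open>
  A simplex is cut if the interface enters its interior; equivalently, if it meets both open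
  subdomains.  Simplices that the interface merely touches from outside do not count.
\<close>

definition cut_mesh :: "('a::euclidean_space) cutfem \<Rightarrow> 'a set set" where
  "cut_mesh P = {T \<in> mesh P. interior T \<inter> Gam P \<noteq> {}}"

definition cut_dom :: "('a::euclidean_space) cutfem \<Rightarrow> 'a set" where
  "cut_dom P = \<Union>(cut_mesh P)"

definition ext_mesh :: "('a::euclidean_space) cutfem \<Rightarrow> nat \<Rightarrow> 'a set set" where
  "ext_mesh P i = {T \<in> mesh P. T \<inter> sub P i \<noteq> {}}"

definition ext_dom :: "('a::euclidean_space) cutfem \<Rightarrow> nat \<Rightarrow> 'a set" where
  "ext_dom P i = \<Union>(ext_mesh P i)"

text \<open>Functions on a subset of \<open>\<real>\<^sup>d\<close> are represented by their extension by zero.\<close>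

definition Vh :: "('a::euclidean_space) cutfem \<Rightarrow> ('a \<Rightarrow> real) set" where
  "Vh P = {v. continuous_on (closure (Om P)) v \<and>
     (\<forall>T\<in>mesh P. \<exists>p\<in>poly_space (deg P). \<forall>x\<in>T. v x = p x) \<and>
     (\<forall>x\<in>frontier (Om P). v x = 0) \<and> (\<forall>x. x \<notin> closure (Om P) \<longrightarrow> v x = 0)}"

text \<open>The labels of the basis functions are the nodes themselves; nodes on the boundary carry none.\<close>

definition nodes :: "('a::euclidean_space) cutfem \<Rightarrow> 'a set" where
  "nodes P = (\<Union>T\<in>mesh P. lagrange_nodes (deg P) T) - frontier (Om P)"

definition nodal_basis :: "('a::euclidean_space) cutfem \<Rightarrow> 'a \<Rightarrow> 'a \<Rightarrow> real" where
  "nodal_basis P j = (THE v. v \<in> Vh P \<and> (\<forall>i\<in>nodes P. v i = (if i = j then 1 else 0)))"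

definition cut_nodes :: "('a::euclidean_space) cutfem \<Rightarrow> 'a set" where
  "cut_nodes P = nodes P \<inter> cut_dom P"

definition cut_nodes_of :: "('a::euclidean_space) cutfem \<Rightarrow> nat \<Rightarrow> 'a set" where
  "cut_nodes_of P i = {j \<in> cut_nodes P. j \<notin> sub P i}"

definition cut_basis :: "('a::euclidean_space) cutfem \<Rightarrow> 'a \<Rightarrow> 'a \<Rightarrow> real" where
  "cut_basis P j = restr (cut_dom P) (nodal_basis P j)"

definition VhGam :: "('a::euclidean_space) cutfem \<Rightarrow> ('a \<Rightarrow> real) set" where
  "VhGam P = {u. \<exists>c. u = (\<lambda>x. \<Sum>j\<in>cut_nodes P. c j * cut_basis P j x)}"

definition cut_coeff :: "('a::euclidean_space) cutfem \<Rightarrow> ('a \<Rightarrow> real) \<Rightarrow> 'a \<Rightarrow> real" where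
  "cut_coeff P u = (SOME c. u = (\<lambda>x. \<Sum>j\<in>cut_nodes P. c j * cut_basis P j x))"

definition Qproj :: "('a::euclidean_space) cutfem \<Rightarrow> nat \<Rightarrow> ('a \<Rightarrow> real) \<Rightarrow> 'a \<Rightarrow> real" where
  "Qproj P i u = (\<lambda>x. \<Sum>j\<in>cut_nodes_of P i. cut_coeff P u j * cut_basis P j x)"

definition Liso ::
    "('a::euclidean_space) cutfem \<Rightarrow> ('a \<Rightarrow> real) \<times> ('a \<Rightarrow> real) \<Rightarrow> nat \<Rightarrow> 'a \<Rightarrow> real" where
  "Liso P u i = (\<lambda>x. restr (ext_dom P i) (fst u) x + Qproj P i (snd u) x)"

text \<open>
  \<open>piece P T v\<close> is the polynomial that coincides with \<open>v\<close> on the simplex \<open>T\<close>.  It provides the one-sided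
  gradients and normal derivatives on \<open>T\<close>, including its boundary.
\<close>

definition piece :: "('a::euclidean_space) cutfem \<Rightarrow> 'a set \<Rightarrow> ('a \<Rightarrow> real) \<Rightarrow> 'a \<Rightarrow> real" where
  "piece P T v = (THE p. p \<in> poly_space (deg P) \<and> (\<forall>x\<in>T. p x = v x))"

text \<open>
  \<open>(\<nabla>u, \<nabla>v)\<close> on a subset of the domain.  The gradients exist off the faces of the mesh, which form a null
  set; the completed measure \<open>lebesgue\<close> makes the values there irrelevant.
\<close>

definition grad_prod :: "('a::euclidean_space) set \<Rightarrow> ('a \<Rightarrow> real) \<Rightarrow> ('a \<Rightarrow> real) \<Rightarrow> real" where
  "grad_prod S u v = set_lebesgue_integral lebesgue S (\<lambda>x. grad u x \<bullet> grad v x)"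

definition jump :: "(nat \<Rightarrow> 'a \<Rightarrow> real) \<Rightarrow> 'a \<Rightarrow> real" where
  "jump u x = u 1 x - u 2 x"

definition jump_prod ::
    "('a::euclidean_space) cutfem \<Rightarrow> (nat \<Rightarrow> 'a \<Rightarrow> real) \<Rightarrow> (nat \<Rightarrow> 'a \<Rightarrow> real) \<Rightarrow> real" where
  "jump_prod P u v =
     (\<Sum>T\<in>cut_mesh P. surface_integral (T \<inter> Gam P) (\<lambda>x. jump u x * jump v x) / diameter T)"

text \<open>The interface integral is taken simplex by simplex, as in \<open>jump_prod\<close>.\<close>

definition Nhc ::
    "('a::euclidean_space) cutfem \<Rightarrow> (nat \<Rightarrow> 'a \<Rightarrow> real) \<Rightarrow> (nat \<Rightarrow> 'a \<Rightarrow> real) \<Rightarrow> real" where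
  "Nhc P u v = (\<Sum>T\<in>cut_mesh P. surface_integral (T \<inter> Gam P) (\<lambda>x.
     ((\<Sum>i\<in>{1,2}. weight P i T *\<^sub>R (- diffc P i *\<^sub>R grad (piece P T (v i)) x)) \<bullet> normal P x) * jump u x))"

text \<open>
  A stabilization face is shared by exactly two simplices.  Interchanging them, or reversing the face
  normal, changes the sign of both factors in the integrand of \<open>Gh\<close> or of neither.
\<close>

definition face_sides :: "('a::euclidean_space) cutfem \<Rightarrow> 'a set \<Rightarrow> 'a set \<times> 'a set" where
  "face_sides P F = (SOME (T, T'). T \<in> mesh P \<and> T' \<in> mesh P \<and> T \<noteq> T' \<and> F = T \<inter> T')"

definition face_normal :: "'a::euclidean_space set \<Rightarrow> 'a" where
  "face_normal F = (SOME n. norm n = 1 \<and> (\<forall>x\<in>F. \<forall>y\<in>F. n \<bullet> (x - y) = 0))"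

definition face_jump ::
    "('a::euclidean_space) cutfem \<Rightarrow> nat \<Rightarrow> 'a set \<Rightarrow> ('a \<Rightarrow> real) \<Rightarrow> 'a \<Rightarrow> real" where
  "face_jump P l F v x =
     dir_deriv l (face_normal F) (piece P (fst (face_sides P F)) v) x -
     dir_deriv l (face_normal F) (piece P (snd (face_sides P F)) v) x"

definition Gh ::
    "('a::euclidean_space) cutfem \<Rightarrow> (nat \<Rightarrow> 'a \<Rightarrow> real) \<Rightarrow> (nat \<Rightarrow> 'a \<Rightarrow> real) \<Rightarrow> real" where
  "Gh P u v = ghost P * (\<Sum>i\<in>{1,2}. \<Sum>l\<in>{1..deg P}. \<Sum>F\<in>gfaces P i.
     diameter F ^ (2 * l - 1) *
       surface_integral F (\<lambda>x. face_jump P l F (u i) x * face_jump P l F (v i) x))"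

definition Ah ::
    "('a::euclidean_space) cutfem \<Rightarrow> (nat \<Rightarrow> 'a \<Rightarrow> real) \<Rightarrow> (nat \<Rightarrow> 'a \<Rightarrow> real) \<Rightarrow> real" where
  "Ah P u v = (\<Sum>i\<in>{1,2}. diffc P i * grad_prod (sub P i) (u i) (v i)) +
     Nhc P u v + Nhc P v u + abar P * nitsche P * jump_prod P u v + Gh P u v"

definition Ahat ::
    "('a::euclidean_space) cutfem \<Rightarrow> ('a \<Rightarrow> real) \<times> ('a \<Rightarrow> real) \<Rightarrow> ('a \<Rightarrow> real) \<times> ('a \<Rightarrow> real) \<Rightarrow> real"
  where "Ahat P u v = Ah P (Liso P u) (Liso P v)"

definition norm_equivalence :: "real \<Rightarrow> real \<Rightarrow> ('a::euclidean_space) cutfem \<Rightarrow> bool" where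
  "norm_equivalence c\<^sub>1 c\<^sub>2 P \<longleftrightarrow> (\<forall>u\<in>Vh P \<times> VhGam P.
     let N = (\<Sum>i\<in>{1,2}. grad_prod (ext_dom P i) (Liso P u i) (Liso P u i)) +
             jump_prod P (Liso P u) (Liso P u)
     in c\<^sub>1 * N \<le> Ahat P u u \<and> Ahat P u u \<le> c\<^sub>2 * N)"

text \<open>
  The structural assumptions.  A stabilization face for subdomain \<open>i\<close> is a facet shared by a cut simplex
  and another simplex of the extended mesh of that subdomain, so that the jump is defined.
\<close>

definition cutfem_discretization :: "('a::euclidean_space) cutfem \<Rightarrow> bool" where
  "cutfem_discretization P \<longleftrightarrow>
     partitioned P \<and> simplicial_mesh (Om P) (mesh P) \<and> nodes P \<inter> Gam P = {} \<and>
     (\<forall>T\<in>cut_mesh P. 0 \<le> weight P 1 T \<and> 0 \<le> weight P 2 T \<and> weight P 1 T + weight P 2 T = 1) \<and>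
     min (diffc P 1) (diffc P 2) \<le> abar P \<and> abar P \<le> max (diffc P 1) (diffc P 2) \<and>
     (\<forall>i\<in>{1,2}. \<forall>F\<in>gfaces P i.
        \<exists>T\<in>cut_mesh P. \<exists>T'\<in>ext_mesh P i. T \<noteq> T' \<and> F = T \<inter> T' \<and> F facet_of T \<and> F facet_of T')"

definition spectral_norm :: "real mat \<Rightarrow> real" where
  "spectral_norm A = (SUP x\<in>{x \<in> carrier_vec (dim_col A). scalar_prod x x \<le> 1}.
     sqrt (scalar_prod (A *\<^sub>v x) (A *\<^sub>v x)))"

definition spectral_cond :: "real mat \<Rightarrow> ereal" where
  "spectral_cond A = (case mat_inverse A of
     None \<Rightarrow> \<infinity> | Some B \<Rightarrow> ereal (spectral_norm A * spectral_norm B))"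

text \<open>
  All discretizations with the given domain, degree and parameters that satisfy the shape regularity,
  the smoothness of the interface and the norm equivalence with the given constants.  A bound for all
  members of this set depends neither on the mesh size nor on the position of the interface.
\<close>

definition cutfem_class ::
    "'a::euclidean_space set \<Rightarrow> nat \<Rightarrow> real \<Rightarrow> real \<Rightarrow> real \<Rightarrow> real \<Rightarrow> real \<Rightarrow> real \<Rightarrow> real \<Rightarrow> real \<Rightarrow> real
       \<Rightarrow> 'a cutfem set" where
  "cutfem_class \<Omega> k \<alpha>\<^sub>1 \<alpha>\<^sub>2 \<gamma> \<beta> \<sigma> r M c\<^sub>1 c\<^sub>2 = {P.
     Om P = \<Omega> \<and> deg P = k \<and> diffc P 1 = \<alpha>\<^sub>1 \<and> diffc P 2 = \<alpha>\<^sub>2 \<and> nitsche P = \<gamma> \<and> ghost P = \<beta> \<and>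
     cutfem_discretization P \<and> shape_regular \<sigma> (mesh P) \<and> smooth_interface r M P \<and>
     norm_equivalence c\<^sub>1 c\<^sub>2 P}"

text \<open>The list \<open>js\<close> is a numbering of the cut nodes.\<close>

definition A1_mat :: "('a::euclidean_space) cutfem \<Rightarrow> 'a list \<Rightarrow> real mat" where
  "A1_mat P js = Matrix.mat (length js) (length js) (\<lambda>(m, l).
     Ahat P (\<lambda>_. 0, cut_basis P (js ! l)) (\<lambda>_. 0, cut_basis P (js ! m)))"

definition diag_scaled :: "real mat \<Rightarrow> real mat" where
  "diag_scaled A = (let S = mat_diag (dim_row A) (\<lambda>i. 1 / sqrt (A $$ (i, i))) in S * A * S)"

end

(* Let c be the coefficient vector of a function u^Gamma in V_h^Gamma.  Both components of L(0, u^Gamma)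
   are supported on the cut simplices, so by the norm equivalence the energy of (0, u^Gamma) is comparable
   to the sum over the cut simplices T of

     |grad u_1|^2_T + |grad u_2|^2_T + h_T^(-1) |u_1 - u_2|^2_(T cap Gamma).

   This sum is in turn comparable to the diagonal form sum_j W_j c_j^2 with W_j = sum_(T containing j) h_T^(d-2).
   The upper bound consists of inverse and trace estimates.  For the lower bound, pick a point of the
   interface inside T and a vertex v of T whose hat function is at least 1/(d+1) there.  If u_i vanishes at
   some node of a cut simplex T' around v, then the gradient of u_i on T' controls u_i(v).  Otherwise the
   other component vanishes on every cut simplex around v, so the jump is u_i itself, and it is controlled
   on the interface near v, whose area is at least a multiple of h_T^(d-1).  The remaining nodal values on T
   differ from u_i(v) by at most the oscillation of u_i, which the gradient controls.

   Hence A_1 is spectrally equivalent to diag(W), and so is its own diagonal D_1.  On a quasi-uniform mesh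
   the weights W_j are comparable to each other. *)

theory Submission
  imports Defs "Jordan_Normal_Form.Determinant"
begin

no_notation scalar_prod (infix \<open>\<bullet>\<close> 70)

section \<open>Spectral condition numbers of symmetric matrices\<close>

text \<open>The obstacle is the position of the cut: \<open>T \<inter> \<Gamma>\<close> can have
  arbitrarily small area, so the jump on \<open>T\<close> alone controls nothing. The interface is
  therefore measured in a ball whose radius is proportional to \<open>h_T\<close>, centred at an
  interface point of \<open>T\<close>. This ball may leave \<open>T\<close>. The argument stays
  uniform because the hat function of the chosen vertex \<open>v\<close> is positive on the ball, so
  that the ball lies in the domain and meets only simplices around \<open>v\<close>, and because
  these simplices have sizes comparable to \<open>h_T\<close>. Without quasi-uniformity the
  comparison of sizes has to come from shape regularity, by walking around \<open>v\<close> from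
  simplex to simplex. This requires an interior vertex; at boundary vertices the components vanish
  anyway.

  The surface measure is a Hausdorff measure, so additivity on Borel sets and the two-sided area
  bounds for the interface are derived from coverings. Reference simplices are replaced by explicit
  bounds on Lagrange functions in barycentric coordinates. The weight \<open>h_T^(d-2)\<close> is
  the scaling of the Dirichlet energy of one nodal function.\<close>

lemma discriminant_nonneg_form:
  fixes a b c :: real
  assumes "\<And>t. 0 \<le> a + 2 * t * b + t\<^sup>2 * c"
  shows "b\<^sup>2 \<le> a * c"
proof (cases "c = 0")
  case True
  have "b = 0"
  proof (rule ccontr)
    assume "b \<noteq> 0"
    \<comment> \<open>For \<open>c = 0\<close> the polynomial is affine, and at this
      \<open>t\<close> it equals -1.\<close>
    define t where "t = - (a + 1) / (2 * b)"
    have "2 * t * b = - (a + 1)" unfolding t_def using \<open>b \<noteq> 0\<close> by (simp add: field_simps)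
    then show False using assms[of t] True by simp
  qed
  then show ?thesis using True by simp
next
  case False
  have "c > 0"
  proof (rule ccontr)
    assume "\<not> c > 0"
    with False have c: "c < 0" by simp
    \<comment> \<open>With this \<open>t \<ge> 1\<close> the number \<open>- c * t\<close> exceeds
      \<open>1 + |a| + 2 |b|\<close>, so the negative square term outweighs the other two.\<close>
    define t where "t = (1 + \<bar>a\<bar> + 2 * \<bar>b\<bar>) / (- c) + 1"
    have t1: "t \<ge> 1" unfolding t_def using c divide_nonneg_neg[of "1 + \<bar>a\<bar> + 2 * \<bar>b\<bar>" c] by simp
    have "- c * t = 1 + \<bar>a\<bar> + 2 * \<bar>b\<bar> - c" unfolding t_def using c by (simp add: field_simps)
    then have "t * (- c * t) = t * (1 + \<bar>a\<bar> + 2 * \<bar>b\<bar> - c)" by simp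
    then have e: "t\<^sup>2 * c = - (t * (1 + \<bar>a\<bar> + 2 * \<bar>b\<bar> - c))" by (simp add: power2_eq_square algebra_simps)
    have "0 \<le> a + 2 * t * b - t * (1 + \<bar>a\<bar> + 2 * \<bar>b\<bar> - c)" using assms[of t] e by simp
    moreover have "t * (- c) > 0" using t1 c by (simp add: mult_pos_neg)
    moreover have "t * b \<le> t * \<bar>b\<bar>" using t1 by (intro mult_left_mono) auto
    moreover have "a \<le> t * \<bar>a\<bar>"
      using t1 mult_right_mono[of 1 t "\<bar>a\<bar>"] by linarith
    moreover have "t * (1 + \<bar>a\<bar> + 2 * \<bar>b\<bar> - c) = t + t * \<bar>a\<bar> + 2 * (t * \<bar>b\<bar>) + t * (- c)"
      by (simp add: algebra_simps)
    moreover have "2 * t * b = 2 * (t * b)" by simp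
    ultimately show False using t1 by linarith
  qed
  then show ?thesis using assms[of "- b / c"]
    by (simp add: field_simps power2_eq_square)
qed

lemma scalar_prod_self_nonneg: "0 \<le> scalar_prod (x :: real Matrix.vec) x"
  unfolding scalar_prod_def by (auto intro: sum_nonneg)

lemma scalar_prod_self_eq_0:
  assumes "x \<in> carrier_vec n" "scalar_prod (x :: real Matrix.vec) x = 0"
  shows "x = 0\<^sub>v n"
proof -
  have "\<forall>i\<in>{0..<dim_vec x}. x $ i * x $ i = 0"
    using assms(2) unfolding scalar_prod_def by (subst (asm) sum_nonneg_eq_0_iff) auto
  then show ?thesis using assms(1) by (intro eq_vecI) auto
qed

text \<open>Symmetry merges the mixed terms of the form at \<open>x + t y\<close>, leaving a
  nonnegative quadratic polynomial in \<open>t\<close>. Semidefiniteness suffices, since the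
  discriminant bound also covers a vanishing leading coefficient.\<close>

lemma positive_form_Cauchy_Schwarz:
  fixes A :: "real mat"
  assumes A: "A \<in> carrier_mat n n"
    and sym: "\<And>x y. x \<in> carrier_vec n \<Longrightarrow> y \<in> carrier_vec n \<Longrightarrow>
      scalar_prod x (A *\<^sub>v y) = scalar_prod y (A *\<^sub>v x)"
    and pos: "\<And>x. x \<in> carrier_vec n \<Longrightarrow> 0 \<le> scalar_prod x (A *\<^sub>v x)"
    and x: "x \<in> carrier_vec n" and y: "y \<in> carrier_vec n"
  shows "(scalar_prod x (A *\<^sub>v y))\<^sup>2 \<le> scalar_prod x (A *\<^sub>v x) * scalar_prod y (A *\<^sub>v y)"
proof (rule discriminant_nonneg_form)
  fix t :: real
  have c: "A *\<^sub>v x \<in> carrier_vec n" "A *\<^sub>v y \<in> carrier_vec n" "t \<cdot>\<^sub>v y \<in> carrier_vec n"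
    using A x y by auto
  have "0 \<le> scalar_prod (x + t \<cdot>\<^sub>v y) (A *\<^sub>v (x + t \<cdot>\<^sub>v y))" using x y by (intro pos) auto
  also have "A *\<^sub>v (x + t \<cdot>\<^sub>v y) = A *\<^sub>v x + t \<cdot>\<^sub>v (A *\<^sub>v y)"
    using A x y by (simp add: mult_add_distrib_mat_vec mult_mat_vec)
  also have "scalar_prod (x + t \<cdot>\<^sub>v y) \<dots> =
      scalar_prod x (A *\<^sub>v x) + 2 * t * scalar_prod x (A *\<^sub>v y) + t\<^sup>2 * scalar_prod y (A *\<^sub>v y)"
    using c x y sym[OF x y]
    by (simp add: add_scalar_prod_distrib[of _ n] scalar_prod_add_distrib[of _ n]
        algebra_simps power2_eq_square)
  finally show "0 \<le> scalar_prod x (A *\<^sub>v x) + 2 * t * scalar_prod x (A *\<^sub>v y) + t\<^sup>2 * scalar_prod y (A *\<^sub>v y)" .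
qed

lemma scalar_prod_Cauchy_Schwarz:
  assumes x: "x \<in> carrier_vec n" and y: "y \<in> carrier_vec n"
  shows "(scalar_prod x y)\<^sup>2 \<le> scalar_prod x x * scalar_prod y (y :: real Matrix.vec)"
  using positive_form_Cauchy_Schwarz[of "1\<^sub>m n" n x y] x y
  by (simp add: scalar_prod_self_nonneg comm_scalar_prod[of _ n])

text \<open>The bound serves the second conclusion as well: the value at the zero vector lies below
  the supremum because the set is bounded above.\<close>

lemma spectral_norm_le:
  assumes A: "A \<in> carrier_mat n n" and b: "0 \<le> b"
    and le: "\<And>x. x \<in> carrier_vec n \<Longrightarrow>
      scalar_prod (A *\<^sub>v x) (A *\<^sub>v x) \<le> b\<^sup>2 * scalar_prod x x"
  shows "spectral_norm A \<le> b" "0 \<le> spectral_norm A"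
proof -
  let ?X = "{x \<in> carrier_vec (dim_col A). scalar_prod x x \<le> (1::real)}"
  have z: "0\<^sub>v n \<in> ?X" using A by auto
  have u: "sqrt (scalar_prod (A *\<^sub>v x) (A *\<^sub>v x)) \<le> b" if "x \<in> ?X" for x
  proof -
    have "scalar_prod (A *\<^sub>v x) (A *\<^sub>v x) \<le> b\<^sup>2 * scalar_prod x x" using that A by (intro le) auto
    also have "\<dots> \<le> b\<^sup>2 * 1" using that by (intro mult_left_mono) auto
    finally show ?thesis using b by (simp add: real_le_lsqrt)
  qed
  show "spectral_norm A \<le> b" unfolding spectral_norm_def using z u by (intro cSUP_least) auto
  have "0 \<le> sqrt (scalar_prod (A *\<^sub>v 0\<^sub>v n) (A *\<^sub>v 0\<^sub>v n))" by (simp add: scalar_prod_self_nonneg)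
  also have "\<dots> \<le> spectral_norm A" unfolding spectral_norm_def
    using z u by (intro cSUP_upper bdd_aboveI2[where M = b]) auto
  finally show "0 \<le> spectral_norm A" .
qed

text \<open>Eigenvalues are avoided. Cauchy-Schwarz for the form of \<open>A\<close> turns the upper
  Rayleigh bound into \<open>|A x| \<le> b |x|\<close>, and Cauchy-Schwarz for the scalar product
  turns the lower one into \<open>|A x| \<ge> a |x|\<close>, which bounds the inverse.\<close>

lemma spectral_cond_le:
  assumes A: "A \<in> carrier_mat n n"
    and sym: "\<And>i j. i < n \<Longrightarrow> j < n \<Longrightarrow> A $$ (i, j) = A $$ (j, i)"
    and a: "0 < a" and b: "0 \<le> b"
    and lo: "\<And>x. x \<in> carrier_vec n \<Longrightarrow> a * scalar_prod x x \<le> scalar_prod x (A *\<^sub>v x)"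
    and up: "\<And>x. x \<in> carrier_vec n \<Longrightarrow> scalar_prod x (A *\<^sub>v x) \<le> b * scalar_prod x x"
  shows "spectral_cond A \<le> ereal (b / a)"
proof -
  have tr: "A\<^sup>T = A" using A sym by (intro eq_matI) auto
  have sym': "scalar_prod x (A *\<^sub>v y) = scalar_prod y (A *\<^sub>v x)"
    if "x \<in> carrier_vec n" "y \<in> carrier_vec n" for x y
    using transpose_vec_mult_scalar[OF A that(2,1)] A that tr
    by (metis comm_scalar_prod mult_mat_vec_carrier)
  have pos: "0 \<le> scalar_prod x (A *\<^sub>v x)" if "x \<in> carrier_vec n" for x
    using lo[OF that] a scalar_prod_self_nonneg[of x] by (smt (verit) mult_nonneg_nonneg)
  have upA: "scalar_prod (A *\<^sub>v x) (A *\<^sub>v x) \<le> b\<^sup>2 * scalar_prod x x" if x: "x \<in> carrier_vec n" for x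
  proof -
    define y where "y = A *\<^sub>v x"
    have y: "y \<in> carrier_vec n" unfolding y_def using A x by auto
    define s where "s = scalar_prod y y"
    have s0: "0 \<le> s" unfolding s_def by (rule scalar_prod_self_nonneg)
    \<comment> \<open>Since \<open>y = A x\<close>, the mixed value of the form is
      \<open>s = |A x|^2\<close>, and one factor \<open>s\<close> cancels at the end.\<close>
    have "s\<^sup>2 \<le> scalar_prod y (A *\<^sub>v y) * scalar_prod x (A *\<^sub>v x)"
      using positive_form_Cauchy_Schwarz[OF A sym' pos y x] unfolding s_def y_def by simp
    also have "\<dots> \<le> (b * s) * (b * scalar_prod x x)"
      unfolding s_def using up[OF x] up[OF y] pos[OF x] b scalar_prod_self_nonneg[of y]
      by (intro mult_mono) auto
    finally have "s * s \<le> s * (b\<^sup>2 * scalar_prod x x)" by (simp add: power2_eq_square algebra_simps)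
    then have "s \<le> b\<^sup>2 * scalar_prod x x"
      using s0 b scalar_prod_self_nonneg[of x]
      by (cases "s = 0") (auto simp: mult_le_cancel_left)
    then show ?thesis unfolding s_def y_def .
  qed
  have loA: "a\<^sup>2 * scalar_prod x x \<le> scalar_prod (A *\<^sub>v x) (A *\<^sub>v x)" if x: "x \<in> carrier_vec n" for x
  proof -
    define y where "y = A *\<^sub>v x"
    have y: "y \<in> carrier_vec n" unfolding y_def using A x by auto
    define s where "s = scalar_prod x x"
    have s0: "0 \<le> s" unfolding s_def by (rule scalar_prod_self_nonneg)
    have "a * s \<le> scalar_prod x y" using lo[OF x] unfolding s_def y_def .
    then have "(a * s)\<^sup>2 \<le> (scalar_prod x y)\<^sup>2" using a s0 by (intro power_mono) auto
    also have "\<dots> \<le> s * scalar_prod y y" unfolding s_def by (rule scalar_prod_Cauchy_Schwarz[OF x y])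
    finally have "s * (a\<^sup>2 * s) \<le> s * scalar_prod y y" by (simp add: power2_eq_square algebra_simps)
    then have "a\<^sup>2 * s \<le> scalar_prod y y"
      using s0 scalar_prod_self_nonneg[of y] by (cases "s = 0") (auto simp: mult_le_cancel_left)
    then show ?thesis unfolding s_def y_def .
  qed
  \<comment> \<open>\<open>spectral_cond\<close> is infinite unless \<open>mat_inverse\<close>
    returns a matrix; the lower bound excludes a kernel.\<close>
  have "det A \<noteq> 0"
  proof
    assume "det A = 0"
    then obtain v where v: "v \<in> carrier_vec n" "v \<noteq> 0\<^sub>v n" "A *\<^sub>v v = 0\<^sub>v n"
      using det_0_iff_vec_prod_zero_field[OF A] by auto
    have "a * scalar_prod v v \<le> 0" using lo[OF v(1)] v by simp
    then have "scalar_prod v v = 0" using a scalar_prod_self_nonneg[of v] by (simp add: mult_le_0_iff)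
    then show False using scalar_prod_self_eq_0[OF v(1)] v(2) by simp
  qed
  then have "A \<in> Units (ring_mat TYPE(real) n n)" by (rule det_non_zero_imp_unit[OF A])
  then obtain B where B: "mat_inverse A = Some B" using mat_inverse(1)[OF A, of n] by (cases "mat_inverse A") auto
  from mat_inverse(2)[OF A B] have AB: "A * B = 1\<^sub>m n" and Bc: "B \<in> carrier_mat n n" by auto
  have upB: "scalar_prod (B *\<^sub>v x) (B *\<^sub>v x) \<le> (1 / a)\<^sup>2 * scalar_prod x x" if x: "x \<in> carrier_vec n" for x
  proof -
    have Bx: "B *\<^sub>v x \<in> carrier_vec n" using Bc x by auto
    have "A *\<^sub>v (B *\<^sub>v x) = x" using AB A Bc x by (metis assoc_mult_mat_vec one_mult_mat_vec)
    then show ?thesis using loA[OF Bx] a by (simp add: field_simps power2_eq_square)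
  qed
  have "spectral_norm A * spectral_norm B \<le> b * (1 / a)"
    using spectral_norm_le[OF A b upA] spectral_norm_le[OF Bc _ upB] a b
    by (intro mult_mono) auto
  then show ?thesis unfolding spectral_cond_def using B by simp
qed

lemma quadratic_form_sum:
  fixes A :: "'a::comm_semiring_0 mat"
  assumes "A \<in> carrier_mat n n" "x \<in> carrier_vec n"
  shows "scalar_prod x (A *\<^sub>v x) = (\<Sum>i<n. \<Sum>j<n. x $ i * x $ j * A $$ (i, j))" (is "?l = ?r")
proof -
  have "?l = (\<Sum>i<n. x $ i * (\<Sum>j<n. A $$ (i, j) * x $ j))"
    using assms by (simp add: scalar_prod_def lessThan_atLeast0)
  also have "\<dots> = ?r" unfolding sum_distrib_left by (intro sum.cong refl) (simp only: mult_ac)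
  finally show ?thesis .
qed

section \<open>Symmetric matrices comparable to a diagonal form\<close>

context
  fixes A :: "real mat" and n :: nat and w :: "nat \<Rightarrow> real" and a b :: real
  assumes A: "A \<in> carrier_mat n n"
    and sym: "\<And>i j. i < n \<Longrightarrow> j < n \<Longrightarrow> A $$ (i, j) = A $$ (j, i)"
    and a: "0 < a" and b: "0 < b"
    and lo: "\<And>x. a * (\<Sum>i<n. w i * (x i)\<^sup>2) \<le> (\<Sum>i<n. \<Sum>j<n. x i * x j * A $$ (i, j))"
    and up: "\<And>x. (\<Sum>i<n. \<Sum>j<n. x i * x j * A $$ (i, j)) \<le> b * (\<Sum>i<n. w i * (x i)\<^sup>2)"
begin

text \<open>The diagonal form lies between \<open>w0\<close> and \<open>w1\<close> times the
  Euclidean one, so the Rayleigh quotients lie between \<open>a w0\<close> and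
  \<open>b w1\<close>.\<close>

lemma spectral_cond_weighted:
  assumes w0: "0 < w0" and w1: "0 \<le> w1" and w: "\<And>i. i < n \<Longrightarrow> w0 \<le> w i" "\<And>i. i < n \<Longrightarrow> w i \<le> w1"
  shows "spectral_cond A \<le> ereal (b * w1 / (a * w0))"
proof (rule spectral_cond_le[OF A sym])
  show "0 < a * w0" "0 \<le> b * w1" using a b w0 w1 by auto
  fix x :: "real Matrix.vec" assume x: "x \<in> carrier_vec n"
  have xx: "scalar_prod x x = (\<Sum>i<n. (x $ i)\<^sup>2)"
    using x by (simp add: scalar_prod_def lessThan_atLeast0 power2_eq_square)
  have "w0 * (\<Sum>i<n. (x $ i)\<^sup>2) \<le> (\<Sum>i<n. w i * (x $ i)\<^sup>2)" "(\<Sum>i<n. w i * (x $ i)\<^sup>2) \<le> w1 * (\<Sum>i<n. (x $ i)\<^sup>2)"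
    unfolding sum_distrib_left using w by (auto intro!: sum_mono mult_right_mono)
  then have "a * (w0 * (\<Sum>i<n. (x $ i)\<^sup>2)) \<le> a * (\<Sum>i<n. w i * (x $ i)\<^sup>2)"
    "b * (\<Sum>i<n. w i * (x $ i)\<^sup>2) \<le> b * (w1 * (\<Sum>i<n. (x $ i)\<^sup>2))"
    using a b by simp_all
  then show "a * w0 * scalar_prod x x \<le> scalar_prod x (A *\<^sub>v x)" "scalar_prod x (A *\<^sub>v x) \<le> b * w1 * scalar_prod x x"
    unfolding quadratic_form_sum[OF A x] xx mult.assoc[of a w0] mult.assoc[of b w1] using lo[of "\<lambda>i. x $ i"] up[of "\<lambda>i. x $ i"] by linarith+
qed

text \<open>The equivalence is tested on a unit vector.\<close>

lemma diagonal_bounds: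
  assumes i: "i < n" shows "a * w i \<le> A $$ (i, i)" "A $$ (i, i) \<le> b * w i"
proof -
  let ?x = "\<lambda>k. if k = i then 1 else 0 :: real"
  have one: "(\<Sum>k<n. if k = i then f k else 0) = f i" for f :: "nat \<Rightarrow> real" using i by simp
  have "(\<Sum>k<n. w k * (?x k)\<^sup>2) = (\<Sum>k<n. if k = i then w k else 0)" by (intro sum.cong) auto
  moreover have "(\<Sum>k<n. \<Sum>l<n. ?x k * ?x l * A $$ (k, l)) = (\<Sum>k<n. if k = i then A $$ (k, i) else 0)"
  proof (rule sum.cong[OF refl])
    fix k
    have "(\<Sum>l<n. ?x k * ?x l * A $$ (k, l)) = (\<Sum>l<n. if l = i then ?x k * A $$ (k, l) else 0)"
      by (intro sum.cong) auto
    then show "(\<Sum>l<n. ?x k * ?x l * A $$ (k, l)) = (if k = i then A $$ (k, i) else 0)" unfolding one by simp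
  qed
  ultimately show "a * w i \<le> A $$ (i, i)" "A $$ (i, i) \<le> b * w i" using lo[of ?x] up[of ?x] unfolding one by auto
qed

text \<open>The substitution \<open>y i = s i * x i\<close> brings in the factors
  \<open>w i / A $$ (i, i)\<close>, which lie between \<open>1 / b\<close> and \<open>1 / a\<close>.
  The equivalence with the weights contributes \<open>a\<close> and \<open>b\<close> once more, so
  the Rayleigh quotients lie between \<open>a / b\<close> and \<open>b / a\<close>; this explains
  the square.\<close>

lemma spectral_cond_diag_scaled:
  assumes w: "\<And>i. i < n \<Longrightarrow> 0 < w i"
  shows "spectral_cond (diag_scaled A) \<le> ereal ((b / a)\<^sup>2)"
proof -
  define s where "s i = 1 / sqrt (A $$ (i, i))" for i
  have d: "dim_row A = n" "dim_col A = n" using A by auto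
  have diag: "0 < A $$ (i, i)" if "i < n" for i
    using diagonal_bounds(1)[OF that] mult_pos_pos[OF a w[OF that]] by linarith
  have B: "diag_scaled A = Matrix.mat n n (\<lambda>(i, j). s i * A $$ (i, j) * s j)"
  proof -
    have "mat_diag n s * A = Matrix.mat n n (\<lambda>(i, j). s i * A $$ (i, j))" by (rule mat_diag_mult_left[OF A])
    then have "diag_scaled A = Matrix.mat n n (\<lambda>(i, j). s i * A $$ (i, j)) * mat_diag n s"
      unfolding diag_scaled_def Let_def d s_def[abs_def] by simp
    then show ?thesis by (subst (asm) mat_diag_mult_right) (auto intro!: eq_matI)
  qed
  have Bc: "diag_scaled A \<in> carrier_mat n n" unfolding B by simp
  have "spectral_cond (diag_scaled A) \<le> ereal ((b / a) / (a / b))"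
  proof (rule spectral_cond_le[OF Bc])
    show "diag_scaled A $$ (i, j) = diag_scaled A $$ (j, i)" if "i < n" "j < n" for i j
      using that sym[OF that] unfolding B by simp
    show "0 < a / b" "0 \<le> b / a" using a b by auto
    fix x :: "real Matrix.vec" assume x: "x \<in> carrier_vec n"
    let ?y = "\<lambda>i. s i * x $ i"
    have xx: "scalar_prod x x = (\<Sum>i<n. (x $ i)\<^sup>2)"
      using x by (simp add: scalar_prod_def lessThan_atLeast0 power2_eq_square)
    have form: "scalar_prod x (diag_scaled A *\<^sub>v x) = (\<Sum>i<n. \<Sum>j<n. ?y i * ?y j * A $$ (i, j))"
      unfolding quadratic_form_sum[OF Bc x] unfolding B by (intro sum.cong refl) (simp add: mult_ac)
    have sq: "w i * (?y i)\<^sup>2 = w i / A $$ (i, i) * (x $ i)\<^sup>2" if "i < n" for i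
      using diag[OF that] unfolding s_def by (simp add: power_mult_distrib power_divide)
    have "1 / b \<le> w i / A $$ (i, i)" "w i / A $$ (i, i) \<le> 1 / a" if "i < n" for i
      using diagonal_bounds[OF that] diag[OF that] a b by (simp_all add: divide_le_eq le_divide_eq mult.commute)
    then have each: "1 / b * (x $ i)\<^sup>2 \<le> w i * (?y i)\<^sup>2" "w i * (?y i)\<^sup>2 \<le> 1 / a * (x $ i)\<^sup>2" if "i < n" for i
      unfolding sq[OF that] using that by (intro mult_right_mono; simp)+
    have "1 / b * (\<Sum>i<n. (x $ i)\<^sup>2) \<le> (\<Sum>i<n. w i * (?y i)\<^sup>2)" "(\<Sum>i<n. w i * (?y i)\<^sup>2) \<le> 1 / a * (\<Sum>i<n. (x $ i)\<^sup>2)"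
      unfolding sum_distrib_left by (rule sum_mono, use each in simp)+
    then have "a * (1 / b * (\<Sum>i<n. (x $ i)\<^sup>2)) \<le> a * (\<Sum>i<n. w i * (?y i)\<^sup>2)"
      "b * (\<Sum>i<n. w i * (?y i)\<^sup>2) \<le> b * (1 / a * (\<Sum>i<n. (x $ i)\<^sup>2))"
      using a b by (simp_all only: mult_le_cancel_left_pos)
    then show "a / b * scalar_prod x x \<le> scalar_prod x (diag_scaled A *\<^sub>v x)"
      "scalar_prod x (diag_scaled A *\<^sub>v x) \<le> b / a * scalar_prod x x"
      unfolding form xx using lo[of ?y] up[of ?y] by simp_all
  qed
  also have "(b / a) / (a / b) = (b / a)\<^sup>2" using a b by (simp add: power2_eq_square)
  finally show ?thesis .
qed

end

section \<open>Hausdorff measure\<close>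

definition hausdorff_cost :: "nat \<Rightarrow> (nat \<Rightarrow> 'a::euclidean_space set) \<Rightarrow> ennreal" where
  "hausdorff_cost s U = (\<Sum>i. ennreal (unit_ball_vol (real s) * (diameter (U i) / 2) ^ s))"

definition hausdorff_covers :: "real \<Rightarrow> 'a::euclidean_space set \<Rightarrow> (nat \<Rightarrow> 'a set) set" where
  "hausdorff_covers \<delta> A = {U. A \<subseteq> (\<Union>i. U i) \<and> (\<forall>i. bounded (U i) \<and> diameter (U i) \<le> \<delta>)}"

definition hausdorff_premeasure :: "nat \<Rightarrow> real \<Rightarrow> 'a::euclidean_space set \<Rightarrow> ennreal" where
  "hausdorff_premeasure s \<delta> A = (INF U\<in>hausdorff_covers \<delta> A. hausdorff_cost s U)"

lemma hausdorff_outer_eq: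
  "hausdorff_outer s A = (SUP \<delta>\<in>{0<..}. hausdorff_premeasure s \<delta> A)"
  unfolding hausdorff_outer_def hausdorff_premeasure_def hausdorff_covers_def hausdorff_cost_def ..

lemma hausdorff_premeasure_le:
  "U \<in> hausdorff_covers \<delta> A \<Longrightarrow> hausdorff_premeasure s \<delta> A \<le> hausdorff_cost s U"
  unfolding hausdorff_premeasure_def by (rule INF_lower)

lemma hausdorff_premeasure_mono:
  "A \<subseteq> B \<Longrightarrow> \<delta>' \<le> \<delta> \<Longrightarrow> hausdorff_premeasure s \<delta> A \<le> hausdorff_premeasure s \<delta>' B"
  unfolding hausdorff_premeasure_def hausdorff_covers_def
  by (rule INF_superset_mono) (auto intro: order_trans)

lemma hausdorff_premeasure_le_outer:
  "0 < \<delta> \<Longrightarrow> hausdorff_premeasure s \<delta> A \<le> hausdorff_outer s A"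
  unfolding hausdorff_outer_eq by (rule SUP_upper) auto

lemma hausdorff_outer_mono: "A \<subseteq> B \<Longrightarrow> hausdorff_outer s A \<le> hausdorff_outer s B"
  unfolding hausdorff_outer_eq by (rule SUP_mono) (auto intro: hausdorff_premeasure_mono)

text \<open>For \<open>s = 0\<close> the factor \<open>0 ^ s\<close> would be 1 and even a covering
  by empty sets would have infinite cost. With \<open>1 \<le> s\<close> empty members are free,
  which is used wherever coverings are padded.\<close>

lemma hausdorff_outer_empty:
  assumes "1 \<le> s" shows "hausdorff_outer s ({} :: 'a::euclidean_space set) = 0"
proof -
  have "hausdorff_premeasure s \<delta> ({} :: 'a set) \<le> 0" if "0 < \<delta>" for \<delta>
  proof -
    have "(\<lambda>_. {}) \<in> hausdorff_covers \<delta> ({}::'a set)" using that by (auto simp: hausdorff_covers_def)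
    from hausdorff_premeasure_le[OF this, of s] show ?thesis
      using assms by (simp add: hausdorff_cost_def power_0_left)
  qed
  then have "hausdorff_outer s ({}::'a set) \<le> 0" unfolding hausdorff_outer_eq by (intro SUP_least) auto
  then show ?thesis by simp
qed

lemma hausdorff_premeasure_UN_le:
  fixes A :: "nat \<Rightarrow> 'a::euclidean_space set"
  shows "hausdorff_premeasure s \<delta> (\<Union>n. A n) \<le> (\<Sum>n. hausdorff_premeasure s \<delta> (A n))"
proof (rule ennreal_le_epsilon)
  fix e :: real assume "0 < e" and fin: "(\<Sum>n. hausdorff_premeasure s \<delta> (A n)) < top_class.top"
  then have *: "hausdorff_premeasure s \<delta> (A n) < hausdorff_premeasure s \<delta> (A n) + e * (1/2)^Suc n" for n
    by (auto simp add: less_top dest!: ennreal_suminf_lessD)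
  have "\<exists>U\<in>hausdorff_covers \<delta> (A n). hausdorff_cost s U < hausdorff_premeasure s \<delta> (A n) + e * (1/2)^Suc n" for n
    using *[of n] unfolding hausdorff_premeasure_def INF_less_iff .
  then obtain U where U: "\<And>n. U n \<in> hausdorff_covers \<delta> (A n)"
    "\<And>n. hausdorff_cost s (U n) \<le> hausdorff_premeasure s \<delta> (A n) + e * (1/2)^Suc n"
    by (metis less_imp_le)
  \<comment> \<open>The nearly optimal coverings \<open>U n\<close> are merged into one sequence by
    enumerating pairs; their excesses \<open>e / 2^(n+1)\<close> add up to \<open>e\<close>.\<close>
  define C where "C = (\<lambda>i. case_prod U (prod_decode i))"
  have "C \<in> hausdorff_covers \<delta> (\<Union>n. A n)"
    unfolding hausdorff_covers_def
  proof (intro CollectI conjI allI subsetI)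
    fix x assume "x \<in> (\<Union>n. A n)"
    then obtain n i where "x \<in> U n i" using U(1) unfolding hausdorff_covers_def by blast
    then have "x \<in> C (prod_encode (n, i))" unfolding C_def by simp
    then show "x \<in> (\<Union>i. C i)" by blast
  next
    fix i show "bounded (C i)" "diameter (C i) \<le> \<delta>"
      using U(1) unfolding hausdorff_covers_def C_def by (auto split: prod.split)
  qed
  then have "hausdorff_premeasure s \<delta> (\<Union>n. A n) \<le> hausdorff_cost s C" by (rule hausdorff_premeasure_le)
  also have "\<dots> = (\<Sum>n. hausdorff_cost s (U n))"
    unfolding hausdorff_cost_def C_def
    using suminf_ennreal_2dimen[of "\<lambda>n. hausdorff_cost s (U n)"
      "\<lambda>p. ennreal (unit_ball_vol (real s) * (diameter (case_prod U p) / 2) ^ s)"]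
    by (simp add: hausdorff_cost_def)
  also have "\<dots> \<le> (\<Sum>n. hausdorff_premeasure s \<delta> (A n) + e * (1/2)^Suc n)"
    by (intro suminf_le U(2)) auto
  also have "\<dots> = (\<Sum>n. hausdorff_premeasure s \<delta> (A n)) + (\<Sum>n. ennreal e * ennreal ((1/2) ^ Suc n))"
    using \<open>0 < e\<close> by (subst suminf_add[symmetric])
      (auto simp del: ennreal_suminf_cmult simp add: ennreal_mult[symmetric])
  also have "\<dots> = (\<Sum>n. hausdorff_premeasure s \<delta> (A n)) + e"
    unfolding ennreal_suminf_cmult
    by (subst suminf_ennreal_eq[OF zero_le_power power_half_series]) auto
  finally show "hausdorff_premeasure s \<delta> (\<Union>n. A n) \<le> (\<Sum>n. hausdorff_premeasure s \<delta> (A n)) + e" .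
qed

lemma hausdorff_outer_UN_le:
  fixes A :: "nat \<Rightarrow> 'a::euclidean_space set"
  shows "hausdorff_outer s (\<Union>n. A n) \<le> (\<Sum>n. hausdorff_outer s (A n))"
  unfolding hausdorff_outer_eq[of s "\<Union>n. A n"]
proof (rule SUP_least)
  fix \<delta> :: real assume "\<delta> \<in> {0<..}"
  then show "hausdorff_premeasure s \<delta> (\<Union>n. A n) \<le> (\<Sum>n. hausdorff_outer s (A n))"
    by (intro order_trans[OF hausdorff_premeasure_UN_le] suminf_le)
      (auto intro: hausdorff_premeasure_le_outer)
qed

lemma hausdorff_outer_Un_le:
  assumes "1 \<le> s"
  shows "hausdorff_outer s (A \<union> B) \<le> hausdorff_outer s A + hausdorff_outer s (B :: 'a::euclidean_space set)"
proof -
  let ?A = "\<lambda>n::nat. if n = 0 then A else if n = 1 then B else {}"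
  have "hausdorff_outer s (A \<union> B) \<le> hausdorff_outer s (\<Union>n. ?A n)"
    by (rule hausdorff_outer_mono) (auto split: if_splits)
  also have "\<dots> \<le> (\<Sum>n. hausdorff_outer s (?A n))" by (rule hausdorff_outer_UN_le)
  also have "\<dots> = (\<Sum>n<2. hausdorff_outer s (?A n))"
    by (rule suminf_finite) (auto simp: hausdorff_outer_empty[OF assms])
  also have "\<dots> = hausdorff_outer s A + hausdorff_outer s B" by (simp add: numeral_2_eq_2)
  finally show ?thesis .
qed

text \<open>A covering set of diameter below \<open>e\<close> cannot meet both sets, so a fine
  covering of the union splits into coverings of the two parts. This is the metric property on which
  Caratheodory's criterion rests.\<close>

lemma hausdorff_outer_separated:
  fixes A B :: "'a::euclidean_space set"
  assumes s: "1 \<le> s" and e: "0 < e" and sep: "\<And>x y. x \<in> A \<Longrightarrow> y \<in> B \<Longrightarrow> e \<le> dist x y"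
  shows "hausdorff_outer s A + hausdorff_outer s B \<le> hausdorff_outer s (A \<union> B)"
proof -
  have small: "hausdorff_premeasure s \<delta> A + hausdorff_premeasure s \<delta> B \<le> hausdorff_premeasure s \<delta> (A \<union> B)"
    if d: "0 < \<delta>" "\<delta> < e" for \<delta>
    unfolding hausdorff_premeasure_def[of s \<delta> "A \<union> B"]
  proof (rule INF_greatest)
    fix U assume U: "U \<in> hausdorff_covers \<delta> (A \<union> B)"
    \<comment> \<open>Members that belong to the other set are replaced by the empty set, so the two
      costs add up to the cost of \<open>U\<close>.\<close>
    define V where "V i = (if U i \<inter> A = {} then {} else U i)" for i
    define W where "W i = (if U i \<inter> A = {} then U i else {})" for i
    have dU: "bounded (U i)" "diameter (U i) \<le> \<delta>" for i using U unfolding hausdorff_covers_def by auto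
    have V: "V \<in> hausdorff_covers \<delta> A"
      using U d unfolding hausdorff_covers_def V_def by (auto split: if_splits) blast
    have "W \<in> hausdorff_covers \<delta> B"
      unfolding hausdorff_covers_def
    proof (intro CollectI conjI allI subsetI)
      fix y assume y: "y \<in> B"
      then obtain i where i: "y \<in> U i" using U unfolding hausdorff_covers_def by auto
      have "U i \<inter> A = {}"
      proof (rule ccontr)
        assume "U i \<inter> A \<noteq> {}"
        then obtain x where "x \<in> U i" "x \<in> A" by auto
        then show False using sep[OF \<open>x \<in> A\<close> y] diameter_bounded_bound[OF dU(1)[of i] \<open>x \<in> U i\<close> i] dU(2)[of i] d
          by linarith
      qed
      then show "y \<in> (\<Union>i. W i)" using i unfolding W_def by auto
    next
      fix i show "bounded (W i)" "diameter (W i) \<le> \<delta>" using dU[of i] d unfolding W_def by auto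
    qed
    then have "hausdorff_premeasure s \<delta> A + hausdorff_premeasure s \<delta> B \<le> hausdorff_cost s V + hausdorff_cost s W"
      using V by (intro add_mono hausdorff_premeasure_le)
    also have "\<dots> = hausdorff_cost s U"
      unfolding hausdorff_cost_def using s
      by (subst suminf_add) (auto intro!: suminf_cong simp: V_def W_def)
    finally show "hausdorff_premeasure s \<delta> A + hausdorff_premeasure s \<delta> B \<le> hausdorff_cost s U" .
  qed
  \<comment> \<open>The two suprema run over independent scales; monotonicity in the scale reduces
    each pair to a common scale below \<open>e\<close>.\<close>
  have "hausdorff_premeasure s \<delta>\<^sub>1 A + hausdorff_premeasure s \<delta>\<^sub>2 B \<le> hausdorff_outer s (A \<union> B)"
    if "\<delta>\<^sub>1 \<in> {0<..}" "\<delta>\<^sub>2 \<in> {0<..}" for \<delta>\<^sub>1 \<delta>\<^sub>2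
  proof -
    define \<delta> where "\<delta> = min (min \<delta>\<^sub>1 \<delta>\<^sub>2) (e / 2)"
    have d: "0 < \<delta>" "\<delta> < e" "\<delta> \<le> \<delta>\<^sub>1" "\<delta> \<le> \<delta>\<^sub>2" using that e unfolding \<delta>_def by auto
    have "hausdorff_premeasure s \<delta>\<^sub>1 A + hausdorff_premeasure s \<delta>\<^sub>2 B
        \<le> hausdorff_premeasure s \<delta> A + hausdorff_premeasure s \<delta> B"
      using d by (intro add_mono hausdorff_premeasure_mono) auto
    also have "\<dots> \<le> hausdorff_outer s (A \<union> B)"
      using small[OF d(1,2)] hausdorff_premeasure_le_outer[OF d(1)] by (rule order_trans)
    finally show ?thesis .
  qed
  then have "(SUP \<delta>\<^sub>2\<in>{0<..}. hausdorff_premeasure s \<delta>\<^sub>2 B + (SUP \<delta>\<^sub>1\<in>{0<..}. hausdorff_premeasure s \<delta>\<^sub>1 A))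
      \<le> hausdorff_outer s (A \<union> B)"
    by (intro SUP_least) (subst add.commute, subst ennreal_SUP_add_left[symmetric], auto intro!: SUP_least)
  then show ?thesis
    by (subst (asm) ennreal_SUP_add_left) (auto simp: hausdorff_outer_eq add.commute)
qed

text \<open>Caratheodory's argument: \<open>Y n\<close> has positive distance from \<open>F\<close>,
  so additivity holds for it. What is missing from \<open>X - F\<close> is cut into shells
  \<open>D n\<close> of decreasing distance to \<open>F\<close>. Shells with indices of equal parity
  are separated, hence the sum of all their measures is finite and its tails are small.\<close>

lemma hausdorff_outer_closed_split:
  fixes F :: "'a::euclidean_space set"
  assumes s: "1 \<le> s" and F: "closed F"
  shows "hausdorff_outer s (X \<inter> F) + hausdorff_outer s (X - F) \<le> hausdorff_outer s X"
proof (cases "F = {} \<or> hausdorff_outer s X = \<infinity>")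
  case True
  then show ?thesis by (auto simp: hausdorff_outer_empty[OF s])
next
  case False
  then have ne: "F \<noteq> {}" and fin: "hausdorff_outer s X < \<infinity>" by (auto simp: less_top)
  let ?m = "hausdorff_outer s"
  define Y where "Y n = {x \<in> X. 1 / (real n + 1) \<le> infdist x F}" for n
  define D where "D n = {x \<in> X. 1 / (real n + 2) \<le> infdist x F \<and> infdist x F < 1 / (real n + 1)}" for n
  have sep: "1 / (real a) - 1 / (real b) \<le> dist x y"
    if "1 / real a \<le> infdist x F" "infdist y F \<le> 1 / real b" for a b x y
    using infdist_triangle[of x F y] that by linarith
  \<comment> \<open>A family with fixed \<open>i\<close> skips every second shell, which leaves a
    positive gap between its members.\<close>
  have part: "(\<Sum>m<k. ?m (D (2 * m + i))) \<le> ?m (\<Union>m<k. D (2 * m + i))" for k i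
  proof (induction k)
    case (Suc k)
    have "(\<Sum>m<Suc k. ?m (D (2 * m + i))) \<le> ?m (\<Union>m<k. D (2 * m + i)) + ?m (D (2 * k + i))"
      using Suc by (auto intro: add_mono)
    also have "\<dots> \<le> ?m ((\<Union>m<k. D (2 * m + i)) \<union> D (2 * k + i))"
    proof (cases "k = 0")
      case True then show ?thesis by (simp add: hausdorff_outer_empty[OF s])
    next
      case k: False
      show ?thesis
      proof (rule hausdorff_outer_separated[OF s, of "1 / real (2 * k + i) - 1 / real (2 * k + i + 1)"])
        show "0 < 1 / real (2 * k + i) - 1 / real (2 * k + i + 1)"
          using k frac_less2[of 1 1 "real (2 * k + i)" "real (2 * k + i + 1)"] by simp
        fix x y assume "x \<in> (\<Union>m<k. D (2 * m + i))" "y \<in> D (2 * k + i)"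
        then obtain m where m: "m < k" "x \<in> D (2 * m + i)" by auto
        have "1 / real (2 * k + i) \<le> 1 / (real (2 * m + i) + 2)" using m by (intro frac_le) auto
        also have "\<dots> \<le> infdist x F" using m unfolding D_def by auto
        finally have "1 / real (2 * k + i) \<le> infdist x F" .
        moreover have "infdist y F \<le> 1 / real (2 * k + i + 1)"
          using \<open>y \<in> D (2 * k + i)\<close> unfolding D_def by (auto simp: add_ac)
        ultimately show "1 / real (2 * k + i) - 1 / real (2 * k + i + 1) \<le> dist x y" by (rule sep)
      qed
    qed
    also have "(\<Union>m<k. D (2 * m + i)) \<union> D (2 * k + i) = (\<Union>m<Suc k. D (2 * m + i))"
      by (auto simp: lessThan_Suc)
    finally show ?case .
  qed simp
  have part': "(\<Sum>m<k. ?m (D (2 * m + i))) \<le> ?m X" for k i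
    by (rule order_trans[OF part]) (auto intro!: hausdorff_outer_mono simp: D_def)
  have all: "(\<Sum>m<n. ?m (D m)) \<le> ?m X + ?m X" for n
  proof -
    have "(\<Sum>m<n. ?m (D m)) \<le> (\<Sum>m<2 * n. ?m (D m))" by (rule sum_mono2) auto
    also have "\<dots> = (\<Sum>m<n. ?m (D (2 * m + 0))) + (\<Sum>m<n. ?m (D (2 * m + 1)))"
      by (induction n) (auto simp: algebra_simps)
    also have "\<dots> \<le> ?m X + ?m X" by (intro add_mono part')
    finally show ?thesis .
  qed
  define r where "r n = enn2real (?m (D n))" for n
  have Dfin: "?m (D n) < \<infinity>" for n
    using hausdorff_outer_mono[of "D n" X s] fin unfolding D_def by (auto intro: le_less_trans)
  have rD: "?m (D n) = ennreal (r n)" and r0: "0 \<le> r n" for n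
    using Dfin[of n] unfolding r_def by auto
  have "summable r"
  proof (rule summableI_nonneg_bounded[OF r0])
    fix n
    have "ennreal (\<Sum>m<n. r m) = (\<Sum>m<n. ?m (D m))" unfolding rD by (rule sum_ennreal[symmetric]) (rule r0)
    also have "\<dots> \<le> ?m X + ?m X" by (rule all)
    finally have "enn2real (ennreal (\<Sum>m<n. r m)) \<le> enn2real (?m X + ?m X)"
      using fin by (intro enn2real_mono) (auto simp: less_top[symmetric])
    then show "(\<Sum>m<n. r m) \<le> enn2real (?m X + ?m X)"
      by (simp add: sum_nonneg r0)
  qed
  show ?thesis
  proof (rule ennreal_le_epsilon)
    fix e :: real assume e: "0 < e"
    obtain N where N: "norm (\<Sum>i. r (i + N)) < e"
      using suminf_exist_split[OF e \<open>summable r\<close>] by blast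
    have sub: "X - F \<subseteq> Y N \<union> (\<Union>m. D (m + N))"
    proof
      fix x assume x: "x \<in> X - F"
      have "0 < infdist x F" using x F ne by (simp add: infdist_pos_not_in_closed)
      show "x \<in> Y N \<union> (\<Union>m. D (m + N))"
      proof (cases "x \<in> Y N")
        case False
        define n where "n = nat (\<lfloor>1 / infdist x F\<rfloor>)"
        have n: "real n \<le> 1 / infdist x F" "1 / infdist x F < real n + 1"
          using \<open>0 < infdist x F\<close> unfolding n_def by auto
        have f: "real N + 1 < 1 / infdist x F"
          using False x \<open>0 < infdist x F\<close> unfolding Y_def by (auto simp: field_simps)
        have Nn: "N + 1 \<le> n" using f n by linarith
        have "1 / (real n + 1) \<le> infdist x F" "infdist x F \<le> 1 / real n"
          using n \<open>0 < infdist x F\<close> Nn by (auto simp: field_simps)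
        \<comment> \<open>The shells are half open: the value \<open>infdist x F = 1 / n\<close>
          belongs to \<open>D (n - 2)\<close>, every other value considered here to
          \<open>D (n - 1)\<close>.\<close>
        then have "x \<in> D (n - 1) \<or> (x \<in> D (n - 2) \<and> N + 2 \<le> n)"
        proof (cases "infdist x F = 1 / real n")
          case True
          have "n \<noteq> N + 1" using f True by auto
          then have "N + 2 \<le> n" using Nn by auto
          moreover have "x \<in> D (n - 2)" using x True \<open>N + 2 \<le> n\<close> \<open>0 < infdist x F\<close> unfolding D_def
            by (auto simp: of_nat_diff field_simps)
          ultimately show ?thesis by auto
        qed (use x Nn in \<open>auto simp: D_def of_nat_diff add.commute\<close>)
        then show ?thesis
        proof
          assume "x \<in> D (n - 1)"
          moreover have "n - 1 = (n - 1 - N) + N" using Nn by auto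
          ultimately show ?thesis by (metis UN_I UnCI UNIV_I)
        next
          assume "x \<in> D (n - 2) \<and> N + 2 \<le> n"
          moreover from this have "n - 2 = (n - 2 - N) + N" by auto
          ultimately show ?thesis by (metis UN_I UnCI UNIV_I)
        qed
      qed simp
    qed
    have "?m (X - F) \<le> ?m (Y N) + ?m (\<Union>m. D (m + N))"
      using hausdorff_outer_mono[OF sub] hausdorff_outer_Un_le[OF s] by (rule order_trans)
    also have "?m (\<Union>m. D (m + N)) \<le> (\<Sum>m. ?m (D (m + N)))" by (rule hausdorff_outer_UN_le)
    also have "\<dots> = ennreal (\<Sum>m. r (m + N))" unfolding rD
      using \<open>summable r\<close> r0 by (intro suminf_ennreal2) (auto simp: summable_iff_shift)
    also have "\<dots> \<le> ennreal e" using N by (intro ennreal_leI) auto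
    finally have 1: "?m (X - F) \<le> ?m (Y N) + ennreal e" by (simp add: add_mono)
    have "?m (X \<inter> F) + ?m (Y N) \<le> ?m ((X \<inter> F) \<union> Y N)"
    proof (rule hausdorff_outer_separated[OF s, of "1 / (real N + 1)"])
      fix x y assume "x \<in> X \<inter> F" "y \<in> Y N"
      then show "1 / (real N + 1) \<le> dist x y"
        using infdist_le[of x F y] unfolding Y_def by (auto simp: dist_commute)
    qed simp
    also have "\<dots> \<le> ?m X" by (rule hausdorff_outer_mono) (auto simp: Y_def)
    finally have 2: "?m (X \<inter> F) + ?m (Y N) \<le> ?m X" .
    have "?m (X \<inter> F) + ?m (X - F) \<le> ?m (X \<inter> F) + (?m (Y N) + ennreal e)" by (rule add_left_mono[OF 1])
    also have "\<dots> = (?m (X \<inter> F) + ?m (Y N)) + ennreal e" by (simp add: add.assoc)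
    also have "\<dots> \<le> ?m X + ennreal e" by (rule add_right_mono[OF 2])
    finally show "?m (X \<inter> F) + ?m (X - F) \<le> ?m X + ennreal e" .
  qed
qed

text \<open>\<open>measure_of\<close> takes the values of the outer measure only where that is
  countably additive. Caratheodory's lemma provides this on a sigma algebra which contains the
  closed sets by the preceding splitting, hence all Borel sets.\<close>

lemma emeasure_hausdorff:
  fixes A :: "'a::euclidean_space set"
  assumes s: "1 \<le> s" and A: "A \<in> sets borel"
  shows "emeasure (hausdorff s) A = hausdorff_outer s A"
proof -
  let ?m = "hausdorff_outer s :: 'a set \<Rightarrow> ennreal"
  interpret P: sigma_algebra "UNIV :: 'a set" "Pow UNIV" by (rule sigma_algebra_Pow)
  have oms: "outer_measure_space (Pow UNIV) ?m"
    unfolding outer_measure_space_def positive_def increasing_def countably_subadditive_def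
    using hausdorff_outer_empty[OF s] hausdorff_outer_mono hausdorff_outer_UN_le by auto
  define L where "L = lambda_system UNIV (Pow UNIV) ?m"
  have ms: "measure_space UNIV L ?m" unfolding L_def by (rule P.caratheodory_lemma[OF oms])
  have cl: "F \<in> L" if "closed F" for F
    unfolding L_def lambda_system_def
  proof (safe, simp)
    fix X :: "'a set"
    show "?m (F \<inter> X) + ?m ((UNIV - F) \<inter> X) = ?m X"
    proof (rule antisym)
      show "?m (F \<inter> X) + ?m ((UNIV - F) \<inter> X) \<le> ?m X"
        using hausdorff_outer_closed_split[OF s that, of X] by (simp add: Int_commute Diff_eq)
      have "X = (F \<inter> X) \<union> ((UNIV - F) \<inter> X)" by auto
      then show "?m X \<le> ?m (F \<inter> X) + ?m ((UNIV - F) \<inter> X)" using hausdorff_outer_Un_le[OF s] by metis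
    qed
  qed
  have "sigma_algebra UNIV L" using ms unfolding measure_space_def by auto
  then have "sigma_sets UNIV (Collect closed) \<subseteq> L"
    using cl by (intro sigma_algebra.sigma_sets_subset) auto
  then have sub: "sets borel \<subseteq> L" by (simp add: borel_eq_closed)
  have "emeasure (measure_of UNIV (sets borel) ?m) A = ?m A"
  proof (rule emeasure_measure_of_sigma)
    show "sigma_algebra UNIV (sets (borel :: 'a measure))"
      using sets.sigma_algebra_axioms[of "borel :: 'a measure"] by simp
    show "positive (sets borel) ?m" using ms unfolding measure_space_def positive_def by auto
    show "countably_additive (sets borel) ?m"
      using ms sub unfolding measure_space_def countably_additive_def by (meson subset_iff order_trans)
  qed (use A in simp)
  then show ?thesis unfolding hausdorff_def .
qed

lemma sets_hausdorff [simp, measurable_cong]: "sets (hausdorff s :: 'a::euclidean_space measure) = sets borel"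
  and space_hausdorff [simp]: "space (hausdorff s :: 'a measure) = UNIV"
proof -
  have "sets borel \<subseteq> Pow (UNIV :: 'a set)" by auto
  then show "space (hausdorff s :: 'a measure) = UNIV" unfolding hausdorff_def by (rule space_measure_of)
  show "sets (hausdorff s :: 'a measure) = sets borel"
    unfolding hausdorff_def using sets.sigma_sets_eq[of "borel :: 'a measure"]
    by (simp add: sets_measure_of)
qed


section \<open>Upper and lower bounds for the Hausdorff measure of hypersurfaces\<close>

lemma hausdorff_premeasure_finite_le:
  fixes V :: "'b \<Rightarrow> 'a::euclidean_space set"
  assumes s: "1 \<le> s" and I: "finite I" and A: "A \<subseteq> (\<Union>m\<in>I. V m)" and d: "0 \<le> \<eta>" "\<eta> \<le> \<delta>"
    and V: "\<And>m. m \<in> I \<Longrightarrow> bounded (V m) \<and> diameter (V m) \<le> \<eta>"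
  shows "hausdorff_premeasure s \<delta> A \<le> ennreal (real (card I) * (unit_ball_vol (real s) * (\<eta> / 2) ^ s))"
proof -
  obtain e where e: "bij_betw e {0..<card I} I" using ex_bij_betw_nat_finite[OF I] by auto
  define U where "U i = (if i < card I then V (e i) else {})" for i
  have eI: "e i \<in> I" if "i < card I" for i using e that by (auto simp: bij_betw_def)
  have "U \<in> hausdorff_covers \<delta> A"
    unfolding hausdorff_covers_def
  proof (intro CollectI conjI allI subsetI)
    fix x assume "x \<in> A"
    then obtain m where m: "m \<in> I" "x \<in> V m" using A by auto
    then obtain i where "i < card I" "e i = m" using e unfolding bij_betw_def by force
    then show "x \<in> (\<Union>i. U i)" using m unfolding U_def by auto
  next
    fix i show "bounded (U i)" "diameter (U i) \<le> \<delta>"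
      using V[OF eI] d unfolding U_def by (auto intro: order_trans)
  qed
  then have "hausdorff_premeasure s \<delta> A \<le> hausdorff_cost s U" by (rule hausdorff_premeasure_le)
  also have "\<dots> = (\<Sum>i<card I. ennreal (unit_ball_vol (real s) * (diameter (U i) / 2) ^ s))"
    unfolding hausdorff_cost_def using s
    by (intro suminf_finite) (auto simp: U_def power_0_left)
  also have "\<dots> \<le> (\<Sum>i<card I. ennreal (unit_ball_vol (real s) * (\<eta> / 2) ^ s))"
  proof (intro sum_mono ennreal_leI mult_left_mono power_mono)
    fix i assume "i \<in> {..<card I}"
    then show "diameter (U i) / 2 \<le> \<eta> / 2" "0 \<le> diameter (U i) / 2"
      using V[OF eI] unfolding U_def by (auto intro: diameter_ge_0)
  qed auto
  also have "\<dots> = ennreal (real (card I) * (unit_ball_vol (real s) * (\<eta> / 2) ^ s))"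
    using d by (simp add: ennreal_mult ennreal_of_nat_eq_real_of_nat)
  finally show ?thesis .
qed

text \<open>Sets on which secants stay away from a fixed direction \<open>\<nu>\<close> are Lipschitz graphs over the hyperplane
  orthogonal to \<open>\<nu>\<close>; they are covered by the preimages of a grid in that hyperplane.\<close>

lemma hausdorff_outer_graph_le:
  fixes A :: "'a::euclidean_space set"
  assumes d2: "2 \<le> DIM('a)" and h: "0 < h" and nu: "norm \<nu> = 1"
    and sec: "\<And>x y. x \<in> A \<Longrightarrow> y \<in> A \<Longrightarrow> \<bar>\<nu> \<bullet> (x - y)\<bar> \<le> norm (x - y) / 2"
    and diam: "\<And>x y. x \<in> A \<Longrightarrow> y \<in> A \<Longrightarrow> norm (x - y) \<le> h"
  shows "hausdorff_outer (DIM('a) - 1) A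
    \<le> ennreal (unit_ball_vol (real (DIM('a) - 1)) * (5 * real DIM('a) * h) ^ (DIM('a) - 1))"
proof (cases "A = {}")
  case True
  then show ?thesis using d2 by (simp add: hausdorff_outer_empty)
next
  case False
  then obtain p where p: "p \<in> A" by auto
  let ?s = "DIM('a) - 1" and ?d = "real DIM('a)"
  have s: "1 \<le> ?s" using d2 by simp
  obtain S where S: "\<nu> \<in> S" "pairwise real_inner_class.orthogonal S" "\<And>x. x \<in> S \<Longrightarrow> norm x = 1"
    "independent S" "card S = DIM('a)" "span S = UNIV"
    using vector_in_orthonormal_basis[OF nu] by metis
  have finS: "finite S" using S(4) by (rule independent_imp_finite)
  have normS: "(norm z)\<^sup>2 = (\<Sum>u\<in>S. (z \<bullet> u)\<^sup>2)" for z
  proof -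
    have "(norm z)\<^sup>2 = z \<bullet> z" by (simp add: dot_square_norm)
    also have "\<dots> = z \<bullet> (\<Sum>u\<in>S. (z \<bullet> u) *\<^sub>R u)"
      using orthonormal_basis_expand[OF S(2,3), of z] finS S(6) by simp
    finally show ?thesis by (simp add: inner_sum_right power2_eq_square)
  qed
  define B where "B = S - {\<nu>}"
  have B: "finite B" "card B = ?s" "\<And>u. u \<in> B \<Longrightarrow> norm u = 1"
    using finS S unfolding B_def by auto
  \<comment> \<open>The component along \<open>\<nu>\<close> carries at most a quarter of the
    squared length, so the coordinates in \<open>B\<close> control the whole vector.\<close>
  have key: "(norm z)\<^sup>2 \<le> 2 * (\<Sum>u\<in>B. (z \<bullet> u)\<^sup>2)" if "\<bar>\<nu> \<bullet> z\<bar> \<le> norm z / 2" for z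
  proof -
    have "\<bar>\<nu> \<bullet> z\<bar>\<^sup>2 \<le> (norm z / 2)\<^sup>2" using that by (intro power_mono) auto
    moreover have eq: "(norm z)\<^sup>2 = (z \<bullet> \<nu>)\<^sup>2 + (\<Sum>u\<in>B. (z \<bullet> u)\<^sup>2)"
      unfolding normS[of z] B_def by (rule sum.remove[OF finS S(1)])
    ultimately have "3 * (z \<bullet> \<nu>)\<^sup>2 \<le> (\<Sum>u\<in>B. (z \<bullet> u)\<^sup>2)"
      by (simp add: inner_commute power_divide)
    then show ?thesis using eq zero_le_power2[of "z \<bullet> \<nu>"] by linarith
  qed
  have main: "hausdorff_premeasure ?s \<delta> A \<le> ennreal (unit_ball_vol (real ?s) * (5 * ?d * h) ^ ?s)"
    if del: "0 < \<delta>" for \<delta>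
  proof -
    \<comment> \<open>Cells of width \<open>h / N\<close> have diameter at most
      \<open>2 d h / N\<close>, and \<open>N\<close> is large enough to bring this below
      \<open>\<delta>\<close>. There are \<open>(2 N + 1)^(d-1)\<close> of them, so the total cost
      stays bounded as \<open>N\<close> grows.\<close>
    obtain n :: nat where n: "2 * ?d * h / \<delta> < real n" using reals_Archimedean2 by blast
    define N where "N = real (Suc n)"
    have N: "1 \<le> N" "2 * ?d * h / N \<le> \<delta>"
      using n del h unfolding N_def by (auto simp: field_simps)
    define V where "V m = {x \<in> A. \<forall>u\<in>B. \<lfloor>(x - p) \<bullet> u * N / h\<rfloor> = m u}" for m :: "'a \<Rightarrow> int"
    define I where "I = (\<Pi>\<^sub>E u\<in>B. {- int (Suc n)..int (Suc n)})"
    have "int (Suc n) - - int (Suc n) + 1 = int (2 * Suc n + 1)" by simp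
    then have "card {- int (Suc n)..int (Suc n)} = 2 * Suc n + 1"
      by (simp only: card_atLeastAtMost_int nat_int)
    then have cI: "card I = (2 * Suc n + 1) ^ ?s"
      unfolding I_def card_PiE[OF B(1)] using B(2) by (simp only: prod_constant)
    have cover: "A \<subseteq> (\<Union>m\<in>I. V m)"
    proof
      fix x assume x: "x \<in> A"
      define m where "m = (\<lambda>u\<in>B. \<lfloor>(x - p) \<bullet> u * N / h\<rfloor>)"
      have "m \<in> I" unfolding I_def
      proof (rule PiE_I)
        fix u assume u: "u \<in> B"
        have "\<bar>(x - p) \<bullet> u\<bar> \<le> norm (x - p) * norm u" by (rule Cauchy_Schwarz_ineq2)
        also have "\<dots> \<le> h" using diam[OF x p] B(3)[OF u] by simp
        finally have "\<bar>(x - p) \<bullet> u\<bar> \<le> h" .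
        then have "\<bar>(x - p) \<bullet> u\<bar> * N / h \<le> h * N / h"
          using h N by (intro divide_right_mono mult_right_mono) auto
        then have ab: "\<bar>(x - p) \<bullet> u * N / h\<bar> \<le> N" using h N by (simp add: abs_mult)
        have "- N \<le> (x - p) \<bullet> u * N / h" "(x - p) \<bullet> u * N / h \<le> N"
          using abs_le_D2[OF ab] abs_le_D1[OF ab] by (simp_all only: minus_le_iff)
        then show "m u \<in> {- int (Suc n)..int (Suc n)}"
          using u unfolding m_def N_def by (simp add: le_floor_iff floor_le_iff)
      qed (auto simp: m_def)
      moreover have "x \<in> V m" unfolding V_def m_def using x by auto
      ultimately show "x \<in> (\<Union>m\<in>I. V m)" by blast
    qed
    have dV: "norm (x - y) \<le> 2 * ?d * h / N" if xy: "x \<in> V m" "y \<in> V m" for m x y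
    proof -
      have "((x - y) \<bullet> u)\<^sup>2 \<le> (h / N)\<^sup>2" if "u \<in> B" for u
      proof -
        have "\<lfloor>(x - p) \<bullet> u * N / h\<rfloor> = \<lfloor>(y - p) \<bullet> u * N / h\<rfloor>" using xy that unfolding V_def by auto
        then have "\<bar>(x - p) \<bullet> u * N / h - (y - p) \<bullet> u * N / h\<bar> \<le> 1" by linarith
        moreover have "(x - p) \<bullet> u * N / h - (y - p) \<bullet> u * N / h = (x - y) \<bullet> u * N / h"
          by (simp add: inner_diff_left algebra_simps diff_divide_distrib)
        ultimately have "\<bar>(x - y) \<bullet> u\<bar> \<le> h / N" using h N by (simp add: abs_mult field_simps)
        then show ?thesis by (metis abs_le_square_iff abs_of_nonneg abs_ge_zero order_trans)
      qed
      then have "(\<Sum>u\<in>B. ((x - y) \<bullet> u)\<^sup>2) \<le> real ?s * (h / N)\<^sup>2"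
        using sum_bounded_above[of B "\<lambda>u. ((x - y) \<bullet> u)\<^sup>2" "(h / N)\<^sup>2"] B by simp
      then have "(norm (x - y))\<^sup>2 \<le> 2 * (?d * (h / N)\<^sup>2)"
        using key[OF sec, of x y] xy unfolding V_def by (smt (verit) mem_Collect_eq mult_right_mono zero_le_power2 of_nat_diff of_nat_mono diff_le_self)
      also have "\<dots> \<le> (2 * ?d * h / N)\<^sup>2"
      proof -
        have "2 \<le> ?d" using d2 by simp
        then have "2 * ?d \<le> (2 * ?d)\<^sup>2" by (intro self_le_power) auto
        then have "2 * ?d * (h / N)\<^sup>2 \<le> (2 * ?d)\<^sup>2 * (h / N)\<^sup>2" by (rule mult_right_mono) simp
        then show ?thesis by (simp add: power_mult_distrib power_divide)
      qed
      finally show ?thesis by (rule power2_le_imp_le) (use h N in auto)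
    qed
    have "hausdorff_premeasure ?s \<delta> A
        \<le> ennreal (real (card I) * (unit_ball_vol (real ?s) * ((2 * ?d * h / N) / 2) ^ ?s))"
    proof (rule hausdorff_premeasure_finite_le[OF s _ cover _ N(2)])
      show "finite I" unfolding I_def using B by (intro finite_PiE) auto
      show "0 \<le> 2 * ?d * h / N" using h N by auto
      fix m assume "m \<in> I"
      have "bounded A" using diam p unfolding bounded_def dist_norm by blast
      then show "bounded (V m) \<and> diameter (V m) \<le> 2 * ?d * h / N"
        using dV h N by (auto intro!: diameter_le bounded_subset[of A] simp: V_def)
    qed
    also have "real (card I) * (unit_ball_vol (real ?s) * ((2 * ?d * h / N) / 2) ^ ?s)
        = unit_ball_vol (real ?s) * ((2 * N + 1) * (?d * h / N)) ^ ?s"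
    proof -
      have "real (card I) = (2 * N + 1) ^ ?s" unfolding cI N_def by simp
      moreover have "2 * ?d * h / N / 2 = ?d * h / N" by simp
      ultimately show ?thesis by (simp only: power_mult_distrib ac_simps)
    qed
    also have "\<dots> \<le> unit_ball_vol (real ?s) * (5 * ?d * h) ^ ?s"
    proof (intro mult_left_mono power_mono)
      have "(2 * N + 1) * (?d * h / N) \<le> (5 * N) * (?d * h / N)"
        using N h by (intro mult_right_mono) auto
      then show "(2 * N + 1) * (?d * h / N) \<le> 5 * ?d * h" using N by simp
    qed (use N h in auto)
    finally show ?thesis by (simp add: ennreal_leI)
  qed
  show ?thesis unfolding hausdorff_outer_eq using main by (intro SUP_least) auto
qed

text \<open>Every covering of \<open>A\<close> yields a covering of the ball by tubes in direction
  \<open>\<nu>\<close>. The tube over a set of diameter \<open>\<rho>\<close> has volume at most a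
  multiple of \<open>L \<rho>^(d-1)\<close>, so comparing Lebesgue volumes bounds the cost of the
  covering from below.\<close>

lemma hausdorff_outer_slab_lower:
  fixes A :: "'a::euclidean_space set"
  assumes d2: "2 \<le> DIM('a)" and L: "0 < L" and nu: "norm \<nu> = 1"
    and sub: "ball p L \<subseteq> {a + t *\<^sub>R \<nu> | a t. a \<in> A \<and> \<bar>t\<bar> \<le> 4 * L}"
  shows "ennreal (unit_ball_vol (real (DIM('a) - 1)) / 12 / 4 ^ DIM('a) * L ^ (DIM('a) - 1))
    \<le> hausdorff_outer (DIM('a) - 1) A"
proof -
  let ?d = "DIM('a)" and ?s = "DIM('a) - 1"
  let ?\<omega> = "unit_ball_vol (real DIM('a))" and ?\<kappa> = "unit_ball_vol (real (DIM('a) - 1))"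
  have ds: "?d = Suc ?s" by simp
  have \<omega>: "0 < ?\<omega>" and \<kappa>: "0 < ?\<kappa>" by auto
  \<comment> \<open>A tube of radius \<open>\<rho>\<close> is covered by at most
    \<open>12 L / \<rho>\<close> balls of radius \<open>2 \<rho>\<close>.\<close>
  define K where "K = 12 * ?\<omega> * 2 ^ ?d * L"
  have K: "0 < K" unfolding K_def using \<omega> L by simp
  define tb where "tb U = {a + t *\<^sub>R \<nu> | a t. a \<in> U \<and> \<bar>t\<bar> \<le> 4 * L}" for U
  have tube: "\<exists>V. V \<in> sets lborel \<and> tb U \<subseteq> V \<and>
      emeasure lborel V \<le> ennreal (K * \<rho> ^ ?s)"
    if U: "bounded U" "diameter U \<le> \<rho>" and \<rho>: "0 < \<rho>" "\<rho> \<le> L" for U :: "'a set" and \<rho>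
  proof (cases "U = {}")
    case True
    then show ?thesis unfolding tb_def by (intro exI[of _ "{}"]) auto
  next
    case False
    then obtain u where u: "u \<in> U" by auto
    define m where "m = nat \<lceil>4 * L / \<rho>\<rceil>"
    have m: "4 * L / \<rho> \<le> real m" "real m \<le> 4 * L / \<rho> + 1" unfolding m_def using L \<rho> by (auto simp: of_nat_nat ceiling_le_iff)
    let ?V = "\<Union>k\<in>{- int m - 1..int m}. cball (u + (real_of_int k * \<rho>) *\<^sub>R \<nu>) (2 * \<rho>)"
    have "tb U \<subseteq> ?V"
      unfolding tb_def
    proof clarify
      fix a t assume a: "a \<in> U" and t: "\<bar>t\<bar> \<le> 4 * L"
      define k where "k = \<lfloor>t / \<rho>\<rfloor>"
      have "\<bar>t / \<rho>\<bar> \<le> 4 * L / \<rho>" using t \<rho> by (simp add: divide_right_mono)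
      then have "- real m \<le> t / \<rho>" "t / \<rho> \<le> real m" using m by linarith+
      then have kr: "k \<in> {- int m - 1..int m}" unfolding k_def by (auto simp: le_floor_iff floor_le_iff)
      have k: "\<bar>t / \<rho> - k\<bar> \<le> 1" unfolding k_def by linarith
      have "\<bar>t - k * \<rho>\<bar> = \<rho> * \<bar>t / \<rho> - k\<bar>"
        using \<rho> by (simp add: abs_if field_simps)
      also have "\<dots> \<le> \<rho> * 1" using k \<rho> by (intro mult_left_mono) auto
      finally have tk: "\<bar>t - k * \<rho>\<bar> \<le> \<rho>" by simp
      have "norm (a - u) \<le> \<rho>" using diameter_bounded_bound[OF U(1) a u] U(2) by (simp add: dist_norm)
      then have "norm ((a - u) + (t - k * \<rho>) *\<^sub>R \<nu>) \<le> \<rho> + \<rho>"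
        using tk nu by (intro norm_triangle_le add_mono) auto
      then have "a + t *\<^sub>R \<nu> \<in> cball (u + (real_of_int k * \<rho>) *\<^sub>R \<nu>) (2 * \<rho>)"
        by (simp add: mem_cball dist_norm norm_minus_commute algebra_simps)
      then show "a + t *\<^sub>R \<nu> \<in> ?V" using kr by blast
    qed
    moreover have "emeasure lborel ?V \<le> ennreal (K * \<rho> ^ ?s)"
    proof -
      have "emeasure lborel ?V \<le> (\<Sum>k\<in>{- int m - 1..int m}. emeasure lborel (cball (u + (real_of_int k * \<rho>) *\<^sub>R \<nu>) (2 * \<rho>)))"
        by (intro emeasure_subadditive_finite) auto
      also have "\<dots> = of_nat (2 * m + 2) * ennreal (?\<omega> * (2 * \<rho>) ^ ?d)"
      proof -
        have "card {- int m - 1..int m} = 2 * m + 2" by simp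
        moreover have "emeasure lborel (cball (u + (real_of_int k * \<rho>) *\<^sub>R \<nu>) (2 * \<rho>)) = ennreal (?\<omega> * (2 * \<rho>) ^ ?d)" for k
          using \<rho> by (simp add: emeasure_cball)
        ultimately show ?thesis by (simp only: sum_constant)
      qed
      also have "\<dots> = ennreal (real (2 * m + 2) * (?\<omega> * (2 * \<rho>) ^ ?d))"
        unfolding ennreal_of_nat_eq_real_of_nat using \<rho> \<omega> by (intro ennreal_mult[symmetric]) auto
      also have "\<dots> \<le> ennreal (K * \<rho> ^ ?s)"
      proof (rule ennreal_leI)
        have "real (2 * m + 2) \<le> 12 * L / \<rho>"
        proof -
          have "1 \<le> L / \<rho>" using \<rho> by simp
          moreover have "12 * L / \<rho> = 12 * (L / \<rho>)" "4 * L / \<rho> = 4 * (L / \<rho>)" by simp_all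
          ultimately show ?thesis using m by linarith
        qed
        then have "real (2 * m + 2) * (?\<omega> * (2 * \<rho>) ^ ?d) \<le> 12 * L / \<rho> * (?\<omega> * (2 * \<rho>) ^ ?d)"
          using \<rho> \<omega> by (intro mult_right_mono) auto
        also have "\<dots> = K * \<rho> ^ ?s"
          unfolding K_def using \<rho> by (simp add: power_mult_distrib power_eq_if[of \<rho> "?d"])
        finally show "real (2 * m + 2) * (?\<omega> * (2 * \<rho>) ^ ?d) \<le> K * \<rho> ^ ?s" .
      qed
      finally show ?thesis .
    qed
    ultimately show ?thesis by (intro exI[of _ ?V]) auto
  qed
  have split: "K * (a + e / K * t) = K * c / k * (k * (a / c)) + e * t" if "k \<noteq> 0" "c \<noteq> 0" for a c e k t :: real
    using K that by (simp add: field_simps)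
  have enn: "ennreal (a * b + c * e) = ennreal a * ennreal b + ennreal c * ennreal e"
    if "0 \<le> a" "0 \<le> b" "0 \<le> c" "0 \<le> e" for a b c e
    using that by (simp add: ennreal_mult ennreal_plus)
  have cost: "ennreal (?\<omega> * L ^ ?d) \<le> ennreal (K * 2 ^ ?s / ?\<kappa>) * hausdorff_cost ?s U"
    if U: "U \<in> hausdorff_covers (L / 2) A" for U
  proof (rule ennreal_le_epsilon)
    fix e :: real assume e: "0 < e"
    define \<eta> where "\<eta> = e / K"
    have \<eta>: "0 < \<eta>" unfolding \<eta>_def using e K by simp
    have bU: "bounded (U i)" "diameter (U i) \<le> L / 2" "0 \<le> diameter (U i)" for i
      using U unfolding hausdorff_covers_def by (auto intro: diameter_ge_0)
    \<comment> \<open>The tube estimate asks for a positive radius, but members of the covering may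
      have diameter 0. Each diameter is enlarged slightly, with summable errors; the bound
      \<open>L / 2\<close> on the diameters leaves room for this below \<open>L\<close>.\<close>
    have "\<exists>\<rho>. diameter (U i) < \<rho> \<and> \<rho> \<le> L \<and> \<rho> ^ ?s \<le> diameter (U i) ^ ?s + \<eta> * (1/2) ^ Suc i" for i
    proof -
      have "((\<lambda>\<rho>. \<rho> ^ ?s) \<longlongrightarrow> diameter (U i) ^ ?s) (at_right (diameter (U i)))"
        by (intro tendsto_intros)
      then have "\<forall>\<^sub>F \<rho> in at_right (diameter (U i)). \<rho> ^ ?s < diameter (U i) ^ ?s + \<eta> * (1/2) ^ Suc i"
        using \<eta> by (intro order_tendstoD(2)) auto
      moreover have "\<forall>\<^sub>F \<rho> in at_right (diameter (U i)). \<rho> \<in> {diameter (U i)<..<L}"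
        using bU(2)[of i] L by (intro eventually_at_right_real) linarith
      ultimately have "\<forall>\<^sub>F \<rho> in at_right (diameter (U i)). diameter (U i) < \<rho> \<and> \<rho> \<le> L \<and> \<rho> ^ ?s \<le> diameter (U i) ^ ?s + \<eta> * (1/2) ^ Suc i"
        by eventually_elim auto
      then show ?thesis using eventually_happens'[OF trivial_limit_at_right_real] by blast
    qed
    then obtain \<rho> where \<rho>: "\<And>i. diameter (U i) < \<rho> i" "\<And>i. \<rho> i \<le> L"
      "\<And>i. \<rho> i ^ ?s \<le> diameter (U i) ^ ?s + \<eta> * (1/2) ^ Suc i" by metis
    have "\<forall>i. \<exists>V. V \<in> sets lborel \<and> tb (U i) \<subseteq> V \<and> emeasure lborel V \<le> ennreal (K * \<rho> i ^ ?s)"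
    proof
      fix i
      have "diameter (U i) \<le> \<rho> i" "0 < \<rho> i" using \<rho>(1)[of i] bU(3)[of i] by linarith+
      then show "\<exists>V. V \<in> sets lborel \<and> tb (U i) \<subseteq> V \<and> emeasure lborel V \<le> ennreal (K * \<rho> i ^ ?s)"
        by (intro tube bU(1) \<rho>(2))
    qed
    from choice[OF this] obtain V where "\<forall>i. V i \<in> sets lborel \<and> tb (U i) \<subseteq> V i \<and>
        emeasure lborel (V i) \<le> ennreal (K * \<rho> i ^ ?s)" ..
    then have V: "\<And>i. V i \<in> sets lborel" "\<And>i. tb (U i) \<subseteq> V i"
      "\<And>i. emeasure lborel (V i) \<le> ennreal (K * \<rho> i ^ ?s)" by auto
    have "ball p L \<subseteq> (\<Union>i. V i)"
    proof
      fix x assume "x \<in> ball p L"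
      then obtain a t where at: "a \<in> A" "\<bar>t\<bar> \<le> 4 * L" "x = a + t *\<^sub>R \<nu>" using sub by blast
      then obtain i where "a \<in> U i" using U unfolding hausdorff_covers_def by blast
      then show "x \<in> (\<Union>i. V i)" using V(2)[of i] at unfolding tb_def by blast
    qed
    then have "emeasure lborel (ball p L) \<le> emeasure lborel (\<Union>i. V i)"
      using V(1) by (intro emeasure_mono) auto
    also have "\<dots> \<le> (\<Sum>i. emeasure lborel (V i))" using V(1) by (intro emeasure_subadditive_countably) auto
    also have "\<dots> \<le> (\<Sum>i. ennreal (K * 2 ^ ?s / ?\<kappa>) * ennreal (?\<kappa> * (diameter (U i) / 2) ^ ?s) + ennreal e * ennreal ((1/2) ^ Suc i))"
    proof (intro suminf_le)
      fix i
      have "K * \<rho> i ^ ?s \<le> K * (diameter (U i) ^ ?s + \<eta> * (1/2) ^ Suc i)"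
        using K \<rho>(3) by (intro mult_left_mono) auto
      also have "\<dots> = K * 2 ^ ?s / ?\<kappa> * (?\<kappa> * (diameter (U i) / 2) ^ ?s) + e * (1/2) ^ Suc i"
        unfolding \<eta>_def power_divide by (rule split[OF less_imp_neq[OF \<kappa>, symmetric]]) simp
      finally have "ennreal (K * \<rho> i ^ ?s) \<le> ennreal (K * 2 ^ ?s / ?\<kappa> * (?\<kappa> * (diameter (U i) / 2) ^ ?s) + e * (1/2) ^ Suc i)"
        by (rule ennreal_leI)
      also have "\<dots> = ennreal (K * 2 ^ ?s / ?\<kappa>) * ennreal (?\<kappa> * (diameter (U i) / 2) ^ ?s) + ennreal e * ennreal ((1/2) ^ Suc i)"
        using K \<kappa> e bU(3)[of i] by (intro enn) auto
      finally show "emeasure lborel (V i) \<le> \<dots>" using V(3) order_trans by blast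
    qed auto
    also have "\<dots> = ennreal (K * 2 ^ ?s / ?\<kappa>) * hausdorff_cost ?s U + ennreal e * (\<Sum>i. ennreal ((1/2) ^ Suc i))"
      unfolding hausdorff_cost_def ennreal_suminf_cmult[symmetric] by (rule suminf_add[symmetric]) auto
    also have "(\<Sum>i. ennreal ((1/2) ^ Suc i)) = 1"
      by (subst suminf_ennreal_eq[OF zero_le_power power_half_series]) auto
    finally show "ennreal (?\<omega> * L ^ ?d) \<le> ennreal (K * 2 ^ ?s / ?\<kappa>) * hausdorff_cost ?s U + ennreal e"
      using L by (simp add: emeasure_ball)
  qed
  have "ennreal (?\<kappa> / 12 / 4 ^ ?d * L ^ ?s) \<le> hausdorff_cost ?s U" if U: "U \<in> hausdorff_covers (L / 2) A" for U
  proof -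
    have "ennreal (?\<kappa> / (K * 2 ^ ?s)) * ennreal (?\<omega> * L ^ ?d)
        \<le> ennreal (?\<kappa> / (K * 2 ^ ?s)) * (ennreal (K * 2 ^ ?s / ?\<kappa>) * hausdorff_cost ?s U)"
      by (intro mult_left_mono cost[OF U]) auto
    also have "\<dots> = hausdorff_cost ?s U"
    proof -
      have inv: "a / b * (b / a) = 1" if "a \<noteq> 0" "b \<noteq> 0" for a b :: real using that by simp
      have "ennreal (?\<kappa> / (K * 2 ^ ?s)) * ennreal (K * 2 ^ ?s / ?\<kappa>) = ennreal (?\<kappa> / (K * 2 ^ ?s) * (K * 2 ^ ?s / ?\<kappa>))"
        using K \<kappa> by (intro ennreal_mult[symmetric]) auto
      also have "\<dots> = 1"
        by (subst inv[OF less_imp_neq[OF \<kappa>, symmetric]]) (use K in auto)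
      finally show ?thesis by (simp only: mult.assoc[symmetric] mult_1_left)
    qed
    also have "ennreal (?\<kappa> / (K * 2 ^ ?s)) * ennreal (?\<omega> * L ^ ?d) = ennreal (?\<kappa> / (K * 2 ^ ?s) * (?\<omega> * L ^ ?d))"
      using K \<kappa> \<omega> L by (intro ennreal_mult[symmetric]) auto
    also have "?\<kappa> / (K * 2 ^ ?s) * (?\<omega> * L ^ ?d) = ?\<kappa> / 12 / 2 ^ (?d + ?s) * L ^ ?s"
    proof -
      have can: "k / (12 * w * a * L * b) * (w * (L * c)) = k / 12 / (a * b) * c" if "w \<noteq> 0" for k w a b c :: real
        using that L by simp
      have "L ^ ?d = L * L ^ ?s" using ds by (metis power_Suc)
      then show ?thesis unfolding K_def power_add
        using can[OF less_imp_neq[OF \<omega>, symmetric]] by simp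
    qed
    finally have "ennreal (?\<kappa> / 12 / 2 ^ (?d + ?s) * L ^ ?s) \<le> hausdorff_cost ?s U" .
    moreover have "?\<kappa> / 12 / 4 ^ ?d * L ^ ?s \<le> ?\<kappa> / 12 / 2 ^ (?d + ?s) * L ^ ?s"
    proof (intro mult_right_mono divide_left_mono)
      have "(2::real) ^ (?d + ?s) \<le> 2 ^ (2 * ?d)" by (intro power_increasing) auto
      then show "2 ^ (?d + ?s) \<le> (4::real) ^ ?d" by (simp add: power_mult)
    qed (use \<kappa> L in auto)
    ultimately show ?thesis using ennreal_leI order_trans by blast
  qed
  then have "ennreal (?\<kappa> / 12 / 4 ^ ?d * L ^ ?s) \<le> hausdorff_premeasure ?s (L / 2) A"
    unfolding hausdorff_premeasure_def by (intro INF_greatest)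
  also have "\<dots> \<le> hausdorff_outer ?s A" using L by (intro hausdorff_premeasure_le_outer) auto
  finally show ?thesis .
qed

section \<open>Polynomials and barycentric coordinates\<close>

text \<open>The sum over multi-indices in \<open>poly_space\<close> is awkward for derivatives and
  products. These rules generate the same functions, by \<open>poly_space_iff\<close>, and allow
  rule induction on the degree bound.\<close>

inductive polyfun :: "nat \<Rightarrow> ('a::euclidean_space \<Rightarrow> real) \<Rightarrow> bool" where
  polyfun_const: "polyfun k (\<lambda>x. c)"
| polyfun_add: "polyfun k p \<Longrightarrow> polyfun k q \<Longrightarrow> polyfun k (\<lambda>x. p x + q x)"
| polyfun_coord: "polyfun k p \<Longrightarrow> b \<in> Basis \<Longrightarrow> polyfun (Suc k) (\<lambda>x. (x \<bullet> b) * p x)"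

lemma polyfun_Suc: "polyfun k p \<Longrightarrow> polyfun (Suc k) p"
  by (induction rule: polyfun.induct) (auto intro: polyfun.intros)

lemma polyfun_mono:
  assumes "polyfun k p" "k \<le> l" shows "polyfun l p"
  using assms(2,1) by (induction rule: dec_induct) (auto intro: polyfun_Suc)

lemma polyfun_scale: "polyfun k p \<Longrightarrow> polyfun k (\<lambda>x. a * p x)"
proof (induction rule: polyfun.induct)
  case (polyfun_add k p q)
  then show ?case using polyfun.polyfun_add[of k "\<lambda>x. a * p x" "\<lambda>x. a * q x"] by (simp add: distrib_left)
next
  case (polyfun_coord k p b)
  then show ?case using polyfun.polyfun_coord[of k "\<lambda>x. a * p x" b] by (simp add: mult.left_commute)
qed (rule polyfun_const)

lemma polyfun_diff: "polyfun k p \<Longrightarrow> polyfun k q \<Longrightarrow> polyfun k (\<lambda>x. p x - q x)"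
  using polyfun_add[of k p "\<lambda>x. -1 * q x"] polyfun_scale[of k q "-1"] by simp

lemma polyfun_sum: "(\<And>i. i \<in> I \<Longrightarrow> polyfun k (f i)) \<Longrightarrow> polyfun k (\<lambda>x. \<Sum>i\<in>I. f i x)"
  by (induction I rule: infinite_finite_induct) (auto intro: polyfun.intros)

lemma polyfun_affine_mult:
  assumes "polyfun k p" shows "polyfun (Suc k) (\<lambda>x. (c + n \<bullet> x) * p x)"
proof -
  have "polyfun (Suc k) (\<lambda>x. c * p x + (\<Sum>b\<in>Basis. (n \<bullet> b) * ((x \<bullet> b) * p x)))"
    using assms by (intro polyfun_add polyfun_sum polyfun_scale polyfun_coord polyfun_Suc) auto
  moreover have "(c + n \<bullet> x) * p x = c * p x + (\<Sum>b\<in>Basis. (n \<bullet> b) * ((x \<bullet> b) * p x))" for x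
    unfolding euclidean_inner[of n x] by (simp only: distrib_right sum_distrib_right mult.assoc)
  ultimately show ?thesis by simp
qed

text \<open>Serves the monomials as well as the Lagrange functions, both being products of as many
  affine factors as their degree.\<close>

lemma polyfun_affine_prod:
  assumes "finite I" "\<And>i. i \<in> I \<Longrightarrow> \<exists>c n. f i = (\<lambda>x. c + n \<bullet> x)"
  shows "polyfun (card I) (\<lambda>x. \<Prod>i\<in>I. f i x)"
  using assms
proof (induction rule: finite_induct)
  case (insert i I)
  from insert.prems[of i] obtain c n where "f i = (\<lambda>x. c + n \<bullet> x)" by blast
  with insert show ?case using polyfun_affine_mult[of "card I" "\<lambda>x. \<Prod>i\<in>I. f i x" c n] by simp
qed (auto intro: polyfun_const)

lemma finite_multi_indices:
  "finite {m :: 'a::euclidean_space \<Rightarrow> nat. (\<forall>b. b \<notin> Basis \<longrightarrow> m b = 0) \<and> (\<Sum>b\<in>Basis. m b) \<le> k}"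
proof (rule finite_subset)
  show "{m :: 'a \<Rightarrow> nat. (\<forall>b. b \<notin> Basis \<longrightarrow> m b = 0) \<and> (\<Sum>b\<in>Basis. m b) \<le> k}
      \<subseteq> {m. \<forall>b. (b \<in> Basis \<longrightarrow> m b \<in> {..k}) \<and> (b \<notin> Basis \<longrightarrow> m b = 0)}"
  proof clarify
    fix m :: "'a \<Rightarrow> nat" and b
    assume m: "\<forall>b. b \<notin> Basis \<longrightarrow> m b = 0" "sum m Basis \<le> k"
    have "m b \<le> sum m Basis" if "b \<in> Basis" using that by (intro member_le_sum) auto
    then show "(b \<in> Basis \<longrightarrow> m b \<in> {..k}) \<and> (b \<notin> Basis \<longrightarrow> m b = 0)"
      using m by auto
  qed
  show "finite {m. \<forall>b. (b \<in> (Basis :: 'a set) \<longrightarrow> m b \<in> {..k}) \<and> (b \<notin> Basis \<longrightarrow> m b = 0)}"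
    by (rule finite_set_of_finite_funs) auto
qed

lemma polyfun_monomial:
  fixes m :: "'a::euclidean_space \<Rightarrow> nat"
  shows "polyfun (\<Sum>b\<in>Basis. m b) (\<lambda>x. \<Prod>b\<in>Basis. (x \<bullet> b) ^ m b)"
proof -
  have "polyfun (card (Sigma (Basis :: 'a set) (\<lambda>b. {..<m b}))) (\<lambda>x. \<Prod>i\<in>Sigma Basis (\<lambda>b. {..<m b}). x \<bullet> fst i)"
  proof (rule polyfun_affine_prod)
    fix i :: "'a \<times> nat"
    show "\<exists>c n. (\<lambda>x. x \<bullet> fst i) = (\<lambda>x. c + n \<bullet> x)"
      by (intro exI[of _ 0] exI[of _ "fst i"]) (auto simp: inner_commute)
  qed auto
  moreover have "(\<Prod>i\<in>Sigma Basis (\<lambda>b. {..<m b}). x \<bullet> fst i) = (\<Prod>b\<in>Basis. (x \<bullet> b) ^ m b)" for x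
  proof -
    have "(\<Prod>i\<in>Sigma Basis (\<lambda>b. {..<m b}). x \<bullet> fst i) = (\<Prod>(b, l)\<in>Sigma Basis (\<lambda>b. {..<m b}). x \<bullet> b)"
      by (simp only: case_prod_unfold)
    also have "\<dots> = (\<Prod>b\<in>Basis. \<Prod>l<m b. x \<bullet> b)" by (rule prod.Sigma[symmetric]) auto
    finally show ?thesis by simp
  qed
  moreover have "card (Sigma (Basis :: 'a set) (\<lambda>b. {..<m b})) = (\<Sum>b\<in>Basis. m b)" by simp
  ultimately show ?thesis by simp
qed

text \<open>The span of the monomials is closed under the three rules: a coordinate factor merely
  raises one exponent in each monomial.\<close>

lemma poly_space_iff: "p \<in> poly_space k \<longleftrightarrow> polyfun k p"
proof
  let ?I = "\<lambda>k. {m :: 'a \<Rightarrow> nat. (\<forall>b. b \<notin> Basis \<longrightarrow> m b = 0) \<and> (\<Sum>b\<in>Basis. m b) \<le> k}"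
  let ?mon = "\<lambda>m (x::'a). \<Prod>b\<in>Basis. (x \<bullet> b) ^ m b"
  {
    assume "p \<in> poly_space k"
    then obtain c where "p = (\<lambda>x. \<Sum>m\<in>?I k. c m * ?mon m x)" unfolding poly_space_def by blast
    then show "polyfun k p"
      using polyfun_mono[OF polyfun_monomial] by (auto intro!: polyfun_sum polyfun_scale)
  }
  have psI: "(\<lambda>x. \<Sum>m\<in>?I k. c m * ?mon m x) \<in> poly_space k" for c :: "('a \<Rightarrow> nat) \<Rightarrow> real" and k
    unfolding poly_space_def by (intro CollectI exI[of _ c] refl)
  have ps_add: "(\<lambda>x. p x + q x) \<in> poly_space k" if "p \<in> poly_space k" "q \<in> poly_space k" for p q :: "'a \<Rightarrow> real" and k
  proof -
    from that obtain c d where "p = (\<lambda>x. \<Sum>m\<in>?I k. c m * ?mon m x)" "q = (\<lambda>x. \<Sum>m\<in>?I k. d m * ?mon m x)"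
      unfolding poly_space_def by blast
    then have "(\<lambda>x. p x + q x) = (\<lambda>x. \<Sum>m\<in>?I k. (c m + d m) * ?mon m x)"
      by (simp only: sum.distrib distrib_right)
    then show ?thesis using psI[of "\<lambda>m. c m + d m" k] by simp
  qed
  have ps_mon: "(\<lambda>x. a * ?mon m x) \<in> poly_space k" if "m \<in> ?I k" for m a k
  proof -
    have "(\<Sum>m'\<in>?I k. (if m' = m then a else 0) * ?mon m' x) = a * ?mon m x" for x
    proof -
      have "(\<Sum>m'\<in>?I k. (if m' = m then a else 0) * ?mon m' x) = (\<Sum>m'\<in>?I k. if m' = m then a * ?mon m' x else 0)"
        by (intro sum.cong) auto
      also have "\<dots> = a * ?mon m x" using that finite_multi_indices[of k, where 'a = 'a] by (subst sum.delta) auto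
      finally show ?thesis .
    qed
    then show ?thesis using psI[of "\<lambda>m'. if m' = m then a else 0" k] by simp
  qed
  have ps_0: "(\<lambda>x :: 'a. 0) \<in> poly_space k" for k using psI[of "\<lambda>_. 0" k] by simp
  have ps_sum: "(\<lambda>x. \<Sum>i\<in>J. f i x) \<in> poly_space k" if "finite J" "\<And>i. i \<in> J \<Longrightarrow> f i \<in> poly_space k"
    for J and f :: "('a \<Rightarrow> nat) \<Rightarrow> 'a \<Rightarrow> real" and k
    using that
  proof (induction rule: finite_induct)
    case (insert i J)
    then show ?case using ps_add[of "f i" k "\<lambda>x. \<Sum>i\<in>J. f i x"] by simp
  qed (simp add: ps_0)
  assume "polyfun k p"
  then show "p \<in> poly_space k"
  proof (induction rule: polyfun.induct)
    case (polyfun_const k c)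
    show ?case using ps_mon[of "\<lambda>_. 0" k c] by simp
  next
    case (polyfun_add k p q)
    then show ?case by (intro ps_add)
  next
    case (polyfun_coord k p b)
    then obtain c where p: "p = (\<lambda>x. \<Sum>m\<in>?I k. c m * ?mon m x)" unfolding poly_space_def by blast
    have "(x \<bullet> b) * ?mon m x = ?mon (m(b := Suc (m b))) x" for m x
    proof -
      have "?mon (m(b := Suc (m b))) x = (x \<bullet> b) ^ Suc (m b) * (\<Prod>c\<in>Basis - {b}. (x \<bullet> c) ^ m c)"
        by (subst prod.remove[OF finite_Basis polyfun_coord.hyps(2)]) (auto intro!: prod.cong)
      moreover have "?mon m x = (x \<bullet> b) ^ m b * (\<Prod>c\<in>Basis - {b}. (x \<bullet> c) ^ m c)"
        by (rule prod.remove[OF finite_Basis polyfun_coord.hyps(2)])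
      ultimately show ?thesis by simp
    qed
    then have e: "(\<lambda>x. (x \<bullet> b) * p x) = (\<lambda>x. \<Sum>m\<in>?I k. c m * ?mon (m(b := Suc (m b))) x)"
      unfolding p by (intro ext) (simp only: sum_distrib_left mult.left_commute)
    have "m(b := Suc (m b)) \<in> ?I (Suc k)" if "m \<in> ?I k" for m
    proof -
      have "sum (m(b := Suc (m b))) Basis = Suc (m b) + (\<Sum>c\<in>Basis - {b}. m c)"
        by (subst sum.remove[OF finite_Basis polyfun_coord.hyps(2)]) (auto intro!: sum.cong)
      moreover have "sum m Basis = m b + (\<Sum>c\<in>Basis - {b}. m c)"
        by (rule sum.remove[OF finite_Basis polyfun_coord.hyps(2)])
      ultimately show ?thesis using that polyfun_coord.hyps(2) by auto
    qed
    then show ?case unfolding e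
      by (intro ps_sum finite_multi_indices ps_mon)
  qed
qed

text \<open>The derivative keeps the degree bound \<open>k\<close>; this is all that is needed to
  apply the estimates for degree \<open>k\<close> to partial derivatives.\<close>

lemma polyfun_has_derivative:
  assumes "polyfun k p"
  shows "\<exists>p'. (\<forall>x. (p has_derivative p' x) (at x)) \<and> (\<forall>v. polyfun k (\<lambda>x. p' x v))"
  using assms
proof (induction rule: polyfun.induct)
  case (polyfun_const k c)
  show ?case by (rule exI[of _ "\<lambda>_ _. 0"]) (auto intro: polyfun.polyfun_const)
next
  case (polyfun_add k p q)
  then obtain p' q' where "\<And>x. (p has_derivative p' x) (at x)" "\<And>v. polyfun k (\<lambda>x. p' x v)"
    "\<And>x. (q has_derivative q' x) (at x)" "\<And>v. polyfun k (\<lambda>x. q' x v)" by blast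
  then show ?case
    by (intro exI[of _ "\<lambda>x v. p' x v + q' x v"]) (auto intro: polyfun.polyfun_add has_derivative_add)
next
  case (polyfun_coord k p b)
  then obtain p' where p': "\<And>x. (p has_derivative p' x) (at x)" "\<And>v. polyfun k (\<lambda>x. p' x v)" by blast
  have "((\<lambda>x. (x \<bullet> b) * p x) has_derivative (\<lambda>v. (x \<bullet> b) * p' x v + (v \<bullet> b) * p x)) (at x)" for x
    using p' by (auto intro!: derivative_eq_intros)
  moreover have "polyfun (Suc k) (\<lambda>x. (x \<bullet> b) * p' x v + (v \<bullet> b) * p x)" for v
    using p' polyfun_coord.hyps by (intro polyfun.polyfun_add polyfun.polyfun_coord polyfun_scale polyfun_Suc)
  ultimately show ?case by (intro exI[of _ "\<lambda>x v. (x \<bullet> b) * p' x v + (v \<bullet> b) * p x"]) auto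
qed

lemma polyfun_differentiable: "polyfun k p \<Longrightarrow> p differentiable (at x)"
  using polyfun_has_derivative unfolding differentiable_def by blast

lemma polyfun_frechet: "polyfun k p \<Longrightarrow> (p has_derivative frechet_derivative p (at x)) (at x)"
  using polyfun_differentiable frechet_derivative_works by blast

lemma polyfun_frechet_derivative:
  assumes "polyfun k p" shows "polyfun k (\<lambda>x. frechet_derivative p (at x) v)"
proof -
  obtain p' where p': "\<And>x. (p has_derivative p' x) (at x)" "\<And>v. polyfun k (\<lambda>x. p' x v)"
    using polyfun_has_derivative[OF assms] by blast
  then have "frechet_derivative p (at x) = p' x" for x by (metis frechet_derivative_at)
  then show ?thesis using p' by simp
qed

lemma polyfun_continuous: "polyfun k p \<Longrightarrow> continuous_on S p"
  by (meson continuous_at_imp_continuous_on differentiable_imp_continuous_within polyfun_differentiable)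

lemma grad_inner_Basis: "b \<in> Basis \<Longrightarrow> grad f x \<bullet> b = frechet_derivative f (at x) b"
  unfolding grad_def by (simp add: inner_sum_left inner_Basis sum.delta if_distrib cong: if_cong)

lemma polyfun_grad_inner:
  assumes "polyfun k p" shows "grad p x \<bullet> v = frechet_derivative p (at x) v"
proof -
  have lin: "linear (frechet_derivative p (at x))" using polyfun_frechet[OF assms] by (rule has_derivative_linear)
  have "frechet_derivative p (at x) v = frechet_derivative p (at x) (\<Sum>b\<in>Basis. (v \<bullet> b) *\<^sub>R b)"
    by (simp add: euclidean_representation)
  also have "\<dots> = (\<Sum>b\<in>Basis. (v \<bullet> b) * frechet_derivative p (at x) b)"
    using lin by (simp add: linear_sum linear_scale)
  also have "\<dots> = grad p x \<bullet> v"
    unfolding grad_def inner_sum_left inner_scaleR_left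
    by (intro sum.cong) (simp_all add: inner_commute mult.commute)
  finally show ?thesis by simp
qed

lemma polyfun_grad_continuous: "polyfun k p \<Longrightarrow> continuous_on S (grad p)"
  unfolding grad_def by (intro continuous_intros polyfun_continuous[OF polyfun_frechet_derivative]) auto

section \<open>Barycentric coordinates\<close>

definition nondeg :: "'a::euclidean_space set \<Rightarrow> bool" where
  "nondeg C \<longleftrightarrow> \<not> affine_dependent C \<and> card C = Suc DIM('a)"

text \<open>The coordinates are defined on the whole space. The value 0 for \<open>v\<close> outside
  \<open>C\<close> allows the coordinates of different simplices to be compared at one and the same
  \<open>v\<close>.\<close>

definition bary :: "'a::euclidean_space set \<Rightarrow> 'a \<Rightarrow> 'a \<Rightarrow> real" where
  "bary C v x = (if v \<in> C then (SOME u. sum u C = 1 \<and> (\<Sum>w\<in>C. u w *\<^sub>R w) = x) v else 0)"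

lemma nondeg_finite: "nondeg C \<Longrightarrow> finite C"
  unfolding nondeg_def by (metis card.infinite nat.distinct(1))

lemma bary_outside [simp]: "v \<notin> C \<Longrightarrow> bary C v x = 0"
  by (simp add: bary_def)

lemma
  assumes "nondeg (C :: 'a::euclidean_space set)"
  shows bary_sum: "(\<Sum>v\<in>C. bary C v x) = 1" and bary_repr: "(\<Sum>v\<in>C. bary C v x *\<^sub>R v) = x"
proof -
  have "affine hull C = UNIV" using assms affine_independent_span_eq[of C] unfolding nondeg_def by auto
  then have "x \<in> {y. \<exists>u. sum u C = 1 \<and> (\<Sum>v\<in>C. u v *\<^sub>R v) = y}"
    unfolding affine_hull_finite[OF nondeg_finite[OF assms], symmetric] by simp
  then have ex: "\<exists>u. sum u C = 1 \<and> (\<Sum>w\<in>C. u w *\<^sub>R w) = x" by blast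
  from someI_ex[OF this] show "(\<Sum>v\<in>C. bary C v x) = 1" "(\<Sum>v\<in>C. bary C v x *\<^sub>R v) = x"
    by (simp_all add: bary_def)
qed

lemma bary_unique:
  assumes "nondeg (C :: 'a::euclidean_space set)" "sum u C = 1" "(\<Sum>w\<in>C. u w *\<^sub>R w) = x" "v \<in> C"
  shows "bary C v x = u v"
proof (rule ccontr)
  assume "bary C v x \<noteq> u v"
  then have "\<exists>w\<in>C. u w - bary C w x \<noteq> 0" using assms(4) by (intro bexI[of _ v]) auto
  moreover have "(\<Sum>w\<in>C. u w - bary C w x) = 0" "(\<Sum>w\<in>C. (u w - bary C w x) *\<^sub>R w) = 0"
    using assms bary_sum[OF assms(1), of x] bary_repr[OF assms(1), of x]
    by (auto simp: sum_subtractf scaleR_diff_left)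
  ultimately have "affine_dependent C"
    unfolding affine_dependent_explicit_finite[OF nondeg_finite[OF assms(1)]] by blast
  then show False using assms(1) unfolding nondeg_def by simp
qed

text \<open>Suitable combinations of coordinates again satisfy the two defining equations, so
  uniqueness makes the coordinates linear up to the value at 0.\<close>

lemma bary_affine:
  assumes C: "nondeg (C :: 'a::euclidean_space set)"
  shows "\<exists>n. \<forall>x. bary C v x = bary C v 0 + n \<bullet> x"
proof (cases "v \<in> C")
  case v: True
  define f where "f x = bary C v x - bary C v 0" for x
  have add: "bary C v (x + y) = bary C v x + bary C v y - bary C v 0" for x y
    by (rule bary_unique[OF C _ _ v])
      (simp_all add: sum.distrib sum_subtractf scaleR_add_left scaleR_diff_left bary_sum[OF C] bary_repr[OF C])
  have scale: "bary C v (c *\<^sub>R x) = c * bary C v x + (1 - c) * bary C v 0" for x c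
    by (rule bary_unique[OF C _ _ v])
      (simp_all add: sum.distrib scaleR_add_left sum_distrib_left[symmetric] bary_sum[OF C] bary_repr[OF C]
        scaleR_scaleR[symmetric] scaleR_sum_right[symmetric] del: scaleR_scaleR)
  have lin: "linear f"
    unfolding f_def by (rule linearI) (auto simp: add scale algebra_simps)
  have "f x = (\<Sum>b\<in>Basis. f b *\<^sub>R b) \<bullet> x" for x
  proof -
    have "f x = f (\<Sum>b\<in>Basis. (x \<bullet> b) *\<^sub>R b)" by (simp add: euclidean_representation)
    also have "\<dots> = (\<Sum>b\<in>Basis. (x \<bullet> b) * f b)" using lin by (simp add: linear_sum linear_scale)
    also have "\<dots> = (\<Sum>b\<in>Basis. f b *\<^sub>R b) \<bullet> x"
      unfolding inner_sum_left inner_scaleR_left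
      by (intro sum.cong) (simp_all add: inner_commute mult.commute)
    finally show ?thesis .
  qed
  then have "bary C v x = bary C v 0 + (\<Sum>b\<in>Basis. f b *\<^sub>R b) \<bullet> x" for x
    using f_def[of x] by (metis add.commute diff_add_cancel)
  then show ?thesis by blast
qed (auto intro: exI[of _ 0])

lemma bary_combination:
  assumes C: "nondeg C"
  shows "bary C v ((1 - t) *\<^sub>R x + t *\<^sub>R y) = (1 - t) * bary C v x + t * bary C v y"
proof -
  obtain n where n: "\<And>x. bary C v x = bary C v 0 + n \<bullet> x" using bary_affine[OF C] by blast
  show ?thesis unfolding n[of "(1 - t) *\<^sub>R x + t *\<^sub>R y"] n[of x] n[of y]
    by (simp add: inner_add_right algebra_simps)
qed

lemma bary_continuous: "nondeg C \<Longrightarrow> continuous_on S (bary C v)"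
proof -
  assume "nondeg C"
  then obtain n where "\<forall>x. bary C v x = bary C v 0 + n \<bullet> x" using bary_affine by blast
  then have e: "bary C v = (\<lambda>x. bary C v 0 + n \<bullet> x)" by blast
  show ?thesis by (subst e) (intro continuous_intros)
qed

lemma bary_vertex: "nondeg C \<Longrightarrow> w \<in> C \<Longrightarrow> bary C v w = (if v = w then 1 else 0)"
proof (cases "v \<in> C")
  case True
  assume C: "nondeg C" "w \<in> C"
  have "(\<Sum>u\<in>C. (if u = w then 1 else 0) *\<^sub>R u) = (\<Sum>u\<in>C. if u = w then u else 0)"
    by (intro sum.cong) auto
  then have "bary C v w = (\<lambda>v. if v = w then 1 else 0) v"
    using C True nondeg_finite[OF C(1)] by (intro bary_unique) (simp_all add: sum.delta)
  then show ?thesis by simp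
qed auto

lemma convex_hull_bary:
  assumes C: "nondeg (C :: 'a::euclidean_space set)" shows "x \<in> convex hull C \<longleftrightarrow> (\<forall>v\<in>C. 0 \<le> bary C v x)"
  unfolding convex_hull_finite[OF nondeg_finite[OF C]]
proof safe
  fix u :: "'a \<Rightarrow> real" and v assume "\<forall>x\<in>C. 0 \<le> u x" "sum u C = 1" "v \<in> C"
  then show "0 \<le> bary C v (\<Sum>x\<in>C. u x *\<^sub>R x)" using bary_unique[OF C, of u _ v] by simp
next
  assume "\<forall>v\<in>C. 0 \<le> bary C v x"
  then show "\<exists>u. (\<forall>x\<in>C. 0 \<le> u x) \<and> sum u C = 1 \<and> (\<Sum>x\<in>C. u x *\<^sub>R x) = x"
    using bary_sum[OF C] bary_repr[OF C] by (intro exI[of _ "\<lambda>v. bary C v x"]) auto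
qed

lemma bary_nonneg: "nondeg C \<Longrightarrow> x \<in> convex hull C \<Longrightarrow> 0 \<le> bary C v x"
  by (cases "v \<in> C") (auto simp: convex_hull_bary)

lemma bary_le_1:
  assumes C: "nondeg C" "x \<in> convex hull C" shows "bary C v x \<le> 1"
proof (cases "v \<in> C")
  case True
  then show ?thesis
    using member_le_sum[of v C "\<lambda>v. bary C v x"] bary_nonneg[OF C] nondeg_finite[OF C(1)] bary_sum[OF C(1)] by auto
qed auto

lemma interior_convex_hull_bary:
  assumes C: "nondeg (C :: 'a::euclidean_space set)"
  shows "x \<in> interior (convex hull C) \<longleftrightarrow> (\<forall>v\<in>C. 0 < bary C v x)"
proof
  let ?U = "\<Inter>v\<in>C. {x. 0 < bary C v x}"
  assume "\<forall>v\<in>C. 0 < bary C v x"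
  moreover have "open ?U" using bary_continuous[OF C] nondeg_finite[OF C]
    by (intro open_INT ballI open_Collect_less continuous_on_const) auto
  moreover have "?U \<subseteq> convex hull C" using convex_hull_bary[OF C] by (auto intro: less_imp_le)
  ultimately show "x \<in> interior (convex hull C)" by (intro interiorI[of ?U]) auto
next
  assume x: "x \<in> interior (convex hull C)"
  show "\<forall>v\<in>C. 0 < bary C v x"
  proof (rule ccontr)
    assume "\<not> (\<forall>v\<in>C. 0 < bary C v x)"
    then obtain v where v: "v \<in> C" "\<not> 0 < bary C v x" by blast
    moreover have "0 \<le> bary C v x" using bary_nonneg[OF C] interior_subset x by blast
    ultimately have v0: "bary C v x = 0" by simp
    obtain e where e: "0 < e" "ball x e \<subseteq> convex hull C" using x mem_interior by blast
    define t where "t = e / 2 / (norm (x - v) + 1)"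
    have t: "0 < t" "t * norm (x - v) < e"
    proof -
      show "0 < t" unfolding t_def using e by (simp add: add_nonneg_pos)
      have "t * norm (x - v) = (e / 2) * (norm (x - v) / (norm (x - v) + 1))" unfolding t_def by simp
      also have "\<dots> \<le> e / 2"
      proof (rule mult_left_le)
        show "norm (x - v) / (norm (x - v) + 1) \<le> 1"
          by (subst pos_divide_le_eq) (simp_all add: add_nonneg_pos)
      qed (use e in simp)
      finally have "t * norm (x - v) \<le> e / 2" .
      then show "t * norm (x - v) < e" using e by simp
    qed
    \<comment> \<open>Moving from \<open>x\<close> slightly further away from \<open>v\<close> stays
      in the hull, as \<open>x\<close> is interior, but gives the coordinate of \<open>v\<close> the
      value \<open>- t\<close>.\<close>
    define y where "y = (1 - (- t)) *\<^sub>R x + (- t) *\<^sub>R v"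
    have "y - x = t *\<^sub>R (x - v)" unfolding y_def by (simp add: algebra_simps)
    then have "y \<in> ball x e" using t by (simp add: dist_norm norm_minus_commute[of x y])
    then have "0 \<le> bary C v y" using bary_nonneg[OF C] e by blast
    moreover have "bary C v y = - t"
      unfolding y_def bary_combination[OF C] using v v0 by (simp add: bary_vertex[OF C])
    ultimately show False using t by simp
  qed
qed

text \<open>Between the centre and the boundary of an inscribed ball the coordinate grows by at most
  1, which bounds its constant gradient by \<open>1 / \<rho>\<close>.\<close>

lemma bary_lipschitz:
  assumes C: "nondeg (C :: 'a::euclidean_space set)" and r: "0 < \<rho>" "cball c \<rho> \<subseteq> convex hull C"
  shows "\<bar>bary C v x - bary C v y\<bar> \<le> norm (x - y) / \<rho>"
proof -
  obtain n where n: "\<And>x. bary C v x = bary C v 0 + n \<bullet> x" using bary_affine[OF C] by blast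
  have "norm n * \<rho> \<le> 1"
  proof (cases "n = 0")
    case False
    define z where "z = c + (\<rho> / norm n) *\<^sub>R n"
    have "z \<in> convex hull C" "c \<in> convex hull C" using r False unfolding z_def
      by (auto intro!: subsetD[OF r(2)] simp: dist_norm)
    then have "bary C v z - bary C v c \<le> 1" using bary_le_1[OF C, of z v] bary_nonneg[OF C, of c v] by simp
    moreover have "bary C v z - bary C v c = norm n * \<rho>"
    proof -
      have "bary C v z - bary C v c = n \<bullet> (z - c)" using n[of z] n[of c] by (simp add: inner_diff_right)
      then show ?thesis using False unfolding z_def by (simp add: dot_square_norm power2_eq_square)
    qed
    ultimately show ?thesis by simp
  qed simp
  have "bary C v x - bary C v y = n \<bullet> (x - y)" unfolding n[of x] n[of y] by (simp add: inner_diff_right)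
  then have "\<bar>bary C v x - bary C v y\<bar> \<le> norm n * norm (x - y)" by (simp add: Cauchy_Schwarz_ineq2)
  also have "\<dots> \<le> (1 / \<rho>) * norm (x - y)"
    using \<open>norm n * \<rho> \<le> 1\<close> r by (intro mult_right_mono) (simp_all add: pos_le_divide_eq)
  finally show ?thesis by simp
qed


section \<open>Lagrange interpolation on a simplex\<close>

text \<open>Multi-indices vanish outside \<open>C\<close>, so that distinct ones differ at a vertex
  and \<open>lattice_point\<close> is injective on them.\<close>

definition multi :: "'a set \<Rightarrow> nat \<Rightarrow> ('a \<Rightarrow> nat) set" where
  "multi C k = {m. (\<forall>v. v \<notin> C \<longrightarrow> m v = 0) \<and> sum m C = k}"

definition lattice_point :: "'a::real_vector set \<Rightarrow> nat \<Rightarrow> ('a \<Rightarrow> nat) \<Rightarrow> 'a" where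
  "lattice_point C k m = (\<Sum>v\<in>C. (real (m v) / real k) *\<^sub>R v)"

text \<open>The falling factorials of the scaled barycentric coordinates; the Lagrange basis consists of
  multiples of those with \<open>\<Sum>m = k\<close>.\<close>

definition falling :: "'a::euclidean_space set \<Rightarrow> nat \<Rightarrow> ('a \<Rightarrow> nat) \<Rightarrow> 'a \<Rightarrow> real" where
  "falling C k m x = (\<Prod>v\<in>C. \<Prod>l<m v. real k * bary C v x - real l)"

text \<open>Recovers the multi-index from the lattice point, so that \<open>lagrange\<close> is
  indexed by points, as the nodal basis is. At lattice points the floor is exact.\<close>

definition lattice_index :: "'a::euclidean_space set \<Rightarrow> nat \<Rightarrow> 'a \<Rightarrow> 'a \<Rightarrow> nat" where
  "lattice_index C k j v = nat \<lfloor>real k * bary C v j\<rfloor>"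

definition lagrange :: "'a::euclidean_space set \<Rightarrow> nat \<Rightarrow> 'a \<Rightarrow> 'a \<Rightarrow> real" where
  "lagrange C k j x = (\<Prod>v\<in>C. \<Prod>l<lattice_index C k j v.
     (real k * bary C v x - real l) / (real (lattice_index C k j v) - real l))"

lemma multi_le: "finite C \<Longrightarrow> m \<in> multi C k \<Longrightarrow> m v \<le> k"
  unfolding multi_def using member_le_sum[of v C m] by (cases "v \<in> C") auto

lemma finite_multi: "finite C \<Longrightarrow> finite (multi C k)"
  and card_multi_le: "finite C \<Longrightarrow> card (multi C k) \<le> (k + 1) ^ card C"
proof -
  assume C: "finite C"
  let ?r = "\<lambda>m. restrict m C"
  have inj: "inj_on ?r (multi C k)"
  proof (rule inj_onI, rule ext)
    fix m m' v assume "m \<in> multi C k" "m' \<in> multi C k" "?r m = ?r m'"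
    then show "m v = m' v" unfolding multi_def by (cases "v \<in> C") (auto dest: fun_cong[of _ _ v])
  qed
  have sub: "?r ` multi C k \<subseteq> (\<Pi>\<^sub>E v\<in>C. {..k})" using multi_le[OF C] by auto
  have fin: "finite (\<Pi>\<^sub>E v\<in>C. {..k})" using C by (intro finite_PiE) auto
  show "finite (multi C k)" using inj sub fin by (metis finite_imageD finite_subset)
  show "card (multi C k) \<le> (k + 1) ^ card C"
    using card_inj_on_le[OF inj sub fin] C by (simp add: card_PiE)
qed

lemma lattice_point_bary:
  assumes C: "nondeg C" and k: "1 \<le> k" and m: "m \<in> multi C k"
  shows "bary C v (lattice_point C k m) = real (m v) / real k"
proof (cases "v \<in> C")
  case True
  have "(\<Sum>v\<in>C. real (m v) / real k) = 1"
    using m k unfolding multi_def by (simp add: sum_divide_distrib[symmetric] of_nat_sum[symmetric] del: of_nat_sum)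
  then show ?thesis using bary_unique[OF C _ _ True, of "\<lambda>v. real (m v) / real k"] unfolding lattice_point_def by simp
qed (use m in \<open>simp add: multi_def\<close>)

lemma lattice_index_point:
  assumes "nondeg C" "1 \<le> k" "m \<in> multi C k"
  shows "lattice_index C k (lattice_point C k m) = m"
  using assms by (auto simp: lattice_index_def lattice_point_bary)

lemma lattice_point_inj: "nondeg C \<Longrightarrow> 1 \<le> k \<Longrightarrow> inj_on (lattice_point C k) (multi C k)"
  by (metis inj_onI lattice_index_point)

lemma lattice_point_in_hull:
  assumes "nondeg C" "1 \<le> k" "m \<in> multi C k" shows "lattice_point C k m \<in> convex hull C"
  using assms by (simp add: convex_hull_bary lattice_point_bary)

lemma falling_polyfun:
  assumes C: "nondeg (C :: 'a::euclidean_space set)" shows "polyfun (sum m C) (falling C k m)"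
proof -
  have fin: "finite C" by (rule nondeg_finite[OF C])
  have "polyfun (card (Sigma C (\<lambda>v. {..<m v}))) (\<lambda>x. \<Prod>i\<in>Sigma C (\<lambda>v. {..<m v}). real k * bary C (fst i) x - real (snd i))"
  proof (rule polyfun_affine_prod)
    fix i :: "'a \<times> nat"
    obtain n where n: "\<And>x. bary C (fst i) x = bary C (fst i) 0 + n \<bullet> x" using bary_affine[OF C] by blast
    have "real k * bary C (fst i) x - real (snd i) = (real k * bary C (fst i) 0 - real (snd i)) + (real k *\<^sub>R n) \<bullet> x" for x
      using n[of x] by (simp add: distrib_left)
    then show "\<exists>c n. (\<lambda>x. real k * bary C (fst i) x - real (snd i)) = (\<lambda>x. c + n \<bullet> x)" by blast
  qed (use fin in auto)
  moreover have "(\<Prod>i\<in>Sigma C (\<lambda>v. {..<m v}). real k * bary C (fst i) x - real (snd i)) = falling C k m x" for x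
    unfolding falling_def using prod.Sigma[of C "\<lambda>v. {..<m v}" "\<lambda>v l. real k * bary C v x - real l"] fin
    by (simp add: case_prod_unfold)
  moreover have "card (Sigma C (\<lambda>v. {..<m v})) = sum m C" using fin by simp
  ultimately show ?thesis by simp
qed

text \<open>Two multi-indices of equal sum are different only if \<open>m' v < m v\<close> for some
  \<open>v\<close>; then the factor with \<open>l = m' v\<close> vanishes.\<close>

lemma falling_at_point:
  assumes C: "nondeg C" and k: "1 \<le> k" and m: "m \<in> multi C k" "m' \<in> multi C k"
  shows "falling C k m (lattice_point C k m') = 0 \<longleftrightarrow> m \<noteq> m'"
proof -
  have fin: "finite C" by (rule nondeg_finite[OF C])
  have "falling C k m (lattice_point C k m') = (\<Prod>v\<in>C. \<Prod>l<m v. real (m' v) - real l)"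
    unfolding falling_def using k m(2) by (simp add: lattice_point_bary[OF C])
  also have "\<dots> = 0 \<longleftrightarrow> (\<exists>v\<in>C. m' v < m v)" using fin by auto
  also have "\<dots> \<longleftrightarrow> m \<noteq> m'"
  proof
    assume ne: "m \<noteq> m'"
    show "\<exists>v\<in>C. m' v < m v"
    proof (rule ccontr)
      assume "\<not> ?thesis"
      then have le: "\<And>v. v \<in> C \<Longrightarrow> m v \<le> m' v" by (auto simp: not_less)
      have "sum m C = sum m' C" using m unfolding multi_def by simp
      then have "\<And>v. v \<in> C \<Longrightarrow> m v = m' v"
        using sum_mono_inv[of m C m'] le fin by auto
      then have "m = m'" using m unfolding multi_def by (intro ext) (metis (mono_tags, lifting) mem_Collect_eq)
      then show False using ne by simp
    qed
  qed auto
  finally show ?thesis .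
qed

lemma falling_step:
  assumes C: "nondeg C" and v: "v \<in> C" and k: "1 \<le> k"
  shows "falling C k (m(v := Suc (m v))) x = (real k * bary C v x - real (m v)) * falling C k m x"
proof -
  have fin: "finite C" by (rule nondeg_finite[OF C])
  have "falling C k (m(v := Suc (m v))) x =
      (\<Prod>l<Suc (m v). real k * bary C v x - real l) * (\<Prod>w\<in>C - {v}. \<Prod>l<m w. real k * bary C w x - real l)"
    unfolding falling_def by (subst prod.remove[OF fin v]) (auto intro!: prod.cong)
  also have "\<dots> = (real k * bary C v x - real (m v)) * falling C k m x"
    unfolding falling_def by (subst prod.remove[OF fin v, of "\<lambda>w. \<Prod>l<m w. real k * bary C w x - real l"]) (simp add: mult_ac)
  finally show ?thesis .
qed

text \<open>Unisolvence: the functions reproduced by interpolation contain all products of a falling factorial with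
  a polynomial, by the identities \<open>(k - \<bar>m\<bar>) \<Phi>\<^sub>m = \<Sum>\<^sub>v \<Phi>\<^sub>m\<^sub>+\<^sub>v\<close> and \<open>k \<lambda>\<^sub>v \<Phi>\<^sub>m = \<Phi>\<^sub>m\<^sub>+\<^sub>v + m\<^sub>v \<Phi>\<^sub>m\<close>.\<close>

definition reproduced :: "'a::euclidean_space set \<Rightarrow> nat \<Rightarrow> ('a \<Rightarrow> real) \<Rightarrow> bool" where
  "reproduced C k p \<longleftrightarrow> (\<forall>x. p x = (\<Sum>m\<in>multi C k. p (lattice_point C k m) *
     (falling C k m x / falling C k m (lattice_point C k m))))"

lemma reproduced_scale: "reproduced C k p \<Longrightarrow> reproduced C k (\<lambda>x. a * p x)"
  unfolding reproduced_def
proof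
  fix x assume "\<forall>x. p x = (\<Sum>m\<in>multi C k. p (lattice_point C k m) *
     (falling C k m x / falling C k m (lattice_point C k m)))"
  then have "p x = (\<Sum>m\<in>multi C k. p (lattice_point C k m) *
     (falling C k m x / falling C k m (lattice_point C k m)))" ..
  then show "a * p x = (\<Sum>m\<in>multi C k. a * p (lattice_point C k m) *
     (falling C k m x / falling C k m (lattice_point C k m)))"
    by (simp only: sum_distrib_left mult.assoc)
qed

lemma reproduced_add:
  assumes "reproduced C k p" "reproduced C k q" shows "reproduced C k (\<lambda>x. p x + q x)"
  unfolding reproduced_def
proof
  fix x
  let ?l = "\<lambda>m. falling C k m x / falling C k m (lattice_point C k m)"
  have "p x = (\<Sum>m\<in>multi C k. p (lattice_point C k m) * ?l m)"
    "q x = (\<Sum>m\<in>multi C k. q (lattice_point C k m) * ?l m)" using assms unfolding reproduced_def by blast+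
  then show "p x + q x = (\<Sum>m\<in>multi C k. (p (lattice_point C k m) + q (lattice_point C k m)) * ?l m)"
    by (simp only: distrib_right sum.distrib)
qed

lemma reproduced_sum:
  "(\<And>i. i \<in> I \<Longrightarrow> reproduced C k (f i)) \<Longrightarrow> reproduced C k (\<lambda>x. \<Sum>i\<in>I. f i x)"
proof (induction I rule: infinite_finite_induct)
  case (insert i I)
  then show ?case using reproduced_add[of C k "f i" "\<lambda>x. \<Sum>i\<in>I. f i x"] by simp
qed (auto simp: reproduced_def)

lemma reproduced_falling:
  assumes C: "nondeg C" and k: "1 \<le> k" and m: "\<forall>v. v \<notin> C \<longrightarrow> m v = 0" "sum m C \<le> k"
  shows "reproduced C k (falling C k m)"
  using m
\<comment> \<open>The induction runs downwards in \<open>sum m C\<close>: at \<open>k\<close> the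
  function is a multiple of a Lagrange function, and below \<open>k\<close> the first identity
  expresses it by larger multi-indices.\<close>
proof (induction "k - sum m C" arbitrary: m)
  case 0
  then have m: "m \<in> multi C k" unfolding multi_def by auto
  have fin: "finite (multi C k)" using finite_multi nondeg_finite[OF C] by blast
  show ?case unfolding reproduced_def
  proof
    fix x
    have "(\<Sum>m'\<in>multi C k. falling C k m (lattice_point C k m') * (falling C k m' x / falling C k m' (lattice_point C k m')))
       = (\<Sum>m'\<in>multi C k. if m' = m then falling C k m x else 0)"
    proof (intro sum.cong refl)
      fix m' assume "m' \<in> multi C k"
      then show "falling C k m (lattice_point C k m') * (falling C k m' x / falling C k m' (lattice_point C k m'))
          = (if m' = m then falling C k m x else 0)"
        using falling_at_point[OF C k m] by auto
    qed
    also have "\<dots> = falling C k m x" using m fin by (subst sum.delta) auto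
    finally show "falling C k m x = (\<Sum>m'\<in>multi C k. falling C k m (lattice_point C k m') * (falling C k m' x / falling C k m' (lattice_point C k m')))" ..
  qed
next
  case (Suc n)
  have fin: "finite C" by (rule nondeg_finite[OF C])
  have up: "sum (m(v := Suc (m v))) C = Suc (sum m C)" if v: "v \<in> C" for v
  proof -
    have "sum (m(v := Suc (m v))) C = Suc (m v) + sum m (C - {v})"
      by (subst sum.remove[OF fin v]) (auto intro!: sum.cong)
    then show ?thesis using sum.remove[OF fin v, of m] by simp
  qed
  have "reproduced C k (\<lambda>x. \<Sum>v\<in>C. falling C k (m(v := Suc (m v))) x)"
  proof (rule reproduced_sum)
    fix v assume v: "v \<in> C"
    show "reproduced C k (falling C k (m(v := Suc (m v))))"
      using Suc.hyps(2) Suc.prems v up[OF v] by (intro Suc.hyps(1)) auto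
  qed
  then have "reproduced C k (\<lambda>x. 1 / (real k - real (sum m C)) * (\<Sum>v\<in>C. falling C k (m(v := Suc (m v))) x))"
    by (rule reproduced_scale)
  moreover have "(\<Sum>v\<in>C. falling C k (m(v := Suc (m v))) x) = (real k - real (sum m C)) * falling C k m x" for x
  proof -
    have "(\<Sum>v\<in>C. falling C k (m(v := Suc (m v))) x) = (\<Sum>v\<in>C. (real k * bary C v x - real (m v)) * falling C k m x)"
      using falling_step[OF C _ k] by (intro sum.cong) auto
    also have "\<dots> = (real k * (\<Sum>v\<in>C. bary C v x) - real (sum m C)) * falling C k m x"
      by (simp add: sum_distrib_right[symmetric] sum_subtractf sum_distrib_left)
    finally show ?thesis by (simp add: bary_sum[OF C])
  qed
  moreover have "real k - real (sum m C) \<noteq> 0"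
  proof -
    have "sum m C < k" using Suc.hyps(2) by linarith
    then have "real (sum m C) < real k" by (simp only: of_nat_less_iff)
    then show ?thesis by linarith
  qed
  ultimately show ?case by simp
qed

lemma reproduced_falling_mult:
  assumes C: "nondeg (C :: 'a::euclidean_space set)" and k: "1 \<le> k" and "polyfun n p"
    and "\<forall>v. v \<notin> C \<longrightarrow> m v = 0" "sum m C + n \<le> k"
  shows "reproduced C k (\<lambda>x. falling C k m x * p x)"
  using assms(3-)
proof (induction arbitrary: m rule: polyfun.induct)
  case (polyfun_const n c)
  then show ?case using reproduced_scale[OF reproduced_falling[OF C k, of m], of c] by (simp add: mult.commute)
next
  case (polyfun_add n p q)
  then show ?case using reproduced_add[of C k "\<lambda>x. falling C k m x * p x" "\<lambda>x. falling C k m x * q x"]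
    by (simp add: distrib_left)
next
  case (polyfun_coord n p b)
  have fin: "finite C" by (rule nondeg_finite[OF C])
  have up: "sum (m(v := Suc (m v))) C = Suc (sum m C)" if v: "v \<in> C" for v
  proof -
    have "sum (m(v := Suc (m v))) C = Suc (m v) + sum m (C - {v})"
      by (subst sum.remove[OF fin v]) (auto intro!: sum.cong)
    then show ?thesis using sum.remove[OF fin v, of m] by simp
  qed
  \<comment> \<open>The coordinate \<open>x \<bullet> b\<close> is the combination of the
    barycentric coordinates with weights \<open>v \<bullet> b\<close>, and the second identity
    absorbs each of them into a falling factorial.\<close>
  have "reproduced C k (\<lambda>x. \<Sum>v\<in>C. (v \<bullet> b) / real k *
      (falling C k (m(v := Suc (m v))) x * p x + real (m v) * (falling C k m x * p x)))"
  proof (intro reproduced_sum reproduced_scale reproduced_add)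
    fix v assume v: "v \<in> C"
    show "reproduced C k (\<lambda>x. falling C k (m(v := Suc (m v))) x * p x)"
      using polyfun_coord.prems v up[OF v] by (intro polyfun_coord.IH) auto
    show "reproduced C k (\<lambda>x. falling C k m x * p x)"
      using polyfun_coord.prems by (intro polyfun_coord.IH) auto
  qed
  moreover have "(\<Sum>v\<in>C. (v \<bullet> b) / real k *
      (falling C k (m(v := Suc (m v))) x * p x + real (m v) * (falling C k m x * p x)))
      = falling C k m x * ((x \<bullet> b) * p x)" for x
  proof -
    have "(\<Sum>v\<in>C. (v \<bullet> b) / real k *
      (falling C k (m(v := Suc (m v))) x * p x + real (m v) * (falling C k m x * p x)))
      = (\<Sum>v\<in>C. ((bary C v x *\<^sub>R v) \<bullet> b) * (falling C k m x * p x))"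
    proof (intro sum.cong refl)
      fix v assume v: "v \<in> C"
      have "falling C k (m(v := Suc (m v))) x * p x + real (m v) * (falling C k m x * p x)
          = real k * bary C v x * (falling C k m x * p x)"
        unfolding falling_step[OF C v k] by (simp add: algebra_simps)
      then show "(v \<bullet> b) / real k * (falling C k (m(v := Suc (m v))) x * p x + real (m v) * (falling C k m x * p x))
          = ((bary C v x *\<^sub>R v) \<bullet> b) * (falling C k m x * p x)"
        using k by simp
    qed
    also have "\<dots> = ((\<Sum>v\<in>C. bary C v x *\<^sub>R v) \<bullet> b) * (falling C k m x * p x)"
      by (simp only: inner_sum_left sum_distrib_right)
    finally show ?thesis unfolding bary_repr[OF C] by (simp add: mult_ac)
  qed
  ultimately show ?case by simp
qed

lemma lagrange_eq_falling:
  assumes C: "nondeg C" and k: "1 \<le> k" and m: "m \<in> multi C k"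
  shows "lagrange C k (lattice_point C k m) x = falling C k m x / falling C k m (lattice_point C k m)"
proof -
  have "falling C k m (lattice_point C k m) = (\<Prod>v\<in>C. \<Prod>l<m v. real (m v) - real l)"
    unfolding falling_def using k by (simp add: lattice_point_bary[OF C k m])
  then show ?thesis unfolding lagrange_def lattice_index_point[OF C k m] falling_def
    by (simp add: prod_dividef)
qed

lemma lagrange_interpolation:
  assumes C: "nondeg (C :: 'a::euclidean_space set)" and k: "1 \<le> k" and p: "polyfun k p"
  shows "p x = (\<Sum>j\<in>lattice_point C k ` multi C k. p j * lagrange C k j x)"
proof -
  have f0: "falling C k (\<lambda>_. 0) x = 1" for x by (simp add: falling_def)
  have "reproduced C k (\<lambda>x. falling C k (\<lambda>_. 0) x * p x)"
    by (rule reproduced_falling_mult[OF C k p]) auto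
  then have "p x = (\<Sum>m\<in>multi C k. p (lattice_point C k m) *
     (falling C k m x / falling C k m (lattice_point C k m)))"
    unfolding reproduced_def f0 mult_1_left by (rule spec)
  also have "\<dots> = (\<Sum>m\<in>multi C k. p (lattice_point C k m) * lagrange C k (lattice_point C k m) x)"
    using lagrange_eq_falling[OF C k] by (intro sum.cong) auto
  also have "\<dots> = (\<Sum>j\<in>lattice_point C k ` multi C k. p j * lagrange C k j x)"
    by (subst sum.reindex[OF lattice_point_inj[OF C k]]) simp
  finally show ?thesis .
qed

lemma lagrange_polyfun:
  assumes C: "nondeg C" and k: "1 \<le> k" and j: "j \<in> lattice_point C k ` multi C k"
  shows "polyfun k (lagrange C k j)"
proof -
  obtain m where m: "m \<in> multi C k" "j = lattice_point C k m" using j by auto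
  have "polyfun k (\<lambda>x. (1 / falling C k m j) * falling C k m x)"
    using falling_polyfun[OF C, of m k] m by (intro polyfun_scale) (simp add: multi_def)
  moreover have "lagrange C k j = (\<lambda>x. (1 / falling C k m j) * falling C k m x)"
    using lagrange_eq_falling[OF C k m(1)] m(2) by (intro ext) simp
  ultimately show ?thesis by simp
qed

lemma lagrange_at_points:
  assumes C: "nondeg C" and k: "1 \<le> k" and j: "j \<in> lattice_point C k ` multi C k" "i \<in> lattice_point C k ` multi C k"
  shows "lagrange C k j i = (if i = j then 1 else 0)"
proof -
  obtain m where m: "m \<in> multi C k" "j = lattice_point C k m" using j by auto
  obtain m' where m': "m' \<in> multi C k" "i = lattice_point C k m'" using j by auto
  have "i = j \<longleftrightarrow> m = m'" using inj_onD[OF lattice_point_inj[OF C k]] m m' by blast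
  then show ?thesis
    unfolding m(2) m'(2) lagrange_eq_falling[OF C k m(1)]
    using falling_at_point[OF C k m(1) m(1)] falling_at_point[OF C k m(1) m'(1)] by auto
qed

text \<open>With \<open>k\<close> extracted from each of the \<open>k\<close> affine factors, all
  factors are at most 1 in modulus on the simplex. Hence the product is bounded, and the difference
  of two products is at most the sum of the differences of the factors.\<close>

lemma
  assumes C: "nondeg (C :: 'a::euclidean_space set)" and k: "1 \<le> k" and j: "j \<in> lattice_point C k ` multi C k"
    and r: "0 < \<rho>" "cball c \<rho> \<subseteq> convex hull C" and x: "x \<in> convex hull C" and y: "y \<in> convex hull C"
  shows lagrange_bound: "\<bar>lagrange C k j x\<bar> \<le> real k ^ k"
    and lagrange_lipschitz: "\<bar>lagrange C k j x - lagrange C k j y\<bar> \<le> real k ^ k * real k * (norm (x - y) / \<rho>)"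
proof -
  obtain m where m: "m \<in> multi C k" "j = lattice_point C k m" using j by auto
  have fin: "finite C" by (rule nondeg_finite[OF C])
  let ?I = "Sigma C (\<lambda>v. {..<m v})"
  have cI: "card ?I = k" using fin m(1) unfolding multi_def by simp
  define g where "g x i = (bary C (fst i) x - real (snd i) / real k) / (real (m (fst i)) - real (snd i))" for x i
  have eq: "lagrange C k j x = real k ^ k * (\<Prod>i\<in>?I. g x i)" for x
  proof -
    have "lagrange C k j x = (\<Prod>i\<in>?I. (real k * bary C (fst i) x - real (snd i)) / (real (m (fst i)) - real (snd i)))"
      unfolding lagrange_def m(2) lattice_index_point[OF C k m(1)]
      using prod.Sigma[of C "\<lambda>v. {..<m v}" "\<lambda>v l. (real k * bary C v x - real l) / (real (m v) - real l)"] fin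
      by (simp add: case_prod_unfold)
    also have "\<dots> = (\<Prod>i\<in>?I. real k * g x i)"
      unfolding g_def using k by (intro prod.cong refl) (simp add: right_diff_distrib)
    finally show ?thesis by (simp add: prod.distrib cI)
  qed
  have den: "1 \<le> real (m (fst i)) - real (snd i)" if "i \<in> ?I" for i
    using that by auto
  have g1: "norm (g x i) \<le> 1" if x: "x \<in> convex hull C" and i: "i \<in> ?I" for x i
  proof -
    have "real (snd i) \<le> real k" using i multi_le[OF fin m(1), of "fst i"] by auto
    then have "0 \<le> real (snd i) / real k" "real (snd i) / real k \<le> 1" using k by auto
    then have "\<bar>bary C (fst i) x - real (snd i) / real k\<bar> \<le> 1"
      using bary_nonneg[OF C x, of "fst i"] bary_le_1[OF C x, of "fst i"] by linarith
    then show ?thesis unfolding g_def using den[OF i] by (simp add: divide_le_eq_1)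
  qed
  have "norm (\<Prod>i\<in>?I. g x i) \<le> 1"
    unfolding prod_norm[symmetric] using g1[OF x] by (intro prod_le_1) auto
  then show "\<bar>lagrange C k j x\<bar> \<le> real k ^ k" unfolding eq by (simp add: abs_mult mult_left_le)
  have "norm ((\<Prod>i\<in>?I. g x i) - (\<Prod>i\<in>?I. g y i)) \<le> (\<Sum>i\<in>?I. norm (g x i - g y i))"
    using g1 x y by (intro norm_prod_diff) auto
  also have "\<dots> \<le> (\<Sum>i\<in>?I. norm (x - y) / \<rho>)"
  proof (rule sum_mono)
    fix i assume i: "i \<in> ?I"
    have "g x i - g y i = (bary C (fst i) x - bary C (fst i) y) / (real (m (fst i)) - real (snd i))"
      unfolding g_def by (simp add: diff_divide_distrib)
    then have "norm (g x i - g y i) = \<bar>bary C (fst i) x - bary C (fst i) y\<bar> / (real (m (fst i)) - real (snd i))"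
      using den[OF i] by simp
    also have "\<dots> \<le> \<bar>bary C (fst i) x - bary C (fst i) y\<bar> / 1" using den[OF i] by (intro divide_left_mono) auto
    also have "\<dots> \<le> norm (x - y) / \<rho>" using bary_lipschitz[OF C r, of "fst i" x y] by simp
    finally show "norm (g x i - g y i) \<le> norm (x - y) / \<rho>" .
  qed
  finally have "norm ((\<Prod>i\<in>?I. g x i) - (\<Prod>i\<in>?I. g y i)) \<le> real k * (norm (x - y) / \<rho>)" by (simp add: cI)
  then have "real k ^ k * norm ((\<Prod>i\<in>?I. g x i) - (\<Prod>i\<in>?I. g y i)) \<le> real k ^ k * (real k * (norm (x - y) / \<rho>))"
    by (rule mult_left_mono) simp
  moreover have "\<bar>lagrange C k j x - lagrange C k j y\<bar> = real k ^ k * norm ((\<Prod>i\<in>?I. g x i) - (\<Prod>i\<in>?I. g y i))"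
    unfolding eq by (simp add: right_diff_distrib[symmetric] abs_mult)
  ultimately show "\<bar>lagrange C k j x - lagrange C k j y\<bar> \<le> real k ^ k * real k * (norm (x - y) / \<rho>)"
    by (simp add: mult.assoc)
qed

section \<open>Inverse estimates on shape regular simplices\<close>

definition verts :: "'a::real_vector set \<Rightarrow> 'a set" where
  "verts T = {v. v extreme_point_of T}"

definition fat :: "real \<Rightarrow> 'a::euclidean_space set \<Rightarrow> bool" where
  "fat \<sigma> T \<longleftrightarrow> (\<exists>c \<rho>. 0 < \<rho> \<and> cball c \<rho> \<subseteq> T \<and> diameter T \<le> \<sigma> * \<rho>)"

lemma
  assumes "int DIM('a) simplex (T :: 'a::euclidean_space set)"
  shows simplex_nondeg: "nondeg (verts T)" and simplex_hull: "convex hull (verts T) = T"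
proof -
  obtain C where C: "\<not> affine_dependent C" "int (card C) = int DIM('a) + 1" "T = convex hull C"
    using assms unfolding simplex_def by auto
  have "verts T = C" unfolding verts_def C(3) using extreme_point_of_convex_hull_affine_independent[OF C(1)] by auto
  then show "nondeg (verts T)" "convex hull (verts T) = T" using C unfolding nondeg_def by auto
qed

lemma lagrange_nodes_eq:
  assumes T: "int DIM('a) simplex (T :: 'a::euclidean_space set)"
  shows "lagrange_nodes k T = lattice_point (verts T) k ` multi (verts T) k"
proof (intro Set.set_eqI iffI)
  fix x assume "x \<in> lagrange_nodes k T"
  then obtain m where m: "x = (\<Sum>v\<in>verts T. (real (m v) / real k) *\<^sub>R v)" "sum m (verts T) = k"
    unfolding lagrange_nodes_def verts_def by blast
  \<comment> \<open>\<open>lagrange_nodes\<close> leaves \<open>m\<close> arbitrary away from the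
    vertices, whereas \<open>multi\<close> asks for zero there.\<close>
  define m' where "m' v = (if v \<in> verts T then m v else 0)" for v
  have "m' \<in> multi (verts T) k" "x = lattice_point (verts T) k m'"
    using m unfolding multi_def lattice_point_def m'_def by auto
  then show "x \<in> lattice_point (verts T) k ` multi (verts T) k" by blast
next
  fix x assume "x \<in> lattice_point (verts T) k ` multi (verts T) k"
  then obtain m where "m \<in> multi (verts T) k" "x = lattice_point (verts T) k m" by blast
  then have "x = (\<Sum>v\<in>verts T. (real (m v) / real k) *\<^sub>R v) \<and> sum m (verts T) = k"
    unfolding multi_def lattice_point_def by auto
  then show "x \<in> lagrange_nodes k T" unfolding lagrange_nodes_def verts_def by blast
qed

lemma
  assumes "int DIM('a) simplex (T :: 'a::euclidean_space set)"
  shows finite_lagrange_nodes: "finite (lagrange_nodes k T)"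
    and card_lagrange_nodes_le: "card (lagrange_nodes k T) \<le> (k + 1) ^ Suc DIM('a)"
proof -
  have n: "nondeg (verts T)" by (rule simplex_nondeg[OF assms])
  have f: "finite (verts T)" by (rule nondeg_finite[OF n])
  show "finite (lagrange_nodes k T)" unfolding lagrange_nodes_eq[OF assms] using finite_multi[OF f] by blast
  have "card (lagrange_nodes k T) \<le> card (multi (verts T) k)"
    unfolding lagrange_nodes_eq[OF assms] by (rule card_image_le[OF finite_multi[OF f]])
  also have "\<dots> \<le> (k + 1) ^ Suc DIM('a)" using card_multi_le[OF f, of k] n unfolding nondeg_def by simp
  finally show "card (lagrange_nodes k T) \<le> (k + 1) ^ Suc DIM('a)" .
qed

lemma lagrange_nodes_subset:
  assumes "int DIM('a) simplex (T :: 'a::euclidean_space set)" "1 \<le> k"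
  shows "lagrange_nodes k T \<subseteq> T"
  using lattice_point_in_hull[OF simplex_nondeg[OF assms(1)] assms(2)] simplex_hull[OF assms(1)]
  unfolding lagrange_nodes_eq[OF assms(1)] by auto

lemma verts_subset_lagrange_nodes:
  assumes T: "int DIM('a) simplex (T :: 'a::euclidean_space set)" and k: "1 \<le> k"
  shows "verts T \<subseteq> lagrange_nodes k T"
proof
  fix v assume v: "v \<in> verts T"
  have f: "finite (verts T)" by (rule nondeg_finite[OF simplex_nondeg[OF T]])
  define m where "m w = (if w = v then k else 0)" for w
  have "m \<in> multi (verts T) k" unfolding multi_def m_def using v f by (auto simp: sum.delta)
  moreover have "v = lattice_point (verts T) k m"
  proof -
    have "lattice_point (verts T) k m = (\<Sum>w\<in>verts T. if w = v then v else 0)"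
      unfolding lattice_point_def m_def using k by (intro sum.cong) auto
    then show ?thesis using v f by (simp add: sum.delta)
  qed
  ultimately show "v \<in> lagrange_nodes k T" unfolding lagrange_nodes_eq[OF T] by blast
qed

lemma poly_eq_on_simplex:
  assumes T: "int DIM('a) simplex (T :: 'a::euclidean_space set)" and k: "1 \<le> k"
    and p: "polyfun k p" and q: "polyfun k q" and eq: "\<And>x. x \<in> lagrange_nodes k T \<Longrightarrow> p x = q x"
  shows "p = q"
proof
  fix x
  note n = simplex_nondeg[OF T]
  show "p x = q x"
    unfolding lagrange_interpolation[OF n k p, of x] lagrange_interpolation[OF n k q, of x]
    using eq unfolding lagrange_nodes_eq[OF T] by (intro sum.cong) auto
qed

lemma
  assumes T: "int DIM('a) simplex (T :: 'a::euclidean_space set)"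
  shows simplex_compact: "compact T" and simplex_convex: "convex T" and simplex_bounded: "bounded T"
  using compact_simplex[OF T] convex_simplex[OF T] by (auto intro: compact_imp_bounded)

text \<open>The inscribed ball is no wider than the simplex, which forces
  \<open>\<sigma> \<ge> 2\<close> as soon as one such simplex exists.\<close>

lemma fatE:
  assumes "fat \<sigma> T" "bounded T"
  obtains c \<rho> where "0 < \<rho>" "cball c \<rho> \<subseteq> T" "diameter T \<le> \<sigma> * \<rho>" "2 * \<rho> \<le> diameter T" "2 \<le> \<sigma>" "0 < diameter T"
    "1 / \<rho> \<le> \<sigma> / diameter T"
proof -
  obtain c \<rho> where r: "0 < \<rho>" "cball c \<rho> \<subseteq> T" "diameter T \<le> \<sigma> * \<rho>" using assms unfolding fat_def by blast
  have d: "2 * \<rho> \<le> diameter T" using diameter_subset[OF r(2) assms(2)] r(1) by simp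
  then have "2 * \<rho> \<le> \<sigma> * \<rho>" using r(3) by linarith
  then have "2 \<le> \<sigma>" using r(1) by simp
  moreover have "0 < diameter T" using d r(1) by linarith
  moreover have "1 / \<rho> \<le> \<sigma> / diameter T" using r(1,3) \<open>0 < diameter T\<close> by (simp add: field_simps)
  ultimately show ?thesis using that r d by blast
qed

text \<open>Replaces the transformation to a reference simplex: the interpolation formula and the
  explicit bounds on Lagrange functions give a constant that depends on \<open>k\<close>,
  \<open>\<sigma>\<close> and the dimension only.\<close>

lemma nodal_bounds:
  assumes k: "1 \<le> k"
  shows "\<exists>G\<ge>1. \<forall>(T :: 'a::euclidean_space set) p B. int DIM('a) simplex T \<longrightarrow> fat \<sigma> T \<longrightarrow> polyfun k p \<longrightarrow>
    (\<forall>j\<in>lagrange_nodes k T. \<bar>p j\<bar> \<le> B) \<longrightarrow>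
    (\<forall>x\<in>T. \<bar>p x\<bar> \<le> G * B) \<and> (\<forall>x\<in>T. \<forall>y\<in>T. \<bar>p x - p y\<bar> \<le> G * B * (norm (x - y) / diameter T))"
proof -
  define n where "n = real ((k + 1) ^ Suc DIM('a))"
  define G where "G = n * real k ^ k * real k * max 1 \<sigma>"
  have "1 \<le> (k + 1) ^ Suc DIM('a)" by (rule one_le_power) simp
  then have "real 1 \<le> n" unfolding n_def by (simp only: of_nat_le_iff)
  then have n1: "1 \<le> n" by simp
  have k1: "1 \<le> real k ^ k" using k by (simp add: one_le_power)
  have nk: "1 \<le> n * real k ^ k" using mult_mono[OF n1 k1] n1 by simp
  have nkk: "n * real k ^ k * 1 \<le> n * real k ^ k * real k" using nk k by (intro mult_left_mono) auto
  have nkk1: "n * real k ^ k * real k * 1 \<le> G" unfolding G_def using nk k by (intro mult_left_mono) auto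
  have "1 \<le> G" using nk nkk nkk1 by linarith
  have "(\<forall>x\<in>T. \<bar>p x\<bar> \<le> G * B) \<and> (\<forall>x\<in>T. \<forall>y\<in>T. \<bar>p x - p y\<bar> \<le> G * B * (norm (x - y) / diameter T))"
    if T: "int DIM('a) simplex T" and fat: "fat \<sigma> T" and p: "polyfun k p" and B: "\<forall>j\<in>lagrange_nodes k T. \<bar>p j\<bar> \<le> B"
    for T :: "'a set" and p B
  proof -
    note nd = simplex_nondeg[OF T]
    note hull = simplex_hull[OF T]
    let ?N = "lagrange_nodes k T"
    obtain c \<rho> where r: "0 < \<rho>" "cball c \<rho> \<subseteq> T" "diameter T \<le> \<sigma> * \<rho>" "2 \<le> \<sigma>" "0 < diameter T" "1 / \<rho> \<le> \<sigma> / diameter T"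
      using fatE[OF fat simplex_bounded[OF T]] by metis
    obtain v where "v \<in> verts T" using nd unfolding nondeg_def by fastforce
    then have B0: "0 \<le> B" using B verts_subset_lagrange_nodes[OF T k] by (metis abs_ge_zero order_trans subsetD)
    have c: "real (card ?N) \<le> n" unfolding n_def using card_lagrange_nodes_le[OF T] by (simp only: of_nat_le_iff)
    have pe: "p x = (\<Sum>j\<in>?N. p j * lagrange (verts T) k j x)" for x
      unfolding lagrange_nodes_eq[OF T] by (rule lagrange_interpolation[OF nd k p])
    have lb: "\<bar>lagrange (verts T) k j x\<bar> \<le> real k ^ k" if "j \<in> ?N" "x \<in> T" for j x
      using lagrange_bound[OF nd k _ r(1), of j c x x] r(2) that unfolding lagrange_nodes_eq[OF T] hull by auto
    have ll: "\<bar>lagrange (verts T) k j x - lagrange (verts T) k j y\<bar> \<le> real k ^ k * real k * (\<sigma> * (norm (x - y) / diameter T))"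
      if "j \<in> ?N" "x \<in> T" "y \<in> T" for j x y
    proof -
      have "\<bar>lagrange (verts T) k j x - lagrange (verts T) k j y\<bar> \<le> real k ^ k * real k * (norm (x - y) / \<rho>)"
        using lagrange_lipschitz[OF nd k _ r(1), of j c x y] r(2) that unfolding lagrange_nodes_eq[OF T] hull by auto
      also have "\<dots> \<le> real k ^ k * real k * (\<sigma> * (norm (x - y) / diameter T))"
        using mult_left_mono[OF r(6) norm_ge_zero[of "x - y"]] by (intro mult_left_mono) (auto simp: mult_ac)
      finally show ?thesis .
    qed
    have b1: "\<bar>p x\<bar> \<le> G * B" if x: "x \<in> T" for x
    proof -
      have "\<bar>p x\<bar> \<le> (\<Sum>j\<in>?N. \<bar>p j * lagrange (verts T) k j x\<bar>)" unfolding pe[of x] by (rule sum_abs)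
      also have "\<dots> \<le> (\<Sum>j\<in>?N. B * real k ^ k)"
        unfolding abs_mult using B lb x B0 by (intro sum_mono mult_mono) auto
      also have "\<dots> = real (card ?N) * (B * real k ^ k)" by simp
      also have "\<dots> \<le> n * (B * real k ^ k)" using c B0 by (intro mult_right_mono) auto
      also have "\<dots> = (n * real k ^ k) * B" by simp
      also have "\<dots> \<le> G * B" using nkk nkk1 B0 by (intro mult_right_mono) auto
      finally show ?thesis .
    qed
    have b2: "\<bar>p x - p y\<bar> \<le> G * B * (norm (x - y) / diameter T)" if x: "x \<in> T" "y \<in> T" for x y
    proof -
      let ?q = "norm (x - y) / diameter T"
      have q0: "0 \<le> ?q" using r by simp
      have "p x - p y = (\<Sum>j\<in>?N. p j * (lagrange (verts T) k j x - lagrange (verts T) k j y))"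
        unfolding pe[of x] pe[of y] right_diff_distrib sum_subtractf ..
      then have "\<bar>p x - p y\<bar> \<le> (\<Sum>j\<in>?N. \<bar>p j * (lagrange (verts T) k j x - lagrange (verts T) k j y)\<bar>)" by (simp add: sum_abs)
      also have "\<dots> \<le> (\<Sum>j\<in>?N. B * (real k ^ k * real k * (\<sigma> * ?q)))"
        unfolding abs_mult using B ll x B0 by (intro sum_mono mult_mono) auto
      also have "\<dots> = real (card ?N) * (B * (real k ^ k * real k * (\<sigma> * ?q)))" by simp
      also have "\<dots> \<le> n * (B * (real k ^ k * real k * (\<sigma> * ?q)))" using c B0 q0 r by (intro mult_right_mono) auto
      also have "\<dots> = G * B * ?q" unfolding G_def using r(4) by (simp add: max_def mult_ac)
      finally show ?thesis .
    qed
    show ?thesis using b1 b2 by blast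
  qed
  then show ?thesis using \<open>1 \<le> G\<close> by (intro exI[of _ G]) blast
qed

lemma set_integrable_lebesgue_compact:
  fixes f :: "'a::euclidean_space \<Rightarrow> real"
  assumes "compact S" "continuous_on S f"
  shows "set_integrable lebesgue S f"
  unfolding set_integrable_def using borel_integrable_compact[OF assms]
  by (subst integrable_completion) (auto intro: borel_measurable_integrable)

lemma set_integral_lebesgue_le:
  fixes f :: "'a::euclidean_space \<Rightarrow> real"
  assumes S: "compact S" "continuous_on S f" and le: "\<And>x. x \<in> S \<Longrightarrow> f x \<le> B"
    and T: "S \<subseteq> cball z h" "0 \<le> h" and B: "0 \<le> B"
  shows "(LINT x:S|lebesgue. f x) \<le> B * (unit_ball_vol (real DIM('a)) * h ^ DIM('a))"
proof -
  have "(LINT x:S|lebesgue. f x) \<le> (LINT x:S|lebesgue. B)"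
    by (rule set_integral_mono[OF set_integrable_lebesgue_compact set_integrable_lebesgue_compact]) (use S le in auto)
  also have "\<dots> = measure lebesgue S * B"
    using S by (subst set_integral_const) (auto intro: fmeasurableD emeasure_compact_finite simp: lmeasurable_compact fmeasurableD2)
  also have "\<dots> \<le> measure lebesgue (cball z h) * B"
    using S T B by (intro mult_right_mono measure_mono_fmeasurable) (auto simp: lmeasurable_compact fmeasurableD)
  also have "measure lebesgue (cball z h) = unit_ball_vol (real DIM('a)) * h ^ DIM('a)"
    using content_cball[OF T(2), of z] by (simp add: measure_completion)
  finally show ?thesis by (simp add: mult.commute)
qed

text \<open>Near a point \<open>m\<close> where \<open>|q|\<close> is maximal, the Lipschitz bound
  keeps \<open>|q|\<close> above half of its maximum. The neighbourhood used is the image of the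
  inscribed ball under the homothety with centre \<open>m\<close> and ratio
  \<open>e = 1 / (2 G)\<close>, whose volume is a fixed fraction of \<open>h^d\<close>.\<close>

lemma poly_L2_lower:
  assumes k: "1 \<le> k"
  shows "\<exists>c>0. \<forall>(T :: 'a::euclidean_space set) q z. int DIM('a) simplex T \<longrightarrow> fat \<sigma> T \<longrightarrow> polyfun k q \<longrightarrow> z \<in> T \<longrightarrow>
    c * diameter T ^ DIM('a) * (q z)\<^sup>2 \<le> (LINT x:T|lebesgue. (q x)\<^sup>2)"
proof -
  obtain G where G: "1 \<le> G" "\<And>(T :: 'a set) p B. int DIM('a) simplex T \<Longrightarrow> fat \<sigma> T \<Longrightarrow> polyfun k p \<Longrightarrow>
    (\<forall>j\<in>lagrange_nodes k T. \<bar>p j\<bar> \<le> B) \<Longrightarrow>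
    (\<forall>x\<in>T. \<bar>p x\<bar> \<le> G * B) \<and> (\<forall>x\<in>T. \<forall>y\<in>T. \<bar>p x - p y\<bar> \<le> G * B * (norm (x - y) / diameter T))"
    using nodal_bounds[OF k, of \<sigma>, where 'a = 'a] by blast
  let ?\<omega> = "unit_ball_vol (real DIM('a))"
  define s where "s = max \<sigma> 1"
  define a where "a = 1 / (2 * G * s)"
  define c where "c = ?\<omega> / 4 * a ^ DIM('a)"
  have s: "0 < s" unfolding s_def by simp
  have a: "0 < a" unfolding a_def using G(1) s by simp
  have c0: "0 < c" unfolding c_def using a by simp
  have "c * diameter T ^ DIM('a) * (q z)\<^sup>2 \<le> (LINT x:T|lebesgue. (q x)\<^sup>2)"
    if T: "int DIM('a) simplex T" and fat: "fat \<sigma> T" and q: "polyfun k q" and z: "z \<in> T"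
    for T :: "'a set" and q z
  proof -
    obtain w \<rho> where r: "0 < \<rho>" "cball w \<rho> \<subseteq> T" "diameter T \<le> \<sigma> * \<rho>" "2 \<le> \<sigma>" "0 < diameter T"
      using fatE[OF fat simplex_bounded[OF T]] by metis
    have cq: "continuous_on T (\<lambda>x. \<bar>q x\<bar>)" using polyfun_continuous[OF q] by (intro continuous_on_rabs)
    obtain m where m: "m \<in> T" "\<And>y. y \<in> T \<Longrightarrow> \<bar>q y\<bar> \<le> \<bar>q m\<bar>"
      using continuous_attains_sup[OF simplex_compact[OF T] _ cq] z by blast
    define B where "B = \<bar>q m\<bar>"
    have B0: "0 \<le> B" unfolding B_def by simp
    define e where "e = 1 / (2 * G)"
    have e: "0 < e" "e \<le> 1" unfolding e_def using G(1) by (auto simp: divide_le_eq_1)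
    define u where "u = m + e *\<^sub>R (w - m)"
    have both: "y \<in> T \<and> B / 2 \<le> \<bar>q y\<bar>" if y: "y \<in> ball u (e * \<rho>)" for y
    proof -
      \<comment> \<open>The preimage of \<open>y\<close> under the homothety. It lies in the
        inscribed ball, so \<open>y\<close> is in \<open>T\<close> by convexity and within
        \<open>e * diameter T\<close> of \<open>m\<close>.\<close>
      define y' where "y' = m + (1 / e) *\<^sub>R (y - m)"
      have yy: "y = (1 - e) *\<^sub>R m + e *\<^sub>R y'" unfolding y'_def using e by (simp add: scaleR_add_right scaleR_diff_left)
      have "y - u = e *\<^sub>R (y' - w)" unfolding yy u_def
        by (simp add: scaleR_diff_left scaleR_diff_right scaleR_add_right)
      then have "norm (y - u) = e * norm (y' - w)" using e by simp
      moreover have "norm (y - u) < e * \<rho>" using y by (simp add: dist_norm norm_minus_commute)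
      ultimately have "e * norm (y' - w) < e * \<rho>" by simp
      then have "y' \<in> T" using e r(2) by (auto simp: dist_norm norm_minus_commute)
      then have yT: "y \<in> T" using convexD_alt[OF simplex_convex[OF T] m(1), of y' e] e yy by simp
      have "norm (y' - m) \<le> diameter T"
        using diameter_bounded_bound[OF simplex_bounded[OF T] \<open>y' \<in> T\<close> m(1)] by (simp add: dist_norm)
      moreover have "y - m = e *\<^sub>R (y' - m)" unfolding yy by (simp add: scaleR_diff_left scaleR_diff_right)
      ultimately have ym: "norm (y - m) / diameter T \<le> e" using e r by (simp add: divide_le_eq)
      have "\<forall>j\<in>lagrange_nodes k T. \<bar>q j\<bar> \<le> B" using m(2) lagrange_nodes_subset[OF T k] unfolding B_def by blast
      then have "\<bar>q y - q m\<bar> \<le> G * B * (norm (y - m) / diameter T)" using G(2)[OF T fat q] yT m(1) by blast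
      also have "\<dots> \<le> G * B * e" using ym G(1) B0 by (intro mult_left_mono) auto
      also have "\<dots> = B / 2" unfolding e_def using G(1) by simp
      finally show ?thesis using yT unfolding B_def by linarith
    qed
    have sub: "ball u (e * \<rho>) \<subseteq> T" and big: "\<And>y. y \<in> ball u (e * \<rho>) \<Longrightarrow> B / 2 \<le> \<bar>q y\<bar>"
      using both by blast+
    have qz: "(q z)\<^sup>2 \<le> B\<^sup>2" using m(2)[OF z] unfolding B_def by (simp add: abs_le_square_iff)
    have "diameter T / s \<le> \<rho>" using r s unfolding s_def by (simp add: divide_le_eq max_def mult.commute)
    then have "e * (diameter T / s) \<le> e * \<rho>" using e by (intro mult_left_mono) auto
    then have "a * diameter T \<le> e * \<rho>" unfolding e_def a_def by simp
    then have "?\<omega> / 4 * (a * diameter T) ^ DIM('a) \<le> ?\<omega> / 4 * (e * \<rho>) ^ DIM('a)"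
      using r a by (intro mult_left_mono power_mono) auto
    then have le1: "c * diameter T ^ DIM('a) \<le> ?\<omega> / 4 * (e * \<rho>) ^ DIM('a)"
      unfolding c_def by (simp only: power_mult_distrib[of a] mult.assoc)
    have "c * diameter T ^ DIM('a) * (q z)\<^sup>2 \<le> ?\<omega> / 4 * (e * \<rho>) ^ DIM('a) * B\<^sup>2"
      by (rule mult_mono[OF le1 qz]) (use e r in auto)
    also have "\<dots> = measure lebesgue (ball u (e * \<rho>)) * (B / 2)\<^sup>2"
      using content_ball[of "e * \<rho>" u] e r by (simp add: measure_completion power_divide)
    also have "\<dots> = (LINT x:ball u (e * \<rho>)|lebesgue. (B / 2)\<^sup>2)"
      using e r by (subst set_integral_const) (auto simp: emeasure_ball)
    also have "\<dots> \<le> (LINT x:T|lebesgue. (q x)\<^sup>2)"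
      unfolding set_lebesgue_integral_def
    proof (rule integral_mono)
      show "integrable lebesgue (\<lambda>x. indicat_real T x *\<^sub>R (q x)\<^sup>2)"
        using set_integrable_lebesgue_compact[OF simplex_compact[OF T], of "\<lambda>x. (q x)\<^sup>2"] polyfun_continuous[OF q]
        unfolding set_integrable_def by (auto intro: continuous_intros)
      show "integrable lebesgue (\<lambda>x. indicat_real (ball u (e * \<rho>)) x *\<^sub>R (B / 2)\<^sup>2)"
        by (intro integrable_scaleR_left) (use e r in \<open>auto intro!: integrable_real_indicator simp: emeasure_ball\<close>)
      fix x
      show "indicat_real (ball u (e * \<rho>)) x *\<^sub>R (B / 2)\<^sup>2 \<le> indicat_real T x *\<^sub>R (q x)\<^sup>2"
      proof (cases "x \<in> ball u (e * \<rho>)")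
        case True
        then have "(B / 2)\<^sup>2 \<le> \<bar>q x\<bar>\<^sup>2" using big B0 by (intro power_mono) auto
        then show ?thesis using True sub by (auto simp: indicator_def)
      qed (auto simp: indicator_def)
    qed
    finally show ?thesis .
  qed
  then show ?thesis using c0 by blast
qed

section \<open>Gradients of polynomials on a simplex\<close>

lemma polyfun_line_derivative:
  assumes p: "polyfun k p"
  shows "((\<lambda>t. p (x + t *\<^sub>R v)) has_real_derivative (grad p (x + t *\<^sub>R v) \<bullet> v)) (at t)"
proof -
  let ?y = "x + t *\<^sub>R v"
  have "((\<lambda>t. x + t *\<^sub>R v) has_derivative (\<lambda>s. s *\<^sub>R v)) (at t)"
    by (auto intro!: derivative_eq_intros)
  from has_derivative_compose[OF this polyfun_frechet[OF p, of ?y]]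
  have "((\<lambda>t. p (x + t *\<^sub>R v)) has_derivative (\<lambda>s. grad p ?y \<bullet> (s *\<^sub>R v))) (at t)"
    by (simp only: polyfun_grad_inner[OF p])
  moreover have "(\<lambda>s. grad p ?y \<bullet> (s *\<^sub>R v)) = (*) (grad p ?y \<bullet> v)" by (auto simp: mult.commute)
  ultimately show ?thesis unfolding has_field_derivative_def by simp
qed

text \<open>The difference quotient in the direction of the gradient itself tends to the squared
  norm of the gradient.\<close>

lemma grad_norm_le:
  assumes p: "polyfun k p" and L: "0 \<le> L" and x: "x \<in> interior T"
    and lip: "\<And>y. y \<in> T \<Longrightarrow> \<bar>p y - p x\<bar> \<le> L * norm (y - x)"
  shows "norm (grad p x) \<le> L"
proof -
  let ?g = "grad p x"
  have "((\<lambda>t. p (x + t *\<^sub>R ?g)) has_real_derivative (?g \<bullet> ?g)) (at 0)"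
    using polyfun_line_derivative[OF p, of x ?g 0] by simp
  then have lim: "((\<lambda>t. (p (x + t *\<^sub>R ?g) - p x) / t) \<longlongrightarrow> ?g \<bullet> ?g) (at 0)"
    unfolding has_field_derivative_iff by simp
  have "((\<lambda>t::real. x + t *\<^sub>R ?g) \<longlongrightarrow> x + 0 *\<^sub>R ?g) (at 0)" by (intro tendsto_intros)
  then have "\<forall>\<^sub>F t::real in at 0. x + t *\<^sub>R ?g \<in> interior T"
    using x by (intro topological_tendstoD) auto
  then have ev: "\<forall>\<^sub>F t::real in at 0. (p (x + t *\<^sub>R ?g) - p x) / t \<le> L * norm ?g"
  proof (eventually_elim)
    case (elim t)
    then have "\<bar>p (x + t *\<^sub>R ?g) - p x\<bar> \<le> L * norm ((x + t *\<^sub>R ?g) - x)" using interior_subset by (intro lip) blast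
    then have "\<bar>p (x + t *\<^sub>R ?g) - p x\<bar> \<le> (L * norm ?g) * \<bar>t\<bar>" by (simp add: mult_ac)
    then have "\<bar>(p (x + t *\<^sub>R ?g) - p x) / t\<bar> \<le> L * norm ?g"
      using L by (cases "t = 0") (auto simp: abs_divide divide_le_eq)
    then show ?case by linarith
  qed
  have "?g \<bullet> ?g \<le> L * norm ?g" by (rule tendsto_upperbound[OF lim ev]) simp
  then have "norm ?g * norm ?g \<le> L * norm ?g" by (simp add: dot_square_norm power2_eq_square)
  then show ?thesis using L by (cases "norm ?g = 0") (auto simp: mult_le_cancel_right)
qed

lemma grad_integral_upper:
  assumes k: "1 \<le> k" and d2: "2 \<le> DIM('a::euclidean_space)"
  shows "\<exists>C>0. \<forall>(T :: 'a set) p B. int DIM('a) simplex T \<longrightarrow> fat \<sigma> T \<longrightarrow> polyfun k p \<longrightarrow>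
    (\<forall>j\<in>lagrange_nodes k T. \<bar>p j\<bar> \<le> B) \<longrightarrow>
    (LINT x:T|lebesgue. grad p x \<bullet> grad p x) \<le> C * diameter T ^ (DIM('a) - 2) * B\<^sup>2"
proof -
  obtain G where G: "1 \<le> G" "\<And>(T :: 'a set) p B. int DIM('a) simplex T \<Longrightarrow> fat \<sigma> T \<Longrightarrow> polyfun k p \<Longrightarrow>
    (\<forall>j\<in>lagrange_nodes k T. \<bar>p j\<bar> \<le> B) \<Longrightarrow>
    (\<forall>x\<in>T. \<bar>p x\<bar> \<le> G * B) \<and> (\<forall>x\<in>T. \<forall>y\<in>T. \<bar>p x - p y\<bar> \<le> G * B * (norm (x - y) / diameter T))"
    using nodal_bounds[OF k, of \<sigma>, where 'a = 'a] by blast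
  let ?\<omega> = "unit_ball_vol (real DIM('a))"
  define C where "C = G\<^sup>2 * ?\<omega>"
  have C0: "0 < C" unfolding C_def using G(1) by simp
  have "(LINT x:T|lebesgue. grad p x \<bullet> grad p x) \<le> C * diameter T ^ (DIM('a) - 2) * B\<^sup>2"
    if T: "int DIM('a) simplex T" and fat: "fat \<sigma> T" and p: "polyfun k p"
      and B: "\<forall>j\<in>lagrange_nodes k T. \<bar>p j\<bar> \<le> B" for T :: "'a set" and p B
  proof -
    let ?h = "diameter T"
    obtain w \<rho> where r: "0 < \<rho>" "cball w \<rho> \<subseteq> T" "0 < ?h"
      using fatE[OF fat simplex_bounded[OF T]] by metis
    have w: "w \<in> T" using r by auto
    have B0: "0 \<le> G * B" using G(2)[OF T fat p B] w by (meson abs_ge_zero order_trans)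
    have int: "norm (grad p x) \<le> G * B / ?h" if x: "x \<in> interior T" for x
    proof (rule grad_norm_le[OF p _ x])
      show "0 \<le> G * B / ?h" using B0 r by simp
      fix y assume "y \<in> T"
      then show "\<bar>p y - p x\<bar> \<le> G * B / ?h * norm (y - x)"
        using G(2)[OF T fat p B] x interior_subset by fastforce
    qed
    have cg: "continuous_on T (\<lambda>x. norm (grad p x))" by (intro continuous_on_norm polyfun_grad_continuous[OF p])
    \<comment> \<open>The bound on the gradient holds at interior points, where all directions are
      admissible, and extends to \<open>T\<close> by continuity.\<close>
    have "T \<subseteq> closure (interior T)"
      using convex_closure_interior[OF simplex_convex[OF T]] r(1,2) closure_subset
      by (metis ball_subset_cball centre_in_ball empty_iff interior_maximal open_ball order_trans subsetD)
    have le: "norm (grad p x) \<le> G * B / ?h" if x: "x \<in> T" for x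
    proof -
      have "closed {x. norm (grad p x) \<le> G * B / ?h}"
        by (intro closed_Collect_le continuous_on_norm polyfun_grad_continuous[OF p] continuous_on_const)
      then have "closure (interior T) \<subseteq> {x. norm (grad p x) \<le> G * B / ?h}"
        using int by (intro closure_minimal) auto
      then show ?thesis using x \<open>T \<subseteq> closure (interior T)\<close> by blast
    qed
    have "T \<subseteq> cball w ?h"
      using diameter_bounded_bound[OF simplex_bounded[OF T] w] by auto
    then have "(LINT x:T|lebesgue. grad p x \<bullet> grad p x) \<le> (G * B / ?h)\<^sup>2 * (?\<omega> * ?h ^ DIM('a))"
      using le r by (intro set_integral_lebesgue_le[where z = w] simplex_compact[OF T] continuous_on_inner polyfun_grad_continuous[OF p])
        (auto simp: dot_square_norm intro!: power_mono)
    also have "?h ^ DIM('a) = ?h\<^sup>2 * ?h ^ (DIM('a) - 2)" using d2 by (metis le_add_diff_inverse power_add)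
    also have "(G * B / ?h)\<^sup>2 * (?\<omega> * (?h\<^sup>2 * ?h ^ (DIM('a) - 2))) = C * ?h ^ (DIM('a) - 2) * B\<^sup>2"
      unfolding C_def using r by (simp add: power_mult_distrib power_divide)
    finally show ?thesis .
  qed
  then show ?thesis using C0 by blast
qed

text \<open>The mean value theorem gives a point of the segment where the gradient is at least
  \<open>|p a - p b| / h\<close>. Each partial derivative is again a polynomial, so its value at
  that point is controlled by its L2 norm.\<close>

lemma poly_oscillation:
  assumes k: "1 \<le> k" and d2: "2 \<le> DIM('a::euclidean_space)"
  shows "\<exists>c>0. \<forall>(T :: 'a set) p a b. int DIM('a) simplex T \<longrightarrow> fat \<sigma> T \<longrightarrow> polyfun k p \<longrightarrow> a \<in> T \<longrightarrow> b \<in> T \<longrightarrow>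
    c * diameter T ^ (DIM('a) - 2) * (p a - p b)\<^sup>2 \<le> (LINT x:T|lebesgue. grad p x \<bullet> grad p x)"
proof -
  obtain c where c: "0 < c" "\<And>(T :: 'a set) q z. int DIM('a) simplex T \<Longrightarrow> fat \<sigma> T \<Longrightarrow> polyfun k q \<Longrightarrow> z \<in> T \<Longrightarrow>
    c * diameter T ^ DIM('a) * (q z)\<^sup>2 \<le> (LINT x:T|lebesgue. (q x)\<^sup>2)"
    using poly_L2_lower[OF k, of \<sigma>, where 'a = 'a] by blast
  have "c * diameter T ^ (DIM('a) - 2) * (p a - p b)\<^sup>2 \<le> (LINT x:T|lebesgue. grad p x \<bullet> grad p x)"
    if T: "int DIM('a) simplex T" and fat: "fat \<sigma> T" and p: "polyfun k p" and ab: "a \<in> T" "b \<in> T"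
    for T :: "'a set" and p a b
  proof -
    let ?h = "diameter T"
    have h: "0 < ?h" using fatE[OF fat simplex_bounded[OF T]] by metis
    have seg: "closed_segment b a \<subseteq> T" using ab simplex_convex[OF T] by (intro closed_segment_subset)
    have "\<exists>x\<in>T. \<bar>p a - p b\<bar> \<le> norm (grad p x) * ?h"
    proof (cases "a = b")
      case False
      note D = polyfun_line_derivative[OF p, of b "a - b"]
      obtain t where t: "0 < t" "t < 1"
        "p (b + 1 *\<^sub>R (a - b)) - p (b + 0 *\<^sub>R (a - b)) = (1 - 0) * (grad p (b + t *\<^sub>R (a - b)) \<bullet> (a - b))"
        using MVT2[of 0 1 "\<lambda>t. p (b + t *\<^sub>R (a - b))" "\<lambda>t. grad p (b + t *\<^sub>R (a - b)) \<bullet> (a - b)"] D by auto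
      let ?x = "b + t *\<^sub>R (a - b)"
      have "?x = (1 - t) *\<^sub>R b + t *\<^sub>R a" by (simp add: scaleR_diff_left scaleR_diff_right)
      then have xT: "?x \<in> T" using convexD_alt[OF simplex_convex[OF T] ab(2,1), of t] t by simp
      have "\<bar>p a - p b\<bar> \<le> norm (grad p ?x) * norm (a - b)" using t(3) Cauchy_Schwarz_ineq2[of "grad p ?x" "a - b"] by simp
      also have "\<dots> \<le> norm (grad p ?x) * ?h"
        using diameter_bounded_bound[OF simplex_bounded[OF T] ab] by (intro mult_left_mono) (auto simp: dist_norm)
      finally show ?thesis using xT by blast
    qed (use ab h in auto)
    then obtain x where x: "x \<in> T" "\<bar>p a - p b\<bar> \<le> norm (grad p x) * ?h" by blast
    have "\<bar>p a - p b\<bar>\<^sup>2 \<le> (norm (grad p x) * ?h)\<^sup>2" using x(2) by (intro power_mono) auto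
    then have "c * ?h ^ (DIM('a) - 2) * (p a - p b)\<^sup>2 \<le> c * ?h ^ (DIM('a) - 2) * (norm (grad p x) * ?h)\<^sup>2"
      using c(1) h by (intro mult_left_mono) auto
    also have "\<dots> = c * (?h ^ (DIM('a) - 2) * ?h\<^sup>2) * (norm (grad p x))\<^sup>2" by (simp add: power_mult_distrib)
    also have "?h ^ (DIM('a) - 2) * ?h\<^sup>2 = ?h ^ DIM('a)" using d2 by (metis le_add_diff_inverse power_add mult.commute)
    also have "(norm (grad p x))\<^sup>2 = (\<Sum>b\<in>Basis. (frechet_derivative p (at x) b)\<^sup>2)"
      unfolding dot_square_norm[symmetric]
      by (subst euclidean_inner, intro sum.cong) (auto simp: grad_inner_Basis power2_eq_square)
    also have "c * ?h ^ DIM('a) * \<dots> = (\<Sum>b\<in>Basis. c * ?h ^ DIM('a) * (frechet_derivative p (at x) b)\<^sup>2)"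
      by (rule sum_distrib_left)
    also have "\<dots> \<le> (\<Sum>b\<in>Basis. LINT y:T|lebesgue. (frechet_derivative p (at y) b)\<^sup>2)"
      by (intro sum_mono c(2)[OF T fat polyfun_frechet_derivative[OF p] x(1)])
    also have "\<dots> = (LINT y:T|lebesgue. (\<Sum>b\<in>Basis. (frechet_derivative p (at y) b)\<^sup>2))"
    proof -
      have "integrable lebesgue (\<lambda>y. indicator T y *\<^sub>R (frechet_derivative p (at y) b)\<^sup>2)" for b
        using set_integrable_lebesgue_compact[OF simplex_compact[OF T]
          continuous_on_power[OF polyfun_continuous[OF polyfun_frechet_derivative[OF p, of b]], of T 2]]
        unfolding set_integrable_def .
      then show ?thesis unfolding set_lebesgue_integral_def scaleR_sum_right by (intro Bochner_Integration.integral_sum[symmetric])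
    qed
    also have "(\<lambda>y. \<Sum>b\<in>Basis. (frechet_derivative p (at y) b)\<^sup>2) = (\<lambda>y. grad p y \<bullet> grad p y)"
      by (intro ext, subst euclidean_inner, intro sum.cong) (auto simp: grad_inner_Basis power2_eq_square)
    finally show ?thesis .
  qed
  then show ?thesis using c(1) by blast
qed

section \<open>Simplicial meshes\<close>

locale mesh_complex =
  fixes \<T> :: "'a::euclidean_space set set"
  assumes triang: "triangulation \<T>"
    and full: "\<And>T. T \<in> \<T> \<Longrightarrow> int DIM('a) simplex T"
begin

definition dom :: "'a set" where "dom = \<Union>\<T>"

definition vertices :: "'a set" where "vertices = (\<Union>T\<in>\<T>. verts T)"

definition star :: "'a \<Rightarrow> 'a set set" where "star v = {T \<in> \<T>. v \<in> verts T}"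

text \<open>The continuous piecewise linear function of the vertex \<open>v\<close>. The chosen
  simplex does not matter, since \<open>bary_agree\<close> gives the same value for all simplices
  containing \<open>x\<close>.\<close>

definition hat :: "'a \<Rightarrow> 'a \<Rightarrow> real" where
  "hat v x = (if x \<in> dom then bary (verts (SOME T. T \<in> \<T> \<and> x \<in> T)) v x else 0)"

lemma finite_mesh: "finite \<T>"
  using triang unfolding triangulation_def by auto

lemma nd: "T \<in> \<T> \<Longrightarrow> nondeg (verts T)"
  and hull: "T \<in> \<T> \<Longrightarrow> convex hull (verts T) = T"
  and fin_verts: "T \<in> \<T> \<Longrightarrow> finite (verts T)"
  using simplex_nondeg[OF full] simplex_hull[OF full] nondeg_finite by auto

lemma compact_mesh: "T \<in> \<T> \<Longrightarrow> compact T" and closed_mesh: "T \<in> \<T> \<Longrightarrow> closed T"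
  and convex_mesh: "T \<in> \<T> \<Longrightarrow> convex T" and bounded_mesh: "T \<in> \<T> \<Longrightarrow> bounded T"
  using simplex_compact[OF full] simplex_convex[OF full] by (auto intro: compact_imp_closed compact_imp_bounded)

lemma verts_subset: "T \<in> \<T> \<Longrightarrow> verts T \<subseteq> T"
  unfolding verts_def extreme_point_of_def by auto

lemma finite_vertices: "finite vertices"
  unfolding vertices_def using finite_mesh fin_verts by auto

lemma closed_dom: "closed dom"
  unfolding dom_def using finite_mesh closed_mesh by auto

text \<open>A face of \<open>T\<close> is the hull of some vertices of \<open>T\<close>. They are
  extreme points of the intersection, which is a face of \<open>T'\<close> as well, so they are also
  vertices of \<open>T'\<close>.\<close>

lemma Int_eq_hull:
  assumes T: "T \<in> \<T>" "T' \<in> \<T>" shows "T \<inter> T' = convex hull (verts T \<inter> verts T')"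
proof
  have f: "(T \<inter> T') face_of T" "(T' \<inter> T) face_of T'" using triang T unfolding triangulation_def by auto
  have ind: "\<not> affine_dependent (verts T)" using nd[OF T(1)] unfolding nondeg_def by simp
  obtain c where c: "c \<subseteq> verts T" "T \<inter> T' = convex hull c"
    using f(1) face_of_convex_hull_affine_independent[OF ind] hull[OF T(1)] by metis
  have "c \<subseteq> verts T'"
  proof
    fix w assume w: "w \<in> c"
    have "\<not> affine_dependent c" using ind c(1) affine_independent_subset by blast
    then have "w extreme_point_of (T' \<inter> T)"
      using extreme_point_of_convex_hull_affine_independent w c(2) by (metis inf_commute)
    then show "w \<in> verts T'" using extreme_point_of_face[OF f(2)] unfolding verts_def by blast
  qed
  then show "T \<inter> T' \<subseteq> convex hull (verts T \<inter> verts T')" using c by (simp add: hull_mono)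
  have "convex hull (verts T \<inter> verts T') \<subseteq> convex hull (verts T)" "convex hull (verts T \<inter> verts T') \<subseteq> convex hull (verts T')"
    by (simp_all add: hull_mono)
  then show "convex hull (verts T \<inter> verts T') \<subseteq> T \<inter> T'" using hull T by auto
qed

text \<open>A point of the common face is a combination of the shared vertices; these coefficients,
  extended by zero, are its coordinates in either simplex.\<close>

lemma bary_agree:
  assumes T: "T \<in> \<T>" "T' \<in> \<T>" and x: "x \<in> T" "x \<in> T'"
  shows "bary (verts T) v x = bary (verts T') v x"
proof -
  let ?c = "verts T \<inter> verts T'"
  have fin: "finite ?c" using fin_verts[OF T(1)] by auto
  have "x \<in> convex hull ?c" using Int_eq_hull[OF T] x by auto
  then obtain u where u: "sum u ?c = 1" "(\<Sum>w\<in>?c. u w *\<^sub>R w) = x"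
    unfolding convex_hull_finite[OF fin] by blast
  define u' where "u' w = (if w \<in> ?c then u w else 0)" for w
  have eq: "bary (verts S) v x = u' v" if S: "S \<in> \<T>" "?c \<subseteq> verts S" for S
  proof (cases "v \<in> verts S")
    case True
    have "sum u' (verts S) = sum u' ?c"
      by (rule sum.mono_neutral_right[OF fin_verts[OF S(1)] S(2)]) (auto simp: u'_def)
    moreover have "sum u' ?c = 1" using u(1) by (simp add: u'_def)
    moreover have "(\<Sum>w\<in>verts S. u' w *\<^sub>R w) = (\<Sum>w\<in>?c. u' w *\<^sub>R w)"
      by (rule sum.mono_neutral_right[OF fin_verts[OF S(1)] S(2)]) (auto simp: u'_def)
    moreover have "(\<Sum>w\<in>?c. u' w *\<^sub>R w) = x" using u(2) by (simp add: u'_def)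
    ultimately have "sum u' (verts S) = 1" "(\<Sum>w\<in>verts S. u' w *\<^sub>R w) = x" by simp_all
    then show ?thesis using bary_unique[OF nd[OF S(1)] _ _ True] by blast
  next
    case False
    then show ?thesis using S unfolding u'_def by auto
  qed
  show ?thesis using eq[of T] eq[of T'] T by auto
qed

lemma hat_eq:
  assumes "T \<in> \<T>" "x \<in> T" shows "hat v x = bary (verts T) v x"
proof -
  have "x \<in> dom" using assms unfolding dom_def by auto
  moreover have "(SOME T. T \<in> \<T> \<and> x \<in> T) \<in> \<T> \<and> x \<in> (SOME T. T \<in> \<T> \<and> x \<in> T)"
    by (rule someI[of "\<lambda>T. T \<in> \<T> \<and> x \<in> T"]) (use assms in auto)
  ultimately show ?thesis unfolding hat_def using bary_agree[OF _ assms(1) _ assms(2)] by simp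
qed

lemma hat_nonneg: "0 \<le> hat v x"
proof (cases "x \<in> dom")
  case True
  then obtain T where "T \<in> \<T>" "x \<in> T" unfolding dom_def by auto
  then show ?thesis using bary_nonneg[OF nd, of T x v] hull by (simp add: hat_eq)
qed (simp add: hat_def)

lemma hat_pos_vert:
  assumes "T \<in> \<T>" "x \<in> T" "0 < hat v x" shows "v \<in> verts T"
  using assms hat_eq[OF assms(1,2), of v] by (cases "v \<in> verts T") auto

lemma hat_pos_dom: "0 < hat v x \<Longrightarrow> x \<in> dom"
  unfolding hat_def by (auto split: if_splits)

lemma hat_eq_0_iff: "\<not> 0 < hat v x \<longleftrightarrow> hat v x = 0"
  using hat_nonneg[of v x] by auto

lemma hat_vertex:
  assumes "T \<in> \<T>" "w \<in> verts T" shows "hat v w = (if v = w then 1 else 0)"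
  using assms hat_eq[OF assms(1), of w v] verts_subset[OF assms(1)] bary_vertex[OF nd[OF assms(1)] assms(2)] by auto

text \<open>A point lies in a simplex as soon as the vertices of its carrier do.\<close>

lemma carrier_subset_imp_mem:
  assumes T: "T \<in> \<T>" and x: "x \<in> dom" and sub: "\<And>v. 0 < hat v x \<Longrightarrow> v \<in> verts T"
  shows "x \<in> T"
proof -
  obtain T' where T': "T' \<in> \<T>" "x \<in> T'" using x unfolding dom_def by auto
  let ?u = "\<lambda>v. bary (verts T') v x"
  have fin: "finite (verts T' \<inter> verts T)" using fin_verts[OF T] by auto
  have z: "?u v = 0" if "v \<in> verts T' - verts T \<inter> verts T'" for v
    using sub[of v] hat_eq[OF T', of v] hat_nonneg[of v x] that by (cases "0 < hat v x") auto
  have "sum ?u (verts T') = sum ?u (verts T \<inter> verts T')"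
    by (rule sum.mono_neutral_right[OF fin_verts[OF T'(1)]]) (use z in auto)
  moreover have "(\<Sum>v\<in>verts T'. ?u v *\<^sub>R v) = (\<Sum>v\<in>verts T \<inter> verts T'. ?u v *\<^sub>R v)"
    by (rule sum.mono_neutral_right[OF fin_verts[OF T'(1)]]) (use z in auto)
  ultimately have "sum ?u (verts T \<inter> verts T') = 1" "(\<Sum>v\<in>verts T \<inter> verts T'. ?u v *\<^sub>R v) = x"
    using bary_sum[OF nd[OF T'(1)], of x] bary_repr[OF nd[OF T'(1)], of x] by simp_all
  moreover have "\<forall>v\<in>verts T \<inter> verts T'. 0 \<le> ?u v"
    using hat_eq[OF T'] hat_nonneg[of _ x] by simp
  ultimately have "x \<in> convex hull (verts T \<inter> verts T')"
    unfolding convex_hull_finite[OF finite_subset[OF Int_lower1 fin_verts[OF T]]]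
    by (intro CollectI exI[of _ ?u] conjI)
  then show ?thesis using Int_eq_hull[OF T T'(1)] by auto
qed

lemma hat_continuous_dom: "continuous_on dom (hat v)"
  unfolding dom_def
proof (rule continuous_on_closed_Union[of \<T> "\<lambda>T. T", simplified])
  show "finite \<T>" by (rule finite_mesh)
  fix T assume T: "T \<in> \<T>"
  then show "closed T" by (rule closed_mesh)
  show "continuous_on T (hat v)"
    by (rule continuous_on_eq[OF bary_continuous[OF nd[OF T], of T v]]) (simp add: hat_eq[OF T])
qed

text \<open>At an interior point of \<open>T\<close> the hat functions of all its vertices are
  positive, so these vertices belong to every simplex that contains the point. Counting vertices
  gives equality.\<close>

lemma interior_disjoint:
  assumes T: "T \<in> \<T>" "T' \<in> \<T>" and x: "x \<in> interior T" "x \<in> T'" shows "T = T'"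
proof -
  have xT: "x \<in> T" using x interior_subset by blast
  have "verts T \<subseteq> verts T'"
  proof
    fix v assume "v \<in> verts T"
    then have "0 < hat v x" using x hat_eq[OF T(1) xT] interior_convex_hull_bary[OF nd[OF T(1)]] hull[OF T(1)] by auto
    then show "v \<in> verts T'" using hat_pos_vert[OF T(2) x(2)] by simp
  qed
  moreover have "card (verts T) = card (verts T')" using nd[OF T(1)] nd[OF T(2)] unfolding nondeg_def by simp
  ultimately have "verts T = verts T'" using card_subset_eq[OF fin_verts[OF T(2)]] by blast
  then show ?thesis using hull T by metis
qed

lemma hat_combination:
  assumes "T \<in> \<T>" "x \<in> T" "y \<in> T" "0 \<le> t" "t \<le> 1"
  shows "(1 - t) *\<^sub>R x + t *\<^sub>R y \<in> T" "hat v ((1 - t) *\<^sub>R x + t *\<^sub>R y) = (1 - t) * hat v x + t * hat v y"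
proof -
  show z: "(1 - t) *\<^sub>R x + t *\<^sub>R y \<in> T" by (rule convexD_alt[OF convex_mesh[OF assms(1)] assms(2-)])
  show "hat v ((1 - t) *\<^sub>R x + t *\<^sub>R y) = (1 - t) * hat v x + t * hat v y"
    unfolding hat_eq[OF assms(1) z] hat_eq[OF assms(1,2)] hat_eq[OF assms(1,3)] by (rule bary_combination[OF nd[OF assms(1)]])
qed

text \<open>If the carrier of \<open>x\<close> contains that of an interior point \<open>y\<close>, then \<open>x\<close> is interior: the homothety
  with centre \<open>y\<close> and small ratio maps a neighbourhood of \<open>x\<close> into the neighbourhood of \<open>y\<close>.\<close>

lemma interior_carrier:
  assumes x: "x \<in> dom" and y: "y \<in> interior dom" and sub: "\<And>v. 0 < hat v y \<Longrightarrow> 0 < hat v x"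
  shows "x \<in> interior dom"
proof -
  obtain e where e: "0 < e" "ball y e \<subseteq> dom" using y mem_interior by blast
  have ydom: "y \<in> dom" using y interior_subset by blast
  define \<delta> where "\<delta> = min (1 / 2) (e / (2 * (norm (x - y) + 1)))"
  have d: "0 < \<delta>" "\<delta> < 1" unfolding \<delta>_def using e by (auto simp: add_nonneg_pos)
  have "\<delta> * norm (x - y) \<le> \<delta> * (norm (x - y) + 1)" using d by (intro mult_left_mono) auto
  also have "\<dots> \<le> e / (2 * (norm (x - y) + 1)) * (norm (x - y) + 1)"
    unfolding \<delta>_def by (intro mult_right_mono) auto
  also have "\<dots> = e / 2"
  proof -
    have "norm (x - y) + 1 > 0" by (simp add: add_nonneg_pos)
    then show ?thesis by (simp add: field_simps)
  qed
  finally have de: "\<delta> * norm (x - y) < e" using e by linarith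
  define w where "w u = (1 - \<delta>) *\<^sub>R y + \<delta> *\<^sub>R u" for u
  have cw: "continuous_on UNIV w" unfolding w_def by (intro continuous_intros)
  have wy: "dist y (w u) = \<delta> * norm (u - y)" for u
  proof -
    have "w u - y = \<delta> *\<^sub>R (u - y)" unfolding w_def by (simp add: scaleR_diff_left scaleR_diff_right)
    then show ?thesis using d by (simp add: dist_norm norm_minus_commute[of y])
  qed
  obtain T where T: "T \<in> \<T>" "x \<in> T" using x unfolding dom_def by auto
  have yT: "y \<in> T" by (rule carrier_subset_imp_mem[OF T(1) ydom]) (use sub hat_pos_vert[OF T] in blast)
  have wx: "0 < hat v (w x)" if "0 < hat v x" for v
    unfolding w_def hat_combination(2)[OF T(1) yT T(2) less_imp_le[OF d(1)] less_imp_le[OF d(2)]]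
    using that d hat_nonneg[of v y] by (simp add: add_nonneg_pos)
  \<comment> \<open>For \<open>u\<close> in \<open>U\<close>, a simplex containing
    \<open>w u\<close> also contains \<open>w x\<close>, hence \<open>x\<close> and
    \<open>y\<close>, and the coordinates positive at \<open>x\<close> stay positive at
    \<open>u\<close>.\<close>
  define U where "U = (w -` ball y e) \<inter> (\<Inter>T\<in>{T\<in>\<T>. w x \<notin> T}. w -` (- T)) \<inter>
      (\<Inter>T\<in>{T\<in>\<T>. x \<in> T}. \<Inter>v\<in>{v\<in>verts T. 0 < hat v x}. {u. 0 < bary (verts T) v u})"
  have "open U" unfolding U_def
  proof (intro open_Int open_INT ballI)
    show "open (w -` ball y e)" using cw by (simp add: continuous_open_vimage open_vimage)
    show "finite {T\<in>\<T>. w x \<notin> T}" "finite {T\<in>\<T>. x \<in> T}" using finite_mesh by auto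
    show "open (w -` (- T))" if "T \<in> {T\<in>\<T>. w x \<notin> T}" for T
      using cw that closed_mesh by (intro open_vimage) auto
    show "finite {v\<in>verts T. 0 < hat v x}" if "T \<in> {T\<in>\<T>. x \<in> T}" for T using that fin_verts by auto
    show "open {u. 0 < bary (verts T) v u}" if "T \<in> {T\<in>\<T>. x \<in> T}" for T v
      using that by (intro open_Collect_less continuous_on_const bary_continuous nd) auto
  qed
  moreover have "x \<in> U" unfolding U_def using de wy[of x] hat_eq by auto
  moreover have "U \<subseteq> dom"
  proof
    fix u assume u: "u \<in> U"
    then have "w u \<in> dom" using e unfolding U_def by auto
    then obtain S where S: "S \<in> \<T>" "w u \<in> S" unfolding dom_def by auto
    have wS: "w x \<in> S" using S u unfolding U_def by auto
    have xS: "x \<in> S" by (rule carrier_subset_imp_mem[OF S(1) x]) (use wx hat_pos_vert[OF S(1) wS] in blast)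
    have yS: "y \<in> S" by (rule carrier_subset_imp_mem[OF S(1) ydom]) (use sub hat_pos_vert[OF S(1) xS] in blast)
    have "0 \<le> bary (verts S) v u" if v: "v \<in> verts S" for v
    proof (cases "0 < hat v x")
      case True
      then have "0 < bary (verts S) v u" using u S(1) xS v unfolding U_def by auto
      then show ?thesis by simp
    next
      case False
      \<comment> \<open>Such a coordinate vanishes at \<open>y\<close>, so \<open>w\<close>
        multiplies it by \<open>\<delta>\<close>: its sign at \<open>u\<close> is its sign at
        \<open>w u\<close>, which is a point of \<open>S\<close>.\<close>
      then have "hat v y = 0" using sub[of v] hat_eq_0_iff by blast
      then have "bary (verts S) v y = 0" using hat_eq[OF S(1) yS] by simp
      moreover have "0 \<le> bary (verts S) v (w u)" using hat_eq[OF S] hat_nonneg by metis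
      ultimately have "0 \<le> \<delta> * bary (verts S) v u" unfolding w_def bary_combination[OF nd[OF S(1)]] by simp
      then show ?thesis using d by (simp add: zero_le_mult_iff)
    qed
    then have "u \<in> S" using convex_hull_bary[OF nd[OF S(1)]] hull[OF S(1)] by blast
    then show "u \<in> dom" using S(1) unfolding dom_def by auto
  qed
  ultimately show ?thesis by (intro interiorI)
qed

lemma hat_pos_interior:
  assumes T: "T \<in> \<T>" "v \<in> verts T" and v: "v \<in> interior dom" and x: "0 < hat v x" shows "x \<in> interior dom"
proof (rule interior_carrier[OF hat_pos_dom[OF x] v])
  fix w assume "0 < hat w v"
  then have "w = v" using hat_vertex[OF T, of w] by (auto split: if_splits)
  then show "0 < hat w x" using x by simp
qed

text \<open>The function vanishes on the boundary, so its extension by zero is continuous. This is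
  needed along segments that are not yet known to stay in the domain.\<close>

lemma hat_continuous:
  assumes T: "T \<in> \<T>" "v \<in> verts T" and v: "v \<in> interior dom" shows "continuous_on UNIV (hat v)"
proof -
  have "continuous_on (dom \<union> closure (- dom)) (hat v)"
  proof (rule continuous_on_closed_Un[OF closed_dom closed_closure hat_continuous_dom])
    have "hat v x = 0" if "x \<in> closure (- dom)" for x
    proof -
      have "x \<notin> interior dom" using that by (simp add: closure_complement)
      then show ?thesis using hat_pos_interior[OF T v, of x] hat_eq_0_iff by blast
    qed
    then show "continuous_on (closure (- dom)) (hat v)" by (subst continuous_on_cong[OF refl, of _ _ "\<lambda>_. 0"]) auto
  qed
  moreover have "dom \<union> closure (- dom) = UNIV" using closure_subset[of "- dom"] by auto
  ultimately show ?thesis by simp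
qed


subsection \<open>Nodal basis functions\<close>

definition mesh_nodes :: "nat \<Rightarrow> 'a set" where "mesh_nodes k = (\<Union>T\<in>\<T>. lagrange_nodes k T)"

text \<open>The Lagrange function written with hat functions, by one formula for all simplices. A
  vertex outside the carrier of \<open>j\<close> contributes an empty product, so the product may
  run over all vertices of the mesh.\<close>

definition node_function :: "nat \<Rightarrow> 'a \<Rightarrow> 'a \<Rightarrow> real" where
  "node_function k j x = (if x \<in> dom then
     \<Prod>v\<in>vertices. \<Prod>l<nat \<lfloor>real k * hat v j\<rfloor>.
       (real k * hat v x - real l) / (real (nat \<lfloor>real k * hat v j\<rfloor>) - real l) else 0)"

lemma mesh_nodes_dom: "1 \<le> k \<Longrightarrow> mesh_nodes k \<subseteq> dom"
  unfolding mesh_nodes_def dom_def using lagrange_nodes_subset full by blast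

lemma finite_mesh_nodes: "finite (mesh_nodes k)"
  unfolding mesh_nodes_def using finite_mesh finite_lagrange_nodes full by blast

lemma hat_mesh_node:
  assumes k: "1 \<le> k" and j: "j \<in> mesh_nodes k"
  shows "\<exists>n. real k * hat v j = real n"
proof -
  obtain T where T: "T \<in> \<T>" "j \<in> lagrange_nodes k T" using j unfolding mesh_nodes_def by auto
  obtain m where m: "m \<in> multi (verts T) k" "j = lattice_point (verts T) k m"
    using T lagrange_nodes_eq[OF full[OF T(1)]] by auto
  have "j \<in> T" using lagrange_nodes_subset[OF full[OF T(1)] k] T(2) by auto
  then have "hat v j = real (m v) / real k"
    using hat_eq[OF T(1)] lattice_point_bary[OF nd[OF T(1)] k m(1)] m(2) by simp
  then show ?thesis using k by (intro exI[of _ "m v"]) simp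
qed

text \<open>The integers \<open>k * hat v j\<close> do not depend on the simplex that contributed
  \<open>j\<close>, and they form its multi-index in every simplex containing it.\<close>

lemma mesh_node_lagrange:
  assumes k: "1 \<le> k" and j: "j \<in> mesh_nodes k" and T: "T \<in> \<T>" "j \<in> T"
  shows "j \<in> lagrange_nodes k T"
proof -
  have "\<forall>v. \<exists>n. real k * hat v j = real n" using hat_mesh_node[OF k j] by blast
  from choice[OF this] obtain m where m: "\<And>v. real k * hat v j = real (m v)" by blast
  have m0: "m v = 0" if "v \<notin> verts T" for v
    using m[of v] hat_eq[OF T, of v] that by simp
  have b: "bary (verts T) v j = real (m v) / real k" for v using m[of v] hat_eq[OF T, of v] k by (simp add: field_simps)
  have "real (sum m (verts T)) = real k * (\<Sum>v\<in>verts T. bary (verts T) v j)"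
    using k by (simp add: b sum_divide_distrib[symmetric])
  then have "sum m (verts T) = k" unfolding bary_sum[OF nd[OF T(1)]] by (simp only: mult_1_right of_nat_eq_iff)
  then have "m \<in> multi (verts T) k" unfolding multi_def using m0 by auto
  moreover have "j = lattice_point (verts T) k m"
    using bary_repr[OF nd[OF T(1)], of j] unfolding lattice_point_def b ..
  ultimately show ?thesis unfolding lagrange_nodes_eq[OF full[OF T(1)]] by blast
qed

lemma node_function_on:
  assumes k: "1 \<le> k" and T: "T \<in> \<T>" "x \<in> T" "j \<in> T"
  shows "node_function k j x = lagrange (verts T) k j x"
proof -
  have x: "x \<in> dom" using T unfolding dom_def by auto
  have "node_function k j x = (\<Prod>v\<in>vertices. \<Prod>l<lattice_index (verts T) k j v.
      (real k * bary (verts T) v x - real l) / (real (lattice_index (verts T) k j v) - real l))"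
    unfolding node_function_def lattice_index_def using x by (simp add: hat_eq[OF T(1,2)] hat_eq[OF T(1,3)])
  also have "\<dots> = lagrange (verts T) k j x"
    unfolding lagrange_def
  proof (rule prod.mono_neutral_right[OF finite_vertices])
    show "verts T \<subseteq> vertices" unfolding vertices_def using T by auto
  qed (auto simp: lattice_index_def)
  finally show ?thesis .
qed

text \<open>A vertex of the carrier of \<open>j\<close> contributes the factor with
  \<open>l = 0\<close>, a multiple of \<open>hat v x\<close>. Hence the function vanishes on every
  simplex that does not contain \<open>j\<close>, and on the boundary if \<open>j\<close> is
  interior.\<close>

lemma node_function_pos_carrier:
  assumes k: "1 \<le> k" and j: "j \<in> mesh_nodes k" and nz: "node_function k j x \<noteq> 0" and v: "0 < hat v j"
  shows "0 < hat v x"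
proof (rule ccontr)
  assume "\<not> 0 < hat v x"
  then have x0: "hat v x = 0" using hat_eq_0_iff by blast
  have xd: "x \<in> dom" using nz unfolding node_function_def by (auto split: if_splits)
  obtain n where n: "real k * hat v j = real n" using hat_mesh_node[OF k j] by blast
  have n0: "0 < n" using n v k by (cases n) auto
  have "j \<in> dom" using mesh_nodes_dom[OF k] j by auto
  then obtain T where T: "T \<in> \<T>" "j \<in> T" unfolding dom_def by auto
  have vv: "v \<in> vertices" using hat_pos_vert[OF T v] T unfolding vertices_def by auto
  have "(\<Prod>l<nat \<lfloor>real k * hat v j\<rfloor>. (real k * hat v x - real l) / (real (nat \<lfloor>real k * hat v j\<rfloor>) - real l)) = 0"
    using n n0 x0 by (intro prod_zero) (auto intro!: bexI[of _ 0])
  then have "node_function k j x = 0" unfolding node_function_def using vv finite_vertices xd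
    by (auto intro!: prod_zero bexI[of _ v])
  then show False using nz by simp
qed

lemma node_function_off:
  assumes k: "1 \<le> k" and j: "j \<in> mesh_nodes k" and T: "T \<in> \<T>" "x \<in> T" and jT: "j \<notin> T"
  shows "node_function k j x = 0"
proof (rule ccontr)
  assume nz: "node_function k j x \<noteq> 0"
  have "j \<in> T"
    by (rule carrier_subset_imp_mem[OF T(1)])
      (use mesh_nodes_dom[OF k] j node_function_pos_carrier[OF k j nz] hat_pos_vert[OF T] in auto)
  then show False using jT by simp
qed

lemma node_function_polyfun:
  assumes k: "1 \<le> k" and j: "j \<in> mesh_nodes k" and T: "T \<in> \<T>"
  shows "\<exists>p. polyfun k p \<and> (\<forall>x\<in>T. node_function k j x = p x)"
proof (cases "j \<in> T")
  case True
  have "j \<in> lattice_point (verts T) k ` multi (verts T) k"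
    using mesh_node_lagrange[OF k j T True] lagrange_nodes_eq[OF full[OF T]] by auto
  then show ?thesis using lagrange_polyfun[OF nd[OF T] k] node_function_on[OF k T _ True] by blast
next
  case False
  then show ?thesis using node_function_off[OF k j T] by (intro exI[of _ "\<lambda>_. 0"]) (auto intro: polyfun_const)
qed

lemma node_function_at_nodes:
  assumes k: "1 \<le> k" and j: "j \<in> mesh_nodes k" "i \<in> mesh_nodes k"
  shows "node_function k j i = (if i = j then 1 else 0)"
proof -
  have "i \<in> dom" using mesh_nodes_dom[OF k] j by auto
  then obtain T where T: "T \<in> \<T>" "i \<in> T" unfolding dom_def by auto
  show ?thesis
  proof (cases "j \<in> T")
    case True
    have "j \<in> lattice_point (verts T) k ` multi (verts T) k" "i \<in> lattice_point (verts T) k ` multi (verts T) k"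
      using mesh_node_lagrange[OF k j(1) T(1) True] mesh_node_lagrange[OF k j(2) T] lagrange_nodes_eq[OF full[OF T(1)]] by auto
    then show ?thesis using node_function_on[OF k T(1,2) True] lagrange_at_points[OF nd[OF T(1)] k] by simp
  next
    case False
    then show ?thesis using node_function_off[OF k j(1) T] T by auto
  qed
qed

lemma node_function_continuous:
  assumes k: "1 \<le> k" and j: "j \<in> mesh_nodes k" shows "continuous_on dom (node_function k j)"
  unfolding dom_def
proof (rule continuous_on_closed_Union[of \<T> "\<lambda>T. T", simplified])
  show "finite \<T>" by (rule finite_mesh)
  fix T assume T: "T \<in> \<T>"
  then show "closed T" by (rule closed_mesh)
  obtain p where p: "polyfun k p" "\<forall>x\<in>T. node_function k j x = p x" using node_function_polyfun[OF k j T] by blast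
  show "continuous_on T (node_function k j)"
    by (rule continuous_on_eq[OF polyfun_continuous[OF p(1), of T]]) (use p(2) in auto)
qed

lemma node_function_frontier:
  assumes k: "1 \<le> k" and j: "j \<in> mesh_nodes k" "j \<in> interior dom" and x: "x \<in> frontier dom"
  shows "node_function k j x = 0"
proof (rule ccontr)
  assume nz: "node_function k j x \<noteq> 0"
  have xd: "x \<in> dom" using x closed_dom by (auto simp: frontier_def)
  have "x \<in> interior dom" by (rule interior_carrier[OF xd j(2) node_function_pos_carrier[OF k j(1) nz]])
  then show False using x by (simp add: frontier_def)
qed

subsection \<open>Simplices around a vertex\<close>

lemma star_mesh: "T \<in> star v \<Longrightarrow> T \<in> \<T>" and star_vert: "T \<in> star v \<Longrightarrow> v \<in> verts T" and finite_star: "finite (star v)"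
  unfolding star_def using finite_mesh by auto

lemma hat_pos_star: "0 < hat v x \<Longrightarrow> T \<in> \<T> \<Longrightarrow> x \<in> T \<Longrightarrow> T \<in> star v"
  unfolding star_def using hat_pos_vert by auto

text \<open>Along the edge the coordinate of \<open>v\<close> falls from 1 to 0, with slope at most
  \<open>1 / \<rho>\<close>.\<close>

lemma edge_length_lower:
  assumes T: "T \<in> \<T>" "fat \<sigma> T" and v: "v \<in> verts T" "w \<in> verts T" "v \<noteq> w"
  shows "diameter T \<le> \<sigma> * norm (v - w)"
proof -
  obtain c \<rho> where r: "0 < \<rho>" "cball c \<rho> \<subseteq> T" "diameter T \<le> \<sigma> * \<rho>" "2 \<le> \<sigma>"
    using fatE[OF T(2) bounded_mesh[OF T(1)]] by metis
  have "\<bar>bary (verts T) v v - bary (verts T) v w\<bar> \<le> norm (v - w) / \<rho>"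
    using bary_lipschitz[OF nd[OF T(1)] r(1)] r(2) hull[OF T(1)] by auto
  then have "1 \<le> norm (v - w) / \<rho>" using v by (simp add: bary_vertex[OF nd[OF T(1)]])
  then have "\<rho> \<le> norm (v - w)" using r(1) by (simp add: le_divide_eq)
  then have "\<sigma> * \<rho> \<le> \<sigma> * norm (v - w)" using r(4) by (intro mult_left_mono) auto
  then show ?thesis using r(3) by linarith
qed

text \<open>The simplices of a star, scaled towards its centre to a common size, contain disjoint balls.\<close>

lemma card_star_le:
  assumes fat: "\<And>T. T \<in> \<T> \<Longrightarrow> fat \<sigma> T" and s: "0 < \<sigma>"
  shows "real (card (star v)) \<le> \<sigma> ^ DIM('a)"
proof (cases "star v = {}")
  case True
  then show ?thesis using s by simp
next
  case False
  let ?\<omega> = "unit_ball_vol (real DIM('a))"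
  define e where "e = Min (diameter ` star v)"
  have h: "0 < diameter T" if "T \<in> star v" for T
    using fatE[OF fat bounded_mesh] star_mesh[OF that] by metis
  have e: "0 < e" "\<And>T. T \<in> star v \<Longrightarrow> e \<le> diameter T"
    unfolding e_def using False finite_star h by auto
  have "\<exists>u. ball u (e / \<sigma>) \<subseteq> T \<inter> cball v e" if T: "T \<in> star v" for T
  proof -
    have vT: "v \<in> T" using verts_subset star_mesh[OF T] star_vert[OF T] by auto
    obtain c \<rho> where r: "0 < \<rho>" "cball c \<rho> \<subseteq> T" "diameter T \<le> \<sigma> * \<rho>"
      using fatE[OF fat bounded_mesh] star_mesh[OF T] by metis
    define t where "t = e / diameter T"
    have t: "0 < t" "t \<le> 1" unfolding t_def using e(1) e(2)[OF T] h[OF T] by auto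
    define u where "u = (1 - t) *\<^sub>R v + t *\<^sub>R c"
    have "y \<in> T \<inter> cball v e" if y: "y \<in> ball u (e / \<sigma>)" for y
    proof -
      define y' where "y' = v + (1 / t) *\<^sub>R (y - v)"
      have yy: "y = (1 - t) *\<^sub>R v + t *\<^sub>R y'" unfolding y'_def using t by (simp add: scaleR_add_right scaleR_diff_left)
      have "y - u = t *\<^sub>R (y' - c)" unfolding u_def yy by (simp add: scaleR_diff_right)
      then have "t * norm (y' - c) = norm (y - u)" using t by simp
      also have "\<dots> < e / \<sigma>" using y by (simp add: dist_norm norm_minus_commute)
      also have "\<dots> \<le> t * \<rho>" unfolding t_def using r(3) s h[OF T] e(1) by (simp add: field_simps)
      finally have "norm (y' - c) < \<rho>" using t by simp
      then have y'T: "y' \<in> T" using r(2) by (auto simp: dist_norm norm_minus_commute)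
      then have yT: "y \<in> T" using convexD_alt[OF convex_mesh[OF star_mesh[OF T]] vT y'T, of t] t yy by simp
      have "norm (y' - v) \<le> diameter T"
        using diameter_bounded_bound[OF bounded_mesh[OF star_mesh[OF T]] y'T vT] by (simp add: dist_norm)
      then have "t * norm (y' - v) \<le> t * diameter T" using t by (intro mult_left_mono) auto
      moreover have "y - v = t *\<^sub>R (y' - v)" unfolding yy by (simp add: scaleR_diff_left scaleR_diff_right)
      ultimately have "norm (y - v) \<le> e" using t h[OF T] e(1) unfolding t_def by simp
      then show ?thesis using yT by (simp add: dist_norm norm_minus_commute)
    qed
    then show ?thesis by blast
  qed
  then have "\<forall>T\<in>star v. \<exists>u. ball u (e / \<sigma>) \<subseteq> T \<inter> cball v e" by blast
  from bchoice[OF this] obtain u where u: "\<And>T. T \<in> star v \<Longrightarrow> ball (u T) (e / \<sigma>) \<subseteq> T \<inter> cball v e" by blast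
  let ?B = "\<lambda>T. ball (u T) (e / \<sigma>)"
  have disj: "disjoint_family_on ?B (star v)"
    unfolding disjoint_family_on_def
  proof (intro ballI impI)
    fix T T' assume T: "T \<in> star v" "T' \<in> star v" "T \<noteq> T'"
    have "?B T \<subseteq> interior T" using u[OF T(1)] by (intro interior_maximal) auto
    then show "?B T \<inter> ?B T' = {}"
      using interior_disjoint[OF star_mesh[OF T(1)] star_mesh[OF T(2)]] u[OF T(2)] T(3) by blast
  qed
  have "(\<Sum>T\<in>star v. emeasure lborel (?B T)) = emeasure lborel (\<Union>T\<in>star v. ?B T)"
    by (rule sum_emeasure[OF _ disj finite_star]) auto
  also have "\<dots> \<le> emeasure lborel (cball v e)" using u by (intro emeasure_mono) auto
  also have "\<dots> = ennreal (?\<omega> * e ^ DIM('a))" using e(1) by (simp add: emeasure_cball)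
  finally have "(\<Sum>T\<in>star v. emeasure lborel (?B T)) \<le> ennreal (?\<omega> * e ^ DIM('a))" .
  moreover have "(\<Sum>T\<in>star v. emeasure lborel (?B T)) = ennreal (real (card (star v)) * (?\<omega> * (e / \<sigma>) ^ DIM('a)))"
  proof -
    have "emeasure lborel (?B T) = ennreal (?\<omega> * (e / \<sigma>) ^ DIM('a))" for T using e s by (simp add: emeasure_ball)
    then have "(\<Sum>T\<in>star v. emeasure lborel (?B T)) = of_nat (card (star v)) * ennreal (?\<omega> * (e / \<sigma>) ^ DIM('a))"
      by (simp only: sum_constant)
    then show ?thesis using e s by (simp only: ennreal_of_nat_eq_real_of_nat) (subst ennreal_mult[symmetric], auto)
  qed
  ultimately have "real (card (star v)) * (?\<omega> * (e / \<sigma>) ^ DIM('a)) \<le> ?\<omega> * e ^ DIM('a)"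
    using e by (simp only: ennreal_le_iff) (subst (asm) ennreal_le_iff, auto)
  then have "?\<omega> * e ^ DIM('a) * (real (card (star v)) / \<sigma> ^ DIM('a)) \<le> ?\<omega> * e ^ DIM('a) * 1"
    by (simp add: power_divide mult_ac)
  moreover have "0 < ?\<omega> * e ^ DIM('a)" using e by simp
  ultimately have "real (card (star v)) / \<sigma> ^ DIM('a) \<le> 1" by (simp only: mult_le_cancel_left_pos)
  then show ?thesis using s by (simp add: divide_le_eq)
qed

text \<open>The simplices that miss \<open>v\<close> form a closed set at positive distance from
  \<open>v\<close>.\<close>

lemma star_neighbourhood:
  assumes v: "v \<in> interior dom" "v \<in> vertices"
  shows "\<exists>e>0. ball v e \<subseteq> \<Union>(star v) \<and> (\<forall>w\<in>vertices. w \<noteq> v \<longrightarrow> e \<le> dist v w)"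
proof -
  obtain d where d: "0 < d" "\<forall>w\<in>vertices. w \<noteq> v \<longrightarrow> d \<le> dist v w"
    using finite_set_avoid[OF finite_vertices] by metis
  let ?O = "interior dom - \<Union>{T \<in> \<T>. v \<notin> T}"
  have "open ?O" using finite_mesh closed_mesh by (intro open_Diff closed_Union) auto
  moreover have "v \<in> ?O" using v by auto
  ultimately obtain a where a: "0 < a" "ball v a \<subseteq> ?O" using open_contains_ball by blast
  obtain S0 where S0: "S0 \<in> \<T>" "v \<in> verts S0" using v(2) unfolding vertices_def by blast
  have st: "T \<in> star v" if "T \<in> \<T>" "v \<in> T" "v \<in> vertices" for T
  proof -
    have "0 < hat v v" using hat_vertex[OF S0, of v] by simp
    then show ?thesis using hat_pos_star that by blast
  qed
  show ?thesis
  proof -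
    have "ball v a \<subseteq> \<Union>(star v)"
    proof
      fix x assume "x \<in> ball v a"
      then have x: "x \<in> ?O" using a by auto
      then obtain T where T: "T \<in> \<T>" "x \<in> T" using interior_subset unfolding dom_def by blast
      then have "v \<in> T" using x by auto
      then show "x \<in> \<Union>(star v)" using st[OF T(1) _ v(2)] T by auto
    qed
    then show ?thesis using a d by (intro exI[of _ "min a d"]) auto
  qed
qed


text \<open>A small sphere around \<open>v\<close> is covered by the star and is connected in
  dimension at least 2, so the closed unions of \<open>A\<close> and of the remaining simplices meet
  on it. A common point differs from \<open>v\<close>; the shared face therefore has another
  vertex.\<close>

lemma star_chain_step:
  assumes d2: "2 \<le> DIM('a)" and v: "v \<in> interior dom" "v \<in> vertices"
    and A: "A \<subseteq> star v" "A \<noteq> {}" "A \<noteq> star v"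
  shows "\<exists>T\<in>A. \<exists>T'\<in>star v - A. \<exists>w. w \<noteq> v \<and> w \<in> verts T \<and> w \<in> verts T'"
proof (rule ccontr)
  assume "\<not> ?thesis"
  then have none: "\<And>T T' w. T \<in> A \<Longrightarrow> T' \<in> star v - A \<Longrightarrow> w \<in> verts T \<Longrightarrow> w \<in> verts T' \<Longrightarrow> w = v" by blast
  obtain e where e: "0 < e" "ball v e \<subseteq> \<Union>(star v)" "\<And>w. w \<in> vertices \<Longrightarrow> w \<noteq> v \<Longrightarrow> e \<le> dist v w"
    using star_neighbourhood[OF v] by blast
  let ?S = "sphere v (e / 2)" and ?B = "star v - A"
  have cl: "closed (\<Union>A)" "closed (\<Union>?B)"
    using A finite_star star_mesh closed_mesh by (auto intro!: closed_Union intro: finite_subset)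
  have sub: "?S \<subseteq> \<Union>A \<union> \<Union>?B"
  proof
    fix x assume "x \<in> ?S"
    then have "x \<in> ball v e" using e(1) by auto
    then show "x \<in> \<Union>A \<union> \<Union>?B" using e(2) by blast
  qed
  have disj: "\<Union>A \<inter> \<Union>?B \<inter> ?S = {}"
  proof (rule ccontr)
    assume "\<not> ?thesis"
    then obtain x T T' where x: "T \<in> A" "x \<in> T" "T' \<in> ?B" "x \<in> T'" "x \<in> ?S" by blast
    have TT: "T \<in> \<T>" "T' \<in> \<T>" using x A star_mesh by auto
    have "verts T \<inter> verts T' \<subseteq> {v}" using none[OF x(1,3)] by blast
    then have "convex hull (verts T \<inter> verts T') \<subseteq> {v}" using hull_mono[of _ "{v}" convex] by (metis convex_hull_singleton)
    then have "x = v" using Int_eq_hull[OF TT] x by auto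
    then show False using x(5) e(1) by simp
  qed
  have meet: "T \<inter> ?S \<noteq> {}" if T: "T \<in> star v" for T
  proof -
    have "card (verts T) = Suc DIM('a)" using nd[OF star_mesh[OF T]] unfolding nondeg_def by simp
    then have "\<not> verts T \<subseteq> {v}" using card_mono[of "{v}" "verts T"] DIM_positive[where 'a = 'a] by auto
    then obtain w where w: "w \<in> verts T" "w \<noteq> v" by auto
    have "w \<in> vertices" using w star_mesh[OF T] unfolding vertices_def by auto
    then have d: "e \<le> dist v w" using e(3) w by simp
    define t where "t = e / 2 / dist v w"
    have dpos: "0 < dist v w" using w by simp
    have t: "0 \<le> t" "t \<le> 1" unfolding t_def using d e(1) dpos by (auto simp: divide_le_eq)
    let ?x = "(1 - t) *\<^sub>R v + t *\<^sub>R w"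
    have "?x \<in> T" using w(1) star_vert[OF T] verts_subset[OF star_mesh[OF T]] t
      by (intro convexD_alt[OF convex_mesh[OF star_mesh[OF T]]]) auto
    moreover have "v - ?x = t *\<^sub>R (v - w)" by (simp add: scaleR_diff_left scaleR_diff_right)
    then have "dist v ?x = t * dist v w" using t by (simp add: dist_norm)
    then have "dist v ?x = e / 2" unfolding t_def using dpos by simp
    ultimately show ?thesis by auto
  qed
  have ne: "\<Union>A \<inter> ?S \<noteq> {}" "\<Union>?B \<inter> ?S \<noteq> {}" using meet A by blast+
  have "connected ?S" by (rule connected_sphere[OF d2])
  then show False using cl sub disj ne unfolding connected_closed by blast
qed

text \<open>If two simplices of the star share a second vertex, their diameters differ at most by
  the factor \<open>\<sigma>\<close>, since both are comparable to the shared edge. Chains of such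
  simplices reach the whole star, and \<open>card_star_le\<close> limits their length in terms of
  \<open>\<sigma>\<close> and the dimension.\<close>

lemma star_comparable:
  assumes d2: "2 \<le> DIM('a)" and v: "v \<in> interior dom" "v \<in> vertices"
    and fat: "\<And>T. T \<in> \<T> \<Longrightarrow> fat \<sigma> T" and T: "T \<in> star v" "T' \<in> star v"
  shows "diameter T \<le> \<sigma> ^ card (star v) * diameter T'"
proof -
  have s: "2 \<le> \<sigma>" using fatE[OF fat bounded_mesh] star_mesh[OF T(1)] by metis
  have h: "0 \<le> diameter S" if "S \<in> star v" for S using diameter_ge_0[OF bounded_mesh[OF star_mesh[OF that]]] .
  define D where "D n = {S \<in> star v. diameter T \<le> \<sigma> ^ n * diameter S}" for n
  have D0: "T \<in> D 0" unfolding D_def using T by simp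
  have DS: "D n \<subseteq> D (Suc n)" for n
  proof
    fix S assume S: "S \<in> D n"
    have "\<sigma> ^ n * diameter S \<le> \<sigma> ^ Suc n * diameter S"
      using s h S unfolding D_def by (intro mult_right_mono power_increasing) auto
    then show "S \<in> D (Suc n)" using S unfolding D_def by auto
  qed
  have fin: "finite (D n)" for n unfolding D_def using finite_star by auto
  \<comment> \<open>Each step adds at least one simplex until the star is exhausted.\<close>
  have step: "D n = star v \<or> n < card (D n)" for n
  proof (induction n)
    case 0
    have "0 < card (D 0)" using card_gt_0_iff[of "D 0"] fin[of 0] D0 by auto
    then show ?case ..
  next
    case (Suc n)
    show ?case
    proof (cases "D n = star v")
      case True
      then show ?thesis using DS[of n] unfolding D_def by blast
    next
      case False
      then have lt: "n < card (D n)" using Suc by simp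
      then have "D n \<noteq> {}" by auto
      obtain S S' w where w: "S \<in> D n" "S' \<in> star v - D n" "w \<noteq> v" "w \<in> verts S" "w \<in> verts S'"
        using star_chain_step[OF d2 v _ \<open>D n \<noteq> {}\<close> False] unfolding D_def by blast
      have S: "S \<in> star v" using w(1) unfolding D_def by auto
      have "diameter S \<le> \<sigma> * norm (v - w)"
        using edge_length_lower[OF star_mesh[OF S] fat[OF star_mesh[OF S]] star_vert[OF S] w(4)] w(3) by simp
      also have "norm (v - w) \<le> diameter S'"
      proof -
        have S': "S' \<in> star v" using w(2) by auto
        have "v \<in> S'" "w \<in> S'" using star_vert[OF S'] w(5) verts_subset[OF star_mesh[OF S']] by auto
        then show ?thesis using diameter_bounded_bound[OF bounded_mesh[OF star_mesh[OF S']], of v w] by (simp add: dist_norm)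
      qed
      finally have "diameter S \<le> \<sigma> * diameter S'" using s by simp
      then have "\<sigma> ^ n * diameter S \<le> \<sigma> ^ n * (\<sigma> * diameter S')" using s by (intro mult_left_mono) auto
      then have "S' \<in> D (Suc n)" using w unfolding D_def by (auto simp: mult_ac)
      then have "insert S' (D n) \<subseteq> D (Suc n)" using DS[of n] by blast
      then have "card (insert S' (D n)) \<le> card (D (Suc n))" by (rule card_mono[OF fin])
      moreover have "card (insert S' (D n)) = Suc (card (D n))" using w fin by simp
      ultimately show ?thesis using lt by simp
    qed
  qed
  have "D (card (star v)) = star v"
    using step[of "card (star v)"] card_mono[OF finite_star, of "D (card (star v))" v] unfolding D_def by fastforce
  then show ?thesis using T(2) unfolding D_def by blast
qed

text \<open>The hat function of an interior vertex has Lipschitz constant of the order of the inverse mesh size.\<close>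

lemma hat_pos_near:
  assumes v: "v \<in> interior dom" "v \<in> vertices" and fat: "\<And>T. T \<in> star v \<Longrightarrow> fat \<sigma> T"
    and s: "0 < \<sigma>" and h: "0 < h" "\<And>T. T \<in> star v \<Longrightarrow> h \<le> diameter T"
    and p: "\<sigma> * norm (y - p) < h * hat v p"
  shows "0 < hat v y"
proof (rule ccontr)
  assume "\<not> 0 < hat v y"
  then have y0: "hat v y = 0" using hat_eq_0_iff by blast
  obtain T0 where T0: "T0 \<in> \<T>" "v \<in> verts T0" using v(2) unfolding vertices_def by blast
  define g where "g t = p + t *\<^sub>R (y - p)" for t :: real
  have cg: "continuous_on S g" for S unfolding g_def by (intro continuous_intros)
  have ch: "continuous_on S (\<lambda>t. hat v (g t))" for S
    by (rule continuous_on_compose2[OF hat_continuous[OF T0 v(1)] cg]) auto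
  \<comment> \<open>\<open>Inf Z\<close> is the first zero of the hat function on the segment from
    \<open>p\<close> to \<open>y\<close>. Up to it the segment stays in the star, so only the sizes
    of simplices around \<open>v\<close> enter the Lipschitz constant.\<close>
  define Z where "Z = {t\<in>{0..1}. hat v (g t) = 0}"
  have "closed Z" unfolding Z_def
    by (rule continuous_closed_preimage_constant[OF ch]) auto
  moreover have "1 \<in> Z" unfolding Z_def g_def using y0 by simp
  moreover have "bdd_below Z" unfolding Z_def by (rule bdd_belowI[of _ 0]) auto
  ultimately have tZ: "Inf Z \<in> Z" by (intro closed_contains_Inf) auto
  define t where "t = Inf Z"
  have t: "0 \<le> t" "t \<le> 1" "hat v (g t) = 0" using tZ unfolding Z_def t_def by auto
  have before: "0 < hat v (g u)" if "0 \<le> u" "u < t" for u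
  proof -
    have "u \<notin> Z" using that cInf_lower[OF _ \<open>bdd_below Z\<close>, of u] unfolding t_def by auto
    then show ?thesis using that t hat_eq_0_iff[of v "g u"] unfolding Z_def by auto
  qed
  have p0: "0 < hat v p" using p s h(1) by (metis mult_nonneg_nonneg mult_zero_right norm_ge_zero hat_eq_0_iff less_imp_le not_le)
  have tpos: "0 < t" using t p0 unfolding g_def by (cases "t = 0") auto
  let ?L = "\<sigma> * norm (y - p) / h"
  have L0: "0 \<le> ?L" using s h by simp
  have "{0..t} \<subseteq> (\<Union>T\<in>star v. g -` T)"
  proof -
    have "{0..<t} \<subseteq> (\<Union>T\<in>star v. g -` T)"
    proof
      fix u assume "u \<in> {0..<t}"
      then have pos: "0 < hat v (g u)" using before by simp
      then obtain T where T: "T \<in> \<T>" "g u \<in> T" using hat_pos_dom unfolding dom_def by blast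
      then show "u \<in> (\<Union>T\<in>star v. g -` T)" using hat_pos_star[OF pos] by blast
    qed
    moreover have "closed (\<Union>T\<in>star v. g -` T)"
      using finite_star star_mesh closed_mesh cg[of UNIV] by (intro closed_UN ballI closed_vimage) auto
    ultimately have "closure {0..<t} \<subseteq> (\<Union>T\<in>star v. g -` T)" by (rule closure_minimal)
    then show ?thesis using tpos by simp
  qed
  moreover have "?L-lipschitz_on (g -` T) (\<lambda>u. hat v (g u))" if T: "T \<in> star v" for T
  proof (rule lipschitz_onI[OF _ L0])
    fix a b assume ab: "a \<in> g -` T" "b \<in> g -` T"
    obtain c \<rho> where r: "0 < \<rho>" "cball c \<rho> \<subseteq> T" "1 / \<rho> \<le> \<sigma> / diameter T"
      using fatE[OF fat[OF T] bounded_mesh[OF star_mesh[OF T]]] by metis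
    have gab: "norm (g a - g b) = norm (y - p) * dist a b"
    proof -
      have "g a - g b = (a - b) *\<^sub>R (y - p)" unfolding g_def by (simp add: scaleR_diff_left)
      then show ?thesis by (simp add: dist_real_def mult.commute)
    qed
    have rho: "1 / \<rho> \<le> \<sigma> / h" using r(3) h(1) h(2)[OF T] s by (meson divide_left_mono less_imp_le order_trans less_le_trans mult_pos_pos)
    have "\<bar>hat v (g a) - hat v (g b)\<bar> \<le> norm (g a - g b) * (1 / \<rho>)"
      using bary_lipschitz[OF nd[OF star_mesh[OF T]] r(1), of c v "g a" "g b"] r(2) hull[OF star_mesh[OF T]] ab
      by (simp add: hat_eq[OF star_mesh[OF T]])
    also have "\<dots> \<le> norm (g a - g b) * (\<sigma> / h)" using rho by (intro mult_left_mono) auto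
    finally show "dist (hat v (g a)) (hat v (g b)) \<le> ?L * dist a b" by (simp add: gab dist_real_def mult_ac)
  qed
  moreover have "closed (g -` T)" if "T \<in> star v" for T
    using that star_mesh closed_mesh cg[of UNIV] by (intro closed_vimage) auto
  ultimately have "?L-lipschitz_on {0..t} (\<lambda>u. hat v (g u))"
    using lipschitz_on_closed_Union[of "star v" ?L "\<lambda>T. g -` T" "\<lambda>u. hat v (g u)" 0 t] finite_star L0 by blast
  then have "dist (hat v (g 0)) (hat v (g t)) \<le> ?L * dist 0 t"
    by (rule lipschitz_onD) (use t in auto)
  then have "hat v p \<le> ?L * t" using t p0 unfolding g_def by (simp add: dist_real_def)
  also have "\<dots> \<le> ?L * 1" using t L0 by (intro mult_left_mono) auto
  finally have "h * hat v p \<le> h * ?L" using h(1) by (intro mult_left_mono) auto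
  then show False using p h(1) by simp
qed

subsection \<open>Facets\<close>

text \<open>An affine function is the interpolant of its vertex values.\<close>

lemma bary_expand:
  assumes C: "nondeg C" and C': "nondeg C'"
  shows "bary C' u x = (\<Sum>v\<in>C. bary C v x * bary C' u v)"
proof -
  obtain n where n: "\<And>x. bary C' u x = bary C' u 0 + n \<bullet> x" using bary_affine[OF C'] by blast
  have "(\<Sum>v\<in>C. bary C v x * bary C' u v) = (\<Sum>v\<in>C. bary C v x * bary C' u 0 + n \<bullet> (bary C v x *\<^sub>R v))"
  proof (intro sum.cong refl)
    fix v
    show "bary C v x * bary C' u v = bary C v x * bary C' u 0 + n \<bullet> (bary C v x *\<^sub>R v)"
      using n[of v] by (simp add: distrib_left)
  qed
  also have "\<dots> = (\<Sum>v\<in>C. bary C v x) * bary C' u 0 + n \<bullet> (\<Sum>v\<in>C. bary C v x *\<^sub>R v)"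
    by (simp only: sum.distrib sum_distrib_right inner_sum_right)
  finally show ?thesis unfolding bary_sum[OF C] bary_repr[OF C] using n[of x] by simp
qed

text \<open>If both apices lie on the same side of the common facet \<open>c\<close>, a point
  slightly off the barycentre of \<open>c\<close> towards \<open>w\<close> lies in both simplices.
  Its coordinate at \<open>w\<close> is positive, so \<open>w\<close> is a vertex of
  \<open>T'\<close> too.\<close>

lemma same_side_eq:
  assumes T: "T \<in> \<T>" "T' \<in> \<T>" and c: "finite c" "c \<noteq> {}" "verts T = insert w c" "verts T' = insert w' c" "w \<notin> c" "w' \<notin> c"
    and pos: "0 < bary (verts T') w' w"
  shows "T = T'"
proof -
  define m where "m = 1 / real (card c)"
  have cc: "0 < real (card c)" using c by (simp add: card_gt_0_iff)
  have m: "0 < m" unfolding m_def using cc by simp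
  define a where "a = (\<Sum>u\<in>c. m *\<^sub>R u)"
  have bound: "\<exists>K\<ge>0. \<forall>u\<in>c. - K \<le> bary (verts T') u w"
  proof (intro exI[of _ "\<Sum>u\<in>c. \<bar>bary (verts T') u w\<bar>"] conjI ballI)
    fix u assume "u \<in> c"
    then have "\<bar>bary (verts T') u w\<bar> \<le> (\<Sum>u\<in>c. \<bar>bary (verts T') u w\<bar>)" using c(1) by (intro member_le_sum) auto
    then show "- (\<Sum>u\<in>c. \<bar>bary (verts T') u w\<bar>) \<le> bary (verts T') u w" by linarith
  qed (auto intro: sum_nonneg)
  then obtain K where K: "0 \<le> K" "\<And>u. u \<in> c \<Longrightarrow> - K \<le> bary (verts T') u w" by blast
  \<comment> \<open>In \<open>T'\<close> the coordinates of \<open>z\<close> at vertices of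
    \<open>c\<close> are at least \<open>(1 - e) * m - e * K\<close>; this \<open>e\<close> keeps
    them nonnegative.\<close>
  define e where "e = m / (K + m + 1)"
  have e: "0 < e" "e \<le> 1" "e * (K + m) \<le> m"
  proof -
    have "0 < K + m + 1" using K m by linarith
    then show "0 < e" "e \<le> 1" unfolding e_def using K m by (auto simp: divide_le_eq)
    have "e * (K + m) \<le> e * (K + m + 1)" using \<open>0 < e\<close> by (intro mult_left_mono) auto
    then show "e * (K + m) \<le> m" unfolding e_def using \<open>0 < K + m + 1\<close> by simp
  qed
  define z where "z = (1 - e) *\<^sub>R a + e *\<^sub>R w"
  have ba: "bary (verts S) u a = (if u \<in> c then m else 0)" if S: "S \<in> \<T>" "verts S = insert s c" "s \<notin> c" for S s u
  proof (cases "u \<in> verts S")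
    case True
    have "(\<Sum>v\<in>verts S. if v \<in> c then m else 0) = 1" "(\<Sum>v\<in>verts S. (if v \<in> c then m else 0) *\<^sub>R v) = a"
    proof -
      have "(\<Sum>v\<in>verts S. if v \<in> c then m else 0) = (\<Sum>v\<in>c. m)" using S c(1) by simp
      then show "(\<Sum>v\<in>verts S. if v \<in> c then m else 0) = 1" unfolding m_def using cc by simp
      have "(\<Sum>v\<in>verts S. (if v \<in> c then m else 0) *\<^sub>R v) = (\<Sum>v\<in>c. (if v \<in> c then m else 0) *\<^sub>R v)" using S c(1) by simp
      also have "\<dots> = a" unfolding a_def by (intro sum.cong) auto
      finally show "(\<Sum>v\<in>verts S. (if v \<in> c then m else 0) *\<^sub>R v) = a" .
    qed
    then show ?thesis using bary_unique[OF nd[OF S(1)] _ _ True] by blast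
  qed (use S in auto)
  have bz: "bary (verts S) u z = (1 - e) * (if u \<in> c then m else 0) + e * bary (verts S) u w"
    if S: "S \<in> \<T>" "verts S = insert s c" "s \<notin> c" for S s u
    unfolding z_def bary_combination[OF nd[OF S(1)]] ba[OF S] ..
  have bw: "bary (verts T) u w = (if u = w then 1 else 0)" for u
    using bary_vertex[OF nd[OF T(1)], of w u] c by simp
  have "0 \<le> bary (verts T) u z" for u unfolding bz[OF T(1) c(3,5)] bw using e m by auto
  then have zT: "z \<in> T" using convex_hull_bary[OF nd[OF T(1)], of z] hull[OF T(1)] by simp
  have "bary (verts T) w z = e" unfolding bz[OF T(1) c(3,5)] bw using c by simp
  then have wz: "0 < hat w z" using hat_eq[OF T(1) zT] e by simp
  have "0 \<le> bary (verts T') u z" if "u \<in> verts T'" for u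
  proof (cases "u \<in> c")
    case True
    have "e * (- K) \<le> e * bary (verts T') u w" using K(2)[OF True] e by (intro mult_left_mono) auto
    moreover have "(1 - e) * m - e * K = m - e * (K + m)" by (simp add: distrib_left left_diff_distrib)
    ultimately show ?thesis unfolding bz[OF T(2) c(4,6)] using True e by simp
  next
    case False
    then have "u = w'" using that c by auto
    then show ?thesis unfolding bz[OF T(2) c(4,6)] using False pos e by simp
  qed
  then have zT': "z \<in> T'" using convex_hull_bary[OF nd[OF T(2)], of z] hull[OF T(2)] by simp
  have "w \<in> verts T'" by (rule hat_pos_vert[OF T(2) zT' wz])
  then have "w = w'" using c by auto
  then have "verts T = verts T'" using c by simp
  then show ?thesis using hull T by metis
qed

text \<open>The apex coordinate of each simplex vanishes on the facet, so those of two simplices are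
  proportional, with a negative factor if the simplices differ. For three different simplices one
  negative factor would be the product of two others. This makes the arbitrary choice in
  \<open>face_sides\<close> unique up to order.\<close>

lemma facet_shared_by_two:
  assumes d2: "2 \<le> DIM('a)" and T: "T \<in> \<T>" "T' \<in> \<T>" "T \<noteq> T'" and F: "(T \<inter> T') facet_of T"
    and S: "S \<in> \<T>" "T \<inter> T' \<subseteq> S"
  shows "S = T \<or> S = T'"
proof (rule ccontr)
  assume ne: "\<not> ?thesis"
  define c where "c = verts T \<inter> verts T'"
  have ind: "\<not> affine_dependent (verts T)" using nd[OF T(1)] unfolding nondeg_def by simp
  have indc: "\<not> affine_dependent c" unfolding c_def using affine_independent_subset[OF ind] by blast
  have aT: "aff_dim T = int DIM('a)" using aff_dim_simplex[OF full[OF T(1)]] .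
  have "aff_dim (T \<inter> T') = int DIM('a) - 1" using F aT unfolding facet_of_def by simp
  moreover have "aff_dim (T \<inter> T') = int (card c) - 1"
    unfolding Int_eq_hull[OF T(1,2)] c_def[symmetric] aff_dim_convex_hull using aff_dim_affine_independent[OF indc] by linarith
  ultimately have cc: "card c = DIM('a)" by linarith
  have finc: "finite c" unfolding c_def using fin_verts[OF T(1)] by auto
  have cne: "c \<noteq> {}" using cc d2 by auto
  have cS: "c \<subseteq> verts S"
  proof
    fix u assume u: "u \<in> c"
    then have "u \<in> S" using S(2) verts_subset T unfolding c_def by blast
    moreover have "0 < hat u u" using hat_vertex[OF T(1), of u u] u unfolding c_def by simp
    ultimately show "u \<in> verts S" using hat_pos_vert[OF S(1)] by blast
  qed
  have ex: "\<exists>w. verts R = insert w c \<and> w \<notin> c" if R: "R \<in> \<T>" "c \<subseteq> verts R" for R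
  proof -
    have "card (verts R - c) = 1" using card_Diff_subset[OF finc R(2)] nd[OF R(1)] cc unfolding nondeg_def by simp
    then obtain w where "verts R - c = {w}" by (auto simp: card_1_singleton_iff)
    then show ?thesis using R(2) by (intro exI[of _ w]) auto
  qed
  obtain w0 where w0: "verts T = insert w0 c" "w0 \<notin> c" using ex[OF T(1)] unfolding c_def by blast
  obtain w1 where w1: "verts T' = insert w1 c" "w1 \<notin> c" using ex[OF T(2)] unfolding c_def by blast
  obtain w2 where w2: "verts S = insert w2 c" "w2 \<notin> c" using ex[OF S(1) cS] by blast
  have proportional: "bary (verts R) r x = bary (verts Q) q x * bary (verts R) r q"
    if R: "R \<in> \<T>" "verts R = insert r c" "r \<notin> c" and Q: "Q \<in> \<T>" "verts Q = insert q c" "q \<notin> c" for R r Q q x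
  proof -
    have "bary (verts R) r x = (\<Sum>v\<in>verts Q. bary (verts Q) v x * bary (verts R) r v)"
      by (rule bary_expand[OF nd[OF Q(1)] nd[OF R(1)]])
    also have "\<dots> = bary (verts Q) q x * bary (verts R) r q + (\<Sum>v\<in>c. bary (verts Q) v x * bary (verts R) r v)"
      by (subst (1) Q(2), subst sum.insert[OF finc Q(3)], rule refl)
    also have "(\<Sum>v\<in>c. bary (verts Q) v x * bary (verts R) r v) = 0"
    proof (rule sum.neutral, rule ballI)
      fix v assume v: "v \<in> c"
      then have "bary (verts R) r v = 0" using bary_vertex[OF nd[OF R(1)], of v r] R by auto
      then show "bary (verts Q) v x * bary (verts R) r v = 0" by simp
    qed
    finally show ?thesis by simp
  qed
  have one: "bary (verts R) r r = 1" if R: "R \<in> \<T>" "verts R = insert r c" for R r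
    using bary_vertex[OF nd[OF R(1)], of r r] R by simp
  have neg: "bary (verts R) r q < 0"
    if R: "R \<in> \<T>" "verts R = insert r c" "r \<notin> c" and Q: "Q \<in> \<T>" "verts Q = insert q c" "q \<notin> c" and RQ: "R \<noteq> Q" for R r Q q
  proof -
    have "\<not> 0 < bary (verts R) r q" using same_side_eq[OF Q(1) R(1) finc cne Q(2) R(2) Q(3) R(3)] RQ by blast
    moreover have "bary (verts R) r q \<noteq> 0" using proportional[OF R Q, of r] one[OF R(1,2)] by auto
    ultimately show ?thesis by linarith
  qed
  have "bary (verts S) w2 w1 = bary (verts T) w0 w1 * bary (verts S) w2 w0" by (rule proportional[OF S(1) w2 T(1) w0])
  moreover have "bary (verts T) w0 w1 < 0" "bary (verts S) w2 w0 < 0" "bary (verts S) w2 w1 < 0"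
    using neg[OF T(1) w0 T(2) w1] neg[OF S(1) w2 T(1) w0] neg[OF S(1) w2 T(2) w1] T(3) ne by auto
  ultimately show False using mult_neg_neg[of "bary (verts T) w0 w1" "bary (verts S) w2 w0"] by linarith
qed

end

section \<open>Measure of the interface\<close>

definition interface_chart :: "real \<Rightarrow> real \<Rightarrow> ('a::euclidean_space) cutfem \<Rightarrow> 'a \<Rightarrow> ('a \<Rightarrow> real) \<Rightarrow> ('a \<Rightarrow> 'a) \<Rightarrow> bool" where
  "interface_chart r M P p f g \<longleftrightarrow> (\<forall>x\<in>ball p r. (f has_derivative (\<lambda>v. g x \<bullet> v)) (at x)) \<and>
     M-lipschitz_on (ball p r) g \<and> norm (g p) = 1 \<and>
     sub P 1 \<inter> ball p r = {x \<in> Om P \<inter> ball p r. f x < 0} \<and>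
     sub P 2 \<inter> ball p r = {x \<in> Om P \<inter> ball p r. f x > 0} \<and>
     (\<forall>y\<in>Gam P \<inter> ball p r. f y = 0 \<and> g y \<noteq> 0 \<and> normal P y = g y /\<^sub>R norm (g y))"

lemma interface_chartD:
  assumes "interface_chart r M P p f g"
  shows "\<And>x. x \<in> ball p r \<Longrightarrow> (f has_derivative (\<lambda>v. g x \<bullet> v)) (at x)"
    "M-lipschitz_on (ball p r) g" "norm (g p) = 1"
    "sub P 1 \<inter> ball p r = {x \<in> Om P \<inter> ball p r. f x < 0}"
    "sub P 2 \<inter> ball p r = {x \<in> Om P \<inter> ball p r. f x > 0}"
    "\<And>y. y \<in> Gam P \<inter> ball p r \<Longrightarrow> f y = 0 \<and> g y \<noteq> 0 \<and> normal P y = g y /\<^sub>R norm (g y)"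
  using assms unfolding interface_chart_def by blast+

text \<open>\<open>smooth_interface\<close> does not state \<open>f = 0\<close> on the interface. It
  follows by continuity, as every interface point is a limit of points of both subdomains, where
  \<open>f\<close> has opposite signs.\<close>

lemma interface_chart:
  assumes sm: "smooth_interface r M P" and p: "p \<in> Gam P"
  shows "\<exists>f g. interface_chart r M P p f g"
proof -
  obtain f g where fg: "\<forall>x\<in>ball p r. (f has_derivative (\<lambda>v. g x \<bullet> v)) (at x)"
    "M-lipschitz_on (ball p r) g" "norm (g p) = 1"
    "sub P 1 \<inter> ball p r = {x \<in> Om P \<inter> ball p r. f x < (0::real)}"
    "sub P 2 \<inter> ball p r = {x \<in> Om P \<inter> ball p r. f x > 0}"
    "\<forall>y\<in>Gam P \<inter> ball p r. g y \<noteq> 0 \<and> normal P y = g y /\<^sub>R norm (g y)"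
    using sm p unfolding smooth_interface_def by blast
  have "f y = 0" if y: "y \<in> Gam P \<inter> ball p r" for y
  proof -
    have cf: "isCont f y" using fg(1) y has_derivative_continuous by blast
    have lim: "\<exists>x. x \<in> sub P i \<and> x \<in> ball p r \<and> \<bar>f x - f y\<bar> < e" if e: "0 < e" and i: "i = 1 \<or> i = 2" for e :: real and i :: nat
    proof -
      obtain d where d: "0 < d" "\<And>x. dist x y < d \<Longrightarrow> \<bar>f x - f y\<bar> < e"
        using cf e unfolding continuous_at_eps_delta dist_real_def by blast
      have "open (ball p r \<inter> ball y d)" by auto
      moreover have "y \<in> ball p r \<inter> ball y d" using y d by auto
      moreover have "y \<in> closure (sub P i)" using y i unfolding Gam_def by auto
      ultimately have "sub P i \<inter> (ball p r \<inter> ball y d) \<noteq> {}"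
        by (meson closure_iff_nhds_not_empty order_refl)
      then show ?thesis using d(2) by (auto simp: dist_commute)
    qed
    show "f y = 0"
    proof (rule ccontr)
      assume "f y \<noteq> 0"
      then have e: "0 < \<bar>f y\<bar>" by simp
      obtain x1 where x1: "x1 \<in> sub P 1" "x1 \<in> ball p r" "\<bar>f x1 - f y\<bar> < \<bar>f y\<bar>" using lim[OF e, of 1] by auto
      obtain x2 where x2: "x2 \<in> sub P 2" "x2 \<in> ball p r" "\<bar>f x2 - f y\<bar> < \<bar>f y\<bar>" using lim[OF e, of 2] by auto
      have "f x1 < 0" using fg(4) x1 by blast
      moreover have "0 < f x2" using fg(5) x2 by blast
      ultimately show False using x1(3) x2(3) by linarith
    qed
  qed
  then have "interface_chart r M P p f g" using fg unfolding interface_chart_def by blast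
  then show ?thesis by blast
qed

text \<open>The gradient varies by at most \<open>M * s\<close> over the smaller ball. If this is
  small, secants of the zero set are nearly orthogonal to \<open>g p\<close>, and \<open>f\<close>
  grows steadily in the direction \<open>g p\<close>.\<close>

lemma chart_mean_value:
  fixes f :: "'a::euclidean_space \<Rightarrow> real"
  assumes D: "\<And>x. x \<in> ball p r \<Longrightarrow> (f has_derivative (\<lambda>v. g x \<bullet> v)) (at x)"
    and lip: "M-lipschitz_on (ball p r) g" and s: "s \<le> r" "0 < s" and xy: "x \<in> ball p s" "y \<in> ball p s"
  shows "\<bar>f x - f y - g p \<bullet> (x - y)\<bar> \<le> M * s * norm (x - y)"
proof (cases "x = y")
  case False
  have seg: "(1 - t) *\<^sub>R y + t *\<^sub>R x \<in> ball p s" if "0 \<le> t" "t \<le> 1" for t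
    by (rule convexD_alt[OF convex_ball xy(2,1) that])
  define h where "h t = f (y + t *\<^sub>R (x - y))" for t
  have eq: "y + t *\<^sub>R (x - y) = (1 - t) *\<^sub>R y + t *\<^sub>R x" for t by (simp add: scaleR_diff_left scaleR_diff_right)
  have Dh: "(h has_real_derivative (g (y + t *\<^sub>R (x - y)) \<bullet> (x - y))) (at t)" if t: "0 \<le> t" "t \<le> 1" for t
  proof -
    let ?z = "y + t *\<^sub>R (x - y)"
    have z: "?z \<in> ball p r" using seg[OF t] s unfolding eq by auto
    have "((\<lambda>t. y + t *\<^sub>R (x - y)) has_derivative (\<lambda>s. s *\<^sub>R (x - y))) (at t)"
      by (auto intro!: derivative_eq_intros)
    from has_derivative_compose[OF this D[OF z]]
    have "(h has_derivative (\<lambda>s. g ?z \<bullet> (s *\<^sub>R (x - y)))) (at t)" unfolding h_def .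
    moreover have "(\<lambda>s. g ?z \<bullet> (s *\<^sub>R (x - y))) = (*) (g ?z \<bullet> (x - y))" by (auto simp: mult.commute)
    ultimately show ?thesis unfolding has_field_derivative_def by simp
  qed
  obtain t where t: "0 < t" "t < 1" "h 1 - h 0 = (1 - 0) * (g (y + t *\<^sub>R (x - y)) \<bullet> (x - y))"
    using MVT2[of 0 1 h "\<lambda>t. g (y + t *\<^sub>R (x - y)) \<bullet> (x - y)"] Dh by auto
  let ?z = "y + t *\<^sub>R (x - y)"
  have z: "?z \<in> ball p s" using seg[of t] t unfolding eq by auto
  have "dist (g ?z) (g p) \<le> M * dist ?z p"
    using z s by (intro lipschitz_onD[OF lip]) auto
  also have "\<dots> \<le> M * s" using z lipschitz_on_nonneg[OF lip] by (intro mult_left_mono) (auto simp: dist_commute)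
  finally have gz: "norm (g ?z - g p) \<le> M * s" by (simp add: dist_norm)
  have "f x - f y - g p \<bullet> (x - y) = (g ?z - g p) \<bullet> (x - y)"
    using t(3) unfolding h_def by (simp add: inner_diff_left)
  then have "\<bar>f x - f y - g p \<bullet> (x - y)\<bar> \<le> norm (g ?z - g p) * norm (x - y)" by (simp add: Cauchy_Schwarz_ineq2)
  also have "\<dots> \<le> M * s * norm (x - y)" using gz by (intro mult_right_mono) auto
  finally show ?thesis .
qed simp

text \<open>Small pieces of the interface are Lipschitz graphs. For coarse meshes the closure of
  \<open>\<Omega>\<close> is covered by finitely many small balls; their number is fixed before the
  interface, so no smallness of \<open>h\<close> is assumed.\<close>

lemma interface_measure_upper:
  fixes \<Omega> :: "'a::euclidean_space set"
  assumes d2: "2 \<le> DIM('a)" and r: "0 < r" and M: "0 < M" and \<Omega>: "bounded \<Omega>"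
  shows "\<exists>C>0. \<forall>(P :: 'a cutfem) A h. Om P = \<Omega> \<longrightarrow> partitioned P \<longrightarrow> smooth_interface r M P \<longrightarrow> A \<subseteq> Gam P \<longrightarrow>
    0 < h \<longrightarrow> (\<forall>x\<in>A. \<forall>y\<in>A. norm (x - y) \<le> h) \<longrightarrow>
    hausdorff_outer (DIM('a) - 1) A \<le> ennreal (C * h ^ (DIM('a) - 1))"
proof -
  let ?s = "DIM('a) - 1"
  have s1: "1 \<le> ?s" using d2 by simp
  \<comment> \<open>\<open>M * \<rho> \<le> 1 / 2\<close> is the secant condition of
    \<open>hausdorff_outer_graph_le\<close>.\<close>
  define \<rho> where "\<rho> = min r (1 / (2 * M))"
  have \<rho>: "0 < \<rho>" "\<rho> \<le> r" "M * \<rho> \<le> 1 / 2" unfolding \<rho>_def using r M by (auto simp: min_def field_simps)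
  define K where "K = unit_ball_vol (real ?s) * (5 * real DIM('a)) ^ ?s"
  have K: "0 < K" unfolding K_def by simp
  have comp: "compact (closure \<Omega>)" using \<Omega> by (simp add: compact_closure)
  have cover: "closure \<Omega> \<subseteq> (\<Union>z\<in>closure \<Omega>. ball z (\<rho> / 2))" using \<rho>(1) by auto
  obtain Z where Z: "Z \<subseteq> closure \<Omega>" "finite Z" "closure \<Omega> \<subseteq> (\<Union>z\<in>Z. ball z (\<rho> / 2))"
    by (rule compactE_image[OF comp _ cover]) auto
  define C where "C = K * (1 + real (card Z))"
  have C: "0 < C" "K \<le> C" unfolding C_def using K by (simp_all add: add_pos_nonneg)
  have small: "hausdorff_outer ?s A \<le> ennreal (K * h ^ ?s)"
    if sm: "smooth_interface r M P" and A: "A \<subseteq> Gam P"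
      and h: "0 < h" "\<And>x y. x \<in> A \<Longrightarrow> y \<in> A \<Longrightarrow> norm (x - y) < \<rho>" "\<And>x y. x \<in> A \<Longrightarrow> y \<in> A \<Longrightarrow> norm (x - y) \<le> h"
    for P :: "'a cutfem" and A h
  proof (cases "A = {}")
    case True
    then show ?thesis using s1 by (simp add: hausdorff_outer_empty)
  next
    case False
    then obtain p where p: "p \<in> A" by auto
    then have pG: "p \<in> Gam P" using A by auto
    obtain f g where "interface_chart r M P p f g" using interface_chart[OF sm pG] by blast
    note fg = interface_chartD[OF this]
    have in_ball: "x \<in> ball p \<rho>" if "x \<in> A" for x using h(2)[OF p that] by (simp add: dist_norm)
    have f0: "f x = 0" if "x \<in> A" for x using fg(6)[of x] in_ball[OF that] A that \<rho> by auto
    have "\<bar>g p \<bullet> (x - y)\<bar> \<le> norm (x - y) / 2" if xy: "x \<in> A" "y \<in> A" for x y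
    proof -
      have "\<bar>f x - f y - g p \<bullet> (x - y)\<bar> \<le> M * \<rho> * norm (x - y)"
        by (rule chart_mean_value[OF fg(1,2) \<rho>(2,1) in_ball[OF xy(1)] in_ball[OF xy(2)]])
      also have "\<dots> \<le> 1 / 2 * norm (x - y)" using \<rho>(3) by (intro mult_right_mono) auto
      finally show ?thesis using f0 xy by simp
    qed
    then have "hausdorff_outer ?s A \<le> ennreal (unit_ball_vol (real ?s) * (5 * real DIM('a) * h) ^ ?s)"
      using h(3) by (intro hausdorff_outer_graph_le[OF d2 h(1) fg(3)]) auto
    then show ?thesis unfolding K_def by (simp add: power_mult_distrib mult.assoc)
  qed
  have "hausdorff_outer ?s A \<le> ennreal (C * h ^ ?s)"
    if P: "Om P = \<Omega>" "partitioned P" "smooth_interface r M P" and A: "A \<subseteq> Gam P" and h: "0 < h" "\<forall>x\<in>A. \<forall>y\<in>A. norm (x - y) \<le> h"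
    for P :: "'a cutfem" and A h
  proof (cases "h < \<rho>")
    case True
    have "hausdorff_outer ?s A \<le> ennreal (K * h ^ ?s)" using h(2) True by (intro small[OF P(3) A h(1)]) (auto intro: le_less_trans)
    also have "\<dots> \<le> ennreal (C * h ^ ?s)" using C(2) h by (intro ennreal_leI mult_right_mono) auto
    finally show ?thesis .
  next
    case False
    have "Gam P \<subseteq> closure \<Omega>" using P(1,2) unfolding partitioned_def Gam_def by (metis closure_mono inf.coboundedI1 Un_upper1 le_supI1)
    then have cov: "A \<subseteq> (\<Union>z\<in>Z. A \<inter> ball z (\<rho> / 2))" using A Z(3) by blast
    have fin: "hausdorff_outer ?s (\<Union>z\<in>Y. A \<inter> ball z (\<rho> / 2)) \<le> ennreal (real (card Y) * (K * h ^ ?s))" if "finite Y" for Y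
      using that
    proof (induction Y rule: finite_induct)
      case empty
      then show ?case using s1 by (simp add: hausdorff_outer_empty)
    next
      case (insert z Y)
      have one: "hausdorff_outer ?s (A \<inter> ball z (\<rho> / 2)) \<le> ennreal (K * h ^ ?s)"
      proof -
        have bd: "norm (x - y) < \<rho>" if "x \<in> A \<inter> ball z (\<rho> / 2)" "y \<in> A \<inter> ball z (\<rho> / 2)" for x y
        proof -
          have "dist x y \<le> dist z x + dist z y" by (metis dist_commute dist_triangle)
          then show ?thesis using that by (simp add: dist_norm)
        qed
        show ?thesis using A h bd by (intro small[OF P(3) _ h(1)]) auto
      qed
      have "(\<Union>y\<in>insert z Y. A \<inter> ball y (\<rho> / 2)) = (A \<inter> ball z (\<rho> / 2)) \<union> (\<Union>y\<in>Y. A \<inter> ball y (\<rho> / 2))" by auto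
      then have "hausdorff_outer ?s (\<Union>y\<in>insert z Y. A \<inter> ball y (\<rho> / 2))
          \<le> hausdorff_outer ?s (A \<inter> ball z (\<rho> / 2)) + hausdorff_outer ?s (\<Union>y\<in>Y. A \<inter> ball y (\<rho> / 2))"
        using hausdorff_outer_Un_le[OF s1] by metis
      also have "\<dots> \<le> ennreal (K * h ^ ?s) + ennreal (real (card Y) * (K * h ^ ?s))" using one insert.IH by (rule add_mono)
      also have "\<dots> = ennreal (K * h ^ ?s + real (card Y) * (K * h ^ ?s))" using K h by (intro ennreal_plus[symmetric]) auto
      also have "K * h ^ ?s + real (card Y) * (K * h ^ ?s) = real (card (insert z Y)) * (K * h ^ ?s)"
        using insert.hyps by (simp add: distrib_right)
      finally show ?case .
    qed
    have "hausdorff_outer ?s A \<le> hausdorff_outer ?s (\<Union>z\<in>Z. A \<inter> ball z (\<rho> / 2))" by (rule hausdorff_outer_mono[OF cov])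
    also have "\<dots> \<le> ennreal (real (card Z) * (K * h ^ ?s))" by (rule fin[OF Z(2)])
    also have "\<dots> \<le> ennreal (C * h ^ ?s)"
    proof (rule ennreal_leI)
      have "0 \<le> K * h ^ ?s" using K h by simp
      then show "real (card Z) * (K * h ^ ?s) \<le> C * h ^ ?s" unfolding C_def by (simp add: distrib_left distrib_right mult_ac)
    qed
    finally show ?thesis .
  qed
  then show ?thesis using C(1) by blast
qed

text \<open>Each line in direction \<open>g p\<close> through a point of a smaller ball meets the
  interface, because \<open>f\<close> changes sign on it. The slab estimate turns this into a lower
  bound for the area.\<close>

lemma interface_measure_lower:
  assumes d2: "2 \<le> DIM('a::euclidean_space)" and r: "0 < r" and M: "0 < M" and R: "0 < R"
  shows "\<exists>c>0. \<forall>(P :: 'a cutfem) p s. partitioned P \<longrightarrow> smooth_interface r M P \<longrightarrow> p \<in> Gam P \<longrightarrow> 0 < s \<longrightarrow> s \<le> R \<longrightarrow>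
    ball p s \<subseteq> Om P \<longrightarrow> ennreal (c * s ^ (DIM('a) - 1)) \<le> hausdorff_outer (DIM('a) - 1) (Gam P \<inter> ball p s)"
proof -
  let ?s = "DIM('a) - 1"
  define \<rho> where "\<rho> = min r (1 / (4 * M))"
  have \<rho>: "0 < \<rho>" "\<rho> \<le> r" "M * \<rho> \<le> 1 / 4" unfolding \<rho>_def using r M by (auto simp: min_def field_simps)
  define K where "K = unit_ball_vol (real ?s) / 12 / 4 ^ DIM('a)"
  have K: "0 < K" unfolding K_def by simp
  \<comment> \<open>Pays for passing from the radius \<open>s\<close> to
    \<open>L = min s \<rho> / 8\<close>, uniformly for \<open>s \<le> R\<close>.\<close>
  define b where "b = min 1 (\<rho> / R) / 8"
  have b: "0 < b" unfolding b_def using \<rho> R by simp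
  define c where "c = K * b ^ ?s"
  have c: "0 < c" unfolding c_def using K b by simp
  have "ennreal (c * s ^ ?s) \<le> hausdorff_outer ?s (Gam P \<inter> ball p s)"
    if part: "partitioned P" and sm: "smooth_interface r M P" and p: "p \<in> Gam P" and s: "0 < s" "s \<le> R" and sub: "ball p s \<subseteq> Om P"
    for P :: "'a cutfem" and p s
  proof -
    define L where "L = min s \<rho> / 8"
    have L: "0 < L" "8 * L \<le> s" "8 * L \<le> \<rho>" unfolding L_def using s \<rho> by auto
    have bL: "b * s \<le> L"
    proof -
      have "\<rho> / R * s \<le> \<rho>" using s R \<rho> by (simp add: divide_le_eq mult.commute)
      then have "min 1 (\<rho> / R) * s \<le> \<rho>" using s by (smt (verit) mult_right_mono min.cobounded2)
      moreover have "min 1 (\<rho> / R) * s \<le> 1 * s" using s by (intro mult_right_mono) auto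
      ultimately show ?thesis unfolding b_def L_def by simp
    qed
    obtain f g where "interface_chart r M P p f g" using interface_chart[OF sm p] by blast
    note fg = interface_chartD[OF this]
    let ?\<nu> = "g p"
    have pr: "p \<in> ball p \<rho>" using \<rho> by simp
    have fp: "f p = 0" using fg(6)[of p] p r by simp
    have mv: "\<bar>f x - f y - ?\<nu> \<bullet> (x - y)\<bar> \<le> norm (x - y) / 4" if "x \<in> ball p \<rho>" "y \<in> ball p \<rho>" for x y
    proof -
      have "\<bar>f x - f y - ?\<nu> \<bullet> (x - y)\<bar> \<le> M * \<rho> * norm (x - y)"
        by (rule chart_mean_value[OF fg(1,2) \<rho>(2,1) that])
      also have "\<dots> \<le> 1 / 4 * norm (x - y)" using \<rho>(3) by (intro mult_right_mono) auto
      finally show ?thesis by simp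
    qed
    have "ball p L \<subseteq> {a + t *\<^sub>R ?\<nu> | a t. a \<in> Gam P \<inter> ball p s \<and> \<bar>t\<bar> \<le> 4 * L}"
    proof
      fix x assume x: "x \<in> ball p L"
      have xp: "norm (x - p) < L" using x by (simp add: dist_norm norm_minus_commute)
      have near: "x + t *\<^sub>R ?\<nu> \<in> ball p (5 * L)" if "\<bar>t\<bar> \<le> 4 * L" for t
      proof -
        have "norm ((x - p) + t *\<^sub>R ?\<nu>) \<le> norm (x - p) + \<bar>t\<bar>" using norm_triangle_ineq[of "x - p" "t *\<^sub>R ?\<nu>"] fg(3) by simp
        then have "norm ((x + t *\<^sub>R ?\<nu>) - p) < 5 * L" using xp that by (simp add: add_diff_eq diff_add_eq)
        then show ?thesis by (simp add: dist_norm norm_minus_commute)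
      qed
      have near\<rho>: "x + t *\<^sub>R ?\<nu> \<in> ball p \<rho>" if "\<bar>t\<bar> \<le> 4 * L" for t using near[OF that] L by auto
      have x\<rho>: "x \<in> ball p \<rho>" using near\<rho>[of 0] L by simp
      have fx: "\<bar>f x\<bar> \<le> 2 * L"
      proof -
        have "\<bar>?\<nu> \<bullet> (x - p)\<bar> \<le> norm (x - p)" using Cauchy_Schwarz_ineq2[of ?\<nu> "x - p"] fg(3) by simp
        then show ?thesis using mv[OF x\<rho> pr] fp xp by linarith
      qed
      have move: "\<bar>f (x + t *\<^sub>R ?\<nu>) - f x - t\<bar> \<le> L" if t: "\<bar>t\<bar> \<le> 4 * L" for t
      proof -
        have gg: "?\<nu> \<bullet> ?\<nu> = 1" using fg(3) by (simp add: dot_square_norm)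
        have "\<bar>f (x + t *\<^sub>R ?\<nu>) - f x - t\<bar> \<le> \<bar>t\<bar> / 4" using mv[OF near\<rho>[OF t] x\<rho>] fg(3) by (simp add: gg)
        then show ?thesis using t by linarith
      qed
      define h where "h t = f (x + t *\<^sub>R ?\<nu>)" for t
      \<comment> \<open>At the two ends \<open>f\<close> has changed by at least \<open>3 L\<close>
        in opposite directions, which exceeds \<open>|f x| \<le> 2 L\<close>.\<close>
      have "h (- (4 * L)) \<le> 0" "0 \<le> h (4 * L)" using move[of "4 * L"] move[of "- (4 * L)"] fx L unfolding h_def by auto
      moreover have "continuous_on {- (4 * L)..4 * L} h"
      proof -
        have "continuous_on (ball p \<rho>) f"
          using fg(1) \<rho> by (intro continuous_at_imp_continuous_on ballI) (meson has_derivative_continuous subset_ball subsetD)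
        then show ?thesis unfolding h_def
          by (rule continuous_on_compose2) (use near\<rho> in \<open>auto intro!: continuous_intros simp: abs_le_iff\<close>)
      qed
      ultimately obtain t where t: "- (4 * L) \<le> t" "t \<le> 4 * L" "h t = 0"
        using IVT'[of h "- (4 * L)" 0 "4 * L"] L by auto
      let ?a = "x + t *\<^sub>R ?\<nu>"
      have tl: "\<bar>t\<bar> \<le> 4 * L" using t by linarith
      have "?a \<in> ball p s" "?a \<in> ball p r" using near[OF tl] L \<rho> by auto
      moreover have "f ?a = 0" using t unfolding h_def by simp
      ultimately have "?a \<notin> sub P 1 \<inter> ball p r" "?a \<notin> sub P 2 \<inter> ball p r" unfolding fg(4,5) by auto
      then have "?a \<notin> sub P 1" "?a \<notin> sub P 2" using \<open>?a \<in> ball p r\<close> by blast+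
      then have aG: "?a \<in> Gam P" using part sub \<open>?a \<in> ball p s\<close> unfolding partitioned_def by blast
      have "x = ?a + (- t) *\<^sub>R ?\<nu>" by simp
      then show "x \<in> {a + t *\<^sub>R ?\<nu> | a t. a \<in> Gam P \<inter> ball p s \<and> \<bar>t\<bar> \<le> 4 * L}"
        using aG \<open>?a \<in> ball p s\<close> tl by (metis (mono_tags, lifting) IntI abs_minus_cancel mem_Collect_eq)
    qed
    from hausdorff_outer_slab_lower[OF d2 L(1) fg(3) this]
    have "ennreal (K * L ^ ?s) \<le> hausdorff_outer ?s (Gam P \<inter> ball p s)" unfolding K_def .
    moreover have "c * s ^ ?s \<le> K * L ^ ?s"
    proof -
      have "(b * s) ^ ?s \<le> L ^ ?s" using bL b s by (intro power_mono) auto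
      then have "K * (b * s) ^ ?s \<le> K * L ^ ?s" using K by (intro mult_left_mono) auto
      then show ?thesis unfolding c_def by (simp only: power_mult_distrib mult.assoc)
    qed
    ultimately show ?thesis using ennreal_leI order_trans by blast
  qed
  then show ?thesis using c by blast
qed

text \<open>The normal is described by charts, hence only locally; its continuity makes the Nitsche
  terms integrable.\<close>

lemma normal_continuous:
  assumes sm: "smooth_interface r M P" and r: "0 < r"
  shows "continuous_on (Gam P) (normal P)"
proof (rule continuous_on_eq_continuous_within[THEN iffD2], rule ballI)
  fix p assume p: "p \<in> Gam P"
  obtain f g where "interface_chart r M P p f g" using interface_chart[OF sm p] by blast
  note fg = interface_chartD[OF this]
  have "continuous_on (Gam P \<inter> ball p r) (\<lambda>y. g y /\<^sub>R norm (g y))"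
    using lipschitz_on_continuous_on[OF fg(2)] fg(6)
    by (intro continuous_intros) (auto intro: continuous_on_subset)
  then have "continuous_on (Gam P \<inter> ball p r) (normal P)"
    by (rule continuous_on_eq) (use fg(6) in auto)
  moreover have "at p within Gam P = at p within (Gam P \<inter> ball p r)"
    using p r by (intro at_within_nhd[of p "ball p r"]) auto
  ultimately show "continuous (at p within Gam P) (normal P)"
    using p r unfolding continuous_on_eq_continuous_within by auto
qed

section \<open>The cut finite element space\<close>

text \<open>The norm equivalence is not part of the setting; it is assumed separately where the
  discrete form is compared with the energy.\<close>

locale cutfem_setting =
  fixes P :: "'a::euclidean_space cutfem" and \<sigma> r M :: real
  assumes d2: "2 \<le> DIM('a)" and k1: "1 \<le> deg P" and domain: "polygonal_domain (Om P)"
    and disc: "cutfem_discretization P" and shape: "shape_regular \<sigma> (mesh P)"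
    and smooth: "smooth_interface r M P" and r0: "0 < r" and M0: "0 < M"
begin

lemma partition: "partitioned P"
  using disc unfolding cutfem_discretization_def by simp

lemma sub_open: "i = 1 \<or> i = 2 \<Longrightarrow> open (sub P i)" and sub_Om: "i = 1 \<or> i = 2 \<Longrightarrow> sub P i \<subseteq> Om P"
  and sub_disjoint: "sub P 1 \<inter> sub P 2 = {}"
  and Om_cases: "x \<in> Om P \<Longrightarrow> x \<in> sub P 1 \<or> x \<in> sub P 2 \<or> x \<in> Gam P"
  using partition unfolding partitioned_def by blast+

end

sublocale cutfem_setting \<subseteq> mesh_complex "mesh P"
  using disc unfolding cutfem_discretization_def simplicial_mesh_def by unfold_locales auto

context cutfem_setting
begin

lemma fat: "T \<in> mesh P \<Longrightarrow> fat \<sigma> T"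
  using shape unfolding shape_regular_def fat_def by blast

lemma dom_eq: "dom = closure (Om P)"
  using disc unfolding cutfem_discretization_def simplicial_mesh_def dom_def by simp

text \<open>A polygonal domain is the interior of a closed set and therefore equals the interior of
  its closure. So the points of \<open>Om P\<close> are exactly the interior points of the
  mesh.\<close>

lemma bounded_Om: "bounded (Om P)" and open_Om: "open (Om P)" and interior_dom: "interior dom = Om P"
proof -
  obtain Q where Q: "finite Q" "\<forall>K\<in>Q. polytope K" "Om P = interior (\<Union>Q)"
    using domain unfolding polygonal_domain_def by blast
  have comp: "compact (\<Union>Q)" using Q polytope_imp_compact by (intro compact_Union) auto
  show "open (Om P)" unfolding Q(3) by simp
  show "bounded (Om P)" unfolding Q(3) using comp by (auto intro: bounded_interior compact_imp_bounded)
  have "closure (Om P) \<subseteq> \<Union>Q" unfolding Q(3) by (rule closure_minimal[OF interior_subset compact_imp_closed[OF comp]])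
  then have "interior dom \<subseteq> Om P" unfolding dom_eq using Q(3) interior_mono by metis
  moreover have "Om P \<subseteq> interior dom" unfolding dom_eq using \<open>open (Om P)\<close> by (intro interior_maximal closure_subset)
  ultimately show "interior dom = Om P" by blast
qed

lemma frontier_eq: "frontier (Om P) = frontier dom"
  unfolding frontier_def interior_dom using open_Om closed_dom dom_eq by (simp add: interior_open)

lemma nodes_eq: "nodes P = mesh_nodes (deg P) \<inter> Om P"
proof -
  have "x \<in> frontier (Om P) \<longleftrightarrow> x \<notin> Om P" if "x \<in> mesh_nodes (deg P)" for x
  proof -
    have "x \<in> closure (Om P)" using mesh_nodes_dom[OF k1] that dom_eq by auto
    then show ?thesis unfolding frontier_def using open_Om by (simp add: interior_open)
  qed
  then show ?thesis unfolding nodes_def mesh_nodes_def[symmetric] by auto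
qed

lemma node_cases:
  assumes "j \<in> nodes P" shows "j \<in> sub P 1 \<and> j \<notin> sub P 2 \<or> j \<in> sub P 2 \<and> j \<notin> sub P 1"
proof -
  have "j \<notin> Gam P" using disc assms unfolding cutfem_discretization_def by blast
  then show ?thesis using Om_cases[of j] sub_disjoint assms unfolding nodes_eq by blast
qed

lemma finite_nodes: "finite (nodes P)"
  unfolding nodes_eq using finite_mesh_nodes by blast

lemma finite_cut_nodes: "finite (cut_nodes P)" and finite_cut_nodes_of: "finite (cut_nodes_of P i)"
  unfolding cut_nodes_of_def cut_nodes_def using finite_nodes by auto

lemma lagrange_node_dichotomy:
  assumes "T \<in> mesh P" "j \<in> lagrange_nodes (deg P) T"
  shows "j \<in> nodes P \<or> j \<in> frontier dom"
proof -
  have "j \<in> mesh_nodes (deg P)" using assms unfolding mesh_nodes_def by blast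
  moreover from this have "j \<in> dom" using mesh_nodes_dom[OF k1] by blast
  ultimately show ?thesis unfolding nodes_eq frontier_def interior_dom[symmetric] using closed_dom by auto
qed

text \<open>Settles the \<open>THE\<close> in \<open>nodal_basis\<close>: the values at the interior
  nodes and the zero boundary values determine the polynomial on each simplex.\<close>

lemma nodal_basis_eq:
  assumes j: "j \<in> nodes P" shows "nodal_basis P j = node_function (deg P) j"
  unfolding nodal_basis_def
proof (rule the_equality)
  have jm: "j \<in> mesh_nodes (deg P)" and jO: "j \<in> interior dom" using j unfolding nodes_eq interior_dom by auto
  have poly: "\<exists>p\<in>poly_space (deg P). \<forall>x\<in>T. node_function (deg P) j x = p x" if "T \<in> mesh P" for T
    using node_function_polyfun[OF k1 jm that] poly_space_iff by blast
  have outside: "node_function (deg P) j x = 0" if "x \<notin> closure (Om P)" for x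
    using that unfolding node_function_def dom_eq by simp
  show nf: "node_function (deg P) j \<in> Vh P \<and> (\<forall>i\<in>nodes P. node_function (deg P) j i = (if i = j then 1 else 0))"
    unfolding Vh_def using node_function_continuous[OF k1 jm] poly outside
      node_function_frontier[OF k1 jm jO] node_function_at_nodes[OF k1 jm] frontier_eq nodes_eq dom_eq by auto
  fix v assume v: "v \<in> Vh P \<and> (\<forall>i\<in>nodes P. v i = (if i = j then 1 else 0))"
  show "v = node_function (deg P) j"
  proof
    fix x
    show "v x = node_function (deg P) j x"
    proof (cases "x \<in> dom")
      case False
      then show ?thesis using v outside[of x] unfolding Vh_def dom_eq by auto
    next
      case True
      then obtain T where T: "T \<in> mesh P" "x \<in> T" unfolding dom_def by auto
      obtain p where p: "polyfun (deg P) p" "\<forall>x\<in>T. v x = p x" using v T poly_space_iff unfolding Vh_def by blast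
      obtain q where q: "polyfun (deg P) q" "\<forall>x\<in>T. node_function (deg P) j x = q x"
        using node_function_polyfun[OF k1 jm T(1)] by blast
      have "p = q"
      proof (rule poly_eq_on_simplex[OF full[OF T(1)] k1 p(1) q(1)])
        fix i assume i: "i \<in> lagrange_nodes (deg P) T"
        then have iT: "i \<in> T" using lagrange_nodes_subset[OF full[OF T(1)] k1] by blast
        have "v i = node_function (deg P) j i"
          using lagrange_node_dichotomy[OF T(1) i]
        proof
          assume "i \<in> nodes P"
          then show ?thesis using v nf by simp
        next
          assume "i \<in> frontier dom"
          then show ?thesis using v nf unfolding Vh_def frontier_eq by simp
        qed
        then show "p i = q i" using p(2) q(2) iT by simp
      qed
      then show ?thesis using p(2) q(2) T by simp
    qed
  qed
qed

section \<open>Cut and uncut simplices\<close>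

lemma cut_mesh_mesh: "T \<in> cut_mesh P \<Longrightarrow> T \<in> mesh P"
  unfolding cut_mesh_def by auto

lemma finite_cut_mesh: "finite (cut_mesh P)"
  using finite_mesh unfolding cut_mesh_def by auto

lemma cut_mesh_ext:
  assumes T: "T \<in> cut_mesh P" and i: "i = 1 \<or> i = 2"
  shows "interior T \<inter> sub P i \<noteq> {}" "T \<in> ext_mesh P i"
proof -
  obtain x where x: "x \<in> interior T" "x \<in> Gam P" using T unfolding cut_mesh_def by blast
  have "x \<in> closure (sub P i)" using x i unfolding Gam_def by auto
  then show 1: "interior T \<inter> sub P i \<noteq> {}"
    using x(1) by (metis closure_iff_nhds_not_empty inf_commute open_interior order_refl)
  show "T \<in> ext_mesh P i" using 1 cut_mesh_mesh[OF T] interior_subset[of T] unfolding ext_mesh_def by blast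
qed

lemma interior_Om: "T \<in> mesh P \<Longrightarrow> interior T \<subseteq> Om P"
  unfolding interior_dom[symmetric] dom_def by (intro interior_mono) auto

lemma closure_interior_mesh:
  assumes T: "T \<in> mesh P" shows "T \<subseteq> closure (interior T)"
proof -
  obtain c \<rho> where r: "0 < \<rho>" "cball c \<rho> \<subseteq> T" using fat[OF T] unfolding fat_def by blast
  have "ball c \<rho> \<subseteq> interior T" using r ball_subset_cball by (intro interior_maximal) auto
  then have "interior T \<noteq> {}" using r(1) by auto
  then show ?thesis using convex_closure_interior[OF convex_mesh[OF T]] closure_subset by auto
qed

text \<open>The interior of an uncut simplex is connected and covered by two disjoint open
  sets.\<close>

lemma uncut_side:
  assumes T: "T \<in> mesh P" "T \<notin> cut_mesh P" and i: "i = 1 \<or> i = 2" and x: "x \<in> interior T" "x \<in> sub P i"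
  shows "interior T \<subseteq> sub P i" "T \<subseteq> closure (sub P i)"
proof -
  have "interior T \<inter> Gam P = {}" using T unfolding cut_mesh_def by auto
  then have cov: "interior T \<subseteq> sub P 1 \<union> sub P 2" using interior_Om[OF T(1)] Om_cases by blast
  have "connected (interior T)" using convex_mesh[OF T(1)] by (intro convex_connected convex_interior)
  then have "sub P 1 \<inter> interior T = {} \<or> sub P 2 \<inter> interior T = {}"
    using connectedD[of "interior T" "sub P 1" "sub P 2"] cov sub_open sub_disjoint by blast
  then show 1: "interior T \<subseteq> sub P i" using cov x i by blast
  show "T \<subseteq> closure (sub P i)" using closure_interior_mesh[OF T(1)] closure_mono[OF 1] by blast
qed

text \<open>The simplex may touch the subdomain in a boundary point only; as the subdomain is open,
  it then also contains interior points of the simplex.\<close>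

lemma uncut_ext:
  assumes T: "T \<in> ext_mesh P i" "T \<notin> cut_mesh P" and i: "i = 1 \<or> i = 2"
  shows "T \<subseteq> closure (sub P i)"
proof -
  have Tm: "T \<in> mesh P" using T unfolding ext_mesh_def by auto
  obtain x where x: "x \<in> T" "x \<in> sub P i" using T unfolding ext_mesh_def by auto
  then have "x \<in> closure (interior T)" using closure_interior_mesh[OF Tm] by blast
  then have "interior T \<inter> sub P i \<noteq> {}"
    using x(2) sub_open[OF i] by (metis closure_iff_nhds_not_empty order_refl)
  then obtain y where "y \<in> interior T" "y \<in> sub P i" by blast
  then show ?thesis using uncut_side[OF Tm T(2) i] by blast
qed

lemma node_in_closure_sub:
  assumes j: "j \<in> nodes P" "j \<in> closure (sub P i)" and i: "i = 1 \<or> i = 2" shows "j \<in> sub P i"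
proof (rule ccontr)
  assume ji: "j \<notin> sub P i"
  define i' where "i' = 3 - i"
  have i': "i' = 1 \<or> i' = 2" using i unfolding i'_def by auto
  have "j \<in> sub P i'" using node_cases[OF j(1)] ji i unfolding i'_def by auto
  moreover have "sub P i \<inter> sub P i' = {}" using sub_disjoint i unfolding i'_def by auto
  ultimately show False using j(2) sub_open[OF i'] by (metis closure_iff_nhds_not_empty inf_commute order_refl)
qed

text \<open>\<open>side_fun c i\<close> is the component \<open>Q\<^sub>i(\<Sum>\<^sub>j c\<^sub>j \<phi>\<^sub>j\<^sup>\<Gamma>)\<close>, \<open>side_val c i\<close> its nodal values, and \<open>side_poly c i T\<close> its
  polynomial on a cut simplex.\<close>

definition side_val :: "('a \<Rightarrow> real) \<Rightarrow> nat \<Rightarrow> 'a \<Rightarrow> real" where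
  "side_val c i j = (if j \<in> cut_nodes P \<and> j \<notin> sub P i then c j else 0)"

definition side_fun :: "('a \<Rightarrow> real) \<Rightarrow> nat \<Rightarrow> 'a \<Rightarrow> real" where
  "side_fun c i x = (\<Sum>j\<in>cut_nodes_of P i. c j * cut_basis P j x)"

definition side_poly :: "('a \<Rightarrow> real) \<Rightarrow> nat \<Rightarrow> 'a set \<Rightarrow> 'a \<Rightarrow> real" where
  "side_poly c i T x = (\<Sum>j\<in>lagrange_nodes (deg P) T. side_val c i j * lagrange (verts T) (deg P) j x)"

lemma side_poly_polyfun:
  assumes T: "T \<in> mesh P" shows "polyfun (deg P) (side_poly c i T)"
  unfolding side_poly_def using lagrange_polyfun[OF nd[OF T] k1] lagrange_nodes_eq[OF full[OF T]]
  by (intro polyfun_sum polyfun_scale) auto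

lemma side_poly_node:
  assumes T: "T \<in> mesh P" and j: "j \<in> lagrange_nodes (deg P) T"
  shows "side_poly c i T j = side_val c i j"
proof -
  have "side_poly c i T j = (\<Sum>l\<in>lagrange_nodes (deg P) T. if l = j then side_val c i j else 0)"
    unfolding side_poly_def using lagrange_at_points[OF nd[OF T] k1] j unfolding lagrange_nodes_eq[OF full[OF T]]
    by (intro sum.cong) auto
  then show ?thesis using j finite_lagrange_nodes[OF full[OF T]] by (simp add: sum.delta)
qed

lemma side_val_linear: "side_val (\<lambda>j. a * c j + d j) i j = a * side_val c i j + side_val d i j"
  unfolding side_val_def by simp

lemma side_poly_linear: "side_poly (\<lambda>j. a * c j + d j) i T x = a * side_poly c i T x + side_poly d i T x"
  unfolding side_poly_def side_val_linear
  by (simp only: distrib_right sum.distrib sum_distrib_left mult.assoc)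

lemma cut_basis_cut:
  assumes "x \<in> cut_dom P" "j \<in> cut_nodes P" shows "cut_basis P j x = node_function (deg P) j x"
  using assms nodal_basis_eq unfolding cut_basis_def restr_def cut_nodes_def by simp

lemma cut_node_mesh: "j \<in> cut_nodes P \<Longrightarrow> j \<in> mesh_nodes (deg P)"
  unfolding cut_nodes_def nodes_eq by auto

lemma side_fun_cut:
  assumes T: "T \<in> cut_mesh P" and x: "x \<in> T"
  shows "side_fun c i x = side_poly c i T x"
proof -
  let ?t = "\<lambda>j. side_val c i j * node_function (deg P) j x" and ?N = "lagrange_nodes (deg P) T"
  have Tm: "T \<in> mesh P" by (rule cut_mesh_mesh[OF T])
  have xc: "x \<in> cut_dom P" using T x unfolding cut_dom_def by auto
  have fin: "finite (cut_nodes_of P i \<union> ?N)" using finite_cut_nodes_of finite_lagrange_nodes[OF full[OF Tm]] by auto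
  have "side_fun c i x = (\<Sum>j\<in>cut_nodes_of P i. ?t j)"
    unfolding side_fun_def cut_nodes_of_def by (intro sum.cong) (auto simp: side_val_def cut_basis_cut[OF xc])
  also have "\<dots> = (\<Sum>j\<in>cut_nodes_of P i \<union> ?N. ?t j)"
    by (rule sum.mono_neutral_left[OF fin]) (auto simp: cut_nodes_of_def side_val_def)
  also have "\<dots> = (\<Sum>j\<in>?N. ?t j)"
  proof (rule sum.mono_neutral_right[OF fin])
    show "\<forall>j\<in>cut_nodes_of P i \<union> ?N - ?N. ?t j = 0"
    proof
      fix j assume j: "j \<in> cut_nodes_of P i \<union> ?N - ?N"
      then have jm: "j \<in> mesh_nodes (deg P)" using cut_node_mesh unfolding cut_nodes_of_def by auto
      then have "j \<notin> T" using mesh_node_lagrange[OF k1 _ Tm] j by blast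
      then show "?t j = 0" using node_function_off[OF k1 jm Tm x] by simp
    qed
  qed auto
  also have "\<dots> = side_poly c i T x"
    unfolding side_poly_def using node_function_on[OF k1 Tm x] lagrange_nodes_subset[OF full[OF Tm] k1]
    by (intro sum.cong) auto
  finally show ?thesis .
qed

text \<open>A node of an uncut simplex of the extended mesh lies in the subdomain, so the corresponding
  component vanishes there.\<close>

lemma side_fun_uncut:
  assumes T: "T \<in> ext_mesh P i" "T \<notin> cut_mesh P" and i: "i = 1 \<or> i = 2" and x: "x \<in> T"
  shows "side_fun c i x = 0"
  unfolding side_fun_def
proof (rule sum.neutral, rule ballI)
  fix j assume j: "j \<in> cut_nodes_of P i"
  have Tm: "T \<in> mesh P" using T unfolding ext_mesh_def by auto
  have jc: "j \<in> cut_nodes P" "j \<in> nodes P" "j \<notin> sub P i" using j unfolding cut_nodes_of_def cut_nodes_def by auto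
  have "j \<notin> T" using node_in_closure_sub[OF jc(2) _ i] uncut_ext[OF T i] jc(3) by blast
  then have "node_function (deg P) j x = 0" by (rule node_function_off[OF k1 cut_node_mesh[OF jc(1)] Tm x])
  then show "c j * cut_basis P j x = 0"
    using cut_basis_cut[OF _ jc(1), of x] unfolding cut_basis_def restr_def by (auto split: if_splits)
qed

text \<open>\<open>cut_coeff\<close> picks some representation; evaluation at the cut nodes shows
  that it is unique there.\<close>

lemma cut_coeff_eq:
  assumes j: "j \<in> cut_nodes P"
  shows "cut_coeff P (\<lambda>x. \<Sum>j\<in>cut_nodes P. c j * cut_basis P j x) j = c j"
proof -
  define w where "w = (\<lambda>x. \<Sum>j\<in>cut_nodes P. c j * cut_basis P j x)"
  have ev: "(\<Sum>l\<in>cut_nodes P. d l * cut_basis P l j) = d j" for d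
  proof -
    have jd: "j \<in> cut_dom P" using j unfolding cut_nodes_def by auto
    have "(\<Sum>l\<in>cut_nodes P. d l * cut_basis P l j) = (\<Sum>l\<in>cut_nodes P. if l = j then d j else 0)"
      using node_function_at_nodes[OF k1 cut_node_mesh cut_node_mesh[OF j]]
      by (intro sum.cong) (auto simp: cut_basis_cut[OF jd])
    then show ?thesis using j finite_cut_nodes by (simp add: sum.delta)
  qed
  have "w = (\<lambda>x. \<Sum>l\<in>cut_nodes P. cut_coeff P w l * cut_basis P l x)"
    unfolding cut_coeff_def by (rule someI[of "\<lambda>d. w = (\<lambda>x. \<Sum>l\<in>cut_nodes P. d l * cut_basis P l x)" c]) (simp add: w_def)
  then have "w j = cut_coeff P w j" using ev[of "cut_coeff P w"] by metis
  moreover have "w j = c j" unfolding w_def by (rule ev)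
  ultimately show ?thesis unfolding w_def by simp
qed

lemma Liso_cut:
  "Liso P (\<lambda>_. 0, \<lambda>x. \<Sum>j\<in>cut_nodes P. c j * cut_basis P j x) i = side_fun c i"
proof
  fix x
  have "Qproj P i (\<lambda>x. \<Sum>j\<in>cut_nodes P. c j * cut_basis P j x) x = side_fun c i x"
    unfolding Qproj_def side_fun_def by (intro sum.cong) (auto simp: cut_coeff_eq cut_nodes_of_def)
  then show "Liso P (\<lambda>_. 0, \<lambda>x. \<Sum>j\<in>cut_nodes P. c j * cut_basis P j x) i x = side_fun c i x"
    unfolding Liso_def restr_def by simp
qed

subsection \<open>Gradients and elementwise integrals\<close>

lemma grad_eqI: "(f has_derivative (\<lambda>v. g \<bullet> v)) (at x) \<Longrightarrow> grad f x = g"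
  for g :: "'b::euclidean_space"
  unfolding grad_def using frechet_derivative_at[of f "\<lambda>v. g \<bullet> v" x]
  by (simp add: euclidean_representation flip: frechet_derivative_at)

lemma polyfun_has_grad: "polyfun k p \<Longrightarrow> (p has_derivative (\<lambda>v. grad p x \<bullet> v)) (at x)"
  using polyfun_frechet[of k p x] by (simp only: polyfun_grad_inner)

lemma grad_on_open:
  assumes p: "polyfun k p" and S: "open S" "x \<in> S" and eq: "\<And>y. y \<in> S \<Longrightarrow> f y = p y"
  shows "grad f x = grad p x"
proof (rule grad_eqI)
  show "(f has_derivative (\<lambda>v. grad p x \<bullet> v)) (at x)"
    by (rule has_derivative_transform_within_open[OF polyfun_has_grad[OF p] S]) (simp add: eq)
qed

lemma grad_linear:
  assumes "polyfun k p" "polyfun k q"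
  shows "grad (\<lambda>x. a * p x + q x) x = a *\<^sub>R grad p x + grad q x"
proof (rule grad_eqI)
  show "((\<lambda>x. a * p x + q x) has_derivative (\<lambda>v. (a *\<^sub>R grad p x + grad q x) \<bullet> v)) (at x)"
    using polyfun_has_grad[OF assms(1), of x] polyfun_has_grad[OF assms(2), of x]
    by (auto intro!: derivative_eq_intros simp: inner_add_left)
qed

lemma side_poly_grad_linear:
  assumes T: "T \<in> mesh P"
  shows "grad (side_poly (\<lambda>j. a * c j + d j) i T) x = a *\<^sub>R grad (side_poly c i T) x + grad (side_poly d i T) x"
proof -
  have "side_poly (\<lambda>j. a * c j + d j) i T = (\<lambda>x. a * side_poly c i T x + side_poly d i T x)"
    by (rule ext) (rule side_poly_linear)
  then show ?thesis using grad_linear[OF side_poly_polyfun[OF T] side_poly_polyfun[OF T]] by simp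
qed

text \<open>Off the frontiers of the simplices, which form a null set, the gradient of a component
  is that of its polynomial on cut simplices and 0 on the other simplices met by \<open>S\<close>.
  The set \<open>S\<close> is general in order to serve the subdomains in the form and the extended
  domains in the norm.\<close>

lemma grad_prod_elementwise:
  assumes S: "S \<in> sets lebesgue" "S \<subseteq> dom" "\<And>T. T \<in> mesh P \<Longrightarrow> S \<inter> interior T \<noteq> {} \<Longrightarrow> T \<in> ext_mesh P i"
    and i: "i = 1 \<or> i = 2"
  shows "grad_prod S (side_fun c i) (side_fun d i) =
    (\<Sum>T\<in>cut_mesh P. LINT x:S \<inter> T|lebesgue. grad (side_poly c i T) x \<bullet> grad (side_poly d i T) x)"
proof -
  let ?g = "\<lambda>T x. grad (side_poly c i T) x \<bullet> grad (side_poly d i T) x"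
  let ?F = "\<lambda>x. indicat_real S x *\<^sub>R (grad (side_fun c i) x \<bullet> grad (side_fun d i) x)"
  let ?G = "\<lambda>x. \<Sum>T\<in>cut_mesh P. indicat_real (S \<inter> T) x *\<^sub>R ?g T x"
  have int: "integrable lebesgue (\<lambda>x. indicat_real (S \<inter> T) x *\<^sub>R ?g T x)" if T: "T \<in> cut_mesh P" for T
  proof -
    have Tm: "T \<in> mesh P" by (rule cut_mesh_mesh[OF T])
    have "set_integrable lebesgue T (?g T)"
      using polyfun_grad_continuous[OF side_poly_polyfun[OF Tm]]
      by (intro set_integrable_lebesgue_compact compact_mesh[OF Tm] continuous_on_inner)
    moreover have "S \<inter> T \<in> sets lebesgue" using S(1) closed_mesh[OF Tm] by auto
    ultimately have "set_integrable lebesgue (S \<inter> T) (?g T)" by (rule set_integrable_subset) auto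
    then show ?thesis unfolding set_integrable_def .
  qed
  have neg: "negligible (\<Union>T\<in>mesh P. frontier T)"
    using finite_mesh convex_mesh bounded_mesh by (intro negligible_Union) (auto intro: negligible_convex_frontier)
  then have "AE x in lebesgue. x \<notin> (\<Union>T\<in>mesh P. frontier T)"
    by (intro AE_not_in) (simp add: negligible_iff_null_sets)
  then have ae: "AE x in lebesgue. ?G x = ?F x"
  proof (rule AE_mp, intro AE_I2 impI)
    fix x assume x: "x \<notin> (\<Union>T\<in>mesh P. frontier T)"
    show "?G x = ?F x"
    proof (cases "x \<in> S")
      case True
      then obtain T where T: "T \<in> mesh P" "x \<in> T" using S(2) unfolding dom_def by auto
      have xi: "x \<in> interior T" using x T closed_mesh[OF T(1)] by (auto simp: frontier_def)
      have only: "T' = T" if "T' \<in> mesh P" "x \<in> T'" for T' using interior_disjoint[OF T(1) that(1) xi that(2)] by simp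
      have ext: "T \<in> ext_mesh P i" using S(3)[OF T(1)] True xi by blast
      show ?thesis
      proof (cases "T \<in> cut_mesh P")
        case cut: True
        have g: "grad (side_fun e i) x = grad (side_poly e i T) x" for e
          by (rule grad_on_open[OF side_poly_polyfun[OF T(1)] open_interior xi])
            (use interior_subset side_fun_cut[OF cut] in blast)
        have "?G x = (\<Sum>T'\<in>cut_mesh P. if T' = T then ?g T x else 0)"
          using only True T(2) cut_mesh_mesh by (intro sum.cong) (auto simp: indicator_def)
        also have "\<dots> = ?g T x" using cut finite_cut_mesh by (simp add: sum.delta)
        finally show ?thesis using True g by simp
      next
        case uncut: False
        have "grad (side_fun e i) x = grad (\<lambda>_. 0) x" for e
          by (rule grad_on_open[OF polyfun_const open_interior xi])
            (use interior_subset side_fun_uncut[OF ext uncut i] in blast)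
        moreover have "grad (\<lambda>_. 0 :: real) x = 0" by (rule grad_eqI) simp
        ultimately have "?F x = 0" by simp
        moreover have "?G x = 0"
          using only uncut cut_mesh_mesh by (intro sum.neutral) (auto simp: indicator_def)
        ultimately show ?thesis by simp
      qed
    qed (simp add: indicator_def)
  qed
  have Gm: "?G \<in> borel_measurable lebesgue" using int by (intro borel_measurable_sum) auto
  \<comment> \<open>Nothing is known about the gradient on the faces; by completeness, measurability
    is inherited through equality almost everywhere.\<close>
  have Fm: "?F \<in> borel_measurable lebesgue" using borel_measurable_AE[OF Gm ae] .
  have "grad_prod S (side_fun c i) (side_fun d i) = integral\<^sup>L lebesgue ?F"
    unfolding grad_prod_def set_lebesgue_integral_def ..
  also have "\<dots> = integral\<^sup>L lebesgue ?G" by (rule integral_cong_AE[OF Fm Gm]) (use ae in \<open>auto elim: AE_mp\<close>)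
  also have "\<dots> = (\<Sum>T\<in>cut_mesh P. LINT x:S \<inter> T|lebesgue. ?g T x)"
    unfolding set_lebesgue_integral_def using int by (intro Bochner_Integration.integral_sum)
  finally show ?thesis .
qed

lemma grad_prod_sub:
  assumes i: "i = 1 \<or> i = 2"
  shows "grad_prod (sub P i) (side_fun c i) (side_fun d i) =
    (\<Sum>T\<in>cut_mesh P. LINT x:sub P i \<inter> T|lebesgue. grad (side_poly c i T) x \<bullet> grad (side_poly d i T) x)"
proof (rule grad_prod_elementwise[OF _ _ _ i])
  show "sub P i \<in> sets lebesgue" using sub_open[OF i] by (simp add: borel_open)
  show "sub P i \<subseteq> dom" using sub_Om[OF i] closure_subset dom_eq by auto
  fix T assume "T \<in> mesh P" "sub P i \<inter> interior T \<noteq> {}"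
  then show "T \<in> ext_mesh P i" unfolding ext_mesh_def using interior_subset by blast
qed

lemma grad_prod_ext:
  assumes i: "i = 1 \<or> i = 2"
  shows "grad_prod (ext_dom P i) (side_fun c i) (side_fun d i) =
    (\<Sum>T\<in>cut_mesh P. LINT x:T|lebesgue. grad (side_poly c i T) x \<bullet> grad (side_poly d i T) x)"
proof -
  have em: "T \<in> mesh P" if "T \<in> ext_mesh P i" for T using that unfolding ext_mesh_def by auto
  have "grad_prod (ext_dom P i) (side_fun c i) (side_fun d i) =
    (\<Sum>T\<in>cut_mesh P. LINT x:ext_dom P i \<inter> T|lebesgue. grad (side_poly c i T) x \<bullet> grad (side_poly d i T) x)"
  proof (rule grad_prod_elementwise[OF _ _ _ i])
    have "closed (ext_dom P i)" unfolding ext_dom_def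
      using finite_mesh em closed_mesh by (intro closed_Union) (auto intro: finite_subset)
    then show "ext_dom P i \<in> sets lebesgue" by (simp add: borel_closed)
    show "ext_dom P i \<subseteq> dom" unfolding ext_dom_def dom_def using em by blast
    fix T assume T: "T \<in> mesh P" "ext_dom P i \<inter> interior T \<noteq> {}"
    then obtain x T' where x: "T' \<in> ext_mesh P i" "x \<in> T'" "x \<in> interior T" unfolding ext_dom_def by blast
    then show "T \<in> ext_mesh P i" using interior_disjoint[OF T(1) em[OF x(1)] x(3,2)] by simp
  qed
  moreover have "ext_dom P i \<inter> T = T" if "T \<in> cut_mesh P" for T
    using cut_mesh_ext(2)[OF that i] unfolding ext_dom_def by blast
  ultimately show ?thesis by simp
qed

end

section \<open>Bilinearity and energy\<close>

text \<open>Compact sets need not have finite Hausdorff measure, so finiteness is assumed here and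
  proved separately for the interface and for facets.\<close>

lemma surface_set_integrable:
  fixes K :: "'a::euclidean_space set" and f :: "'a \<Rightarrow> real"
  assumes s: "1 \<le> s" and K: "compact K" "hausdorff_outer s K < \<infinity>" and f: "continuous_on K f"
  shows "set_integrable (hausdorff s) K f"
proof -
  have Kb: "K \<in> sets borel" using K(1) by (simp add: borel_compact)
  obtain B where B: "\<And>x. x \<in> K \<Longrightarrow> norm (f x) \<le> B"
    using compact_imp_bounded[OF compact_continuous_image[OF f K(1)]] unfolding bounded_iff by auto
  have "integrable (hausdorff s) (\<lambda>x. B * indicat_real K x)"
    using Kb K(2) emeasure_hausdorff[OF s Kb] by (intro integrable_mult_right integrable_real_indicator) auto
  moreover have "(\<lambda>x. indicat_real K x *\<^sub>R f x) \<in> borel_measurable (hausdorff s)"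
    using borel_measurable_continuous_on_indicator[OF Kb f] by (simp add: measurable_cong_sets[OF sets_hausdorff refl])
  moreover have "AE x in hausdorff s. norm (indicat_real K x *\<^sub>R f x) \<le> norm (B * indicat_real K x)"
    using B by (intro AE_I2) (auto simp: indicator_def intro: order_trans[OF _ abs_ge_self])
  ultimately show ?thesis unfolding set_integrable_def by (rule Bochner_Integration.integrable_bound)
qed

text \<open>Bilinearity in the coefficient functions, with additivity and homogeneity in one
  identity. The integrals in \<open>Ah\<close> are additive only for integrable integrands, so it
  has to be proved term by term.\<close>

definition bilinear_form :: "(('a \<Rightarrow> real) \<Rightarrow> ('a \<Rightarrow> real) \<Rightarrow> real) \<Rightarrow> bool" where
  "bilinear_form F \<longleftrightarrow> (\<forall>a c d e. F (\<lambda>j. a * c j + d j) e = a * F c e + F d e) \<and>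
     (\<forall>a c d e. F e (\<lambda>j. a * c j + d j) = a * F e c + F e d)"

lemma bilinear_formD:
  assumes "bilinear_form F"
  shows "F (\<lambda>j. a * c j + d j) e = a * F c e + F d e" "F e (\<lambda>j. a * c j + d j) = a * F e c + F e d"
  using assms unfolding bilinear_form_def by simp_all

lemma bilinear_form_sum:
  "(\<And>i. i \<in> I \<Longrightarrow> bilinear_form (F i)) \<Longrightarrow> bilinear_form (\<lambda>c d. \<Sum>i\<in>I. F i c d)"
  unfolding bilinear_form_def by (simp add: sum.distrib sum_distrib_left)

lemma bilinear_form_scale: "bilinear_form F \<Longrightarrow> bilinear_form (\<lambda>c d. t * F c d)"
  unfolding bilinear_form_def by (simp add: distrib_left mult.left_commute)

lemma bilinear_form_divide: "bilinear_form F \<Longrightarrow> bilinear_form (\<lambda>c d. F c d / t)"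
  unfolding bilinear_form_def by (simp add: add_divide_distrib)

lemma bilinear_form_add: "bilinear_form F \<Longrightarrow> bilinear_form G \<Longrightarrow> bilinear_form (\<lambda>c d. F c d + G c d)"
  unfolding bilinear_form_def by (simp add: distrib_left)

lemma bilinear_form_swap: "bilinear_form F \<Longrightarrow> bilinear_form (\<lambda>c d. F d c)"
  unfolding bilinear_form_def by blast

lemma bilinear_form_integral:
  fixes f g :: "('b \<Rightarrow> real) \<Rightarrow> 'a \<Rightarrow> 'c::euclidean_space"
  assumes f: "\<And>a c d x. x \<in> S \<Longrightarrow> f (\<lambda>j. a * c j + d j) x = a *\<^sub>R f c x + f d x"
    and g: "\<And>a c d x. x \<in> S \<Longrightarrow> g (\<lambda>j. a * c j + d j) x = a *\<^sub>R g c x + g d x"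
    and int: "\<And>c d. set_integrable N S (\<lambda>x. f c x \<bullet> g d x)"
  shows "bilinear_form (\<lambda>c d. LINT x:S|N. f c x \<bullet> g d x)"
  unfolding bilinear_form_def
proof (intro conjI allI)
  fix a c d e
  have "(LINT x:S|N. f (\<lambda>j. a * c j + d j) x \<bullet> g e x) = (LINT x:S|N. a * (f c x \<bullet> g e x) + f d x \<bullet> g e x)"
    unfolding set_lebesgue_integral_def
    by (intro Bochner_Integration.integral_cong) (auto simp: indicator_def f inner_add_left)
  also have "\<dots> = a * (LINT x:S|N. f c x \<bullet> g e x) + (LINT x:S|N. f d x \<bullet> g e x)"
    using int by (subst set_integral_add) auto
  finally show "(LINT x:S|N. f (\<lambda>j. a * c j + d j) x \<bullet> g e x) = \<dots>" .
  have "(LINT x:S|N. f e x \<bullet> g (\<lambda>j. a * c j + d j) x) = (LINT x:S|N. a * (f e x \<bullet> g c x) + f e x \<bullet> g d x)"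
    unfolding set_lebesgue_integral_def
    by (intro Bochner_Integration.integral_cong) (auto simp: indicator_def g inner_add_right)
  also have "\<dots> = a * (LINT x:S|N. f e x \<bullet> g c x) + (LINT x:S|N. f e x \<bullet> g d x)"
    using int by (subst set_integral_add) auto
  finally show "(LINT x:S|N. f e x \<bullet> g (\<lambda>j. a * c j + d j) x) = \<dots>" .
qed

lemma bilinear_form_expand:
  assumes F: "bilinear_form F" and J: "finite J"
  shows "F (\<lambda>l. \<Sum>j\<in>J. c j * e j l) (\<lambda>l. \<Sum>j\<in>J. d j * e j l) = (\<Sum>j\<in>J. \<Sum>l\<in>J. c j * d l * F (e j) (e l))"
proof -
  have z: "F (\<lambda>_. 0) f = 0" "F f (\<lambda>_. 0) = 0" for f
    using bilinear_formD[OF F, where a = 1 and c = "\<lambda>_. 0" and d = "\<lambda>_. 0" and e = f] by simp_all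
  have left: "F (\<lambda>l. \<Sum>j\<in>K. c j * e j l) f = (\<Sum>j\<in>K. c j * F (e j) f)" if "finite K" for K f
    using that
  proof (induction K rule: finite_induct)
    case (insert j K)
    have "F (\<lambda>l. c j * e j l + (\<Sum>j\<in>K. c j * e j l)) f = c j * F (e j) f + F (\<lambda>l. \<Sum>j\<in>K. c j * e j l) f"
      by (rule bilinear_formD(1)[OF F])
    then show ?case using insert by simp
  qed (simp add: z)
  have right: "F f (\<lambda>l. \<Sum>j\<in>K. d j * e j l) = (\<Sum>j\<in>K. d j * F f (e j))" if "finite K" for K f
    using that
  proof (induction K rule: finite_induct)
    case (insert j K)
    have "F f (\<lambda>l. d j * e j l + (\<Sum>j\<in>K. d j * e j l)) = d j * F f (e j) + F f (\<lambda>l. \<Sum>j\<in>K. d j * e j l)"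
      by (rule bilinear_formD(2)[OF F])
    then show ?case using insert by simp
  qed (simp add: z)
  show ?thesis unfolding left[OF J] right[OF J] by (simp add: sum_distrib_left mult.assoc)
qed

text \<open>The two Nitsche terms are interchanged; every other term is symmetric by itself.\<close>

lemma Ah_sym: "Ah P u v = Ah P v u"
proof -
  have "grad_prod S f g = grad_prod S g f" for S and f g :: "'a \<Rightarrow> real" unfolding grad_prod_def by (simp add: inner_commute)
  moreover have "jump_prod P u v = jump_prod P v u" unfolding jump_prod_def by (simp add: mult.commute)
  moreover have "Gh P u v = Gh P v u" unfolding Gh_def by (simp add: mult.commute)
  ultimately show ?thesis unfolding Ah_def by simp
qed

text \<open>On polynomials the iterated \<open>deriv\<close> in \<open>dir_deriv\<close> becomes the
  iteration of this linear operator, which does not leave the polynomials.\<close>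

definition dir_grad :: "'a::euclidean_space \<Rightarrow> ('a \<Rightarrow> real) \<Rightarrow> 'a \<Rightarrow> real" where
  "dir_grad n p x = grad p x \<bullet> n"

lemma dir_grad_polyfun: "polyfun k p \<Longrightarrow> polyfun k (dir_grad n p)"
  using polyfun_frechet_derivative[of k p n] by (simp add: dir_grad_def[abs_def] polyfun_grad_inner)

lemma dir_grad_pow_polyfun: "polyfun k p \<Longrightarrow> polyfun k ((dir_grad n ^^ l) p)"
  by (induction l) (auto intro: dir_grad_polyfun)

lemma dir_deriv_polyfun:
  assumes p: "polyfun k p" shows "dir_deriv l n p x = (dir_grad n ^^ l) p x"
proof -
  have "(deriv ^^ l) (\<lambda>t. p (x + t *\<^sub>R n)) = (\<lambda>t. (dir_grad n ^^ l) p (x + t *\<^sub>R n))"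
  proof (induction l)
    case (Suc l)
    have "deriv (\<lambda>t. (dir_grad n ^^ l) p (x + t *\<^sub>R n)) t = dir_grad n ((dir_grad n ^^ l) p) (x + t *\<^sub>R n)" for t
      unfolding dir_grad_def[of n "(dir_grad n ^^ l) p"]
      by (rule DERIV_imp_deriv[OF polyfun_line_derivative[OF dir_grad_pow_polyfun[OF p]]])
    then show ?case using Suc by auto
  qed simp
  then show ?thesis unfolding dir_deriv_def by simp
qed

section \<open>Bilinearity of the discrete form\<close>

context cutfem_setting
begin

lemma dir_grad_linear:
  assumes "polyfun k p" "polyfun k q"
  shows "dir_grad n (\<lambda>x. a * p x + q x) = (\<lambda>x. a * dir_grad n p x + dir_grad n q x)"
  by (rule ext) (simp add: dir_grad_def grad_linear[OF assms] inner_add_left)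

lemma dir_grad_pow_linear:
  assumes "polyfun k p" "polyfun k q"
  shows "(dir_grad n ^^ l) (\<lambda>x. a * p x + q x) = (\<lambda>x. a * (dir_grad n ^^ l) p x + (dir_grad n ^^ l) q x)"
  by (induction l) (simp_all add: dir_grad_linear[OF dir_grad_pow_polyfun[OF assms(1)] dir_grad_pow_polyfun[OF assms(2)]])

text \<open>A stabilization face may border an uncut simplex of the extended mesh, where the
  component vanishes; this polynomial covers both kinds of simplices.\<close>

definition face_poly :: "('a \<Rightarrow> real) \<Rightarrow> nat \<Rightarrow> 'a set \<Rightarrow> 'a \<Rightarrow> real" where
  "face_poly c i T = (if T \<in> cut_mesh P then side_poly c i T else (\<lambda>_. 0))"

lemma face_poly_polyfun: "polyfun (deg P) (face_poly c i T)"
  unfolding face_poly_def using side_poly_polyfun[OF cut_mesh_mesh] by (auto intro: polyfun_const)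

lemma face_poly_linear: "face_poly (\<lambda>j. a * c j + d j) i T = (\<lambda>x. a * face_poly c i T x + face_poly d i T x)"
  unfolding face_poly_def by (auto simp: side_poly_linear)

lemma piece_eqI:
  assumes T: "T \<in> mesh P" and p: "polyfun (deg P) p" and eq: "\<And>x. x \<in> T \<Longrightarrow> v x = p x"
  shows "piece P T v = p"
  unfolding piece_def
proof (rule the_equality)
  show "p \<in> poly_space (deg P) \<and> (\<forall>x\<in>T. p x = v x)" using p eq poly_space_iff by metis
  fix q assume q: "q \<in> poly_space (deg P) \<and> (\<forall>x\<in>T. q x = v x)"
  show "q = p"
  proof (rule poly_eq_on_simplex[OF full[OF T] k1 _ p])
    show "polyfun (deg P) q" using q poly_space_iff by blast
    fix x assume "x \<in> lagrange_nodes (deg P) T"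
    then have "x \<in> T" using lagrange_nodes_subset[OF full[OF T] k1] by blast
    then show "q x = p x" using q eq by simp
  qed
qed

lemma piece_side_fun:
  assumes T: "T \<in> ext_mesh P i" and i: "i = 1 \<or> i = 2"
  shows "piece P T (side_fun c i) = face_poly c i T"
proof (rule piece_eqI[OF _ face_poly_polyfun])
  show "T \<in> mesh P" using T unfolding ext_mesh_def by simp
  fix x assume "x \<in> T"
  then show "side_fun c i x = face_poly c i T x"
    using side_fun_cut[of T x c i] side_fun_uncut[OF T _ i, of x c] unfolding face_poly_def by auto
qed

lemma gface_facet:
  assumes "F \<in> gfaces P i" "i = 1 \<or> i = 2"
  shows "\<exists>T\<in>cut_mesh P. \<exists>T'\<in>ext_mesh P i. T \<noteq> T' \<and> F = T \<inter> T' \<and> F facet_of T \<and> F facet_of T'"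
proof -
  have "\<forall>i\<in>{1,2}. \<forall>F\<in>gfaces P i.
      \<exists>T\<in>cut_mesh P. \<exists>T'\<in>ext_mesh P i. T \<noteq> T' \<and> F = T \<inter> T' \<and> F facet_of T \<and> F facet_of T'"
    using disc unfolding cutfem_discretization_def by (elim conjE)
  from bspec[OF bspec[OF this] assms(1)] assms(2) show ?thesis by simp
qed

text \<open>A facet belongs to only two simplices, so the pair chosen by \<open>SOME\<close> is the
  one from the structural assumption, and the component is a polynomial on both sides.\<close>

lemma face_sides_ext:
  assumes F: "F \<in> gfaces P i" and i: "i = 1 \<or> i = 2"
  shows "fst (face_sides P F) \<in> ext_mesh P i" "snd (face_sides P F) \<in> ext_mesh P i"
proof -
  from gface_facet[OF F i]
  obtain T T' where T: "T \<in> cut_mesh P" "T' \<in> ext_mesh P i" "T \<noteq> T'" "F = T \<inter> T'" "F facet_of T" by (elim bexE conjE)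
  have Tm: "T \<in> mesh P" "T' \<in> mesh P" using T cut_mesh_mesh unfolding ext_mesh_def by auto
  have "\<exists>p. case p of (S, S') \<Rightarrow> S \<in> mesh P \<and> S' \<in> mesh P \<and> S \<noteq> S' \<and> F = S \<inter> S'"
    using T Tm by (intro exI[of _ "(T, T')"]) simp
  then have "case face_sides P F of (S, S') \<Rightarrow> S \<in> mesh P \<and> S' \<in> mesh P \<and> S \<noteq> S' \<and> F = S \<inter> S'"
    unfolding face_sides_def by (rule someI_ex)
  then obtain S S' where S: "face_sides P F = (S, S')" "S \<in> mesh P" "S' \<in> mesh P" "F = S \<inter> S'"
    by (auto split: prod.splits)
  have "R = T \<or> R = T'" if "R \<in> mesh P" "F \<subseteq> R" for R
    using facet_shared_by_two[OF d2 Tm T(3) _ that(1)] T(4,5) that(2) by simp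
  then have "S \<in> ext_mesh P i" "S' \<in> ext_mesh P i" using S T cut_mesh_ext(2)[OF T(1) i] by auto
  then show "fst (face_sides P F) \<in> ext_mesh P i" "snd (face_sides P F) \<in> ext_mesh P i" using S(1) by auto
qed

lemma Gam_closed: "closed (Gam P)"
  unfolding Gam_def by auto

lemma compact_cut: "T \<in> mesh P \<Longrightarrow> compact (T \<inter> Gam P)"
  using compact_mesh Gam_closed by (intro compact_Int_closed)

lemma cut_measure_finite:
  assumes T: "T \<in> mesh P" shows "hausdorff_outer (DIM('a) - 1) (T \<inter> Gam P) < \<infinity>"
proof -
  obtain C where C: "\<forall>(P' :: 'a cutfem) A h. Om P' = Om P \<longrightarrow> partitioned P' \<longrightarrow> smooth_interface r M P' \<longrightarrow> A \<subseteq> Gam P' \<longrightarrow>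
    0 < h \<longrightarrow> (\<forall>x\<in>A. \<forall>y\<in>A. norm (x - y) \<le> h) \<longrightarrow>
    hausdorff_outer (DIM('a) - 1) A \<le> ennreal (C * h ^ (DIM('a) - 1))"
    using interface_measure_upper[OF d2 r0 M0 bounded_Om] by blast
  have "\<forall>x\<in>T \<inter> Gam P. \<forall>y\<in>T \<inter> Gam P. norm (x - y) \<le> diameter T"
    using diameter_bounded_bound[OF bounded_mesh[OF T]] by (auto simp: dist_norm)
  moreover have "0 < diameter T" using fatE[OF fat[OF T] bounded_mesh[OF T]] by metis
  ultimately have "hausdorff_outer (DIM('a) - 1) (T \<inter> Gam P) \<le> ennreal (C * diameter T ^ (DIM('a) - 1))"
    using C partition smooth by blast
  then show ?thesis by (auto intro: le_less_trans)
qed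

text \<open>A facet lies in a hyperplane, so its secants are orthogonal to a fixed unit vector and
  the graph estimate applies.\<close>

lemma facet_measure_finite:
  assumes T: "T \<in> mesh P" and F: "F facet_of T" shows "compact F" "hausdorff_outer (DIM('a) - 1) F < \<infinity>"
proof -
  show comp: "compact F" using F compact_mesh[OF T] convex_mesh[OF T] unfolding facet_of_def
    using face_of_imp_compact by blast
  have "aff_dim F = int DIM('a) - 1" using F aff_dim_simplex[OF full[OF T]] unfolding facet_of_def by simp
  then have "\<exists>a b. a \<noteq> 0 \<and> affine hull F = {x. a \<bullet> x = b}" 
    using aff_dim_eq_hyperplane[of F] d2 by (simp add: of_nat_diff)
  then obtain a b where ab: "a \<noteq> 0" "affine hull F = {x. a \<bullet> x = b}" by (elim exE conjE)
  define n where "n = a /\<^sub>R norm a"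
  have n: "norm n = 1" unfolding n_def using ab by simp
  have flat: "n \<bullet> (x - y) = 0" if "x \<in> F" "y \<in> F" for x y
  proof -
    have "x \<in> affine hull F" "y \<in> affine hull F" using that by (auto intro: hull_inc)
    then have "a \<bullet> x = b" "a \<bullet> y = b" unfolding ab(2) by auto
    then show ?thesis unfolding n_def by (simp add: inner_diff_right)
  qed
  have "0 \<le> diameter F" using comp by (intro diameter_ge_0 compact_imp_bounded)
  then have "hausdorff_outer (DIM('a) - 1) F \<le> ennreal (unit_ball_vol (real (DIM('a) - 1)) * (5 * real DIM('a) * (diameter F + 1)) ^ (DIM('a) - 1))"
  proof (intro hausdorff_outer_graph_le[OF d2 _ n])
    show "norm (x - y) \<le> diameter F + 1" if "x \<in> F" "y \<in> F" for x y
      using diameter_bounded_bound[OF compact_imp_bounded[OF comp] that] by (simp add: dist_norm)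
  qed (use flat in auto)
  then show "hausdorff_outer (DIM('a) - 1) F < \<infinity>" by (auto intro: le_less_trans)
qed

definition side_jump :: "('a \<Rightarrow> real) \<Rightarrow> 'a set \<Rightarrow> 'a \<Rightarrow> real" where
  "side_jump c T x = side_poly c 1 T x - side_poly c 2 T x"

definition side_flux :: "('a \<Rightarrow> real) \<Rightarrow> 'a set \<Rightarrow> 'a \<Rightarrow> real" where
  "side_flux c T x = (\<Sum>i\<in>{1,2}. weight P i T *\<^sub>R (- diffc P i *\<^sub>R grad (side_poly c i T) x)) \<bullet> normal P x"

lemma side_jump_linear: "side_jump (\<lambda>j. a * c j + d j) T x = a *\<^sub>R side_jump c T x + side_jump d T x"
  unfolding side_jump_def side_poly_linear by (simp add: right_diff_distrib)

lemma side_jump_polyfun: "T \<in> mesh P \<Longrightarrow> polyfun (deg P) (side_jump c T)"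
  unfolding side_jump_def[abs_def] by (intro polyfun_diff side_poly_polyfun)

lemma side_flux_linear:
  assumes "T \<in> mesh P" shows "side_flux (\<lambda>j. a * c j + d j) T x = a *\<^sub>R side_flux c T x + side_flux d T x"
  unfolding side_flux_def side_poly_grad_linear[OF assms]
  by (simp add: inner_add_left scaleR_add_right inner_diff_left) (simp add: distrib_left right_diff_distrib mult.left_commute)

lemma side_flux_continuous:
  assumes "T \<in> mesh P" shows "continuous_on (T \<inter> Gam P) (side_flux c T)"
  unfolding side_flux_def
  using normal_continuous[OF smooth r0] polyfun_grad_continuous[OF side_poly_polyfun[OF assms]]
  by (intro continuous_intros) (auto intro: continuous_on_subset)

lemma jump_side_fun: "T \<in> cut_mesh P \<Longrightarrow> x \<in> T \<Longrightarrow> jump (side_fun c) x = side_jump c T x"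
  unfolding jump_def side_jump_def by (simp add: side_fun_cut)

lemma surface_integral_cong: "(\<And>x. x \<in> S \<Longrightarrow> f x = g x) \<Longrightarrow> surface_integral S f = surface_integral S g"
  for f g :: "'a \<Rightarrow> real"
  unfolding surface_integral_def set_lebesgue_integral_def
  by (intro Bochner_Integration.integral_cong) (auto simp: indicator_def)

lemma jump_prod_side:
  "jump_prod P (side_fun c) (side_fun d) =
    (\<Sum>T\<in>cut_mesh P. surface_integral (T \<inter> Gam P) (\<lambda>x. side_jump c T x * side_jump d T x) / diameter T)"
  unfolding jump_prod_def
  by (intro sum.cong refl arg_cong2[of _ _ _ _ "(/)"] surface_integral_cong) (auto simp: jump_side_fun)

lemma Nhc_side:
  "Nhc P (side_fun c) (side_fun d) =
    (\<Sum>T\<in>cut_mesh P. surface_integral (T \<inter> Gam P) (\<lambda>x. side_flux d T x * side_jump c T x))"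
  unfolding Nhc_def
proof (intro sum.cong refl surface_integral_cong)
  fix T x assume T: "T \<in> cut_mesh P" and x: "x \<in> T \<inter> Gam P"
  have "piece P T (side_fun d i) = side_poly d i T" if "i \<in> {1,2}" for i
    using piece_side_fun[OF cut_mesh_ext(2)[OF T]] that T unfolding face_poly_def by auto
  then have "(\<Sum>i\<in>{1,2}. weight P i T *\<^sub>R (- diffc P i *\<^sub>R grad (piece P T (side_fun d i)) x)) \<bullet> normal P x = side_flux d T x"
    unfolding side_flux_def by (intro arg_cong2[of _ _ _ _ "(\<bullet>)"] sum.cong) auto
  then show "(\<Sum>i\<in>{1,2}. weight P i T *\<^sub>R (- diffc P i *\<^sub>R grad (piece P T (side_fun d i)) x)) \<bullet> normal P x * jump (side_fun c) x
      = side_flux d T x * side_jump c T x"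
    using jump_side_fun[OF T] x by simp
qed

lemma face_jump_side:
  assumes F: "F \<in> gfaces P i" and i: "i = 1 \<or> i = 2"
  shows "face_jump P l F (side_fun c i) x =
    (dir_grad (face_normal F) ^^ l) (face_poly c i (fst (face_sides P F))) x -
    (dir_grad (face_normal F) ^^ l) (face_poly c i (snd (face_sides P F))) x"
  unfolding face_jump_def piece_side_fun[OF face_sides_ext(1)[OF F i] i] piece_side_fun[OF face_sides_ext(2)[OF F i] i]
  by (simp add: dir_deriv_polyfun[OF face_poly_polyfun])

lemma surface_bilinear:
  fixes K :: "'a set"
  assumes K: "compact K" "hausdorff_outer (DIM('a) - 1) K < \<infinity>"
    and f: "\<And>a c d x. x \<in> K \<Longrightarrow> f (\<lambda>j. a * c j + d j) x = a *\<^sub>R f c x + f d x" "\<And>c. continuous_on K (f c)"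
    and g: "\<And>a c d x. x \<in> K \<Longrightarrow> g (\<lambda>j. a * c j + d j) x = a *\<^sub>R g c x + g d x" "\<And>c. continuous_on K (g c)"
  shows "bilinear_form (\<lambda>c d. surface_integral K (\<lambda>x. f c x * g d x :: real))"
proof -
  have "set_integrable (hausdorff (DIM('a) - 1)) K (\<lambda>x. f c x \<bullet> g d x)" for c d
    using d2 by (intro surface_set_integrable K continuous_on_inner f(2) g(2)) auto
  then have "bilinear_form (\<lambda>c d. LINT x:K|hausdorff (DIM('a) - 1). f c x \<bullet> g d x)"
    by (intro bilinear_form_integral[where f = f and g = g] f(1) g(1))
  then show ?thesis unfolding surface_integral_def by simp
qed

text \<open>Linearity of each integral rests on integrability: the integrands are continuous on
  compact sets of finite measure, or restricted to measurable parts of them.\<close>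

lemma Ah_bilinear: "bilinear_form (\<lambda>c d. Ah P (side_fun c) (side_fun d))"
proof -
  have A: "bilinear_form (\<lambda>c d. \<Sum>i\<in>{1,2}. diffc P i * grad_prod (sub P i) (side_fun c i) (side_fun d i))"
  proof (intro bilinear_form_sum bilinear_form_scale)
    fix i :: nat assume "i \<in> {1,2}"
    then have i: "i = 1 \<or> i = 2" by auto
    show "bilinear_form (\<lambda>c d. grad_prod (sub P i) (side_fun c i) (side_fun d i))"
      unfolding grad_prod_sub[OF i]
    proof (rule bilinear_form_sum)
      fix T assume "T \<in> cut_mesh P"
      then have T: "T \<in> mesh P" by (rule cut_mesh_mesh)
      have int: "set_integrable lebesgue (sub P i \<inter> T) (\<lambda>x. grad (side_poly c i T) x \<bullet> grad (side_poly d i T) x)" for c d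
      proof (rule set_integrable_subset)
        show "set_integrable lebesgue T (\<lambda>x. grad (side_poly c i T) x \<bullet> grad (side_poly d i T) x)"
          using polyfun_grad_continuous[OF side_poly_polyfun[OF T]]
          by (intro set_integrable_lebesgue_compact compact_mesh[OF T] continuous_on_inner)
        show "sub P i \<inter> T \<in> sets lebesgue" using sub_open[OF i] closed_mesh[OF T] by (auto intro: borel_open borel_closed)
      qed auto
      show "bilinear_form (\<lambda>c d. LINT x:sub P i \<inter> T|lebesgue. grad (side_poly c i T) x \<bullet> grad (side_poly d i T) x)"
        by (rule bilinear_form_integral[where f = "\<lambda>c. grad (side_poly c i T)" and g = "\<lambda>c. grad (side_poly c i T)"])
          (rule side_poly_grad_linear[OF T] int)+
    qed
  qed
  have N: "bilinear_form (\<lambda>c d. Nhc P (side_fun d) (side_fun c))"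
    unfolding Nhc_side
  proof (intro bilinear_form_sum)
    fix T assume "T \<in> cut_mesh P"
    then have T: "T \<in> mesh P" by (rule cut_mesh_mesh)
    show "bilinear_form (\<lambda>c d. surface_integral (T \<inter> Gam P) (\<lambda>x. side_flux c T x * side_jump d T x))"
      by (rule surface_bilinear[where f = "\<lambda>c. side_flux c T" and g = "\<lambda>c. side_jump c T"])
        (rule compact_cut[OF T] cut_measure_finite[OF T] side_flux_linear[OF T] side_flux_continuous[OF T]
          side_jump_linear polyfun_continuous[OF side_jump_polyfun[OF T]])+
  qed
  have J: "bilinear_form (\<lambda>c d. jump_prod P (side_fun c) (side_fun d))"
    unfolding jump_prod_side
  proof (intro bilinear_form_sum bilinear_form_divide)
    fix T assume "T \<in> cut_mesh P"
    then have T: "T \<in> mesh P" by (rule cut_mesh_mesh)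
    show "bilinear_form (\<lambda>c d. surface_integral (T \<inter> Gam P) (\<lambda>x. side_jump c T x * side_jump d T x))"
      by (rule surface_bilinear[where f = "\<lambda>c. side_jump c T" and g = "\<lambda>c. side_jump c T"])
        (rule compact_cut[OF T] cut_measure_finite[OF T]
          side_jump_linear polyfun_continuous[OF side_jump_polyfun[OF T]])+
  qed
  have G: "bilinear_form (\<lambda>c d. Gh P (side_fun c) (side_fun d))"
    unfolding Gh_def
  proof (intro bilinear_form_scale bilinear_form_sum)
    fix i l :: nat and F assume "i \<in> {1,2}" and F: "F \<in> gfaces P i"
    then have i: "i = 1 \<or> i = 2" by auto
    from gface_facet[OF F i] obtain T where T: "T \<in> cut_mesh P" "F facet_of T" by (elim bexE conjE)
    note fin = facet_measure_finite[OF cut_mesh_mesh[OF T(1)] T(2)]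
    show "bilinear_form (\<lambda>c d. surface_integral F (\<lambda>x. face_jump P l F (side_fun c i) x * face_jump P l F (side_fun d i) x))"
      unfolding face_jump_side[OF F i]
    proof -
      let ?j = "\<lambda>c x. (dir_grad (face_normal F) ^^ l) (face_poly c i (fst (face_sides P F))) x -
        (dir_grad (face_normal F) ^^ l) (face_poly c i (snd (face_sides P F))) x"
      have lin: "?j (\<lambda>j. a * c j + d j) x = a *\<^sub>R ?j c x + ?j d x" for a c d x
        unfolding face_poly_linear dir_grad_pow_linear[OF face_poly_polyfun face_poly_polyfun] by (simp add: right_diff_distrib)
      have cont: "continuous_on F (?j c)" for c
        by (intro continuous_on_diff polyfun_continuous[OF dir_grad_pow_polyfun[OF face_poly_polyfun]])
      show "bilinear_form (\<lambda>c d. surface_integral F (\<lambda>x. ?j c x * ?j d x))"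
        by (rule surface_bilinear[where f = ?j and g = ?j]) (rule fin lin cont)+
    qed
  qed
  show ?thesis unfolding Ah_def
    by (intro bilinear_form_add A N bilinear_form_swap[OF N] bilinear_form_scale J G)
qed

definition energy :: "('a \<Rightarrow> real) \<Rightarrow> 'a set \<Rightarrow> real" where
  "energy c T = (\<Sum>i\<in>{1,2}. LINT x:T|lebesgue. grad (side_poly c i T) x \<bullet> grad (side_poly c i T) x) +
     surface_integral (T \<inter> Gam P) (\<lambda>x. (side_jump c T x)\<^sup>2) / diameter T"

lemma Ah_energy:
  assumes ne: "norm_equivalence c\<^sub>1 c\<^sub>2 P"
  shows "c\<^sub>1 * (\<Sum>T\<in>cut_mesh P. energy c T) \<le> Ah P (side_fun c) (side_fun c)"
    and "Ah P (side_fun c) (side_fun c) \<le> c\<^sub>2 * (\<Sum>T\<in>cut_mesh P. energy c T)"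
proof -
  let ?w = "\<lambda>x. \<Sum>j\<in>cut_nodes P. c j * cut_basis P j x"
  let ?u = "(\<lambda>_. 0 :: real, ?w)"
  have "(\<lambda>_. 0) \<in> Vh P" 
  proof -
    have "(\<lambda>_ :: 'a. 0) \<in> poly_space (deg P)" using poly_space_iff[of "\<lambda>_. 0"] polyfun_const by blast
    then show ?thesis unfolding Vh_def by (auto intro!: bexI[of _ "\<lambda>_. 0"])
  qed
  moreover have "?w \<in> VhGam P" unfolding VhGam_def by blast
  ultimately have "?u \<in> Vh P \<times> VhGam P" by simp
  moreover have L: "Liso P ?u = side_fun c" by (rule ext) (rule Liso_cut)
  moreover have "(\<Sum>i\<in>{1,2}. grad_prod (ext_dom P i) (side_fun c i) (side_fun c i)) + jump_prod P (side_fun c) (side_fun c)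
      = (\<Sum>T\<in>cut_mesh P. energy c T)"
    unfolding energy_def jump_prod_side by (simp add: grad_prod_ext sum.distrib power2_eq_square)
  ultimately show "c\<^sub>1 * (\<Sum>T\<in>cut_mesh P. energy c T) \<le> Ah P (side_fun c) (side_fun c)"
    "Ah P (side_fun c) (side_fun c) \<le> c\<^sub>2 * (\<Sum>T\<in>cut_mesh P. energy c T)"
    using ne unfolding norm_equivalence_def Let_def Ahat_def by fastforce+
qed

end

section \<open>Energy bounds\<close>

text \<open>The surface part has area of order \<open>h^(d-1)\<close> and is divided by
  \<open>h\<close>, which gives the same power \<open>h^(d-2)\<close> as the gradient part. The
  statement is outside the locale so that the constant is chosen before the discretization.\<close>

lemma energy_upper:
  fixes \<Omega> :: "'a::euclidean_space set"
  assumes d2: "2 \<le> DIM('a)" and k: "1 \<le> k" and \<Omega>: "bounded \<Omega>" and r: "0 < r" and M: "0 < M"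
  shows "\<exists>C>0. \<forall>(P :: 'a cutfem) c T. cutfem_setting P \<sigma> r M \<longrightarrow> Om P = \<Omega> \<longrightarrow> deg P = k \<longrightarrow> T \<in> cut_mesh P \<longrightarrow>
    cutfem_setting.energy P c T \<le> C * (diameter T ^ (DIM('a) - 2) *
      (\<Sum>j\<in>lagrange_nodes k T. (cutfem_setting.side_val P c 1 j)\<^sup>2 + (cutfem_setting.side_val P c 2 j)\<^sup>2))"
proof -
  obtain G where G: "1 \<le> G" "\<And>(T :: 'a set) p B. int DIM('a) simplex T \<Longrightarrow> fat \<sigma> T \<Longrightarrow> polyfun k p \<Longrightarrow>
    (\<forall>j\<in>lagrange_nodes k T. \<bar>p j\<bar> \<le> B) \<Longrightarrow>
    (\<forall>x\<in>T. \<bar>p x\<bar> \<le> G * B) \<and> (\<forall>x\<in>T. \<forall>y\<in>T. \<bar>p x - p y\<bar> \<le> G * B * (norm (x - y) / diameter T))"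
    using nodal_bounds[OF k, of \<sigma>, where 'a = 'a] by blast
  obtain C1 where C1: "0 < C1" "\<And>(T :: 'a set) p B. int DIM('a) simplex T \<Longrightarrow> fat \<sigma> T \<Longrightarrow> polyfun k p \<Longrightarrow>
    (\<forall>j\<in>lagrange_nodes k T. \<bar>p j\<bar> \<le> B) \<Longrightarrow>
    (LINT x:T|lebesgue. grad p x \<bullet> grad p x) \<le> C1 * diameter T ^ (DIM('a) - 2) * B\<^sup>2"
    using grad_integral_upper[OF k d2, of \<sigma>] by blast
  obtain CH where CH: "0 < CH" "\<forall>(P :: 'a cutfem) A h. Om P = \<Omega> \<longrightarrow> partitioned P \<longrightarrow> smooth_interface r M P \<longrightarrow> A \<subseteq> Gam P \<longrightarrow>
    0 < h \<longrightarrow> (\<forall>x\<in>A. \<forall>y\<in>A. norm (x - y) \<le> h) \<longrightarrow>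
    hausdorff_outer (DIM('a) - 1) A \<le> ennreal (CH * h ^ (DIM('a) - 1))"
    using interface_measure_upper[OF d2 r M \<Omega>] by blast
  define C where "C = 2 * C1 + 4 * G\<^sup>2 * CH"
  have C: "0 < C" unfolding C_def using C1(1) CH(1) by (simp add: add_pos_nonneg)
  have "cutfem_setting.energy P c T \<le> C * (diameter T ^ (DIM('a) - 2) *
      (\<Sum>j\<in>lagrange_nodes k T. (cutfem_setting.side_val P c 1 j)\<^sup>2 + (cutfem_setting.side_val P c 2 j)\<^sup>2))"
    if set: "cutfem_setting P \<sigma> r M" and P: "Om P = \<Omega>" "deg P = k" and T: "T \<in> cut_mesh P" for P :: "'a cutfem" and c T
  proof -
    interpret cutfem_setting P \<sigma> r M by (rule set)
    let ?s = "DIM('a) - 1" and ?h = "diameter T"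
    have Tm: "T \<in> mesh P" by (rule cut_mesh_mesh[OF T])
    have h: "0 < ?h" using fatE[OF fat[OF Tm] bounded_mesh[OF Tm]] by metis
    define V where "V = (\<Sum>j\<in>lagrange_nodes k T. (side_val c 1 j)\<^sup>2 + (side_val c 2 j)\<^sup>2)"
    have V0: "0 \<le> V" unfolding V_def by (intro sum_nonneg) auto
    define B where "B = sqrt V"
    have B: "0 \<le> B" "B\<^sup>2 = V" unfolding B_def using V0 by auto
    have node: "\<forall>j\<in>lagrange_nodes k T. \<bar>side_poly c i T j\<bar> \<le> B" if i: "i = 1 \<or> i = 2" for i
    proof
      fix j assume j: "j \<in> lagrange_nodes k T"
      have "(side_val c i j)\<^sup>2 \<le> (side_val c 1 j)\<^sup>2 + (side_val c 2 j)\<^sup>2" using i by auto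
      also have "\<dots> \<le> V" unfolding V_def
        by (rule member_le_sum[OF j]) (use finite_lagrange_nodes[OF full[OF Tm]] in auto)
      finally have "\<bar>side_val c i j\<bar> \<le> B" unfolding B_def by (simp add: real_le_rsqrt)
      then show "\<bar>side_poly c i T j\<bar> \<le> B" using side_poly_node[OF Tm, of j c i] j P by simp
    qed
    have poly: "polyfun k (side_poly c i T)" for i using side_poly_polyfun[OF Tm, of c i] P by simp
    have g: "(LINT x:T|lebesgue. grad (side_poly c i T) x \<bullet> grad (side_poly c i T) x) \<le> C1 * ?h ^ (DIM('a) - 2) * V"
      if i: "i = 1 \<or> i = 2" for i
      using C1(2)[OF full[OF Tm] fat[OF Tm] poly node[OF i]] B by simp
    have jb: "(side_jump c T x)\<^sup>2 \<le> 4 * G\<^sup>2 * V" if x: "x \<in> T" for x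
    proof -
      have "\<bar>side_poly c i T x\<bar> \<le> G * B" if i: "i = 1 \<or> i = 2" for i
        using G(2)[OF full[OF Tm] fat[OF Tm] poly node[OF i]] x by blast
      from this[of 1] this[of 2] have "\<bar>side_jump c T x\<bar> \<le> 2 * G * B" unfolding side_jump_def by simp
      then have "\<bar>side_jump c T x\<bar>\<^sup>2 \<le> (2 * G * B)\<^sup>2" by (intro power_mono) auto
      then show ?thesis using B by (simp add: power_mult_distrib)
    qed
    have "surface_integral (T \<inter> Gam P) (\<lambda>x. (side_jump c T x)\<^sup>2) \<le> 4 * G\<^sup>2 * V * (CH * ?h ^ ?s)"
    proof -
      have K: "compact (T \<inter> Gam P)" "hausdorff_outer ?s (T \<inter> Gam P) < \<infinity>"
        using compact_cut[OF Tm] cut_measure_finite[OF Tm] by auto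
      have s1: "1 \<le> ?s" using d2 by simp
      have Kb: "T \<inter> Gam P \<in> sets borel" using K(1) by (simp add: borel_compact)
      have "hausdorff_outer ?s (T \<inter> Gam P) \<le> ennreal (CH * ?h ^ ?s)"
      proof -
        have "\<forall>x\<in>T \<inter> Gam P. \<forall>y\<in>T \<inter> Gam P. norm (x - y) \<le> ?h"
          using diameter_bounded_bound[OF bounded_mesh[OF Tm]] by (auto simp: dist_norm)
        then show ?thesis using CH(2) partition smooth P h by blast
      qed
      then have ms: "measure (hausdorff ?s) (T \<inter> Gam P) \<le> CH * ?h ^ ?s"
        unfolding measure_def emeasure_hausdorff[OF s1 Kb] using CH(1) h by (intro enn2real_leI) auto
      have "surface_integral (T \<inter> Gam P) (\<lambda>x. (side_jump c T x)\<^sup>2) \<le> (LINT x:T \<inter> Gam P|hausdorff ?s. 4 * G\<^sup>2 * V)"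
        unfolding surface_integral_def
        using jb K s1 polyfun_continuous[OF side_jump_polyfun[OF Tm]]
        by (intro set_integral_mono surface_set_integrable) (auto intro: continuous_on_power)
      also have "\<dots> = measure (hausdorff ?s) (T \<inter> Gam P) * (4 * G\<^sup>2 * V)"
        using Kb K(2) emeasure_hausdorff[OF s1 Kb] by (subst set_integral_const) auto
      also have "\<dots> \<le> CH * ?h ^ ?s * (4 * G\<^sup>2 * V)" using ms V0 by (intro mult_right_mono) auto
      finally show ?thesis by (simp add: mult_ac)
    qed
    then have "surface_integral (T \<inter> Gam P) (\<lambda>x. (side_jump c T x)\<^sup>2) / ?h \<le> 4 * G\<^sup>2 * V * (CH * ?h ^ ?s) / ?h"
      using h by (intro divide_right_mono) auto
    also have "?h ^ ?s = ?h * ?h ^ (DIM('a) - 2)"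
      using d2 by (metis Suc_diff_Suc Suc_le_lessD numeral_2_eq_2 One_nat_def power_Suc)
    also have "4 * G\<^sup>2 * V * (CH * (?h * ?h ^ (DIM('a) - 2))) / ?h = 4 * G\<^sup>2 * CH * (?h ^ (DIM('a) - 2) * V)"
      using h by simp
    finally have "energy c T \<le> (C1 * ?h ^ (DIM('a) - 2) * V + C1 * ?h ^ (DIM('a) - 2) * V) + 4 * G\<^sup>2 * CH * (?h ^ (DIM('a) - 2) * V)"
      using add_mono[OF add_mono[OF g[OF disjI1[OF refl]] g[OF disjI2[OF refl]]]] by (simp add: energy_def)
    then show ?thesis unfolding C_def V_def[symmetric] by (simp add: distrib_left distrib_right mult_ac)
  qed
  then show ?thesis using C by blast
qed

section \<open>Control of the nodal values by the energy\<close>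

context cutfem_setting
begin

lemma surface_integral_nonneg: "(\<And>x. x \<in> S \<Longrightarrow> 0 \<le> f x) \<Longrightarrow> 0 \<le> surface_integral S f" for f :: "'a \<Rightarrow> real"
  unfolding surface_integral_def set_lebesgue_integral_def
  by (intro Bochner_Integration.integral_nonneg) (auto simp: indicator_def)

lemma grad_integral_nonneg: "0 \<le> (LINT x:T|lebesgue. grad f x \<bullet> grad f x)" for f :: "'a \<Rightarrow> real"
  unfolding set_lebesgue_integral_def by (intro Bochner_Integration.integral_nonneg) (auto simp: indicator_def)

lemma
  assumes T: "T \<in> mesh P" and i: "i = 1 \<or> i = 2"
  shows energy_ge_grad: "(LINT x:T|lebesgue. grad (side_poly c i T) x \<bullet> grad (side_poly c i T) x) \<le> energy c T"
    and energy_ge_jump: "surface_integral (T \<inter> Gam P) (\<lambda>x. (side_jump c T x)\<^sup>2) / diameter T \<le> energy c T"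
    and energy_nonneg: "0 \<le> energy c T"
proof -
  have h: "0 \<le> diameter T" by (rule diameter_ge_0[OF bounded_mesh[OF T]])
  have "0 \<le> surface_integral (T \<inter> Gam P) (\<lambda>x. (side_jump c T x)\<^sup>2) / diameter T"
    using h by (intro divide_nonneg_nonneg surface_integral_nonneg) auto
  then show "(LINT x:T|lebesgue. grad (side_poly c i T) x \<bullet> grad (side_poly c i T) x) \<le> energy c T"
    "surface_integral (T \<inter> Gam P) (\<lambda>x. (side_jump c T x)\<^sup>2) / diameter T \<le> energy c T" "0 \<le> energy c T"
    using i grad_integral_nonneg[of T "side_poly c 1 T"] grad_integral_nonneg[of T "side_poly c 2 T"]
    unfolding energy_def by auto
qed

text \<open>The energy that controls the nodal values on \<open>T\<close> may sit in any cut simplex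
  around the chosen vertex of \<open>T\<close>.\<close>

definition neighbours :: "'a set \<Rightarrow> 'a set set" where
  "neighbours T = {T' \<in> cut_mesh P. verts T \<inter> verts T' \<noteq> {}}"

text \<open>The interface near an interior vertex is covered by cut simplices: otherwise the vertex would belong
  to simplices of both subdomains, hence to the interface, which contains no nodes.\<close>

lemma interface_near_vertex:
  assumes v: "v \<in> nodes P" and y: "y \<in> Gam P" "0 < hat v y"
  shows "\<exists>T\<in>cut_mesh P. y \<in> T \<and> T \<in> star v"
proof (rule ccontr)
  assume none: "\<not> ?thesis"
  have uncut: "T \<notin> cut_mesh P" if "T \<in> mesh P" "y \<in> T" for T
    using none hat_pos_star[OF y(2) that] that(2) by blast
  have vcl: "v \<in> closure (sub P i)" if i: "i = 1 \<or> i = 2" for i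
  proof -
    have "sub P i \<subseteq> (\<Union>T\<in>mesh P. sub P i \<inter> T)" using sub_Om[OF i] interior_dom interior_subset[of dom] unfolding dom_def by blast
    moreover have "y \<in> closure (sub P i)" using y(1) i unfolding Gam_def by auto
    ultimately have "y \<in> closure (\<Union>T\<in>mesh P. sub P i \<inter> T)" using closure_mono by blast
    moreover have "closure (\<Union>T\<in>mesh P. sub P i \<inter> T) \<subseteq> (\<Union>T\<in>mesh P. closure (sub P i \<inter> T))"
      using finite_mesh by (intro closure_minimal UN_mono order_refl closure_subset closed_UN) auto
    ultimately have "y \<in> (\<Union>T\<in>mesh P. closure (sub P i \<inter> T))" by blast
    then obtain T where T: "T \<in> mesh P" "y \<in> closure (sub P i \<inter> T)" by blast
    have yT: "y \<in> T" using T closure_mono[of "sub P i \<inter> T" T] closed_mesh[OF T(1)] by (auto simp: closure_closed)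
    have "sub P i \<inter> T \<noteq> {}" using T(2) by auto
    then have "T \<in> ext_mesh P i" using T(1) unfolding ext_mesh_def by blast
    then have "T \<subseteq> closure (sub P i)" using uncut_ext[OF _ uncut[OF T(1) yT] i] by blast
    moreover have "v \<in> T" using hat_pos_vert[OF T(1) yT y(2)] verts_subset[OF T(1)] by blast
    ultimately show ?thesis by blast
  qed
  have "v \<in> Gam P" using vcl[of 1] vcl[of 2] unfolding Gam_def by simp
  then show False using v disc unfolding cutfem_discretization_def by blast
qed

lemma diameter_pos: "T \<in> mesh P \<Longrightarrow> 0 < diameter T"
  using fatE[OF fat bounded_mesh] by metis

text \<open>The \<open>d + 1\<close> barycentric coordinates add up to 1.\<close>

lemma large_hat:
  assumes T: "T \<in> mesh P" "x \<in> T" shows "\<exists>v\<in>verts T. 1 / (real DIM('a) + 1) \<le> hat v x"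
proof (rule ccontr)
  assume "\<not> ?thesis"
  then have lt: "\<And>v. v \<in> verts T \<Longrightarrow> bary (verts T) v x < 1 / (real DIM('a) + 1)" using hat_eq[OF T] by force
  have c: "card (verts T) = Suc DIM('a)" using nd[OF T(1)] unfolding nondeg_def by simp
  then have ne: "verts T \<noteq> {}" by auto
  have "(\<Sum>v\<in>verts T. bary (verts T) v x) < (\<Sum>v\<in>verts T. 1 / (real DIM('a) + 1))"
    by (rule sum_strict_mono[OF fin_verts[OF T(1)] ne lt])
  also have "\<dots> = 1" by (simp add: c)
  finally show False by (simp add: bary_sum[OF nd[OF T(1)]])
qed

text \<open>The interface part of \<open>T\<close> may be arbitrarily small, so area is collected
  from a ball of radius \<open>b * h\<close> around \<open>p\<close> and distributed over the cut
  simplices around \<open>v\<close>. The hypotheses gather the uniform constants; \<open>C\<close>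
  is the sum of the constants from the two cases, control by a gradient and control by the
  jump.\<close>

lemma vertex_value:
  assumes osc: "0 < co" "\<And>(T :: 'a set) p a b. int DIM('a) simplex T \<Longrightarrow> fat \<sigma> T \<Longrightarrow> polyfun (deg P) p \<Longrightarrow> a \<in> T \<Longrightarrow> b \<in> T \<Longrightarrow>
      co * diameter T ^ (DIM('a) - 2) * (p a - p b)\<^sup>2 \<le> (LINT x:T|lebesgue. grad p x \<bullet> grad p x)"
    and CH: "0 < CH" "\<And>T. T \<in> mesh P \<Longrightarrow> hausdorff_outer (DIM('a) - 1) (T \<inter> Gam P) \<le> ennreal (CH * diameter T ^ (DIM('a) - 1))"
    and cH: "0 < cH" "\<And>p s. p \<in> Gam P \<Longrightarrow> 0 < s \<Longrightarrow> s \<le> R \<Longrightarrow> ball p s \<subseteq> Om P \<Longrightarrow>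
      ennreal (cH * s ^ (DIM('a) - 1)) \<le> hausdorff_outer (DIM('a) - 1) (Gam P \<inter> ball p s)"
    and R: "\<And>T. T \<in> mesh P \<Longrightarrow> diameter T \<le> R"
    and K: "1 \<le> K" "\<And>v T T'. v \<in> Om P \<Longrightarrow> T \<in> star v \<Longrightarrow> T' \<in> star v \<Longrightarrow> diameter T \<le> K * diameter T'"
    and s1: "1 \<le> \<sigma>" and T: "T \<in> cut_mesh P" and i: "i = 1 \<or> i = 2"
    and b: "b = 1 / (K * \<sigma> * (real DIM('a) + 1))"
    and C: "C = K ^ (DIM('a) - 2) / co + (2 + 2 * CH / co) * K / (cH * b ^ (DIM('a) - 1))"
  shows "\<exists>v\<in>verts T. diameter T ^ (DIM('a) - 2) * (side_val c i v)\<^sup>2 \<le> C * (\<Sum>T'\<in>neighbours T. energy c T')"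
proof -
  let ?h = "diameter T" and ?e = "DIM('a) - 2" and ?s = "DIM('a) - 1"
  let ?E = "\<Sum>T'\<in>neighbours T. energy c T'"
  have Tm: "T \<in> mesh P" by (rule cut_mesh_mesh[OF T])
  have h: "0 < ?h" by (rule diameter_pos[OF Tm])
  have finN: "finite (neighbours T)" unfolding neighbours_def using finite_cut_mesh by auto
  have En: "0 \<le> energy c T'" if "T' \<in> cut_mesh P" for T' using energy_nonneg[OF cut_mesh_mesh[OF that] i] .
  have E0: "0 \<le> ?E" unfolding neighbours_def by (intro sum_nonneg En) auto
  have b0: "0 < b" unfolding b using K(1) s1 by simp
  have Cp: "0 \<le> K ^ ?e / co" "0 \<le> (2 + 2 * CH / co) * K / (cH * b ^ ?s)"
    using K(1) osc(1) CH(1) cH(1) b0 by auto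
  have C0: "0 \<le> C" unfolding C using Cp by simp
  obtain p where p: "p \<in> interior T" "p \<in> Gam P" using T unfolding cut_mesh_def by blast
  have pT: "p \<in> T" using p interior_subset by blast
  obtain v where v: "v \<in> verts T" "1 / (real DIM('a) + 1) \<le> hat v p" using large_hat[OF Tm pT] by blast
  have vl: "v \<in> lagrange_nodes (deg P) T'" if "T' \<in> star v" for T'
    using verts_subset_lagrange_nodes[OF full[OF star_mesh[OF that]] k1] star_vert[OF that] by blast
  have Ts: "T \<in> star v" using v Tm unfolding star_def by simp
  define y where "y = side_val c i v"
  have pv: "side_poly c i T' v = y" if "T' \<in> star v" for T'
    unfolding y_def by (rule side_poly_node[OF star_mesh[OF that] vl[OF that]])
  have os: "co * diameter T' ^ ?e * (side_poly c i T' x - y)\<^sup>2 \<le> energy c T'" if T': "T' \<in> star v" "x \<in> T'" for T' x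
  proof -
    have m: "T' \<in> mesh P" by (rule star_mesh[OF T'(1)])
    have "v \<in> T'" using verts_subset[OF m] star_vert[OF T'(1)] by blast
    then have "co * diameter T' ^ ?e * (side_poly c i T' x - side_poly c i T' v)\<^sup>2
        \<le> (LINT x:T'|lebesgue. grad (side_poly c i T') x \<bullet> grad (side_poly c i T') x)"
      by (intro osc(2) full[OF m] fat[OF m] side_poly_polyfun[OF m] T'(2))
    also have "\<dots> \<le> energy c T'" by (rule energy_ge_grad[OF m i])
    finally show ?thesis unfolding pv[OF T'(1)] .
  qed
  have starN: "T' \<in> neighbours T" if "T' \<in> cut_mesh P" "T' \<in> star v" for T'
    using that v(1) star_vert unfolding neighbours_def by blast
  have le1: "energy c T' \<le> ?E" if "T' \<in> cut_mesh P" "T' \<in> star v" for T'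
    by (rule member_le_sum[OF starN[OF that] _ finN]) (use En in \<open>auto simp: neighbours_def\<close>)
  have "?h ^ ?e * y\<^sup>2 \<le> C * ?E"
  proof (cases "v \<in> nodes P \<and> v \<notin> sub P i")
    case False
    \<comment> \<open>A boundary vertex carries no degree of freedom and a node in subdomain
      \<open>i\<close> has side value 0. The remaining vertices are interior, as required for the
      comparison of sizes by \<open>K\<close>.\<close>
    then have "y = 0" unfolding y_def side_val_def cut_nodes_def by auto
    then show ?thesis using C0 E0 by simp
  next
    case vn: True
    then have vO: "v \<in> Om P" and vi: "v \<in> interior dom" unfolding nodes_eq interior_dom by auto
    have vv: "v \<in> vertices" using v(1) Tm unfolding vertices_def by blast
    have cmp: "?h \<le> K * diameter T'" "diameter T' \<le> K * ?h" if "T' \<in> star v" for T'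
      using K(2)[OF vO Ts that] K(2)[OF vO that Ts] by auto
    show ?thesis
    proof (cases "\<exists>T'\<in>cut_mesh P. T' \<in> star v \<and> (\<exists>j\<in>lagrange_nodes (deg P) T'. j \<notin> nodes P \<or> j \<in> sub P i)")
      case True
      then obtain T' j where T': "T' \<in> cut_mesh P" "T' \<in> star v" and j: "j \<in> lagrange_nodes (deg P) T'" "j \<notin> nodes P \<or> j \<in> sub P i"
        by blast
      have m: "T' \<in> mesh P" by (rule cut_mesh_mesh[OF T'(1)])
      have jT: "j \<in> T'" using lagrange_nodes_subset[OF full[OF m] k1] j(1) by blast
      have "side_poly c i T' j = 0" unfolding side_poly_node[OF m j(1)] side_val_def cut_nodes_def using j(2) by auto
      then have e: "co * diameter T' ^ ?e * y\<^sup>2 \<le> energy c T'" using os[OF T'(2) jT] by simp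
      have "?h ^ ?e \<le> (K * diameter T') ^ ?e" using cmp(1)[OF T'(2)] h by (intro power_mono) auto
      then have "?h ^ ?e * y\<^sup>2 \<le> (K * diameter T') ^ ?e * y\<^sup>2" by (rule mult_right_mono) simp
      also have "\<dots> = K ^ ?e / co * (co * diameter T' ^ ?e * y\<^sup>2)" using osc(1) by (simp add: power_mult_distrib)
      also have "\<dots> \<le> K ^ ?e / co * ?E" using e le1[OF T'] Cp(1) by (intro mult_left_mono) auto
      also have "\<dots> \<le> C * ?E" unfolding C using Cp(2) E0 by (intro mult_right_mono) auto
      finally show ?thesis .
    next
      case False
      define Cs where "Cs = cut_mesh P \<inter> star v"
      have Cs: "Cs \<subseteq> neighbours T" "finite Cs" unfolding Cs_def using starN finite_star by auto
      define i' where "i' = 3 - i"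
      have zero: "side_poly c i' T' x = 0" if T': "T' \<in> Cs" for T' x
        unfolding side_poly_def
      proof (rule sum.neutral, rule ballI)
        fix j assume j: "j \<in> lagrange_nodes (deg P) T'"
        then have "j \<in> nodes P" "j \<notin> sub P i" using False T' unfolding Cs_def by auto
        then have "j \<in> sub P i'" using node_cases[of j] i unfolding i'_def by auto
        then have "side_val c i' j = 0" unfolding side_val_def by simp
        then show "side_val c i' j * lagrange (verts T') (deg P) j x = 0" by simp
      qed
      have jump2: "(side_jump c T' x)\<^sup>2 = (side_poly c i T' x)\<^sup>2" if "T' \<in> Cs" for T' x
        using zero[OF that, of x] i unfolding side_jump_def i'_def by auto
      \<comment> \<open>Around \<open>v\<close> the hat function has Lipschitz constant
        \<open>\<sigma> * K / h\<close>. Over distances below \<open>b * h\<close> it therefore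
        cannot drop from \<open>1 / (d + 1)\<close> to 0.\<close>
      define s where "s = b * ?h"
      have s0: "0 < s" unfolding s_def using b0 h by simp
      have "b \<le> 1" unfolding b using mult_mono[of 1 K 1 \<sigma>] mult_mono[of 1 "K * \<sigma>" 1 "real DIM('a) + 1"] K(1) s1 by (simp add: divide_le_eq)
      then have "s \<le> 1 * ?h" unfolding s_def using h by (intro mult_right_mono) auto
      then have sR: "s \<le> R" using R[OF Tm] by simp
      have pos: "0 < hat v z" if z: "z \<in> ball p s" for z
      proof (rule hat_pos_near[OF vi vv _ _ _ _, where \<sigma> = \<sigma> and h = "?h / K" and p = p])
        show "fat \<sigma> T'" if "T' \<in> star v" for T' by (rule fat[OF star_mesh[OF that]])
        show "0 < \<sigma>" "0 < ?h / K" using s1 h K(1) by auto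
        show "?h / K \<le> diameter T'" if "T' \<in> star v" for T' using cmp(1)[OF that] K(1) by (simp add: divide_le_eq mult.commute)
        have "norm (z - p) < s" using z by (simp add: dist_norm norm_minus_commute)
        then have "\<sigma> * norm (z - p) < \<sigma> * s" using s1 by simp
        also have "\<sigma> * s = ?h / K * (1 / (real DIM('a) + 1))" unfolding s_def b using s1 K(1) by simp
        also have "\<dots> \<le> ?h / K * hat v p" using v(2) h K(1) by (intro mult_left_mono) auto
        finally show "\<sigma> * norm (z - p) < ?h / K * hat v p" .
      qed
      have "ball p s \<subseteq> Om P"
        using hat_pos_interior[OF Tm v(1) vi pos] unfolding interior_dom by blast
      then have low: "ennreal (cH * s ^ ?s) \<le> hausdorff_outer ?s (Gam P \<inter> ball p s)" by (rule cH(2)[OF p(2) s0 sR])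
      have cover: "Gam P \<inter> ball p s \<subseteq> (\<Union>T'\<in>Cs. T' \<inter> Gam P)"
        using interface_near_vertex[OF conjunct1[OF vn]] pos unfolding Cs_def by blast
      have d1: "1 \<le> ?s" using d2 by simp
      define m where "m T' = measure (hausdorff ?s) (T' \<inter> Gam P)" for T'
      have bor: "T' \<inter> Gam P \<in> sets borel" if "T' \<in> mesh P" for T' using compact_cut[OF that] by (simp add: borel_compact)
      have em: "emeasure (hausdorff ?s) (T' \<inter> Gam P) = ennreal (m T')" "m T' \<le> CH * diameter T' ^ ?s" if "T' \<in> mesh P" for T'
      proof -
        have f: "emeasure (hausdorff ?s) (T' \<inter> Gam P) \<le> ennreal (CH * diameter T' ^ ?s)"
          unfolding emeasure_hausdorff[OF d1 bor[OF that]] by (rule CH(2)[OF that])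
        then show "m T' \<le> CH * diameter T' ^ ?s"
          unfolding m_def measure_def using CH(1) diameter_pos[OF that] by (intro enn2real_leI) auto
        show "emeasure (hausdorff ?s) (T' \<inter> Gam P) = ennreal (m T')"
          unfolding m_def using f by (intro emeasure_eq_ennreal_measure) (auto simp: top_unique)
      qed
      have Csm: "T' \<in> mesh P" "T' \<in> star v" "T' \<in> cut_mesh P" if "T' \<in> Cs" for T' using that cut_mesh_mesh unfolding Cs_def by auto
      have "ennreal (cH * s ^ ?s) \<le> hausdorff_outer ?s (\<Union>T'\<in>Cs. T' \<inter> Gam P)"
        using low hausdorff_outer_mono[OF cover] by (rule order_trans)
      also have "\<dots> = emeasure (hausdorff ?s) (\<Union>T'\<in>Cs. T' \<inter> Gam P)"
        by (intro emeasure_hausdorff[OF d1, symmetric] sets.finite_UN Cs(2) bor Csm(1))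
      also have "\<dots> \<le> (\<Sum>T'\<in>Cs. emeasure (hausdorff ?s) (T' \<inter> Gam P))"
        using bor Csm(1) Cs(2) by (intro emeasure_subadditive_finite) auto
      also have "\<dots> = (\<Sum>T'\<in>Cs. ennreal (m T'))" using em(1) Csm(1) by (intro sum.cong) auto
      also have "\<dots> = ennreal (\<Sum>T'\<in>Cs. m T')" by (rule sum_ennreal) (simp add: m_def)
      finally have mass: "cH * s ^ ?s \<le> (\<Sum>T'\<in>Cs. m T')"
        by (subst (asm) ennreal_le_iff) (auto intro: sum_nonneg simp: m_def)
      \<comment> \<open>The value at \<open>v\<close> is compared pointwise with the jump, up to the
        oscillation \<open>D\<close>, and the inequality is integrated over the interface part of
        \<open>T'\<close>. An area of order \<open>h'^(d-1)\<close> times \<open>D\<close>, of order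
        \<open>h'^(2-d)\<close> times the energy, leaves one factor \<open>h'\<close>.\<close>
      have each: "y\<^sup>2 * m T' \<le> (2 + 2 * CH / co) * K * ?h * energy c T'" if T': "T' \<in> Cs" for T'
      proof -
        note q = Csm[OF T']
        let ?h' = "diameter T'"
        have h': "0 < ?h'" by (rule diameter_pos[OF q(1)])
        define D where "D = energy c T' / (co * ?h' ^ ?e)"
        have D0: "0 \<le> D" unfolding D_def using En[OF q(3)] osc(1) h' by simp
        have pt: "y\<^sup>2 \<le> 2 * (side_jump c T' x)\<^sup>2 + 2 * D" if x: "x \<in> T'" for x
        proof -
          have "(side_poly c i T' x - y)\<^sup>2 \<le> D" unfolding D_def using os[OF q(2) x] osc(1) h' by (simp add: le_divide_eq mult_ac)
          moreover have "y\<^sup>2 \<le> 2 * (side_poly c i T' x)\<^sup>2 + 2 * (side_poly c i T' x - y)\<^sup>2"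
          proof -
            have "0 \<le> (2 * side_poly c i T' x - y)\<^sup>2" by simp
            then show ?thesis by (simp add: power2_eq_square left_diff_distrib right_diff_distrib) 
          qed
          ultimately show ?thesis unfolding jump2[OF T'] by linarith
        qed
        let ?S = "T' \<inter> Gam P"
        have int: "set_integrable (hausdorff ?s) ?S f" if "continuous_on ?S f" for f :: "'a \<Rightarrow> real"
          by (rule surface_set_integrable[OF d1 compact_cut[OF q(1)] cut_measure_finite[OF q(1)] that])
        have cj: "continuous_on ?S (\<lambda>x. (side_jump c T' x)\<^sup>2)"
          by (intro continuous_on_power polyfun_continuous[OF side_jump_polyfun[OF q(1)]])
        have cst: "(LINT x:?S|hausdorff ?s. t) = m T' * t" for t :: real
          unfolding m_def using bor[OF q(1)] em(1)[OF q(1)] by (subst set_integral_const) auto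
        have "y\<^sup>2 * m T' = (LINT x:?S|hausdorff ?s. y\<^sup>2)" unfolding cst by (rule mult.commute)
        also have "\<dots> \<le> (LINT x:?S|hausdorff ?s. 2 * (side_jump c T' x)\<^sup>2 + 2 * D)"
          by (intro set_integral_mono int continuous_intros cj) (use pt in auto)
        also have "\<dots> = 2 * surface_integral ?S (\<lambda>x. (side_jump c T' x)\<^sup>2) + m T' * (2 * D)"
        proof -
          have "(LINT x:?S|hausdorff ?s. 2 * (side_jump c T' x)\<^sup>2 + 2 * D)
              = (LINT x:?S|hausdorff ?s. 2 * (side_jump c T' x)\<^sup>2) + (LINT x:?S|hausdorff ?s. 2 * D)"
            by (rule set_integral_add(2)[OF int[OF continuous_on_mult_left[OF cj]] int[OF continuous_on_const]])
          then show ?thesis unfolding surface_integral_def cst by simp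
        qed
        also have "\<dots> \<le> 2 * (?h' * energy c T') + (CH * ?h' ^ ?s) * (2 * D)"
        proof (intro add_mono mult_left_mono mult_right_mono)
          show "surface_integral ?S (\<lambda>x. (side_jump c T' x)\<^sup>2) \<le> ?h' * energy c T'"
            using energy_ge_jump[OF q(1) i, of c] h' by (simp add: divide_le_eq mult.commute)
        qed (use em(2)[OF q(1)] D0 in auto)
        also have "?h' ^ ?s = ?h' * ?h' ^ ?e"
          using d2 by (metis Suc_diff_Suc Suc_le_lessD numeral_2_eq_2 One_nat_def power_Suc)
        also have "2 * (?h' * energy c T') + (CH * (?h' * ?h' ^ ?e)) * (2 * D) = ?h' * ((2 + 2 * CH / co) * energy c T')"
          unfolding D_def using osc(1) h' by (simp add: field_simps)
        also have "\<dots> \<le> (K * ?h) * ((2 + 2 * CH / co) * energy c T')"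
          using cmp(2)[OF q(2)] En[OF q(3)] osc(1) CH(1) by (intro mult_right_mono) auto
        finally show ?thesis by (simp add: mult_ac)
      qed
      \<comment> \<open>Single areas \<open>m T'\<close> may be tiny; only their sum is bounded
        below, so summation precedes division.\<close>
      have "y\<^sup>2 * (cH * s ^ ?s) \<le> y\<^sup>2 * (\<Sum>T'\<in>Cs. m T')" using mass by (intro mult_left_mono) auto
      also have "\<dots> = (\<Sum>T'\<in>Cs. y\<^sup>2 * m T')" by (rule sum_distrib_left)
      also have "\<dots> \<le> (\<Sum>T'\<in>Cs. (2 + 2 * CH / co) * K * ?h * energy c T')" by (rule sum_mono[OF each])
      also have "\<dots> = (2 + 2 * CH / co) * K * ?h * (\<Sum>T'\<in>Cs. energy c T')" by (rule sum_distrib_left[symmetric])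
      also have "\<dots> \<le> (2 + 2 * CH / co) * K * ?h * ?E"
        using K(1) h osc(1) CH(1) Cs En by (intro mult_left_mono sum_mono2 finN) (auto simp: neighbours_def)
      finally have main: "y\<^sup>2 * (cH * s ^ ?s) \<le> (2 + 2 * CH / co) * K * ?h * ?E" .
      have hs: "?h ^ ?s = ?h * ?h ^ ?e"
        using d2 by (metis Suc_diff_Suc Suc_le_lessD numeral_2_eq_2 One_nat_def power_Suc)
      have "s ^ ?s = b ^ ?s * (?h * ?h ^ ?e)" unfolding s_def power_mult_distrib hs ..
      then have "?h * (cH * b ^ ?s * (?h ^ ?e * y\<^sup>2)) \<le> ?h * ((2 + 2 * CH / co) * K * ?E)"
        using main by (simp add: mult_ac)
      then have "cH * b ^ ?s * (?h ^ ?e * y\<^sup>2) \<le> (2 + 2 * CH / co) * K * ?E" using h by (simp only: mult_le_cancel_left_pos)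
      then have "?h ^ ?e * y\<^sup>2 \<le> ((2 + 2 * CH / co) * K * ?E) / (cH * b ^ ?s)"
        using cH(1) b0 by (subst pos_le_divide_eq) (auto simp: mult_ac)
      also have "\<dots> = (2 + 2 * CH / co) * K / (cH * b ^ ?s) * ?E" by simp
      also have "\<dots> \<le> C * ?E" unfolding C using Cp(1) E0 by (intro mult_right_mono) auto
      finally show ?thesis .
    qed
  qed
  then show ?thesis using v(1) unfolding y_def by blast
qed

text \<open>Each nodal value is split into the value at \<open>v\<close> and the difference to it,
  which yields \<open>2 / co + 2 * C\<close>; the first factor bounds the number of nodes.\<close>

lemma lagrange_values:
  assumes osc: "0 < co" "\<And>(T :: 'a set) p a b. int DIM('a) simplex T \<Longrightarrow> fat \<sigma> T \<Longrightarrow> polyfun (deg P) p \<Longrightarrow> a \<in> T \<Longrightarrow> b \<in> T \<Longrightarrow>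
      co * diameter T ^ (DIM('a) - 2) * (p a - p b)\<^sup>2 \<le> (LINT x:T|lebesgue. grad p x \<bullet> grad p x)"
    and T: "T \<in> cut_mesh P" and i: "i = 1 \<or> i = 2" and C: "0 \<le> C"
    and v: "v \<in> verts T" "diameter T ^ (DIM('a) - 2) * (side_val c i v)\<^sup>2 \<le> C * (\<Sum>T'\<in>neighbours T. energy c T')"
  shows "diameter T ^ (DIM('a) - 2) * (\<Sum>j\<in>lagrange_nodes (deg P) T. (side_val c i j)\<^sup>2)
    \<le> real ((deg P + 1) ^ Suc DIM('a)) * (2 / co + 2 * C) * (\<Sum>T'\<in>neighbours T. energy c T')"
proof -
  let ?h = "diameter T ^ (DIM('a) - 2)" and ?N = "lagrange_nodes (deg P) T"
  define E where "E = (\<Sum>T'\<in>neighbours T. energy c T')"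
  have Tm: "T \<in> mesh P" by (rule cut_mesh_mesh[OF T])
  have h: "0 < ?h" using diameter_pos[OF Tm] by simp
  have En: "0 \<le> energy c T'" if "T' \<in> cut_mesh P" for T' using energy_nonneg[OF cut_mesh_mesh[OF that] i] .
  have finN: "finite (neighbours T)" unfolding neighbours_def using finite_cut_mesh by auto
  have E0: "0 \<le> E" unfolding E_def neighbours_def by (intro sum_nonneg En) auto
  have TN: "T \<in> neighbours T" using T v(1) unfolding neighbours_def by blast
  have TE: "energy c T \<le> E" unfolding E_def
    by (rule member_le_sum[OF TN _ finN]) (use En in \<open>auto simp: neighbours_def\<close>)
  have each: "?h * (side_val c i j)\<^sup>2 \<le> (2 / co + 2 * C) * E" if j: "j \<in> ?N" for j
  proof -
    let ?a = "side_val c i j" and ?b = "side_val c i v"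
    have vl: "v \<in> ?N" using verts_subset_lagrange_nodes[OF full[OF Tm] k1] v(1) by blast
    have mem: "j \<in> T" "v \<in> T" using lagrange_nodes_subset[OF full[OF Tm] k1] j vl by auto
    have "co * ?h * (side_poly c i T j - side_poly c i T v)\<^sup>2
        \<le> (LINT x:T|lebesgue. grad (side_poly c i T) x \<bullet> grad (side_poly c i T) x)"
      by (intro osc(2) full[OF Tm] fat[OF Tm] side_poly_polyfun[OF Tm] mem)
    also have "\<dots> \<le> energy c T" by (rule energy_ge_grad[OF Tm i])
    finally have "co * ?h * (?a - ?b)\<^sup>2 \<le> E"
      unfolding side_poly_node[OF Tm j] side_poly_node[OF Tm vl] using TE by linarith
    then have "?h * (?a - ?b)\<^sup>2 \<le> E / co" using osc(1) by (simp add: le_divide_eq mult_ac)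
    moreover have "?a\<^sup>2 \<le> 2 * (?a - ?b)\<^sup>2 + 2 * ?b\<^sup>2"
    proof -
      have "0 \<le> (?a - 2 * ?b)\<^sup>2" by simp
      then show ?thesis by (simp add: power2_eq_square left_diff_distrib right_diff_distrib)
    qed
    then have "?h * ?a\<^sup>2 \<le> ?h * (2 * (?a - ?b)\<^sup>2 + 2 * ?b\<^sup>2)" using h by (intro mult_left_mono) auto
    moreover have "\<dots> = 2 * (?h * (?a - ?b)\<^sup>2) + 2 * (?h * ?b\<^sup>2)" by (simp add: distrib_left)
    moreover have "(2 / co + 2 * C) * E = 2 * (E / co) + 2 * (C * E)" by (simp add: distrib_right)
    ultimately show ?thesis using v(2) unfolding E_def[symmetric] by linarith
  qed
  have "?h * (\<Sum>j\<in>?N. (side_val c i j)\<^sup>2) = (\<Sum>j\<in>?N. ?h * (side_val c i j)\<^sup>2)" by (rule sum_distrib_left)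
  also have "\<dots> \<le> real (card ?N) * ((2 / co + 2 * C) * E)" by (rule sum_bounded_above[OF each])
  also have "\<dots> \<le> real ((deg P + 1) ^ Suc DIM('a)) * ((2 / co + 2 * C) * E)"
    using card_lagrange_nodes_le[OF full[OF Tm], of "deg P"] osc(1) C E0
    by (intro mult_right_mono) (simp_all only: of_nat_le_iff, simp)
  finally show ?thesis unfolding E_def by (simp only: mult.assoc)
qed

text \<open>After exchanging the sums, an energy is counted once for each cut simplex that shares
  one of its \<open>d + 1\<close> vertices, and each vertex has at most \<open>\<sigma>^d\<close>
  simplices around it.\<close>

lemma sum_neighbours_le:
  assumes s: "0 < \<sigma>"
  shows "(\<Sum>T\<in>cut_mesh P. \<Sum>T'\<in>neighbours T. energy c T')
    \<le> real (Suc DIM('a)) * \<sigma> ^ DIM('a) * (\<Sum>T\<in>cut_mesh P. energy c T)"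
proof -
  let ?N = "\<lambda>T'. {T \<in> cut_mesh P. verts T \<inter> verts T' \<noteq> {}}"
  have card: "real (card (?N T')) \<le> real (Suc DIM('a)) * \<sigma> ^ DIM('a)" if T': "T' \<in> cut_mesh P" for T'
  proof -
    have Tm: "T' \<in> mesh P" by (rule cut_mesh_mesh[OF T'])
    have "?N T' \<subseteq> (\<Union>v\<in>verts T'. star v)" using cut_mesh_mesh unfolding star_def by blast
    then have "card (?N T') \<le> card (\<Union>v\<in>verts T'. star v)"
      using fin_verts[OF Tm] finite_star by (intro card_mono) auto
    also have "\<dots> \<le> (\<Sum>v\<in>verts T'. card (star v))" by (rule card_UN_le[OF fin_verts[OF Tm]])
    finally have "real (card (?N T')) \<le> (\<Sum>v\<in>verts T'. real (card (star v)))" by (simp only: of_nat_sum[symmetric] of_nat_le_iff)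
    also have "\<dots> \<le> real (card (verts T')) * \<sigma> ^ DIM('a)"
      by (rule sum_bounded_above) (rule card_star_le[OF fat s])
    also have "card (verts T') = Suc DIM('a)" using nd[OF Tm] unfolding nondeg_def by simp
    finally show ?thesis .
  qed
  have "(\<Sum>T\<in>cut_mesh P. \<Sum>T'\<in>neighbours T. energy c T') = (\<Sum>T'\<in>cut_mesh P. \<Sum>T\<in>?N T'. energy c T')"
    unfolding neighbours_def by (rule sum.swap_restrict[OF finite_cut_mesh finite_cut_mesh])
  also have "\<dots> = (\<Sum>T'\<in>cut_mesh P. real (card (?N T')) * energy c T')" by simp
  also have "\<dots> \<le> (\<Sum>T'\<in>cut_mesh P. real (Suc DIM('a)) * \<sigma> ^ DIM('a) * energy c T')"
    using card energy_nonneg[OF cut_mesh_mesh, of _ 1] by (intro sum_mono mult_right_mono) auto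
  also have "\<dots> = real (Suc DIM('a)) * \<sigma> ^ DIM('a) * (\<Sum>T\<in>cut_mesh P. energy c T)" by (rule sum_distrib_left[symmetric])
  finally show ?thesis .
qed

section \<open>Weights of the diagonal form\<close>

definition node_weight :: "'a \<Rightarrow> real" where
  "node_weight j = (\<Sum>T | T \<in> cut_mesh P \<and> j \<in> T. diameter T ^ (DIM('a) - 2))"

text \<open>A node lies in exactly one subdomain, so one of the two side values at a cut node is
  \<open>c j\<close> and the other is 0. The rest is an exchange of sums over simplices and
  nodes.\<close>

lemma node_weight_sum:
  "(\<Sum>T\<in>cut_mesh P. diameter T ^ (DIM('a) - 2) * (\<Sum>j\<in>lagrange_nodes (deg P) T. (side_val c 1 j)\<^sup>2 + (side_val c 2 j)\<^sup>2))
    = (\<Sum>j\<in>cut_nodes P. node_weight j * (c j)\<^sup>2)"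
proof -
  let ?h = "\<lambda>T. diameter T ^ (DIM('a) - 2)" and ?N = "lagrange_nodes (deg P)"
  have inner: "?h T * (\<Sum>j\<in>?N T. (side_val c 1 j)\<^sup>2 + (side_val c 2 j)\<^sup>2) = (\<Sum>j | j \<in> cut_nodes P \<and> j \<in> T. ?h T * (c j)\<^sup>2)"
    if T: "T \<in> cut_mesh P" for T
  proof -
    have Tm: "T \<in> mesh P" by (rule cut_mesh_mesh[OF T])
    have "(\<Sum>j\<in>?N T. (side_val c 1 j)\<^sup>2 + (side_val c 2 j)\<^sup>2) = (\<Sum>j\<in>?N T. if j \<in> cut_nodes P then (c j)\<^sup>2 else 0)"
      using node_cases unfolding side_val_def cut_nodes_def by (intro sum.cong refl) auto
    also have "\<dots> = (\<Sum>j\<in>?N T \<inter> cut_nodes P. (c j)\<^sup>2)"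
      by (rule sum.inter_restrict[OF finite_lagrange_nodes[OF full[OF Tm]], symmetric])
    also have "?N T \<inter> cut_nodes P = {j. j \<in> cut_nodes P \<and> j \<in> T}"
      using lagrange_nodes_subset[OF full[OF Tm] k1] mesh_node_lagrange[OF k1 cut_node_mesh Tm] by blast
    finally show ?thesis by (simp only: sum_distrib_left)
  qed
  have "(\<Sum>T\<in>cut_mesh P. ?h T * (\<Sum>j\<in>?N T. (side_val c 1 j)\<^sup>2 + (side_val c 2 j)\<^sup>2))
      = (\<Sum>T\<in>cut_mesh P. \<Sum>j | j \<in> cut_nodes P \<and> j \<in> T. ?h T * (c j)\<^sup>2)" using inner by (rule sum.cong[OF refl])
  also have "\<dots> = (\<Sum>j\<in>cut_nodes P. \<Sum>T | T \<in> cut_mesh P \<and> j \<in> T. ?h T * (c j)\<^sup>2)"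
    by (rule sum.swap_restrict[OF finite_cut_mesh finite_cut_nodes])
  also have "\<dots> = (\<Sum>j\<in>cut_nodes P. node_weight j * (c j)\<^sup>2)" unfolding node_weight_def by (simp only: sum_distrib_right)
  finally show ?thesis .
qed

lemma node_weight_pos:
  assumes "j \<in> cut_nodes P" shows "0 < node_weight j"
proof -
  obtain T where T: "T \<in> cut_mesh P" "j \<in> T" using assms unfolding cut_nodes_def cut_dom_def by blast
  have "finite {T. T \<in> cut_mesh P \<and> j \<in> T}" using finite_cut_mesh by auto
  moreover have "0 < diameter T ^ (DIM('a) - 2)" if "T \<in> cut_mesh P" for T using diameter_pos[OF cut_mesh_mesh[OF that]] by simp
  ultimately show ?thesis unfolding node_weight_def using T by (intro sum_pos) auto
qed

text \<open>All diameters are compared with that of one simplex \<open>T\<close>. The number of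
  simplices containing \<open>j\<close> is at most that of the star of any vertex whose hat function
  is positive at \<open>j\<close>.\<close>

lemma node_weight_quasi_uniform:
  assumes qu: "quasi_uniform q (cut_mesh P)" and T: "T \<in> cut_mesh P" and j: "j \<in> cut_nodes P" and s: "0 < \<sigma>"
  shows "(diameter T / q) ^ (DIM('a) - 2) \<le> node_weight j"
    and "node_weight j \<le> \<sigma> ^ DIM('a) * (q * diameter T) ^ (DIM('a) - 2)"
proof -
  let ?e = "DIM('a) - 2" and ?S = "{T. T \<in> cut_mesh P \<and> j \<in> T}"
  have pos: "0 < diameter T'" if "T' \<in> cut_mesh P" for T' using diameter_pos[OF cut_mesh_mesh[OF that]] .
  have cmp: "diameter T' \<le> q * diameter T''" if "T' \<in> cut_mesh P" "T'' \<in> cut_mesh P" for T' T''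
    using qu that unfolding quasi_uniform_def by blast
  have "0 < q * diameter T" using cmp[OF T T] pos[OF T] by linarith
  then have q: "0 < q" using pos[OF T] by (simp add: zero_less_mult_iff)
  have fin: "finite ?S" using finite_cut_mesh by auto
  obtain T' where T': "T' \<in> cut_mesh P" "j \<in> T'" using j unfolding cut_nodes_def cut_dom_def by blast
  have "diameter T / q \<le> diameter T'" using cmp[OF T T'(1)] q by (simp add: divide_le_eq mult.commute)
  then have "(diameter T / q) ^ ?e \<le> diameter T' ^ ?e" using pos[OF T] q by (intro power_mono) auto
  also have "\<dots> \<le> node_weight j" unfolding node_weight_def
    using pos by (intro member_le_sum fin) (auto simp: T' less_imp_le)
  finally show "(diameter T / q) ^ ?e \<le> node_weight j" .
  obtain v where v: "v \<in> verts T'" "1 / (real DIM('a) + 1) \<le> hat v j" using large_hat[OF cut_mesh_mesh[OF T'(1)] T'(2)] by blast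
  have "0 < 1 / (real DIM('a) + 1)" by simp
  then have "0 < hat v j" using v(2) by linarith
  then have "?S \<subseteq> star v" using hat_pos_star cut_mesh_mesh by blast
  then have "card ?S \<le> card (star v)" by (rule card_mono[OF finite_star])
  moreover have "real (card (star v)) \<le> \<sigma> ^ DIM('a)" by (rule card_star_le[OF fat s])
  ultimately have card: "real (card ?S) \<le> \<sigma> ^ DIM('a)" by linarith
  have "node_weight j \<le> real (card ?S) * (q * diameter T) ^ ?e" unfolding node_weight_def
    using cmp[OF _ T] pos by (intro sum_bounded_above power_mono) (auto simp: less_imp_le)
  also have "\<dots> \<le> \<sigma> ^ DIM('a) * (q * diameter T) ^ ?e" using card q pos[OF T] by (intro mult_right_mono) auto
  finally show "node_weight j \<le> \<sigma> ^ DIM('a) * (q * diameter T) ^ ?e" .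
qed

end

text \<open>Unlike the upper bound this holds only after summation: the estimate on \<open>T\<close>
  uses the energy of neighbours, and finite overlap makes up for it.\<close>

lemma energy_lower:
  fixes \<Omega> :: "'a::euclidean_space set"
  assumes d2: "2 \<le> DIM('a)" and k: "1 \<le> k" and \<Omega>: "bounded \<Omega>" and r: "0 < r" and M: "0 < M"
  shows "\<exists>C>0. \<forall>(P :: 'a cutfem) c. cutfem_setting P \<sigma> r M \<longrightarrow> Om P = \<Omega> \<longrightarrow> deg P = k \<longrightarrow>
    (\<Sum>T\<in>cut_mesh P. diameter T ^ (DIM('a) - 2) *
      (\<Sum>j\<in>lagrange_nodes k T. (cutfem_setting.side_val P c 1 j)\<^sup>2 + (cutfem_setting.side_val P c 2 j)\<^sup>2))
    \<le> C * (\<Sum>T\<in>cut_mesh P. cutfem_setting.energy P c T)"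
proof -
  let ?e = "DIM('a) - 2" and ?s = "DIM('a) - 1"
  obtain co where co: "0 < co" "\<And>(T :: 'a set) p a b. int DIM('a) simplex T \<Longrightarrow> fat \<sigma> T \<Longrightarrow> polyfun k p \<Longrightarrow> a \<in> T \<Longrightarrow> b \<in> T \<Longrightarrow>
    co * diameter T ^ ?e * (p a - p b)\<^sup>2 \<le> (LINT x:T|lebesgue. grad p x \<bullet> grad p x)"
    using poly_oscillation[OF k d2, of \<sigma>] by blast
  obtain CH where CH: "0 < CH" "\<forall>(P :: 'a cutfem) A h. Om P = \<Omega> \<longrightarrow> partitioned P \<longrightarrow> smooth_interface r M P \<longrightarrow> A \<subseteq> Gam P \<longrightarrow>
    0 < h \<longrightarrow> (\<forall>x\<in>A. \<forall>y\<in>A. norm (x - y) \<le> h) \<longrightarrow> hausdorff_outer ?s A \<le> ennreal (CH * h ^ ?s)"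
    using interface_measure_upper[OF d2 r M \<Omega>] by blast
  \<comment> \<open>A bound for all mesh diameters that is known before the mesh; adding 1 makes it
    positive.\<close>
  define R where "R = diameter \<Omega> + 1"
  have R: "0 < R" unfolding R_def using diameter_ge_0[OF \<Omega>] by linarith
  obtain cH where cH: "0 < cH" "\<forall>(P :: 'a cutfem) p s. partitioned P \<longrightarrow> smooth_interface r M P \<longrightarrow> p \<in> Gam P \<longrightarrow> 0 < s \<longrightarrow> s \<le> R \<longrightarrow>
    ball p s \<subseteq> Om P \<longrightarrow> ennreal (cH * s ^ ?s) \<le> hausdorff_outer ?s (Gam P \<inter> ball p s)"
    using interface_measure_lower[OF d2 r M R] by blast
  \<comment> \<open>Equals \<open>\<sigma>\<close> as soon as there is a simplex. The maximum keeps
    the constants positive while no mesh is at hand.\<close>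
  define \<tau> where "\<tau> = max 1 \<sigma>"
  \<comment> \<open>The exponent bounds the number of simplices around a vertex, so \<open>K\<close>
    dominates the factor in \<open>star_comparable\<close>.\<close>
  define K where "K = \<tau> ^ nat \<lceil>\<tau> ^ DIM('a)\<rceil>"
  have tau: "1 \<le> \<tau>" unfolding \<tau>_def by simp
  have K: "1 \<le> K" unfolding K_def using tau by simp
  define b where "b = 1 / (K * \<tau> * (real DIM('a) + 1))"
  have b: "0 < b" unfolding b_def using K tau by simp
  define C1 where "C1 = K ^ ?e / co + (2 + 2 * CH / co) * K / (cH * b ^ ?s)"
  have C1: "0 \<le> C1" unfolding C1_def using K co(1) CH(1) cH(1) b by simp
  define C2 where "C2 = real ((k + 1) ^ Suc DIM('a)) * (2 / co + 2 * C1)"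
  have C2: "0 < C2" unfolding C2_def using C1 co(1) by (simp add: add_pos_nonneg)
  define C where "C = 2 * C2 * (real (Suc DIM('a)) * \<tau> ^ DIM('a))"
  have C: "0 < C" unfolding C_def using C2 tau by simp
  have "(\<Sum>T\<in>cut_mesh P. diameter T ^ ?e *
      (\<Sum>j\<in>lagrange_nodes k T. (cutfem_setting.side_val P c 1 j)\<^sup>2 + (cutfem_setting.side_val P c 2 j)\<^sup>2))
    \<le> C * (\<Sum>T\<in>cut_mesh P. cutfem_setting.energy P c T)"
    if set: "cutfem_setting P \<sigma> r M" and P: "Om P = \<Omega>" "deg P = k" for P :: "'a cutfem" and c
  proof (cases "cut_mesh P = {}")
    case True
    then show ?thesis by simp
  next
    case False
    interpret cutfem_setting P \<sigma> r M by (rule set)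
    obtain T0 where "T0 \<in> mesh P" using False cut_mesh_mesh by blast
    then have s2: "2 \<le> \<sigma>" using fatE[OF fat bounded_mesh] by metis
    then have st: "\<tau> = \<sigma>" unfolding \<tau>_def by simp
    have s1: "1 \<le> \<sigma>" "0 < \<sigma>" using s2 by auto
    have each: "diameter T ^ ?e * (\<Sum>j\<in>lagrange_nodes k T. (side_val c i j)\<^sup>2) \<le> C2 * (\<Sum>T'\<in>neighbours T. energy c T')"
      if T: "T \<in> cut_mesh P" and i: "i = 1 \<or> i = 2" for T i
    proof -
      have "\<exists>v\<in>verts T. diameter T ^ ?e * (side_val c i v)\<^sup>2 \<le> C1 * (\<Sum>T'\<in>neighbours T. energy c T')"
      proof (rule vertex_value[OF co(1) _ CH(1) _ cH(1) _ _ K _ s1(1) T i, where b = b and C = C1])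
        show "co * diameter T ^ ?e * (p a - p b)\<^sup>2 \<le> (LINT x:T|lebesgue. grad p x \<bullet> grad p x)"
          if "int DIM('a) simplex T" "fat \<sigma> T" "polyfun (deg P) p" "a \<in> T" "b \<in> T" for T :: "'a set" and p a b
          using co(2) that P by simp
        show "hausdorff_outer ?s (T \<inter> Gam P) \<le> ennreal (CH * diameter T ^ ?s)" if T: "T \<in> mesh P" for T
        proof -
          have "\<forall>x\<in>T \<inter> Gam P. \<forall>y\<in>T \<inter> Gam P. norm (x - y) \<le> diameter T"
            using diameter_bounded_bound[OF bounded_mesh[OF T]] by (auto simp: dist_norm)
          then show ?thesis using CH(2) partition smooth P diameter_pos[OF T] by blast
        qed
        show "ennreal (cH * s ^ ?s) \<le> hausdorff_outer ?s (Gam P \<inter> ball p s)"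
          if "p \<in> Gam P" "0 < s" "s \<le> R" "ball p s \<subseteq> Om P" for p s
          using cH(2) partition smooth that by blast
        show "diameter T \<le> R" if T: "T \<in> mesh P" for T
        proof -
          have "T \<subseteq> closure \<Omega>" using T dom_eq P unfolding dom_def by blast
          then have "diameter T \<le> diameter (closure \<Omega>)" using \<Omega> by (intro diameter_subset) auto
          then show ?thesis unfolding R_def using diameter_closure[OF \<Omega>] by simp
        qed
        show "diameter T \<le> K * diameter T'" if "v \<in> Om P" "T \<in> star v" "T' \<in> star v" for v T T'
        proof -
          have "v \<in> vertices" using star_mesh[OF that(2)] star_vert[OF that(2)] unfolding vertices_def by blast
          moreover have "v \<in> interior dom" using that(1) interior_dom by simp
          ultimately have "diameter T \<le> \<sigma> ^ card (star v) * diameter T'"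
            by (intro star_comparable[OF d2 _ _ fat] that)
          moreover have "\<sigma> ^ card (star v) \<le> K"
          proof -
            have "real (card (star v)) \<le> \<tau> ^ DIM('a)" unfolding st by (rule card_star_le[OF fat s1(2)])
            then have "card (star v) \<le> nat \<lceil>\<tau> ^ DIM('a)\<rceil>" by linarith
            then show ?thesis unfolding K_def st using s1(1) by (intro power_increasing) auto
          qed
          ultimately show ?thesis
            using diameter_pos[OF star_mesh[OF that(3)]] by (meson less_imp_le mult_right_mono order_trans)
        qed
      qed (simp_all only: b_def[unfolded st] C1_def)
      then obtain v where v: "v \<in> verts T" "diameter T ^ ?e * (side_val c i v)\<^sup>2 \<le> C1 * (\<Sum>T'\<in>neighbours T. energy c T')"
        by blast
      show ?thesis unfolding C2_def P(2)[symmetric]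
        by (rule lagrange_values[OF co(1) _ T i C1 v]) (use co(2) P in simp)
    qed
    have "(\<Sum>T\<in>cut_mesh P. diameter T ^ ?e * (\<Sum>j\<in>lagrange_nodes k T. (side_val c 1 j)\<^sup>2 + (side_val c 2 j)\<^sup>2))
        \<le> (\<Sum>T\<in>cut_mesh P. 2 * C2 * (\<Sum>T'\<in>neighbours T. energy c T'))"
    proof (rule sum_mono)
      fix T assume T: "T \<in> cut_mesh P"
      have "diameter T ^ ?e * (\<Sum>j\<in>lagrange_nodes k T. (side_val c 1 j)\<^sup>2 + (side_val c 2 j)\<^sup>2)
          = diameter T ^ ?e * (\<Sum>j\<in>lagrange_nodes k T. (side_val c 1 j)\<^sup>2) + diameter T ^ ?e * (\<Sum>j\<in>lagrange_nodes k T. (side_val c 2 j)\<^sup>2)"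
        by (simp only: sum.distrib distrib_left)
      also have "\<dots> \<le> 2 * C2 * (\<Sum>T'\<in>neighbours T. energy c T')"
        using each[OF T disjI1[OF refl]] each[OF T disjI2[OF refl]] by simp
      finally show "diameter T ^ ?e * (\<Sum>j\<in>lagrange_nodes k T. (side_val c 1 j)\<^sup>2 + (side_val c 2 j)\<^sup>2)
          \<le> 2 * C2 * (\<Sum>T'\<in>neighbours T. energy c T')" .
    qed
    also have "\<dots> = 2 * C2 * (\<Sum>T\<in>cut_mesh P. \<Sum>T'\<in>neighbours T. energy c T')" by (rule sum_distrib_left[symmetric])
    also have "\<dots> \<le> 2 * C2 * (real (Suc DIM('a)) * \<sigma> ^ DIM('a) * (\<Sum>T\<in>cut_mesh P. energy c T))"
      using C2 sum_neighbours_le[OF s1(2)] by (intro mult_left_mono) auto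
    finally show ?thesis unfolding C_def st by (simp only: mult.assoc)
  qed
  then show ?thesis using C by blast
qed

lemma stiffness_bounds:
  fixes \<Omega> :: "'a::euclidean_space set"
  assumes d2: "2 \<le> DIM('a)" and k: "1 \<le> k" and \<Omega>: "bounded \<Omega>" and r: "0 < r" and M: "0 < M"
    and c: "0 < c\<^sub>1" "0 < c\<^sub>2"
  shows "\<exists>a>0. \<exists>b>0. \<forall>(P :: 'a cutfem) c. cutfem_setting P \<sigma> r M \<longrightarrow> Om P = \<Omega> \<longrightarrow> deg P = k \<longrightarrow> norm_equivalence c\<^sub>1 c\<^sub>2 P \<longrightarrow>
    a * (\<Sum>j\<in>cut_nodes P. cutfem_setting.node_weight P j * (c j)\<^sup>2)
      \<le> Ah P (cutfem_setting.side_fun P c) (cutfem_setting.side_fun P c) \<and>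
    Ah P (cutfem_setting.side_fun P c) (cutfem_setting.side_fun P c)
      \<le> b * (\<Sum>j\<in>cut_nodes P. cutfem_setting.node_weight P j * (c j)\<^sup>2)"
proof -
  obtain C where C: "0 < C" "\<forall>(P :: 'a cutfem) c T. cutfem_setting P \<sigma> r M \<longrightarrow> Om P = \<Omega> \<longrightarrow> deg P = k \<longrightarrow> T \<in> cut_mesh P \<longrightarrow>
    cutfem_setting.energy P c T \<le> C * (diameter T ^ (DIM('a) - 2) *
      (\<Sum>j\<in>lagrange_nodes k T. (cutfem_setting.side_val P c 1 j)\<^sup>2 + (cutfem_setting.side_val P c 2 j)\<^sup>2))"
    using energy_upper[OF d2 k \<Omega> r M, of \<sigma>] by blast
  obtain D where D: "0 < D" "\<forall>(P :: 'a cutfem) c. cutfem_setting P \<sigma> r M \<longrightarrow> Om P = \<Omega> \<longrightarrow> deg P = k \<longrightarrow>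
    (\<Sum>T\<in>cut_mesh P. diameter T ^ (DIM('a) - 2) *
      (\<Sum>j\<in>lagrange_nodes k T. (cutfem_setting.side_val P c 1 j)\<^sup>2 + (cutfem_setting.side_val P c 2 j)\<^sup>2))
    \<le> D * (\<Sum>T\<in>cut_mesh P. cutfem_setting.energy P c T)"
    using energy_lower[OF d2 k \<Omega> r M, of \<sigma>] by blast
  have "c\<^sub>1 / D * (\<Sum>j\<in>cut_nodes P. cutfem_setting.node_weight P j * (c j)\<^sup>2)
      \<le> Ah P (cutfem_setting.side_fun P c) (cutfem_setting.side_fun P c) \<and>
    Ah P (cutfem_setting.side_fun P c) (cutfem_setting.side_fun P c)
      \<le> c\<^sub>2 * C * (\<Sum>j\<in>cut_nodes P. cutfem_setting.node_weight P j * (c j)\<^sup>2)"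
    if set: "cutfem_setting P \<sigma> r M" and P: "Om P = \<Omega>" "deg P = k" and ne: "norm_equivalence c\<^sub>1 c\<^sub>2 P" for P :: "'a cutfem" and c
  proof -
    interpret cutfem_setting P \<sigma> r M by (rule set)
    define W where "W = (\<Sum>j\<in>cut_nodes P. node_weight j * (c j)\<^sup>2)"
    define E where "E = (\<Sum>T\<in>cut_mesh P. energy c T)"
    have W: "(\<Sum>T\<in>cut_mesh P. diameter T ^ (DIM('a) - 2) * (\<Sum>j\<in>lagrange_nodes k T. (side_val c 1 j)\<^sup>2 + (side_val c 2 j)\<^sup>2)) = W"
      unfolding W_def node_weight_sum[symmetric] P(2) ..
    have "W \<le> D * E" using D(2) set P unfolding W[symmetric] E_def by blast
    then have "W / D \<le> E" using D(1) by (simp add: divide_le_eq mult.commute)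
    then have "c\<^sub>1 * (W / D) \<le> c\<^sub>1 * E" using c(1) by (intro mult_left_mono) auto
    then have lo: "c\<^sub>1 / D * W \<le> Ah P (side_fun c) (side_fun c)" using Ah_energy(1)[OF ne, of c] unfolding E_def by simp
    have "E \<le> (\<Sum>T\<in>cut_mesh P. C * (diameter T ^ (DIM('a) - 2) * (\<Sum>j\<in>lagrange_nodes k T. (side_val c 1 j)\<^sup>2 + (side_val c 2 j)\<^sup>2)))"
      unfolding E_def by (intro sum_mono) (use C(2) set P in blast)
    also have "\<dots> = C * W" unfolding W[symmetric] by (rule sum_distrib_left[symmetric])
    finally have "E \<le> C * W" .
    then have "c\<^sub>2 * E \<le> c\<^sub>2 * (C * W)" using c(2) by (intro mult_left_mono) auto
    then have "Ah P (side_fun c) (side_fun c) \<le> c\<^sub>2 * C * W" using Ah_energy(2)[OF ne, of c] unfolding E_def by simp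
    with lo show ?thesis unfolding W_def by blast
  qed
  moreover have "0 < c\<^sub>1 / D" "0 < c\<^sub>2 * C" using c C(1) D(1) by auto
  ultimately show ?thesis by blast
qed

section \<open>Condition numbers\<close>

context cutfem_setting
begin

text \<open>A cut basis function has an indicator as coefficient function. \<open>A1_mat\<close>
  puts the trial function in the column; symmetry of the form restores the order of the
  indices.\<close>

lemma A1_mat_entry:
  assumes js: "distinct js" "set js = cut_nodes P" and m: "m < length js" and l: "l < length js"
  shows "A1_mat P js $$ (m, l) = Ah P (side_fun (\<lambda>j. if j = js ! m then 1 else 0)) (side_fun (\<lambda>j. if j = js ! l then 1 else 0))"
proof -
  have e: "Liso P (\<lambda>_. 0, cut_basis P (js ! i)) = side_fun (\<lambda>j. if j = js ! i then 1 else 0)" if i: "i < length js" for i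
  proof -
    have mem: "js ! i \<in> cut_nodes P" using js(2) nth_mem[OF i] by blast
    have "cut_basis P (js ! i) = (\<lambda>x. \<Sum>j\<in>cut_nodes P. (if j = js ! i then 1 else 0) * cut_basis P j x)"
    proof
      fix x
      have "(\<Sum>j\<in>cut_nodes P. (if j = js ! i then 1 else 0) * cut_basis P j x)
          = (\<Sum>j\<in>cut_nodes P. if j = js ! i then cut_basis P j x else 0)" by (intro sum.cong) auto
      then show "cut_basis P (js ! i) x = (\<Sum>j\<in>cut_nodes P. (if j = js ! i then 1 else 0) * cut_basis P j x)"
        using mem finite_cut_nodes by simp
    qed
    then show ?thesis by (simp only:) (rule ext, rule Liso_cut)
  qed
  have "A1_mat P js $$ (m, l) = Ah P (Liso P (\<lambda>_. 0, cut_basis P (js ! l))) (Liso P (\<lambda>_. 0, cut_basis P (js ! m)))"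
    using m l unfolding A1_mat_def Ahat_def by simp
  then show ?thesis unfolding e[OF m] e[OF l] by (subst Ah_sym)
qed

text \<open>The vector is transported along the numbering \<open>js\<close> to a coefficient
  function on the nodes, and \<open>js\<close> being distinct makes this a bijection.\<close>

lemma A1_mat_form:
  fixes x :: "nat \<Rightarrow> real"
  assumes js: "distinct js" "set js = cut_nodes P"
  obtains c where
    "(\<Sum>m<length js. \<Sum>l<length js. x m * x l * A1_mat P js $$ (m, l)) = Ah P (side_fun c) (side_fun c)"
    "(\<Sum>m<length js. W (js ! m) * (x m)\<^sup>2) = (\<Sum>j\<in>cut_nodes P. W j * (c j)\<^sup>2)"
proof
  let ?e = "\<lambda>m j. if j = js ! m then 1 else 0 :: real"
  define c where "c = (\<lambda>j. \<Sum>m<length js. x m * ?e m j)"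
  have "Ah P (side_fun c) (side_fun c) = (\<Sum>m<length js. \<Sum>l<length js. x m * x l * Ah P (side_fun (?e m)) (side_fun (?e l)))"
    unfolding c_def by (rule bilinear_form_expand[OF Ah_bilinear finite_lessThan])
  also have "\<dots> = (\<Sum>m<length js. \<Sum>l<length js. x m * x l * A1_mat P js $$ (m, l))"
    by (intro sum.cong refl) (simp add: A1_mat_entry[OF js])
  finally show "(\<Sum>m<length js. \<Sum>l<length js. x m * x l * A1_mat P js $$ (m, l)) = Ah P (side_fun c) (side_fun c)" ..
  have cn: "c (js ! m) = x m" if m: "m < length js" for m
  proof -
    have "c (js ! m) = (\<Sum>i<length js. if i = m then x i else 0)" unfolding c_def
      using js(1) m by (intro sum.cong) (auto simp: nth_eq_iff_index_eq)
    then show ?thesis using m by simp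
  qed
  have bij: "bij_betw (\<lambda>m. js ! m) {..<length js} (cut_nodes P)" by (rule bij_betw_nth[OF js(1) refl js(2)[symmetric]])
  have "(\<Sum>j\<in>cut_nodes P. W j * (c j)\<^sup>2) = (\<Sum>m<length js. W (js ! m) * (c (js ! m))\<^sup>2)"
    by (rule sum.reindex_bij_betw[OF bij, symmetric])
  then show "(\<Sum>m<length js. W (js ! m) * (x m)\<^sup>2) = (\<Sum>j\<in>cut_nodes P. W j * (c j)\<^sup>2)" using cn by simp
qed

lemma A1_mat_carrier: "A1_mat P js \<in> carrier_mat (length js) (length js)"
  unfolding A1_mat_def by simp

lemma A1_mat_sym:
  "m < length js \<Longrightarrow> l < length js \<Longrightarrow> A1_mat P js $$ (m, l) = A1_mat P js $$ (l, m)"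
  unfolding A1_mat_def Ahat_def using Ah_sym by simp

end

theorem corollary6p2:
  fixes \<Omega> :: "'a::euclidean_space set"
    and k :: nat
    and \<alpha>\<^sub>1 \<alpha>\<^sub>2 \<gamma> \<beta> \<sigma> r M c\<^sub>1 c\<^sub>2 :: real
  assumes "DIM('a) = 2 \<or> DIM('a) = 3"
    and "k \<ge> 1"
    and "polygonal_domain \<Omega>"
    and "\<alpha>\<^sub>1 > 0" "\<alpha>\<^sub>2 > 0" "\<gamma> > 0" "\<beta> > 0"
    and "\<sigma> > 0" "r > 0" "M > 0" "c\<^sub>1 > 0" "c\<^sub>2 > 0"
  shows "(\<exists>C::real. \<forall>P \<in> cutfem_class \<Omega> k \<alpha>\<^sub>1 \<alpha>\<^sub>2 \<gamma> \<beta> \<sigma> r M c\<^sub>1 c\<^sub>2. \<forall>js.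
            distinct js \<and> set js = cut_nodes P \<longrightarrow>
            spectral_cond (diag_scaled (A1_mat P js)) \<le> ereal C) \<and>
         (\<forall>q::real. \<exists>C::real. \<forall>P \<in> cutfem_class \<Omega> k \<alpha>\<^sub>1 \<alpha>\<^sub>2 \<gamma> \<beta> \<sigma> r M c\<^sub>1 c\<^sub>2. \<forall>js.
            quasi_uniform q (cut_mesh P) \<and> distinct js \<and> set js = cut_nodes P \<longrightarrow>
            spectral_cond (A1_mat P js) \<le> ereal C)"
proof -
  let ?class = "cutfem_class \<Omega> k \<alpha>\<^sub>1 \<alpha>\<^sub>2 \<gamma> \<beta> \<sigma> r M c\<^sub>1 c\<^sub>2" and ?e = "DIM('a) - 2"
  have d2: "2 \<le> DIM('a)" using assms(1) by auto
  have bdd: "bounded \<Omega>"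
  proof -
    obtain Q where Q: "finite Q" "\<forall>K\<in>Q. polytope K" "\<Omega> = interior (\<Union>Q)" using assms(3) unfolding polygonal_domain_def by blast
    have "bounded (\<Union>Q)" using Q polytope_imp_bounded by (intro bounded_Union) auto
    then show ?thesis unfolding Q(3) by (rule bounded_interior)
  qed
  \<comment> \<open>Both constants are fixed before \<open>P\<close> and \<open>js\<close>, which is
    the claimed uniformity.\<close>
  obtain a b where ab: "0 < a" "0 < b" and bnd: "\<forall>(P :: 'a cutfem) c. cutfem_setting P \<sigma> r M \<longrightarrow> Om P = \<Omega> \<longrightarrow> deg P = k \<longrightarrow> norm_equivalence c\<^sub>1 c\<^sub>2 P \<longrightarrow>
    a * (\<Sum>j\<in>cut_nodes P. cutfem_setting.node_weight P j * (c j)\<^sup>2)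
      \<le> Ah P (cutfem_setting.side_fun P c) (cutfem_setting.side_fun P c) \<and>
    Ah P (cutfem_setting.side_fun P c) (cutfem_setting.side_fun P c)
      \<le> b * (\<Sum>j\<in>cut_nodes P. cutfem_setting.node_weight P j * (c j)\<^sup>2)"
    using stiffness_bounds[OF d2 assms(2) bdd assms(9,10,11,12), of \<sigma>] by (elim exE conjE)
  have set: "cutfem_setting P \<sigma> r M" if "P \<in> ?class" for P
    using that assms d2 unfolding cutfem_class_def by unfold_locales auto
  have form: "a * (\<Sum>m<length js. cutfem_setting.node_weight P (js ! m) * (x m)\<^sup>2)
        \<le> (\<Sum>m<length js. \<Sum>l<length js. x m * x l * A1_mat P js $$ (m, l))"
      "(\<Sum>m<length js. \<Sum>l<length js. x m * x l * A1_mat P js $$ (m, l))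
        \<le> b * (\<Sum>m<length js. cutfem_setting.node_weight P (js ! m) * (x m)\<^sup>2)"
    if P: "P \<in> ?class" and js: "distinct js" "set js = cut_nodes P" for P js and x :: "nat \<Rightarrow> real"
  proof -
    interpret cutfem_setting P \<sigma> r M by (rule set[OF P])
    obtain c where c: "(\<Sum>m<length js. \<Sum>l<length js. x m * x l * A1_mat P js $$ (m, l)) = Ah P (side_fun c) (side_fun c)"
      "(\<Sum>m<length js. node_weight (js ! m) * (x m)\<^sup>2) = (\<Sum>j\<in>cut_nodes P. node_weight j * (c j)\<^sup>2)"
      by (rule A1_mat_form[OF js])
    have "Om P = \<Omega>" "deg P = k" "norm_equivalence c\<^sub>1 c\<^sub>2 P" using P unfolding cutfem_class_def by auto
    then show "a * (\<Sum>m<length js. node_weight (js ! m) * (x m)\<^sup>2) \<le> (\<Sum>m<length js. \<Sum>l<length js. x m * x l * A1_mat P js $$ (m, l))"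
      "(\<Sum>m<length js. \<Sum>l<length js. x m * x l * A1_mat P js $$ (m, l)) \<le> b * (\<Sum>m<length js. node_weight (js ! m) * (x m)\<^sup>2)"
      unfolding c using bnd set[OF P] by blast+
  qed
  have scaled: "spectral_cond (diag_scaled (A1_mat P js)) \<le> ereal ((b / a)\<^sup>2)"
    if P: "P \<in> ?class" and js: "distinct js" "set js = cut_nodes P" for P js
  proof -
    interpret cutfem_setting P \<sigma> r M by (rule set[OF P])
    show ?thesis
    proof (rule spectral_cond_diag_scaled[OF A1_mat_carrier A1_mat_sym ab form[OF P js]])
      show "0 < node_weight (js ! i)" if "i < length js" for i
        using node_weight_pos js(2) nth_mem[OF that] by blast
    qed
  qed
  \<comment> \<open>The ratio of the largest to the smallest weight is at most
    \<open>\<sigma>^d * (q * q)^(d-2)\<close>, the mesh size having cancelled. The maximum with 1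
    covers the empty matrix, which occurs if no simplex is cut.\<close>
  have unscaled: "spectral_cond (A1_mat P js) \<le> ereal (b / a * max 1 (\<sigma> ^ DIM('a) * (q * q) ^ ?e))"
    if P: "P \<in> ?class" and qu: "quasi_uniform q (cut_mesh P)" and js: "distinct js" "set js = cut_nodes P" for P js q
  proof -
    interpret cutfem_setting P \<sigma> r M by (rule set[OF P])
    let ?m = "max 1 (\<sigma> ^ DIM('a) * (q * q) ^ ?e)"
    note cond = spectral_cond_weighted[OF A1_mat_carrier A1_mat_sym ab form[OF P js]]
    show ?thesis
    proof (cases "cut_mesh P = {}")
      case True
      then have "length js = 0" using js(2) unfolding cut_nodes_def cut_dom_def by simp
      then have "spectral_cond (A1_mat P js) \<le> ereal (b * 1 / (a * 1))" by (intro cond) auto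
      also have "b * 1 / (a * 1) \<le> b / a * ?m" using mult_left_mono[of 1 ?m "b / a"] ab by simp
      finally show ?thesis by simp
    next
      case False
      then obtain T where T: "T \<in> cut_mesh P" by blast
      have h: "0 < diameter T" by (rule diameter_pos[OF cut_mesh_mesh[OF T]])
      have "diameter T \<le> q * diameter T" using qu T unfolding quasi_uniform_def by blast
      then have q: "0 < q" using h by (metis less_le_trans zero_less_mult_pos2)
      let ?w0 = "(diameter T / q) ^ ?e" and ?w1 = "\<sigma> ^ DIM('a) * (q * diameter T) ^ ?e"
      have "spectral_cond (A1_mat P js) \<le> ereal (b * ?w1 / (a * ?w0))"
      proof (rule cond)
        show "0 < ?w0" "0 \<le> ?w1" using h q assms(8) by auto
        show "?w0 \<le> node_weight (js ! i)" "node_weight (js ! i) \<le> ?w1" if "i < length js" for i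
          using node_weight_quasi_uniform[OF qu T _ assms(8)] js(2) nth_mem[OF that] by blast+
      qed
      also have "b * ?w1 / (a * ?w0) = b / a * (\<sigma> ^ DIM('a) * (q * q) ^ ?e)"
        using h q by (simp add: power_mult_distrib power_divide)
      also have "ereal \<dots> \<le> ereal (b / a * ?m)"
        using mult_left_mono[of "\<sigma> ^ DIM('a) * (q * q) ^ ?e" ?m "b / a"] ab by (simp only: ereal_less_eq) simp
      finally show ?thesis .
    qed
  qed
  show ?thesis using scaled unscaled by blast
qed

end
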